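(* Let $b,c,\alpha\in\mathbb{R}$ and $1\leq p\leq\infty$. Consider the integral operator \[ T_{bc}f(x)=\int_{\mathbb{B}} R_c(x,y)\,f(y)\,(1-|y|^2)^b\,d\nu(y),\qquad x\in\mathbb{B}. \] Then $T_{bc}$ is bounded from $L^p_\alpha$ to $h^\infty$ if and only if $(b,c,\alpha,p)$ satisfies one of the following conditions: \begin{enumerate} \item[(i)] $1<p<\infty$, $\alpha+1<p(b+1)$ and $c< b-\dfrac{n+\alpha}{p}$; \item[(ii)] $p=1$, and either ($\alpha<b$ and $c\leq b-(n+\alpha)$) or ($\alpha\leq b$ and $c< b-(n+\alpha)$); \item[(iii)] $p=\infty$, $\alpha-1<b$ and $c< b-\alpha$. \end{enumerate}
   Context: Let $n\geq 2$, $\mathbb{B}$ the open unit ball of $\mathbb{R}^n$, $\nu$ Lebesgue volume measure on $\mathbb{B}$ normalized so $\nu(\mathbb{B})=1$. For $\alpha\in\mathbb{R}$, $d\nu_\alpha(x)=V_\alpha^{-1}(1-|x|^2)^\alpha d\nu(x)$, where $V_\alpha$ is chosen so that $\nu_\alpha(\mathbb{B})=1$ when $\alpha>-1$, and $V_\alpha=1$ when $\alpha\leq-1$. For $1\leq p<\infty$, $L^p_\alpha=L^p(\nu_\alpha)$. For $p=\infty$, $L^\infty_\alpha$ denotes the weighted class $\mathcal{L}^\infty_\alpha$ of measurable $\varphi$ on $\mathbb{B}$ with $\|\varphi\|_{\mathcal{L}^\infty_\alpha}=\|(1-|x|^2)^\alpha\varphi(x)\|_{L^\infty(\nu)}<\infty$.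 Harmonic Bergman–Besov kernels: for $\alpha\in\mathbb{R}$ and $x,y\in\mathbb{B}$, $R_\alpha(x,y)=\sum_{k=0}^\infty\gamma_k(\alpha)Z_k(x,y)$, where $Z_k(x,y)$ is the (extended) zonal harmonic of degree $k$ (the reproducing kernel of the space of homogeneous harmonic polynomials of degree $k$ with respect to normalized surface measure on the unit sphere, extended homogeneously), and $\gamma_k(\alpha)=\frac{(1+n/2+\alpha)_k}{(n/2)_k}$ if $\alpha>-(1+n/2)$, $\gamma_k(\alpha)=\frac{(k!)^2}{(1-(n/2+\alpha))_k(n/2)_k}$ if $\alpha\leq-(1+n/2)$, with $(a)_k=\Gamma(a+k)/\Gamma(a)$. $h^\infty$ is the space of bounded complex-valued harmonic functions on $\mathbb{B}$ with the supremum norm. $T_{bc}$ bounded from $L^p_\alpha$ to $h^\infty$ means: for every $f\in L^p_\alpha$ the integral defining $T_{bc}f$ makes sense, $T_{bc}f\in h^\infty$, and $\sup_{\mathbb{B}}|T_{bc}f|\lesssim\|f\|_{L^p_\alpha}$. *)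

theory Defs
  imports "HOL-Analysis.Analysis" "HOL-Probability.Essential_Supremum"
begin

abbreviation unit_ball :: "(real^'n::finite) set" where
  "unit_ball \<equiv> ball 0 1"

definition nu :: "(real^'n::finite) measure" where
  "nu = density (lebesgue_on unit_ball) (\<lambda>_. ennreal (1 / measure lebesgue (unit_ball :: (real^'n) set)))"

definition V_const :: "'n::finite itself \<Rightarrow> real \<Rightarrow> real" where
  "V_const _ a = (if a > -1 then (\<integral>x. (1 - (norm x)^2) powr a \<partial>(nu :: (real^'n) measure)) else 1)"

definition nu_w :: "real \<Rightarrow> (real^'n::finite) measure" where
  "nu_w a = density nu (\<lambda>x. ennreal ((1 - (norm x)^2) powr a / V_const TYPE('n) a))"

definition Lp_w :: "real \<Rightarrow> ereal \<Rightarrow> ((real^'n::finite) \<Rightarrow> complex) set" where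
  "Lp_w a p = {f. f \<in> borel_measurable (nu :: (real^'n) measure) \<and>
     (if p = \<infinity> then esssup (nu :: (real^'n) measure) (\<lambda>x. ereal ((1 - (norm x)^2) powr a * cmod (f x))) < \<infinity>
      else integrable (nu_w a) (\<lambda>x. cmod (f x) powr real_of_ereal p))}"

definition Lp_norm :: "real \<Rightarrow> ereal \<Rightarrow> ((real^'n::finite) \<Rightarrow> complex) \<Rightarrow> ereal" where
  "Lp_norm a p f = (if p = \<infinity> then esssup (nu :: (real^'n) measure) (\<lambda>x. ereal ((1 - (norm x)^2) powr a * cmod (f x)))
      else ereal ((\<integral>x. cmod (f x) powr real_of_ereal p \<partial>(nu_w a)) powr (1 / real_of_ereal p)))"

text \<open>Extended zonal harmonic of degree k on real^'n (explicit formula, Axler-Bourdon-Ramey,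
  Harmonic Function Theory, Thm 5.24, extended homogeneously in both variables).\<close>
definition zonal :: "nat \<Rightarrow> real^'n::finite \<Rightarrow> real^'n \<Rightarrow> real" where
  "zonal k x y = (let n = real CARD('n) in
     if k = 0 then 1 else
     (n + 2 * real k - 2) *
       (\<Sum>j\<in>{0..k div 2}. (-1)^j * (\<Prod>i<k - j - 1. n + 2 * real i)
          / (2^j * fact j * fact (k - 2 * j)) * (x \<bullet> y)^(k - 2 * j) * (norm x * norm y)^(2 * j)))"

definition gamma_coef :: "'n::finite itself \<Rightarrow> real \<Rightarrow> nat \<Rightarrow> real" where
  "gamma_coef _ a k = (let n = real CARD('n) in
     if a > -(1 + n/2) then pochhammer (1 + n/2 + a) k / pochhammer (n/2) k
     else (fact k)^2 / (pochhammer (1 - (n/2 + a)) k * pochhammer (n/2) k))"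

definition R_kernel :: "real \<Rightarrow> real^'n::finite \<Rightarrow> real^'n \<Rightarrow> real" where
  "R_kernel a x y = (\<Sum>k. gamma_coef TYPE('n) a k * zonal k x y)"

definition T_op :: "real \<Rightarrow> real \<Rightarrow> ((real^'n::finite) \<Rightarrow> complex) \<Rightarrow> real^'n \<Rightarrow> complex" where
  "T_op b c f x = (\<integral>y. complex_of_real (R_kernel c x y * (1 - (norm y)^2) powr b) * f y \<partial>nu)"

definition harmonic_on :: "(real^'n::finite) set \<Rightarrow> (real^'n \<Rightarrow> complex) \<Rightarrow> bool" where
  "harmonic_on S u \<longleftrightarrow> open S \<and>
     (\<exists>u' u''. (\<forall>x\<in>S. (u has_derivative blinfun_apply (u' x)) (at x) \<and>
                         (u' has_derivative blinfun_apply (u'' x)) (at x)) \<and>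
               continuous_on S u'' \<and>
               (\<forall>x\<in>S. (\<Sum>i\<in>UNIV. blinfun_apply (blinfun_apply (u'' x) (axis i 1)) (axis i 1)) = 0))"

definition T_bounded :: "'n::finite itself \<Rightarrow> real \<Rightarrow> real \<Rightarrow> real \<Rightarrow> ereal \<Rightarrow> bool" where
  "T_bounded _ b c a p \<longleftrightarrow> (\<exists>C::real. \<forall>f \<in> (Lp_w a p :: ((real^'n) \<Rightarrow> complex) set).
      (\<forall>x\<in>unit_ball. integrable (nu :: (real^'n) measure)
          (\<lambda>y. complex_of_real (R_kernel c x y * (1 - (norm y)^2) powr b) * f y)) \<and>
      harmonic_on unit_ball (T_op b c f) \<and>
      bounded (T_op b c f ` unit_ball) \<and>
      (\<forall>x\<in>unit_ball. ereal (cmod (T_op b c f x)) \<le> ereal C * Lp_norm a p f))"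

end

theory Submission
  imports Defs "HOL-Probability.Probability_Measure"
begin

text \<open>
  With \<open>u = x \<bullet> y\<close>, \<open>v = (|x| |y|)\<^sup>2\<close> and \<open>E = 1 - 2u + v\<close>, zonal harmonics are differences of homogenised
  Gegenbauer polynomials, whose generating function is \<open>E powr (-m)\<close>. Multiplying the coefficients of a
  series by a ratio of Pochhammer symbols is either a differential operator in the dilation parameter or
  a Beta integral over it, and tracking powers of \<open>1 - v\<close> and \<open>E\<close> through both gives
  \<open>|R_c| \<le> C * E powr (-\<kappa>/2)\<close> for \<open>\<kappa> \<ge> max 0 (n + c)\<close>, with strict inequality in one of the two.
  Sufficiency follows from this bound: pointwise for \<open>p = 1\<close>, and for \<open>p > 1\<close> by Young's inequality
  and an integral estimate of Forelli--Rudin type; harmonicity is differentiation under the integral.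

  For necessity, test functions are combinations of indicators of dyadic sets on which \<open>1 - |y|\<^sup>2\<close> is
  comparable to \<open>2^(-j)\<close>. Shells, evaluated at \<open>x = 0\<close> where the kernel is 1, give the condition on \<open>b\<close>.
  Balls marching to a boundary point, evaluated at their centres, give the condition on \<open>c\<close>, because
  near the diagonal the kernel dominates \<open>\<Sum>i\<le>j. 2^(i (n + c))\<close>; at \<open>c = -n\<close> this grows like \<open>j\<close>, which excludes
  the corner \<open>a = b\<close>, \<open>c = -n\<close> for \<open>p = 1\<close>.
\<close>

section \<open>Homogenised Gegenbauer polynomials\<close>

text \<open>A closed form is available only for generating functions such as
  \<open>E powr (-m)\<close> and \<open>(1 - v) * E powr (-l)\<close>, while \<open>gam l c\<close>
  has an arbitrary real parameter. A Beta integral can only lower the order of a multiplier. For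
  \<open>c > - (1 + l)\<close> the order is therefore first raised by an integer exceeding
  \<open>1 + c\<close>, where differentiation keeps an explicit expression, and then lowered by the
  excess. Lowering exactly to exponent 0 would leave a logarithm; this is the source of the
  strictness condition on \<open>\<kappa>\<close>, and for \<open>\<kappa> = b - a\<close> it
  becomes the two alternatives of the case \<open>p = 1\<close>.

  In the necessity part one set per scale yields only non-strict inequalities. If all scales up to
  \<open>J\<close> contribute equally, the left side grows like \<open>J\<close> and the right side
  at most like \<open>J powr (1/p)\<close>, so equality is impossible for \<open>p > 1\<close>; for
  \<open>p = 1\<close> nothing is gained. Off the diagonal the kernel stays under control because,
  at fixed \<open>v\<close>, the deviation \<open>sqrt v - u\<close> is of second order in the
  distance from the axis, which pays for the two orders lost by differentiating in
  \<open>u\<close>.\<close>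

definition gterm :: "nat \<Rightarrow> nat \<Rightarrow> real \<Rightarrow> real \<Rightarrow> real" where
  "gterm k j u v = (-1) ^ j / (fact j * fact (k - 2 * j)) * (2 * u) ^ (k - 2 * j) * v ^ j"

text \<open>For \<open>c = pochhammer m\<close> and \<open>v > 0\<close> this is \<open>v powr (k/2)\<close> times the Gegenbauer polynomial of index \<open>m\<close>
  and degree \<open>k\<close> at \<open>u / sqrt v\<close>.\<close>

definition gbpoly :: "(nat \<Rightarrow> real) \<Rightarrow> nat \<Rightarrow> real \<Rightarrow> real \<Rightarrow> real" where
  "gbpoly c k u v = (\<Sum>j\<le>k div 2. c (k - j) * gterm k j u v)"

abbreviation geg :: "real \<Rightarrow> nat \<Rightarrow> real \<Rightarrow> real \<Rightarrow> real" where
  "geg m \<equiv> gbpoly (pochhammer m)"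

section \<open>Identities between neighbouring degrees, checked coefficientwise\<close>

lemma gterm_shift_u:
  assumes "2 * j \<le> k"
  shows "2 * u * gterm k j u v = real (Suc k - 2 * j) * gterm (Suc k) j u v"
proof -
  have "Suc k - 2 * j = Suc (k - 2 * j)" using assms by simp
  moreover have "real (Suc K) / (F * fact (Suc K)) = 1 / (F * fact K)" for F :: real and K
    by (simp add: divide_simps)
  ultimately have "real (Suc k - 2 * j) * gterm (Suc k) j u v =
      (-1) ^ j * (1 / (fact j * fact (k - 2 * j))) * (2 * u) ^ Suc (k - 2 * j) * v ^ j"
    by (simp add: gterm_def)
  then show ?thesis by (simp add: gterm_def)
qed

lemma gterm_shift_v: "v * gterm k j u v = - (real (Suc j) * gterm (Suc (Suc k)) (Suc j) u v)"
proof -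
  have "real (Suc j) / (fact (Suc j) * F) = 1 / (fact j * F)" for F :: real
    by (simp add: divide_simps)
  then have "real (Suc j) * gterm (Suc (Suc k)) (Suc j) u v =
      (-1) ^ Suc j * (1 / (fact j * fact (k - 2 * j))) * (2 * u) ^ (k - 2 * j) * v ^ Suc j"
    by (simp add: gterm_def)
  then show ?thesis by (simp add: gterm_def)
qed

text \<open>A factor \<open>2 * u\<close> keeps the index \<open>j\<close> and only changes
  \<open>fact (k - 2 * j)\<close>; the extra term that \<open>Suc k div 2\<close> may admit carries
  the factor 0. Together with its companion for \<open>v\<close>, this writes neighbouring degrees
  over the same \<open>gterm\<close>, so that identities between them become identities between
  coefficients.\<close>

lemma gbpoly_shift_u:
  "2 * u * gbpoly (\<lambda>i. c (Suc i)) k u v =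
    (\<Sum>j\<le>Suc k div 2. real (Suc k - 2 * j) * c (Suc k - j) * gterm (Suc k) j u v)"
proof -
  have "2 * u * gbpoly (\<lambda>i. c (Suc i)) k u v =
      (\<Sum>j\<le>k div 2. c (Suc (k - j)) * (2 * u * gterm k j u v))"
    by (simp add: gbpoly_def sum_distrib_left mult_ac)
  also have "\<dots> = (\<Sum>j\<le>k div 2. real (Suc k - 2 * j) * c (Suc k - j) * gterm (Suc k) j u v)"
  proof (rule sum.cong[OF refl])
    fix j assume "j \<in> {..k div 2}"
    then have j: "2 * j \<le> k" by auto
    then have "Suc (k - j) = Suc k - j" by simp
    then show "c (Suc (k - j)) * (2 * u * gterm k j u v) =
        real (Suc k - 2 * j) * c (Suc k - j) * gterm (Suc k) j u v"
      unfolding gterm_shift_u[OF j] by (simp only: mult_ac)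
  qed
  also have "\<dots> = (\<Sum>j\<le>Suc k div 2. real (Suc k - 2 * j) * c (Suc k - j) * gterm (Suc k) j u v)"
    by (rule sum.mono_neutral_left) auto
  finally show ?thesis .
qed

text \<open>A factor \<open>v\<close> moves \<open>j\<close> to \<open>Suc j\<close> and the degree
  up by two; the new term \<open>j = 0\<close> has weight 0, and the sign comes from
  \<open>(-1) ^ j\<close>.\<close>

lemma gbpoly_shift_v:
  "v * gbpoly (\<lambda>i. c (Suc i)) k u v =
    - (\<Sum>j\<le>Suc (Suc k) div 2. real j * c (Suc (Suc k) - j) * gterm (Suc (Suc k)) j u v)"
proof -
  have "v * gbpoly (\<lambda>i. c (Suc i)) k u v =
      (\<Sum>j\<le>k div 2. c (Suc (k - j)) * (v * gterm k j u v))"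
    by (simp add: gbpoly_def sum_distrib_left mult_ac)
  also have "\<dots> = (\<Sum>j\<le>k div 2. - (real (Suc j) * c (Suc (Suc k) - Suc j) * gterm (Suc (Suc k)) (Suc j) u v))"
  proof (rule sum.cong[OF refl])
    fix j assume "j \<in> {..k div 2}"
    then have "Suc (k - j) = Suc (Suc k) - Suc j" by auto
    then show "c (Suc (k - j)) * (v * gterm k j u v) =
        - (real (Suc j) * c (Suc (Suc k) - Suc j) * gterm (Suc (Suc k)) (Suc j) u v)"
      unfolding gterm_shift_v by simp
  qed
  also have "\<dots> = - (\<Sum>j\<le>Suc (k div 2). real j * c (Suc (Suc k) - j) * gterm (Suc (Suc k)) j u v)"
    by (subst sum.atMost_Suc_shift) (simp add: sum_negf)
  finally show ?thesis by simp
qed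

lemma gbpoly_0 [simp]: "gbpoly c 0 u v = c 0"
  by (simp add: gbpoly_def gterm_def)

lemma gbpoly_1 [simp]: "gbpoly c (Suc 0) u v = c 1 * (2 * u)"
  by (simp add: gbpoly_def gterm_def)

lemma gbpoly_scale: "gbpoly c k (t * u) (t\<^sup>2 * v) = t ^ k * gbpoly c k u v"
proof -
  have "gterm k j (t * u) (t\<^sup>2 * v) = t ^ k * gterm k j u v" if "j \<le> k div 2" for j
  proof -
    have "t ^ k = t ^ (k - 2 * j) * t ^ (2 * j)"
      using that by (simp flip: power_add)
    then show ?thesis
      by (simp add: gterm_def power_mult_distrib mult_ac flip: power_mult)
  qed
  then show ?thesis
    unfolding gbpoly_def sum_distrib_left by (intro sum.cong) (auto simp: mult_ac)
qed

lemma pochhammer_Suc_diff: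
  assumes "j \<le> k"
  shows "pochhammer (m :: real) (Suc k - j) = pochhammer m (k - j) * (m + real k - real j)"
  using assms by (simp add: Suc_diff_le pochhammer_Suc of_nat_diff add_diff_eq)

lemma geg_recurrence:
  "real (k + 2) * geg m (k + 2) u v =
     2 * u * (real (k + 1) + m) * geg m (k + 1) u v - v * (real k + 2 * m) * geg m k u v"
proof -
  \<comment> \<open>The truncated value \<open>c 0\<close> is never met: at degree
    \<open>k + 2\<close> the argument \<open>k + 2 - j\<close> is at least 1.\<close>
  define c where "c i = pochhammer m (i - 1)" for i :: nat
  have c: "(\<lambda>i. c (Suc i)) = pochhammer m" by (simp add: c_def fun_eq_iff)
  have 1: "2 * u * geg m (k + 1) u v =
    (\<Sum>j\<le>Suc (Suc k) div 2. real (Suc (Suc k) - 2 * j) * c (Suc (Suc k) - j) * gterm (Suc (Suc k)) j u v)"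
    using gbpoly_shift_u[of u c "Suc k" v] by (simp add: c)
  have 2: "v * geg m k u v =
    - (\<Sum>j\<le>Suc (Suc k) div 2. real j * c (Suc (Suc k) - j) * gterm (Suc (Suc k)) j u v)"
    using gbpoly_shift_v[of v c k u] by (simp add: c)
  have "real (k + 2) * geg m (k + 2) u v =
    (\<Sum>j\<le>Suc (Suc k) div 2. real (k + 2) * pochhammer m (Suc (Suc k) - j) * gterm (Suc (Suc k)) j u v)"
    by (simp add: gbpoly_def sum_distrib_left mult_ac del: div2_Suc_Suc sum.atMost_Suc)
  also have "\<dots> = (\<Sum>j\<le>Suc (Suc k) div 2.
       (real (k + 1) + m) * (real (Suc (Suc k) - 2 * j) * c (Suc (Suc k) - j) * gterm (Suc (Suc k)) j u v)
     + (real k + 2 * m) * (real j * c (Suc (Suc k) - j) * gterm (Suc (Suc k)) j u v))"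
  \<comment> \<open>Apart from a common factor this is \<open>(k + 2) (m + k + 1 - j) = (k + 1 + m)
    (k + 2 - 2 j) + (k + 2 m) j\<close>.\<close>
  proof (rule sum.cong[OF refl])
    fix j assume "j \<in> {..Suc (Suc k) div 2}"
    then have j: "j \<le> Suc k" "2 * j \<le> Suc (Suc k)" by auto
    then have *: "Suc k - j = Suc (Suc k) - j - 1" by simp
    have "pochhammer m (Suc (Suc k) - j) = c (Suc (Suc k) - j) * (m + real (Suc k) - real j)"
      unfolding c_def *[symmetric] by (rule pochhammer_Suc_diff) fact
    moreover have "real (Suc (Suc k) - 2 * j) = real k + 2 - 2 * real j"
      using j by (simp add: of_nat_diff)
    ultimately show "real (k + 2) * pochhammer m (Suc (Suc k) - j) * gterm (Suc (Suc k)) j u v =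
       (real (k + 1) + m) * (real (Suc (Suc k) - 2 * j) * c (Suc (Suc k) - j) * gterm (Suc (Suc k)) j u v)
     + (real k + 2 * m) * (real j * c (Suc (Suc k) - j) * gterm (Suc (Suc k)) j u v)"
      by (simp only:) (simp add: algebra_simps)
  qed
  also have "\<dots> = (real (k + 1) + m) * (2 * u * geg m (k + 1) u v) - (real k + 2 * m) * (v * geg m k u v)"
    unfolding 1 2 sum.distrib by (simp only: sum_distrib_left[symmetric] mult_minus_right diff_minus_eq_add)
  finally show ?thesis by (simp add: algebra_simps)
qed

text \<open>The coefficient form of \<open>(1 - 2 u t + v t^2) F (m + 1) = F m\<close>, where
  \<open>F m\<close> is the generating function \<open>(1 - 2 u t + v t^2) powr (- m)\<close>. It is
  what later cancels the Laplacian of the kernel.\<close>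

lemma geg_contiguous:
  "geg (m + 1) (k + 2) u v - 2 * u * geg (m + 1) (k + 1) u v + v * geg (m + 1) k u v = geg m (k + 2) u v"
proof -
  define c where "c i = pochhammer (m + 1) (i - 1)" for i :: nat
  have c: "(\<lambda>i. c (Suc i)) = pochhammer (m + 1)" by (simp add: c_def fun_eq_iff)
  have 1: "2 * u * geg (m + 1) (k + 1) u v =
    (\<Sum>j\<le>Suc (Suc k) div 2. real (Suc (Suc k) - 2 * j) * c (Suc (Suc k) - j) * gterm (Suc (Suc k)) j u v)"
    using gbpoly_shift_u[of u c "Suc k" v] by (simp add: c)
  have 2: "v * geg (m + 1) k u v =
    - (\<Sum>j\<le>Suc (Suc k) div 2. real j * c (Suc (Suc k) - j) * gterm (Suc (Suc k)) j u v)"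
    using gbpoly_shift_v[of v c k u] by (simp add: c)
  have 3: "geg m (k + 2) u v = (\<Sum>j\<le>Suc (Suc k) div 2. pochhammer m (Suc (Suc k) - j) * gterm (Suc (Suc k)) j u v)"
    and 4: "geg (m + 1) (k + 2) u v = (\<Sum>j\<le>Suc (Suc k) div 2. pochhammer (m + 1) (Suc (Suc k) - j) * gterm (Suc (Suc k)) j u v)"
    by (simp_all add: gbpoly_def)
  show ?thesis unfolding 1 2 3 4 add_uminus_conv_diff sum_subtractf[symmetric]
  \<comment> \<open>Apart from a common factor:
    \<open>(m + k + 2 - j) - (k + 2 - 2 j) - j = m\<close>.\<close>
  proof (rule sum.cong[OF refl])
    fix j assume "j \<in> {..Suc (Suc k) div 2}"
    then have j: "j \<le> Suc k" "2 * j \<le> Suc (Suc k)" by auto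
    then have *: "Suc (Suc k) - j = Suc (Suc k - j)" "Suc k - j = Suc (Suc k) - j - 1" by simp_all
    have "pochhammer (m + 1) (Suc (Suc k) - j) = c (Suc (Suc k) - j) * (m + 1 + real (Suc k) - real j)"
      unfolding c_def *(2)[symmetric] by (rule pochhammer_Suc_diff) fact
    moreover have "pochhammer m (Suc (Suc k) - j) = m * c (Suc (Suc k) - j)"
      unfolding c_def *(2)[symmetric] unfolding *(1) by (rule pochhammer_rec)
    moreover have "real (Suc (Suc k) - 2 * j) = real k + 2 - 2 * real j"
      using j by (simp add: of_nat_diff)
    ultimately show "pochhammer (m + 1) (Suc (Suc k) - j) * gterm (Suc (Suc k)) j u v -
         real (Suc (Suc k) - 2 * j) * c (Suc (Suc k) - j) * gterm (Suc (Suc k)) j u v -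
         real j * c (Suc (Suc k) - j) * gterm (Suc (Suc k)) j u v =
         pochhammer m (Suc (Suc k) - j) * gterm (Suc (Suc k)) j u v"
      by (simp only:) (simp add: algebra_simps)
  qed
qed

text \<open>The coefficient sequence stays arbitrary because zonal harmonics use a Pochhammer
  sequence shifted by one. The inner functions \<open>U\<close> and \<open>V\<close> allow
  differentiation in \<open>u\<close> alone as well as in the point \<open>x\<close> on which both
  arguments depend.\<close>

lemma has_derivative_gbpoly:
  assumes U: "(U has_derivative U') (at x within S)" and V: "(V has_derivative V') (at x within S)"
  shows "((\<lambda>x. gbpoly c (k + 2) (U x) (V x)) has_derivative
     (\<lambda>h. 2 * gbpoly (\<lambda>i. c (Suc i)) (k + 1) (U x) (V x) * U' h
           - gbpoly (\<lambda>i. c (Suc i)) k (U x) (V x) * V' h)) (at x within S)"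
proof -
  let ?K = "Suc (Suc k)"
  let ?A = "\<lambda>j. (-1) ^ j / (fact j * fact (?K - 2 * j)) :: real"
  have "((\<lambda>x. gbpoly c (k + 2) (U x) (V x)) has_derivative
     (\<lambda>h. (\<Sum>j\<le>?K div 2. c (?K - j) * (?A j *
        ((2 * U x) ^ (?K - 2 * j) * (real j * V' h * V x ^ (j - 1))
         + (real (?K - 2 * j) * (2 * U' h) * (2 * U x) ^ (?K - 2 * j - 1)) * V x ^ j))))) (at x within S)"
    unfolding gbpoly_def gterm_def
    by (rule derivative_eq_intros U V refl | (rule ext, simp add: algebra_simps))+
  moreover have "(\<Sum>j\<le>?K div 2. c (?K - j) * (?A j *
        ((2 * U x) ^ (?K - 2 * j) * (real j * V' h * V x ^ (j - 1))
         + (real (?K - 2 * j) * (2 * U' h) * (2 * U x) ^ (?K - 2 * j - 1)) * V x ^ j))) =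
     2 * gbpoly (\<lambda>i. c (Suc i)) (k + 1) (U x) (V x) * U' h
           - gbpoly (\<lambda>i. c (Suc i)) k (U x) (V x) * V' h" for h
  proof -
    have "(\<Sum>j\<le>?K div 2. c (?K - j) * (?A j * ((2 * U x) ^ (?K - 2 * j) * (real j * V' h * V x ^ (j - 1))))) =
       - gbpoly (\<lambda>i. c (Suc i)) k (U x) (V x) * V' h"
    proof -
      have "(\<Sum>j\<le>?K div 2. c (?K - j) * (?A j * ((2 * U x) ^ (?K - 2 * j) * (real j * V' h * V x ^ (j - 1))))) =
        (\<Sum>j\<le>k div 2. c (Suc k - j) * (?A (Suc j) * ((2 * U x) ^ (k - 2 * j) * (real (Suc j) * V' h * V x ^ j))))"
        by (simp only: div2_Suc_Suc sum.atMost_Suc_shift) simp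
      also have "\<dots> = (\<Sum>j\<le>k div 2. - (c (Suc (k - j)) * gterm k j (U x) (V x)) * V' h)"
      proof (rule sum.cong[OF refl])
        fix j assume "j \<in> {..k div 2}"
        then have *: "Suc k - j = Suc (k - j)" by auto
        show "c (Suc k - j) * (?A (Suc j) * ((2 * U x) ^ (k - 2 * j) * (real (Suc j) * V' h * V x ^ j))) =
          - (c (Suc (k - j)) * gterm k j (U x) (V x)) * V' h"
          unfolding * by (simp add: gterm_def divide_simps)
      qed
      also have "\<dots> = - gbpoly (\<lambda>i. c (Suc i)) k (U x) (V x) * V' h"
        by (simp add: gbpoly_def sum_distrib_right sum_negf)
      finally show ?thesis .
    qed
    moreover have "(\<Sum>j\<le>?K div 2. c (?K - j) * (?A j * ((real (?K - 2 * j) * (2 * U' h) * (2 * U x) ^ (?K - 2 * j - 1)) * V x ^ j))) =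
       2 * gbpoly (\<lambda>i. c (Suc i)) (k + 1) (U x) (V x) * U' h"
    proof -
      have "(\<Sum>j\<le>?K div 2. c (?K - j) * (?A j * ((real (?K - 2 * j) * (2 * U' h) * (2 * U x) ^ (?K - 2 * j - 1)) * V x ^ j))) =
        (\<Sum>j\<le>Suc k div 2. c (?K - j) * (?A j * ((real (?K - 2 * j) * (2 * U' h) * (2 * U x) ^ (?K - 2 * j - 1)) * V x ^ j)))"
        by (rule sum.mono_neutral_right) auto
      also have "\<dots> = (\<Sum>j\<le>Suc k div 2. (c (Suc (Suc k - j)) * gterm (Suc k) j (U x) (V x)) * (2 * U' h))"
      proof (rule sum.cong[OF refl])
        fix j assume "j \<in> {..Suc k div 2}"
        then have *: "?K - j = Suc (Suc k - j)" "?K - 2 * j = Suc (Suc k - 2 * j)" by auto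
        show "c (?K - j) * (?A j * ((real (?K - 2 * j) * (2 * U' h) * (2 * U x) ^ (?K - 2 * j - 1)) * V x ^ j)) =
          (c (Suc (Suc k - j)) * gterm (Suc k) j (U x) (V x)) * (2 * U' h)"
          unfolding * by (simp add: gterm_def divide_simps)
      qed
      also have "\<dots> = 2 * gbpoly (\<lambda>i. c (Suc i)) (k + 1) (U x) (V x) * U' h"
        by (simp add: gbpoly_def sum_distrib_right sum_distrib_left mult_ac)
      finally show ?thesis .
    qed
    ultimately show ?thesis by (simp only: distrib_left sum.distrib)
  qed
  ultimately show ?thesis by simp
qed

section \<open>Generating functions: formal binomial series and complex factorisation\<close>

definition binom_fps :: "real \<Rightarrow> complex \<Rightarrow> complex fps" where
  "binom_fps m w = Abs_fps (\<lambda>k. of_real (pochhammer m k / fact k) * w ^ k)"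

text \<open>The differential equation of the formal power \<open>(1 - w X)^(-m)\<close>. It behaves
  well under products, which is how \<open>geg_eq_product\<close> treats two such factors without
  computing a convolution.\<close>

lemma binom_fps_deriv:
  "fps_deriv (binom_fps m w) * (1 - fps_const w * fps_X) = fps_const (of_real m * w) * binom_fps m w"
proof -
  have eq: "fps_deriv (binom_fps m w) * (1 - fps_const w * fps_X) =
    fps_deriv (binom_fps m w) - fps_const w * (fps_X * fps_deriv (binom_fps m w))"
    by (simp add: algebra_simps)
  have a: "of_nat (Suc k) * complex_of_real (pochhammer m (Suc k) / fact (Suc k)) =
      of_real (m + real k) * complex_of_real (pochhammer m k / fact k)" for k
  proof -
    have "real (Suc k) * (pochhammer m (Suc k) / fact (Suc k)) = (m + real k) * (pochhammer m k / fact k)"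
      by (simp add: pochhammer_Suc divide_simps)
    then have "complex_of_real (real (Suc k) * (pochhammer m (Suc k) / fact (Suc k))) =
        complex_of_real ((m + real k) * (pochhammer m k / fact k))"
      by (simp only:)
    then show ?thesis by (simp only: of_real_mult of_real_of_nat_eq)
  qed
  show ?thesis unfolding eq
  proof (rule fps_ext)
    fix n
    show "fps_nth (fps_deriv (binom_fps m w) - fps_const w * (fps_X * fps_deriv (binom_fps m w))) n =
      fps_nth (fps_const (of_real m * w) * binom_fps m w) n"
    proof (cases n)
      case 0
      then show ?thesis by (simp add: binom_fps_def)
    next
      case (Suc k)
      have d: "fps_nth (fps_deriv (binom_fps m w)) i = of_real (m + real i) * complex_of_real (pochhammer m i / fact i) * w ^ Suc i" for i
      proof -
        have "fps_nth (fps_deriv (binom_fps m w)) i =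
           (of_nat (Suc i) * complex_of_real (pochhammer m (Suc i) / fact (Suc i))) * w ^ Suc i"
          by (simp only: fps_deriv_nth binom_fps_def fps_nth_Abs_fps Suc_eq_plus1 mult.assoc)
        then show ?thesis by (simp only: a)
      qed
      have "w * fps_nth (fps_deriv (binom_fps m w)) k = of_nat (Suc k) * (complex_of_real (pochhammer m (Suc k) / fact (Suc k)) * w ^ Suc (Suc k))"
        unfolding d a[symmetric] by simp
      moreover have "of_real (m + real (Suc k)) * A * w ^ Suc (Suc k) - of_nat (Suc k) * (A * w ^ Suc (Suc k)) =
          of_real m * w * (A * w ^ Suc k)" for A
        by (simp add: algebra_simps)
      moreover have "fps_nth (binom_fps m w) i = complex_of_real (pochhammer m i / fact i) * w ^ i" for i
        by (simp add: binom_fps_def)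
      ultimately show ?thesis unfolding Suc
        by (simp only: fps_sub_nth fps_mult_left_const_nth fps_X_mult_nth d diff_Suc_1 nat.distinct if_False)
    qed
  qed
qed

lemma pochhammer_convolution:
  "(\<Sum>i\<le>k. (pochhammer a i / fact i) * (pochhammer b (k - i) / fact (k - i))) =
     pochhammer (a + b :: real) k / fact k"
proof -
  have "pochhammer (a + b) k / fact k = (\<Sum>i\<le>k. real (k choose i) * pochhammer a i * pochhammer b (k - i) / fact k)"
    by (simp add: pochhammer_binomial_sum sum_divide_distrib)
  also have "\<dots> = (\<Sum>i\<le>k. (pochhammer a i / fact i) * (pochhammer b (k - i) / fact (k - i)))"
    by (rule sum.cong) (auto simp: binomial_fact divide_simps)
  finally show ?thesis by simp
qed

text \<open>Since \<open>(1 - w X) (1 - w' X) = 1 - 2 u X + v X^2\<close>, the product satisfies a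
  first-order differential equation with polynomial coefficients. Its coefficients therefore obey
  \<open>geg_recurrence\<close>, and the first two agree with those of \<open>geg\<close>.\<close>

lemma geg_eq_product:
  assumes u: "w + w' = of_real (2 * u)" and v: "w * w' = of_real v"
  shows "complex_of_real (geg m k u v) = fps_nth (binom_fps m w * binom_fps m w') k"
proof -
  let ?a = "binom_fps m w" and ?b = "binom_fps m w'"
  define B where "B = ?a * ?b"
  let ?p = "1 - fps_const w * fps_X :: complex fps" and ?q = "1 - fps_const w' * fps_X :: complex fps"
  have "fps_deriv B * ?p * ?q = (fps_deriv ?a * ?p) * ?q * ?b + (fps_deriv ?b * ?q) * ?p * ?a"
    unfolding B_def by (simp add: algebra_simps)
  also have "\<dots> = (fps_const (of_real m * w) * ?q + fps_const (of_real m * w') * ?p) * B"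
    unfolding binom_fps_deriv B_def by (simp add: algebra_simps del: fps_const_add)
  finally have ode: "fps_deriv B * (?p * ?q) = (fps_const (of_real m * w) * ?q + fps_const (of_real m * w') * ?p) * B"
    by (simp add: mult.assoc)
  have pq: "?p * ?q = 1 - fps_const (w + w') * fps_X + fps_const (w * w') * (fps_X * fps_X)"
    by (simp add: algebra_simps flip: fps_const_add fps_const_mult)
  have mq: "fps_const (of_real m * w) * ?q + fps_const (of_real m * w') * ?p =
      fps_const (of_real m * (w + w')) - fps_const (2 * of_real m * (w * w')) * fps_X"
    by (simp add: algebra_simps flip: fps_const_add fps_const_mult)
  have ode': "fps_deriv B - fps_const (of_real (2 * u)) * (fps_X * fps_deriv B) + fps_const (of_real v) * (fps_X * (fps_X * fps_deriv B))
     = fps_const (of_real m * of_real (2 * u)) * B - fps_const (2 * of_real m * of_real v) * (fps_X * B)"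
    using ode unfolding pq mq u v by (simp add: algebra_simps)
  have rec: "of_nat (k + 2) * fps_nth B (k + 2) = of_real (2 * u * (real (k + 1) + m)) * fps_nth B (k + 1)
      - of_real (v * (real k + 2 * m)) * fps_nth B k" for k
  proof -
    have "fps_nth (fps_deriv B - fps_const (of_real (2 * u)) * (fps_X * fps_deriv B) + fps_const (of_real v) * (fps_X * (fps_X * fps_deriv B))) (k + 1)
     = fps_nth (fps_const (of_real m * of_real (2 * u)) * B - fps_const (2 * of_real m * of_real v) * (fps_X * B)) (k + 1)"
      unfolding ode' by (rule refl)
    moreover have "fps_nth (fps_X * (fps_X * fps_deriv B)) (k + 1) = of_nat k * fps_nth B k"
      by (cases k) simp_all
    moreover have "fps_nth (fps_X * fps_deriv B) (k + 1) = of_nat (k + 1) * fps_nth B (k + 1)"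
      "fps_nth (fps_X * B) (k + 1) = fps_nth B k"
      "fps_nth (fps_deriv B) (k + 1) = of_nat (k + 2) * fps_nth B (k + 2)"
      by simp_all
    ultimately have "of_nat (k + 2) * fps_nth B (k + 2) - of_real (2 * u) * (of_nat (k + 1) * fps_nth B (k + 1))
        + of_real v * (of_nat k * fps_nth B k)
      = of_real m * of_real (2 * u) * fps_nth B (k + 1) - 2 * of_real m * of_real v * fps_nth B k"
      by (simp only: fps_add_nth fps_sub_nth fps_mult_left_const_nth)
    then show ?thesis
      by (simp add: algebra_simps)
  qed
  have "fps_nth B k = complex_of_real (geg m k u v) \<and> fps_nth B (Suc k) = complex_of_real (geg m (Suc k) u v)"
  proof (induction k)
    case 0
    have "fps_nth B 0 = 1" by (simp add: B_def binom_fps_def)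
    moreover have "fps_nth B 1 = of_real m * (w + w')"
      by (simp add: B_def binom_fps_def fps_mult_nth_1 algebra_simps)
    ultimately show ?case by (simp add: u)
  next
    case (Suc k)
    have "of_nat (k + 2) * fps_nth B (k + 2) = of_real (real (k + 2) * geg m (k + 2) u v)"
      unfolding rec geg_recurrence using Suc by simp
    then have "of_nat (k + 2) * fps_nth B (k + 2) = of_nat (k + 2) * of_real (geg m (k + 2) u v)"
      by (simp only: of_real_mult of_real_of_nat_eq)
    then have "fps_nth B (k + 2) = of_real (geg m (k + 2) u v)"
      by (simp only: mult_cancel_left of_nat_eq_0_iff) simp
    then show ?case using Suc by simp
  qed
  then show ?thesis by (simp add: B_def)
qed

text \<open>The hypothesis is the Cauchy-Schwarz inequality for \<open>u = x \<bullet> y\<close>. It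
  makes the two roots conjugate, so that \<open>1 - 2 u + v\<close> is the squared modulus of
  \<open>1 - w\<close>.\<close>

lemma conjugate_pair:
  assumes "u\<^sup>2 \<le> v"
  obtains w :: complex where "w + cnj w = of_real (2 * u)" "w * cnj w = of_real v" "cmod w = sqrt v"
proof
  let ?w = "Complex u (sqrt (v - u\<^sup>2))"
  show "?w + cnj ?w = of_real (2 * u)" by (simp add: complex_eq_iff)
  show c: "cmod ?w = sqrt v" using assms by (simp add: cmod_def)
  have "0 \<le> v" using assms order_trans zero_le_power2 by blast
  then show "?w * cnj ?w = of_real v"
    unfolding complex_norm_square[symmetric] c by (simp flip: of_real_power)
qed

text \<open>Both roots have modulus \<open>sqrt v\<close>, and \<open>m \<ge> 0\<close> makes the
  binomial coefficients nonnegative, so the triangle inequality in the product formula leaves a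
  Chu-Vandermonde sum. Equality at \<open>u = sqrt v\<close> is \<open>geg_diag\<close>.\<close>

lemma geg_abs_le:
  assumes "u\<^sup>2 \<le> v" "0 \<le> m"
  shows "\<bar>geg m k u v\<bar> \<le> pochhammer (2 * m) k / fact k * sqrt v ^ k"
proof -
  obtain w where w: "w + cnj w = of_real (2 * u)" "w * cnj w = of_real v" and c: "cmod w = sqrt v"
    by (rule conjugate_pair[OF assms(1)])
  have "\<bar>geg m k u v\<bar> = cmod (complex_of_real (geg m k u v))" by simp
  also have "\<dots> = cmod (\<Sum>i=0..k. of_real (pochhammer m i / fact i) * w ^ i *
        (of_real (pochhammer m (k - i) / fact (k - i)) * cnj w ^ (k - i)))"
    unfolding geg_eq_product[OF w] by (simp add: fps_mult_nth binom_fps_def)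
  also have "\<dots> \<le> (\<Sum>i=0..k. cmod (of_real (pochhammer m i / fact i) * w ^ i *
        (of_real (pochhammer m (k - i) / fact (k - i)) * cnj w ^ (k - i))))"
    by (rule norm_sum)
  also have "\<dots> = (\<Sum>i=0..k. (pochhammer m i / fact i) * (pochhammer m (k - i) / fact (k - i)) * sqrt v ^ k)"
  proof (rule sum.cong[OF refl])
    fix i assume "i \<in> {0..k}"
    then have *: "sqrt v ^ k = sqrt v ^ i * sqrt v ^ (k - i)" by (simp flip: power_add)
    have "0 \<le> pochhammer m i" for i
      by (cases "m = 0") (use assms in \<open>auto simp: pochhammer_0_left intro!: less_imp_le[OF pochhammer_pos]\<close>)
    then show "cmod (of_real (pochhammer m i / fact i) * w ^ i *
        (of_real (pochhammer m (k - i) / fact (k - i)) * cnj w ^ (k - i))) =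
       (pochhammer m i / fact i) * (pochhammer m (k - i) / fact (k - i)) * sqrt v ^ k"
      unfolding * by (simp add: norm_mult norm_divide norm_power c)
  qed
  also have "\<dots> = pochhammer (2 * m) k / fact k * sqrt v ^ k"
    using pochhammer_convolution[of m m k] by (simp only: sum_distrib_right[symmetric] atMost_atLeast0 mult_2)
  finally show ?thesis .
qed

lemma geg_diag: "geg m k r (r\<^sup>2) = pochhammer (2 * m) k / fact k * r ^ k"
proof -
  have "complex_of_real (geg m k 1 1) = fps_nth (binom_fps m 1 * binom_fps m 1) k"
    by (rule geg_eq_product) simp_all
  also have "\<dots> = of_real (\<Sum>i\<le>k. (pochhammer m i / fact i) * (pochhammer m (k - i) / fact (k - i)))"
    by (simp add: fps_mult_nth binom_fps_def atMost_atLeast0)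
  also have "\<dots> = of_real (pochhammer (2 * m) k / fact k)"
    using pochhammer_convolution[of m m k] by (simp only: mult_2)
  finally have "geg m k 1 1 = pochhammer (2 * m) k / fact k" unfolding of_real_eq_iff .
  then show ?thesis using gbpoly_scale[of "pochhammer m" k r 1 1] by simp
qed

lemma bracket_bounds:
  assumes "u\<^sup>2 \<le> v" "v < (1::real)"
  shows "(1 - sqrt v)\<^sup>2 \<le> 1 - 2 * u + v" "0 < 1 - 2 * u + v" "sqrt v < 1" "0 \<le> v" "\<bar>u\<bar> \<le> sqrt v" "1 - 2 * u + v \<le> 4"
proof -
  show v: "0 \<le> v" using assms(1) order_trans zero_le_power2 by blast
  show u: "\<bar>u\<bar> \<le> sqrt v" using assms(1) real_le_rsqrt by fastforce
  show s: "sqrt v < 1" using assms(2) by simp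
  show 1: "(1 - sqrt v)\<^sup>2 \<le> 1 - 2 * u + v"
    using u v by (simp add: power2_diff)
  show "0 < 1 - 2 * u + v" using 1 s by (meson less_le_trans zero_less_power2 less_irrefl diff_gt_0_iff_gt zero_less_power)
  show "1 - 2 * u + v \<le> 4" using u s assms(2) by linarith
qed

lemma geg_sums:
  assumes "u\<^sup>2 \<le> v" "v < 1"
  shows "(\<lambda>k. geg m k u v) sums (1 - 2 * u + v) powr (- m)"
proof -
  obtain w where w: "w + cnj w = of_real (2 * u)" "w * cnj w = of_real v" and c: "cmod w = sqrt v"
    by (rule conjugate_pair[OF assms(1)])
  have c1: "cmod w < 1" "cmod (cnj w) < 1" using assms bracket_bounds[of u v] c by auto
  let ?a = "\<lambda>w k. complex_of_real (pochhammer m k / fact k) * w ^ k"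
  have a: "?a z k = (- of_real m gchoose k) * (- z) ^ k" for z k
  proof -
    have "pochhammer (complex_of_real m) k = of_real (pochhammer m k)"
      by (simp add: pochhammer_of_real)
    moreover have "(- z) ^ k = (-1) ^ k * z ^ k" by (rule power_minus)
    moreover have "(-1) ^ k * ((-1) ^ k * y) = y" for y :: complex
      by (simp flip: mult.assoc power_mult_distrib)
    ultimately show ?thesis by (simp add: gbinomial_pochhammer mult_ac)
  qed
  have s: "?a z sums (1 - z) powr (- of_real m)" if "cmod z < 1" for z
    unfolding a using gen_binomial_complex[of "- z" "- of_real m"] that by simp
  have sn: "summable (\<lambda>k. norm (?a z k))" if "cmod z < 1" for z
  proof -
    \<comment> \<open>Absolute convergence at \<open>z\<close>, which the Cauchy product requires,
      is drawn from convergence at a real point of larger modulus.\<close>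
    obtain r where r: "cmod z < r" "r < 1" using dense[OF \<open>cmod z < 1\<close>] by auto
    have r0: "0 \<le> r" using order_trans[OF norm_ge_zero less_imp_le[OF r(1)]] .
    have r1: "cmod (of_real r) < 1" using r r0 by simp
    show ?thesis
      by (rule powser_insidea[OF sums_summable[OF s[OF r1]]]) (use r r0 in simp)
  qed
  have "(\<lambda>k. \<Sum>i\<le>k. ?a w i * ?a (cnj w) (k - i)) sums ((\<Sum>k. ?a w k) * (\<Sum>k. ?a (cnj w) k))"
    by (rule Cauchy_product_sums[OF sn[OF c1(1)] sn[OF c1(2)]])
  moreover have "(\<Sum>i\<le>k. ?a w i * ?a (cnj w) (k - i)) = complex_of_real (geg m k u v)" for k
    unfolding geg_eq_product[OF w] by (simp add: fps_mult_nth binom_fps_def atMost_atLeast0)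
  moreover have "(\<Sum>k. ?a w k) = (1 - w) powr (- of_real m)" "(\<Sum>k. ?a (cnj w) k) = (1 - cnj w) powr (- of_real m)"
    using s[OF c1(1)] s[OF c1(2)] by (simp_all only: sums_iff)
  ultimately have *: "(\<lambda>k. complex_of_real (geg m k u v)) sums ((1 - w) powr (- of_real m) * (1 - cnj w) powr (- of_real m))"
    by (simp only:)
  \<comment> \<open>A positive real part keeps \<open>1 - w\<close> off the branch cut, so
    conjugation commutes with the complex power and the product of the two sums is a squared
    modulus.\<close>
  have pos: "0 < Re (1 - w)" using c1 complex_Re_le_cmod[of w] by simp
  have "cnj ((1 - w) powr (- of_real m)) = cnj (1 - w) powr cnj (- of_real m)"
    by (rule cnj_powr) (use pos in simp)
  then have "(1 - cnj w) powr (- of_real m) = cnj ((1 - w) powr (- of_real m))"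
    by simp
  then have "(1 - w) powr (- of_real m) * (1 - cnj w) powr (- of_real m) = of_real ((cmod ((1 - w) powr (- of_real m)))\<^sup>2)"
    by (simp only: complex_norm_square)
  also have "cmod ((1 - w) powr (- of_real m)) = cmod (1 - w) powr (- m)"
    using norm_powr_real_powr'[of "- of_real m" "1 - w"] by simp
  also have "(cmod (1 - w) powr (- m))\<^sup>2 = ((cmod (1 - w))\<^sup>2) powr (- m)"
    unfolding power2_eq_square by (rule powr_mult[symmetric])
  also have "(cmod (1 - w))\<^sup>2 = 1 - 2 * u + v"
  proof -
    have "complex_of_real ((cmod (1 - w))\<^sup>2) = (1 - w) * cnj (1 - w)" by (rule complex_norm_square)
    also have "\<dots> = 1 - (w + cnj w) + w * cnj w" by (simp add: algebra_simps)
    also have "\<dots> = of_real (1 - 2 * u + v)" by (simp only: w) simp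
    finally show ?thesis unfolding of_real_eq_iff .
  qed
  finally have "(\<lambda>k. complex_of_real (geg m k u v)) sums of_real ((1 - 2 * u + v) powr (- m))"
    using * by (simp only:)
  then show ?thesis by (simp only: sums_of_real_iff)
qed

text \<open>The ratio divided by the power converges to \<open>Gamma B / Gamma A\<close>, which is
  finite and positive; hence it and its inverse are both bounded. The base \<open>k + 1\<close>
  covers \<open>k = 0\<close>.\<close>

lemma pochhammer_ratio_bounds:
  fixes A B :: real
  assumes "A > 0" "B > 0"
  obtains c C where "c > 0" "\<And>k. c * real (k + 1) powr (A - B) \<le> pochhammer A k / pochhammer B k"
    "\<And>k. pochhammer A k / pochhammer B k \<le> C * real (k + 1) powr (A - B)"
proof -
  define r where "r k = pochhammer A k / pochhammer B k * real (k + 1) powr (B - A)" for k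
  have pos: "r k > 0" for k using assms by (simp add: r_def pochhammer_pos)
  have G: "Gamma A > 0" "Gamma B > 0" using assms by (auto intro: Gamma_real_pos)
  have "(\<lambda>n. Gamma_series' B n / Gamma_series' A n * ((real n + 1) / real n) powr (B - A)) \<longlonglongrightarrow>
      Gamma B / Gamma A * 1 powr (B - A)"
  proof (intro tendsto_intros Gamma_series'_LIMSEQ)
    have "(\<lambda>n. 1 + inverse (real n)) \<longlonglongrightarrow> 1 + 0"
      by (intro tendsto_intros lim_inverse_n)
    then have "(\<lambda>n. 1 + inverse (real n)) \<longlonglongrightarrow> 1" by simp
    moreover have "eventually (\<lambda>n. 1 + inverse (real n) = (real n + 1) / real n) sequentially"
      using eventually_gt_at_top[of 0] by eventually_elim (simp add: field_simps)
    ultimately show "(\<lambda>n. (real n + 1) / real n) \<longlonglongrightarrow> 1" by (rule Lim_transform_eventually)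
  qed (use G in auto)
  moreover have "eventually (\<lambda>n. Gamma_series' B n / Gamma_series' A n * ((real n + 1) / real n) powr (B - A) = r n) sequentially"
    using eventually_gt_at_top[of 0]
  proof eventually_elim
    case (elim n)
    have "exp (B * ln (real n)) / exp (A * ln (real n)) = real n powr (B - A)"
      using elim by (simp add: powr_def exp_diff left_diff_distrib)
    then have e: "exp (B * ln (real n)) = real n powr (B - A) * exp (A * ln (real n))"
      by (simp add: field_simps)
    have p: "pochhammer A n > 0" "pochhammer B n > 0" using assms by (auto intro: pochhammer_pos)
    have "((real n + 1) / real n) powr (B - A) = (real n + 1) powr (B - A) / real n powr (B - A)"
      by (rule powr_divide)
    then show ?case using p elim by (simp add: Gamma_series'_def r_def e add.commute)
  qed
  ultimately have lim: "r \<longlonglongrightarrow> Gamma B / Gamma A" by (simp add: filterlim_cong[OF refl refl] Lim_transform_eventually)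
  then have "Bseq r" by (rule convergent_imp_Bseq[OF convergentI])
  then obtain C where C: "\<And>k. \<bar>r k\<bar> \<le> C" unfolding Bseq_def by auto
  have "(\<lambda>k. inverse (r k)) \<longlonglongrightarrow> inverse (Gamma B / Gamma A)"
    using lim by (rule tendsto_inverse) (use G in auto)
  then have "Bseq (\<lambda>k. inverse (r k))" by (rule convergent_imp_Bseq[OF convergentI])
  then obtain K where K: "K > 0" "\<And>k. \<bar>inverse (r k)\<bar> \<le> K" unfolding Bseq_def by auto
  have eq: "pochhammer A k / pochhammer B k = r k * real (k + 1) powr (A - B)" for k
    by (simp add: r_def flip: powr_add)
  show thesis
  proof
    show "inverse K > 0" using K by simp
    show "inverse K * real (k + 1) powr (A - B) \<le> pochhammer A k / pochhammer B k" for k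
    proof -
      have "inverse (r k) \<le> K" using K(2)[of k] pos[of k] by simp
      then have "inverse K \<le> inverse (inverse (r k))" using pos[of k] by (intro le_imp_inverse_le) auto
      then show ?thesis unfolding eq by (intro mult_right_mono) auto
    qed
    show "pochhammer A k / pochhammer B k \<le> C * real (k + 1) powr (A - B)" for k
      unfolding eq using C[of k] by (intro mult_right_mono) auto
  qed
qed

text \<open>Polynomial growth is all that convergence inside the ball asks of a coefficient
  sequence, and it survives products and index shifts.\<close>

definition polyb :: "(nat \<Rightarrow> real) \<Rightarrow> bool" where
  "polyb a \<longleftrightarrow> (\<exists>C N. \<forall>k. \<bar>a k\<bar> \<le> C * real (k + 1) ^ N)"

lemma polybI: "(\<And>k. \<bar>a k\<bar> \<le> C * real (k + 1) ^ N) \<Longrightarrow> polyb a"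
  unfolding polyb_def by blast

lemma polybI_powr:
  assumes "\<And>k. \<bar>a k\<bar> \<le> C * real (k + 1) powr s"
  shows "polyb a"
proof (rule polybI)
  fix k
  have "\<bar>a k\<bar> \<le> \<bar>C\<bar> * real (k + 1) powr s"
    using assms[of k] by (rule order_trans) (intro mult_right_mono, auto)
  also have "real (k + 1) powr s \<le> real (k + 1) powr real (nat \<lceil>s\<rceil>)"
    by (rule powr_mono) (simp_all add: real_nat_ceiling_ge)
  also have "\<dots> = real (k + 1) ^ nat \<lceil>s\<rceil>" by (rule powr_realpow) simp
  finally show "\<bar>a k\<bar> \<le> \<bar>C\<bar> * real (k + 1) ^ nat \<lceil>s\<rceil>" by (simp add: mult_left_mono)
qed

lemma polyb_pos:
  assumes "polyb a"
  obtains C N where "C \<ge> 0" "\<And>k. \<bar>a k\<bar> \<le> C * real (k + 1) ^ N"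
proof -
  obtain C N where C: "\<And>k. \<bar>a k\<bar> \<le> C * real (k + 1) ^ N" using assms unfolding polyb_def by blast
  have "C \<ge> 0" using C[of 0] by simp
  then show thesis using C that by blast
qed

lemma polyb_mult [intro]:
  assumes "polyb a" "polyb b"
  shows "polyb (\<lambda>k. a k * b k)"
proof -
  obtain C N where C: "C \<ge> 0" "\<And>k. \<bar>a k\<bar> \<le> C * real (k + 1) ^ N" using polyb_pos[OF assms(1)] by metis
  obtain D M where D: "D \<ge> 0" "\<And>k. \<bar>b k\<bar> \<le> D * real (k + 1) ^ M" using polyb_pos[OF assms(2)] by metis
  show ?thesis
  proof (rule polybI)
    fix k
    have "\<bar>a k * b k\<bar> \<le> (C * real (k + 1) ^ N) * (D * real (k + 1) ^ M)"
      unfolding abs_mult by (intro mult_mono C D) (use C D in auto)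
    then show "\<bar>a k * b k\<bar> \<le> (C * D) * real (k + 1) ^ (N + M)" by (simp add: power_add mult_ac)
  qed
qed

lemma polyb_Suc [intro]:
  assumes "polyb a"
  shows "polyb (\<lambda>k. a (Suc k))"
proof -
  obtain C N where C: "C \<ge> 0" "\<And>k. \<bar>a k\<bar> \<le> C * real (k + 1) ^ N" using polyb_pos[OF assms(1)] by metis
  show ?thesis
  proof (rule polybI)
    fix k
    have "\<bar>a (Suc k)\<bar> \<le> C * real (Suc k + 1) ^ N" by (rule C)
    also have "\<dots> \<le> C * (2 * real (k + 1)) ^ N"
      using C by (intro mult_left_mono power_mono) auto
    finally show "\<bar>a (Suc k)\<bar> \<le> (C * 2 ^ N) * real (k + 1) ^ N" by (simp add: power_mult_distrib[symmetric] mult.assoc)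
  qed
qed

lemma polyb_const [intro, simp]: "polyb (\<lambda>k. c)"
  by (rule polybI[of _ "\<bar>c\<bar>" 0]) simp

lemma polyb_linear [intro, simp]: "polyb (\<lambda>k. real k + c)"
proof (rule polybI[of _ "1 + \<bar>c\<bar>" 1])
  fix k
  have "\<bar>c\<bar> * 1 \<le> \<bar>c\<bar> * real (k + 1)" by (intro mult_left_mono) auto
  then show "\<bar>real k + c\<bar> \<le> (1 + \<bar>c\<bar>) * real (k + 1) ^ 1"
    by (simp add: distrib_right)
qed

lemma polyb_pochhammer:
  assumes "A > 0" "B > 0"
  shows "polyb (\<lambda>k. pochhammer A k / pochhammer B k)"
proof -
  obtain c C where "\<And>k. pochhammer A k / pochhammer B k \<le> C * real (k + 1) powr (A - B)"
    using pochhammer_ratio_bounds[OF assms] by metis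
  moreover have "\<bar>pochhammer A k / pochhammer B k\<bar> = pochhammer A k / pochhammer B k" for k
    using assms by (simp add: pochhammer_pos less_imp_le)
  ultimately show ?thesis by (intro polybI_powr[of _ C "A - B"]) simp
qed

lemma polyb_pochhammer_fact: "A > 0 \<Longrightarrow> polyb (\<lambda>k. pochhammer A k / fact k)"
  using polyb_pochhammer[of A 1] by (simp add: pochhammer_fact)

text \<open>Each factor \<open>k + 1\<close> is absorbed by half of the decay: with
  \<open>t = sqrt q\<close>, the product \<open>(k + 1) * t ^ k\<close> is at most a partial
  geometric sum.\<close>

lemma power_times_geometric_bounded:
  assumes "0 \<le> q" "q < (1::real)"
  shows "\<exists>K. \<forall>k. \<bar>real (k + 1) ^ N * q ^ k\<bar> \<le> K"
  using assms
proof (induction N arbitrary: q)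
  case 0
  then show ?case by (intro exI[of _ 1]) (auto intro: power_le_one)
next
  case (Suc N)
  define t where "t = sqrt q"
  have t: "0 \<le> t" "t < 1" "q = t * t" using Suc.prems by (auto simp: t_def)
  obtain K where K: "\<And>k. \<bar>real (k + 1) ^ N * t ^ k\<bar> \<le> K" using Suc.IH t by blast
  have "real (k + 1) * t ^ k \<le> 1 / (1 - t)" for k
  proof -
    have "real (k + 1) * t ^ k = (\<Sum>i\<le>k. t ^ k)" by simp
    also have "\<dots> \<le> (\<Sum>i\<le>k. t ^ i)" using t by (intro sum_mono power_decreasing) auto
    also have "\<dots> = (1 - t ^ Suc k) / (1 - t)" using t by (subst sum_gp0) auto
    also have "\<dots> \<le> 1 / (1 - t)" using t by (intro divide_right_mono) auto
    finally show ?thesis .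
  qed
  note le = this
  have "\<bar>real (k + 1) ^ Suc N * q ^ k\<bar> \<le> K * (1 / (1 - t))" for k
  proof -
    have "\<bar>real (k + 1) ^ Suc N * q ^ k\<bar> = \<bar>real (k + 1) ^ N * t ^ k\<bar> * (real (k + 1) * t ^ k)"
      using t by (simp add: abs_mult power_mult_distrib)
    also have "\<dots> \<le> K * (1 / (1 - t))"
      by (rule mult_mono[OF K le]) (use t K[of 0] in auto)
    finally show ?thesis .
  qed
  then show ?case by blast
qed

lemma polyb_summable:
  assumes "polyb a" "0 \<le> r" "r < 1"
  shows "summable (\<lambda>k. \<bar>a k\<bar> * r ^ k)"
proof -
  obtain C N where C: "C \<ge> 0" "\<And>k. \<bar>a k\<bar> \<le> C * real (k + 1) ^ N" using polyb_pos[OF assms(1)] by metis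
  obtain s where s: "r < s" "s < 1" using dense[OF assms(3)] by auto
  have s0: "s > 0" using s assms by simp
  obtain K where K: "\<And>k. \<bar>real (k + 1) ^ N * (r / s) ^ k\<bar> \<le> K"
    using power_times_geometric_bounded[of "r / s" N] s s0 assms by auto
  show ?thesis
  proof (rule summable_comparison_test')
    show "summable (\<lambda>k. (C * K) * s ^ k)" using s s0 by (intro summable_mult summable_geometric) auto
    fix k :: nat assume "k \<ge> 0"
    have "\<bar>a k\<bar> * r ^ k \<le> C * real (k + 1) ^ N * r ^ k" by (intro mult_right_mono C) (use assms in auto)
    also have "\<dots> = C * (real (k + 1) ^ N * (r / s) ^ k) * s ^ k"
      using s0 by (simp add: power_divide)
    also have "\<dots> \<le> C * K * s ^ k"
      using K[of k] C s0 by (intro mult_right_mono mult_left_mono) auto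
    finally show "norm (\<bar>a k\<bar> * r ^ k) \<le> (C * K) * s ^ k" using assms by simp
  qed
qed

section \<open>Multipliers on homogeneous series\<close>

lemma nn_integral_powr_0:
  assumes "s > (-1::real)" "c \<ge> 0"
  shows "(\<integral>\<^sup>+t. ennreal (t powr s) * indicator {0..c} t \<partial>lborel) = ennreal (c powr (s + 1) / (s + 1))"
  by (rule nn_integral_has_integral_lebesgue') (auto intro: has_integral_powr_from_0 assms)

lemma nn_integral_powr_inf:
  assumes "s < (-1::real)" "c > 0"
  shows "(\<integral>\<^sup>+t. ennreal (t powr s) * indicator {c..} t \<partial>lborel) = ennreal (- (c powr (s + 1)) / (s + 1))"
  by (rule nn_integral_has_integral_lebesgue') (use has_integral_powr_to_inf[OF assms] in auto)

text \<open>The critical exponent is \<open>\<beta> - s - 1\<close>. When it equals 0 the integral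
  grows like the logarithm of \<open>1 / d\<close>, and \<open>\<kappa> = 0\<close> is excluded; the
  strictness condition enters the whole proof here.\<close>

lemma nn_integral_powr_shift_le:
  assumes s: "s > -1" and b: "\<beta> \<ge> 0" and k: "\<kappa> \<ge> 0" "\<kappa> \<ge> \<beta> - s - 1" "\<kappa> > 0 \<or> \<kappa> > \<beta> - s - 1"
  obtains C where "C > 0" "\<And>d. 0 < d \<Longrightarrow> d \<le> 2 \<Longrightarrow>
    (\<integral>\<^sup>+t. ennreal (t powr s * (t + d) powr (- \<beta>)) * indicator {0<..<1} t \<partial>lborel) \<le> ennreal (C * d powr (- \<kappa>))"
proof (cases "\<kappa> > \<beta> - s - 1")
  case True
  \<comment> \<open>\<open>s'\<close> is the power of \<open>t\<close> that remains after
    \<open>d powr (- \<kappa>)\<close> has been split off; strictness puts it above -1. The 3 in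
    \<open>K\<close> bounds \<open>t + d\<close>.\<close>
  define s' where "s' = s + min 0 (\<kappa> - \<beta>)"
  define K where "K = (3::real) powr \<bar>\<kappa> - \<beta>\<bar>"
  have s': "s' > -1" using s True by (auto simp: s'_def)
  have "(\<integral>\<^sup>+t. ennreal (t powr s * (t + d) powr (- \<beta>)) * indicator {0<..<1} t \<partial>lborel)
      \<le> ennreal (K / (s' + 1) * d powr (- \<kappa>))" if d: "0 < d" "d \<le> 2" for d
  proof -
    have "(\<integral>\<^sup>+t. ennreal (t powr s * (t + d) powr (- \<beta>)) * indicator {0<..<1} t \<partial>lborel)
      \<le> (\<integral>\<^sup>+t. ennreal (K * d powr (- \<kappa>)) * (ennreal (t powr s') * indicator {0..1} t) \<partial>lborel)"
    proof (rule nn_integral_mono)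
      fix t :: real
      have "t powr s * (t + d) powr (- \<beta>) \<le> K * d powr (- \<kappa>) * t powr s'" if t: "0 < t" "t < 1"
      proof -
        have "(t + d) powr (- \<beta>) = (t + d) powr (- \<kappa>) * (t + d) powr (\<kappa> - \<beta>)"
          by (simp flip: powr_add)
        also have "(t + d) powr (- \<kappa>) \<le> d powr (- \<kappa>)"
          using t d k by (intro powr_mono2') auto
        also have "(t + d) powr (\<kappa> - \<beta>) \<le> K * t powr min 0 (\<kappa> - \<beta>)"
        proof (cases "\<kappa> - \<beta> \<ge> 0")
          case True
          have "(t + d) powr (\<kappa> - \<beta>) \<le> 3 powr (\<kappa> - \<beta>)" using t d True by (intro powr_mono2) auto
          then show ?thesis using True t by (simp add: K_def)
        next
          case False
          have "(t + d) powr (\<kappa> - \<beta>) \<le> t powr (\<kappa> - \<beta>)" using t d False by (intro powr_mono2') auto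
          also have "\<dots> \<le> K * t powr (\<kappa> - \<beta>)" using ge_one_powr_ge_zero[of 3 "\<bar>\<kappa> - \<beta>\<bar>"]
            using mult_right_mono[of 1 "3 powr \<bar>\<kappa> - \<beta>\<bar>" "t powr (\<kappa> - \<beta>)"] by (simp add: K_def)
          finally show ?thesis using False by simp
        qed
        finally have "(t + d) powr (- \<beta>) \<le> d powr (- \<kappa>) * (K * t powr min 0 (\<kappa> - \<beta>))"
          by (simp add: mult_left_mono mult_right_mono)
        then have "t powr s * (t + d) powr (- \<beta>) \<le> t powr s * (d powr (- \<kappa>) * (K * t powr min 0 (\<kappa> - \<beta>)))"
          by (rule mult_left_mono) simp
        then show ?thesis by (simp add: s'_def powr_add mult_ac)
      qed
      then show "ennreal (t powr s * (t + d) powr (- \<beta>)) * indicator {0<..<1} t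
         \<le> ennreal (K * d powr (- \<kappa>)) * (ennreal (t powr s') * indicator {0..1} t)"
        by (auto simp: indicator_def K_def simp flip: ennreal_mult intro!: ennreal_leI)
    qed
    also have "\<dots> = ennreal (K * d powr (- \<kappa>)) * ennreal (1 / (s' + 1))"
      using nn_integral_powr_0[OF s', of 1] by (simp add: nn_integral_cmult)
    also have "\<dots> = ennreal (K / (s' + 1) * d powr (- \<kappa>))"
      using s' by (simp add: K_def flip: ennreal_mult)
    finally show ?thesis .
  qed
  moreover have "K / (s' + 1) > 0" using s' by (simp add: K_def)
  ultimately show thesis using that by blast
next
  case False
  \<comment> \<open>In the critical case the integral is cut at \<open>t = d\<close>: below,
    \<open>(t + d) powr (- \<beta>)\<close> is replaced by \<open>d powr (- \<beta>)\<close>, and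
    above by \<open>t powr (- \<beta>)\<close>.\<close>
  then have eq: "\<kappa> = \<beta> - s - 1" and k0: "\<kappa> > 0" using k by auto
  have "(\<integral>\<^sup>+t. ennreal (t powr s * (t + d) powr (- \<beta>)) * indicator {0<..<1} t \<partial>lborel)
      \<le> ennreal ((1 / (s + 1) + 1 / \<kappa>) * d powr (- \<kappa>))" if d: "0 < d" "d \<le> 2" for d
  proof -
    have "(\<integral>\<^sup>+t. ennreal (t powr s * (t + d) powr (- \<beta>)) * indicator {0<..<1} t \<partial>lborel)
      \<le> (\<integral>\<^sup>+t. ennreal (d powr (- \<beta>)) * (ennreal (t powr s) * indicator {0..d} t) +
            ennreal (t powr (s - \<beta>)) * indicator {d..} t \<partial>lborel)"
    proof (rule nn_integral_mono)
      fix t :: real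
      have "t powr s * (t + d) powr (- \<beta>) \<le> d powr (- \<beta>) * t powr s" if "0 < t"
        using that d b powr_mono2'[of "- \<beta>" d "t + d"] by (simp add: mult.commute mult_right_mono)
      moreover have "t powr s * (t + d) powr (- \<beta>) \<le> t powr (s - \<beta>)" if "0 < t"
      proof -
        have "(t + d) powr (- \<beta>) \<le> t powr (- \<beta>)" using that d b by (intro powr_mono2') auto
        then have "t powr s * (t + d) powr (- \<beta>) \<le> t powr s * t powr (- \<beta>)" by (rule mult_left_mono) simp
        then show ?thesis by (simp flip: powr_add)
      qed
      ultimately show "ennreal (t powr s * (t + d) powr (- \<beta>)) * indicator {0<..<1} t \<le>
         ennreal (d powr (- \<beta>)) * (ennreal (t powr s) * indicator {0..d} t) +
            ennreal (t powr (s - \<beta>)) * indicator {d..} t"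
        by (cases "t \<le> d") (auto simp: indicator_def simp flip: ennreal_mult ennreal_plus intro!: ennreal_leI add_increasing2)
    qed
    also have "\<dots> = ennreal (d powr (- \<beta>)) * ennreal (d powr (s + 1) / (s + 1)) + ennreal (- (d powr (s - \<beta> + 1)) / (s - \<beta> + 1))"
      using d s k0 eq by (simp add: nn_integral_add nn_integral_cmult nn_integral_powr_0 nn_integral_powr_inf)
    also have "\<dots> = ennreal ((1 / (s + 1) + 1 / \<kappa>) * d powr (- \<kappa>))"
    proof -
      have "s - \<beta> + 1 = - \<kappa>" using eq by simp
      moreover have "d powr (- \<beta>) * d powr (s + 1) = d powr (- \<kappa>)" using eq by (simp flip: powr_add) (simp add: algebra_simps)
      ultimately have "d powr (- \<beta>) * (d powr (s + 1) / (s + 1)) + - (d powr (s - \<beta> + 1)) / (s - \<beta> + 1) =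
         (1 / (s + 1) + 1 / \<kappa>) * d powr (- \<kappa>)" by (simp add: distrib_right)
      moreover have "0 \<le> - (d powr (s - \<beta> + 1)) / (s - \<beta> + 1)" using \<open>s - \<beta> + 1 = - \<kappa>\<close> k0 by simp
      ultimately show ?thesis using s by (simp flip: ennreal_mult ennreal_plus)
    qed
    finally show ?thesis .
  qed
  moreover have "1 / (s + 1) + 1 / \<kappa> > 0" using s k0 by (simp add: add_pos_pos)
  ultimately show thesis using that by blast
qed

lemma powr_half_one_le:
  fixes x :: real
  assumes "1/2 \<le> x" "x \<le> 1"
  shows "x powr r \<le> 2 powr \<bar>r\<bar>"
proof -
  have "x powr r \<le> x powr (- \<bar>r\<bar>)" using assms by (intro powr_mono') auto
  also have "\<dots> \<le> (1/2) powr (- \<bar>r\<bar>)" using assms by (intro powr_mono2') auto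
  also have "\<dots> = 2 powr \<bar>r\<bar>" by (simp add: powr_minus_divide powr_divide)
  finally show ?thesis .
qed

text \<open>These are the moments of the Beta distribution with parameters \<open>\<alpha>\<close>
  and \<open>\<beta> - \<alpha>\<close>.\<close>

lemma beta_moment:
  assumes "0 < \<alpha>" "\<alpha> < (\<beta>::real)"
  shows "has_bochner_integral lborel
     (\<lambda>t. indicator {0<..<1} t * (t powr (\<alpha> - 1) * (1 - t) powr (\<beta> - \<alpha> - 1) / Beta \<alpha> (\<beta> - \<alpha>)) * t ^ k)
     (pochhammer \<alpha> k / pochhammer \<beta> k)"
proof -
  have B: "Beta \<alpha> (\<beta> - \<alpha>) > 0" using assms by (auto simp: Beta_def intro!: divide_pos_pos mult_pos_pos Gamma_real_pos)
  have "\<alpha> \<notin> \<int>\<^sub>\<le>\<^sub>0" "\<beta> \<notin> \<int>\<^sub>\<le>\<^sub>0" using assms by (auto elim!: nonpos_Ints_cases)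
  then have ratio: "Beta (\<alpha> + real k) (\<beta> - \<alpha>) / Beta \<alpha> (\<beta> - \<alpha>) = pochhammer \<alpha> k / pochhammer \<beta> k"
    using Gamma_real_pos[of "\<beta> - \<alpha>"] Gamma_real_pos[of \<alpha>] Gamma_real_pos[of \<beta>] assms
    by (simp add: pochhammer_Gamma Beta_def add.commute less_imp_neq[symmetric])
  have "((\<lambda>t. t powr (\<alpha> + real k - 1) * (1 - t) powr (\<beta> - \<alpha> - 1)) has_integral Beta (\<alpha> + real k) (\<beta> - \<alpha>)) {0<..<1}"
    using has_integral_Beta_real[of "\<alpha> + real k" "\<beta> - \<alpha>"] assms by (simp add: has_integral_Icc_iff_Ioo)
  then have "((\<lambda>t. t powr (\<alpha> + real k - 1) * (1 - t) powr (\<beta> - \<alpha> - 1) / Beta \<alpha> (\<beta> - \<alpha>)) has_integral (pochhammer \<alpha> k / pochhammer \<beta> k)) {0<..<1}"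
    unfolding ratio[symmetric] by (rule has_integral_divide)
  moreover have "t powr (\<alpha> + real k - 1) = t powr (\<alpha> - 1) * t ^ k" if "t \<in> {0<..<1}" for t
    using that by (simp add: powr_add[symmetric] powr_realpow[symmetric] algebra_simps)
  ultimately have "((\<lambda>t. t powr (\<alpha> - 1) * (1 - t) powr (\<beta> - \<alpha> - 1) / Beta \<alpha> (\<beta> - \<alpha>) * t ^ k) has_integral (pochhammer \<alpha> k / pochhammer \<beta> k)) {0<..<1}"
    by (subst has_integral_cong[where g = "\<lambda>t. t powr (\<alpha> + real k - 1) * (1 - t) powr (\<beta> - \<alpha> - 1) / Beta \<alpha> (\<beta> - \<alpha>)"]) (auto simp: mult_ac)
  from nn_integral_has_integral_lebesgue'[OF _ this]
  have nn: "(\<integral>\<^sup>+t. ennreal (t powr (\<alpha> - 1) * (1 - t) powr (\<beta> - \<alpha> - 1) / Beta \<alpha> (\<beta> - \<alpha>) * t ^ k) * indicator {0<..<1} t \<partial>lborel) =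
     ennreal (pochhammer \<alpha> k / pochhammer \<beta> k)"
    using B by auto
  show ?thesis
  proof (rule has_bochner_integral_nn_integral)
    show "0 \<le> pochhammer \<alpha> k / pochhammer \<beta> k" using assms by (simp add: pochhammer_pos less_imp_le)
    show "(\<integral>\<^sup>+t. ennreal (indicator {0<..<1} t * (t powr (\<alpha> - 1) * (1 - t) powr (\<beta> - \<alpha> - 1) / Beta \<alpha> (\<beta> - \<alpha>)) * t ^ k) \<partial>lborel) =
      ennreal (pochhammer \<alpha> k / pochhammer \<beta> k)"
      unfolding nn[symmetric] by (rule nn_integral_cong) (auto simp: indicator_def)
  qed (use B in \<open>auto simp: indicator_def\<close>)
qed

text \<open>The multiplier averages the dilated sums \<open>\<Sum>k. z k * t ^ k\<close> against a
  Beta density. The density behaves like \<open>(1 - t) powr (\<beta> - \<alpha> - 1)\<close> at 1,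
  so the order drops by \<open>\<beta> - \<alpha>\<close>. \<open>C\<close> has to be independent of
  \<open>z\<close>, \<open>d\<close> and \<open>M\<close>, since these will vary with the point
  \<open>(u, v)\<close>.\<close>

lemma beta_multiplier_bound:
  fixes \<alpha> \<beta> w \<kappa> :: real
  assumes ab: "0 < \<alpha>" "\<alpha> < \<beta>" and w: "w \<ge> 0"
    and k: "\<kappa> \<ge> 0" "\<kappa> \<ge> w - (\<beta> - \<alpha>)" "\<kappa> > 0 \<or> \<kappa> > w - (\<beta> - \<alpha>)"
  obtains C where "C \<ge> 0" "\<And>z d M. summable (\<lambda>k. \<bar>z k\<bar>) \<Longrightarrow> 0 < d \<Longrightarrow> d \<le> 2 \<Longrightarrow> M \<ge> 0 \<Longrightarrow>
     (\<And>t. 0 < t \<Longrightarrow> t < 1 \<Longrightarrow> \<bar>\<Sum>k. z k * t ^ k\<bar> \<le> M * (1 - t + d) powr (- w)) \<Longrightarrow>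
     \<bar>\<Sum>k. pochhammer \<alpha> k / pochhammer \<beta> k * z k\<bar> \<le> C * M * d powr (- \<kappa>)"
proof -
  define e where "e = \<beta> - \<alpha>"
  have e: "e > 0" using ab unfolding e_def by linarith
  define B where "B = Beta \<alpha> e"
  have B: "B > 0" using ab e by (auto simp: B_def Beta_def intro!: divide_pos_pos mult_pos_pos Gamma_real_pos)
  define \<phi> where "\<phi> t = indicator {0<..<1} t * (t powr (\<alpha> - 1) * (1 - t) powr (e - 1) / B)" for t :: real
  have \<phi>0: "\<phi> t \<ge> 0" for t using B by (simp add: \<phi>_def)
  have [measurable]: "\<phi> \<in> borel_measurable borel" unfolding \<phi>_def by measurable
  have mom: "has_bochner_integral lborel (\<lambda>t. \<phi> t * t ^ k) (pochhammer \<alpha> k / pochhammer \<beta> k)" for k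
    using beta_moment[OF ab, of k] by (simp add: \<phi>_def e_def B_def)
  obtain C1 where C1: "C1 > 0" "\<And>d. 0 < d \<Longrightarrow> d \<le> 2 \<Longrightarrow>
    (\<integral>\<^sup>+t. ennreal (t powr (e - 1) * (t + d) powr (- w)) * indicator {0<..<1} t \<partial>lborel) \<le> ennreal (C1 * d powr (- \<kappa>))"
    by (rule nn_integral_powr_shift_le[of "e - 1" w \<kappa>]) (use e w k in \<open>auto simp: e_def[symmetric]\<close>)
  \<comment> \<open>\<open>K1\<close> serves the half \<open>t \<le> 1/2\<close>, where only
    \<open>t powr (\<alpha> - 1)\<close> can be singular; \<open>K2\<close> serves the half near 1,
    which is governed by the shifted integral with constant \<open>C1\<close>.\<close>
  define K1 where "K1 = (2::real) powr \<bar>e - 1\<bar> * 2 powr w"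
  define K2 where "K2 = (2::real) powr \<bar>\<alpha> - 1\<bar>"
  have K: "K1 > 0" "K2 > 0" by (auto simp: K1_def K2_def)
  define C where "C = (K1 / \<alpha> * 2 powr \<kappa> + K2 * C1) / B"
  have C0: "C \<ge> 0" using K C1 B ab by (simp add: C_def)
  have "\<bar>\<Sum>k. pochhammer \<alpha> k / pochhammer \<beta> k * z k\<bar> \<le> C * M * d powr (- \<kappa>)"
    if z: "summable (\<lambda>k. \<bar>z k\<bar>)" and d: "0 < d" "d \<le> 2" and M: "M \<ge> 0"
      and le: "\<And>t. 0 < t \<Longrightarrow> t < 1 \<Longrightarrow> \<bar>\<Sum>k. z k * t ^ k\<bar> \<le> M * (1 - t + d) powr (- w)" for z d M
  proof -
    have int: "integrable lborel (\<lambda>t. \<phi> t * t ^ k * z k)" for k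
      using mom[of k] by (auto intro!: integrable_mult_left dest: has_bochner_integral_integrable simp: has_bochner_integral_iff)
    have ae: "AE t in lborel. summable (\<lambda>k. norm (\<phi> t * t ^ k * z k))"
    proof (rule AE_I2)
      fix t :: real
      show "summable (\<lambda>k. norm (\<phi> t * t ^ k * z k))"
      proof (cases "t \<in> {0<..<1}")
        case True
        show ?thesis
        proof (rule summable_comparison_test')
          show "summable (\<lambda>k. \<phi> t * \<bar>z k\<bar>)" using z by (rule summable_mult)
          fix k
          have "\<bar>t ^ k\<bar> \<le> 1" using True by (simp add: power_le_one)
          then have "\<phi> t * (\<bar>t ^ k\<bar> * \<bar>z k\<bar>) \<le> \<phi> t * (1 * \<bar>z k\<bar>)"
            using \<phi>0 by (intro mult_left_mono mult_right_mono) auto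
          then show "norm (norm (\<phi> t * t ^ k * z k)) \<le> \<phi> t * \<bar>z k\<bar>"
            using \<phi>0[of t] by (simp add: abs_mult mult.assoc)
        qed
      qed (simp add: \<phi>_def)
    qed
    have sm: "summable (\<lambda>k. \<integral>t. norm (\<phi> t * t ^ k * z k) \<partial>lborel)"
    proof (rule summable_comparison_test')
      show "summable (\<lambda>k. \<bar>z k\<bar>)" by fact
      fix k
      have "(\<integral>t. norm (\<phi> t * t ^ k * z k) \<partial>lborel) = (\<integral>t. \<phi> t * t ^ k * \<bar>z k\<bar> \<partial>lborel)"
        by (rule Bochner_Integration.integral_cong) (auto simp: \<phi>_def indicator_def abs_mult B less_imp_le)
      also have "\<dots> = pochhammer \<alpha> k / pochhammer \<beta> k * \<bar>z k\<bar>"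
        using mom[of k] by (simp add: has_bochner_integral_iff)
      also have "\<dots> \<le> 1 * \<bar>z k\<bar>"
      proof (rule mult_right_mono)
        have "pochhammer \<alpha> k \<le> pochhammer \<beta> k"
          unfolding pochhammer_prod using ab by (intro prod_mono) auto
        then show "pochhammer \<alpha> k / pochhammer \<beta> k \<le> 1" using ab by (simp add: pochhammer_pos)
      qed simp
      finally show "norm (\<integral>t. norm (\<phi> t * t ^ k * z k) \<partial>lborel) \<le> \<bar>z k\<bar>" by simp
    qed
    have sums: "(\<lambda>k. \<integral>t. \<phi> t * t ^ k * z k \<partial>lborel) sums (\<integral>t. (\<Sum>k. \<phi> t * t ^ k * z k) \<partial>lborel)"
      and ints: "integrable lborel (\<lambda>t. \<Sum>k. \<phi> t * t ^ k * z k)"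
      using sums_integral[OF int ae sm] integrable_suminf[OF int ae sm] by auto
    have "(\<Sum>k. pochhammer \<alpha> k / pochhammer \<beta> k * z k) = (\<integral>t. (\<Sum>k. \<phi> t * t ^ k * z k) \<partial>lborel)"
      using sums_unique[OF sums] mom by (simp add: has_bochner_integral_iff)
    then have "ennreal \<bar>\<Sum>k. pochhammer \<alpha> k / pochhammer \<beta> k * z k\<bar> \<le> (\<integral>\<^sup>+t. norm (\<Sum>k. \<phi> t * t ^ k * z k) \<partial>lborel)"
      using integral_norm_bound_ennreal[OF ints] by simp
    also have "\<dots> \<le> (\<integral>\<^sup>+t. ennreal (M / B * K1) * (ennreal (t powr (\<alpha> - 1)) * indicator {0..1} t) +
        ennreal (M / B * K2) * (ennreal ((1 - t) powr (e - 1) * (1 - t + d) powr (- w)) * indicator {0<..<1} (1 - t)) \<partial>lborel)"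
    proof (rule nn_integral_mono)
      fix t :: real
      show "ennreal (norm (\<Sum>k. \<phi> t * t ^ k * z k)) \<le> ennreal (M / B * K1) * (ennreal (t powr (\<alpha> - 1)) * indicator {0..1} t) +
        ennreal (M / B * K2) * (ennreal ((1 - t) powr (e - 1) * (1 - t + d) powr (- w)) * indicator {0<..<1} (1 - t))"
      proof (cases "t \<in> {0<..<1}")
        case True
        have zt: "summable (\<lambda>k. z k * t ^ k)"
        proof (rule summable_rabs_cancel, rule summable_comparison_test'[OF z])
          fix k
          show "norm \<bar>z k * t ^ k\<bar> \<le> \<bar>z k\<bar>"
            using True by (simp add: abs_mult mult_left_le power_le_one)
        qed
        have "(\<Sum>k. \<phi> t * t ^ k * z k) = (\<Sum>k. \<phi> t * (z k * t ^ k))" by (simp add: mult_ac)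
        also have "\<dots> = \<phi> t * (\<Sum>k. z k * t ^ k)" by (rule suminf_mult[OF zt])
        finally have "norm (\<Sum>k. \<phi> t * t ^ k * z k) = \<phi> t * \<bar>\<Sum>k. z k * t ^ k\<bar>"
          using \<phi>0 by (simp add: abs_mult)
        also have "\<dots> \<le> \<phi> t * (M * (1 - t + d) powr (- w))"
          using le True \<phi>0 by (intro mult_left_mono) auto
        also have "\<dots> = M / B * (t powr (\<alpha> - 1) * (1 - t) powr (e - 1) * (1 - t + d) powr (- w))"
          using True by (simp add: \<phi>_def)
        also have "t powr (\<alpha> - 1) * (1 - t) powr (e - 1) * (1 - t + d) powr (- w) \<le>
            K1 * t powr (\<alpha> - 1) + K2 * ((1 - t) powr (e - 1) * (1 - t + d) powr (- w))"
        proof (cases "t \<le> 1/2")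
          case True2: True
          have "(1 - t) powr (e - 1) \<le> 2 powr \<bar>e - 1\<bar>" using True True2 by (intro powr_half_one_le) auto
          moreover have "(1 - t + d) powr (- w) \<le> (1/2) powr (- w)" using True True2 d w by (intro powr_mono2') auto
          moreover have "(1/2) powr (- w) = 2 powr w" by (simp add: powr_minus_divide powr_divide)
          ultimately have "(1 - t) powr (e - 1) * (1 - t + d) powr (- w) \<le> K1"
            unfolding K1_def by (intro mult_mono) auto
          then have "t powr (\<alpha> - 1) * ((1 - t) powr (e - 1) * (1 - t + d) powr (- w)) \<le> t powr (\<alpha> - 1) * K1"
            by (rule mult_left_mono) simp
          moreover have "0 \<le> K2 * ((1 - t) powr (e - 1) * (1 - t + d) powr (- w))" using K by simp
          ultimately show ?thesis by (simp add: mult_ac)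
        next
          case False
          have "t powr (\<alpha> - 1) \<le> K2" unfolding K2_def using True False by (intro powr_half_one_le) auto
          then have "t powr (\<alpha> - 1) * ((1 - t) powr (e - 1) * (1 - t + d) powr (- w)) \<le> K2 * ((1 - t) powr (e - 1) * (1 - t + d) powr (- w))"
            by (rule mult_right_mono) simp
          moreover have "0 \<le> K1 * t powr (\<alpha> - 1)" using K by simp
          ultimately show ?thesis by (simp add: mult_ac)
        qed
        finally have "norm (\<Sum>k. \<phi> t * t ^ k * z k) \<le> M / B * (K1 * t powr (\<alpha> - 1) + K2 * ((1 - t) powr (e - 1) * (1 - t + d) powr (- w)))"
          using M B by (simp add: mult_left_mono divide_right_mono)
        then have "ennreal (norm (\<Sum>k. \<phi> t * t ^ k * z k)) \<le> ennreal (M / B * K1 * t powr (\<alpha> - 1) + M / B * K2 * ((1 - t) powr (e - 1) * (1 - t + d) powr (- w)))"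
          by (intro ennreal_leI) (simp add: distrib_left mult.assoc)
        moreover have "ennreal (M / B * K1 * t powr (\<alpha> - 1) + M / B * K2 * ((1 - t) powr (e - 1) * (1 - t + d) powr (- w))) =
            ennreal (M / B * K1) * ennreal (t powr (\<alpha> - 1)) + ennreal (M / B * K2) * ennreal ((1 - t) powr (e - 1) * (1 - t + d) powr (- w))"
          using M B K by (simp flip: ennreal_mult ennreal_plus)
        ultimately show ?thesis using True by simp
      qed (simp add: \<phi>_def)
    qed
    also have "\<dots> = ennreal (M / B * K1) * ennreal (1 / \<alpha>) + ennreal (M / B * K2) *
        (\<integral>\<^sup>+t. ennreal ((1 - t) powr (e - 1) * (1 - t + d) powr (- w)) * indicator {0<..<1} (1 - t) \<partial>lborel)"
      using nn_integral_powr_0[of "\<alpha> - 1" 1] ab by (simp add: nn_integral_add nn_integral_cmult)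
    also have "(\<integral>\<^sup>+t. ennreal ((1 - t) powr (e - 1) * (1 - t + d) powr (- w)) * indicator {0<..<1} (1 - t) \<partial>lborel) =
        (\<integral>\<^sup>+t. ennreal (t powr (e - 1) * (t + d) powr (- w)) * indicator {0<..<1} t \<partial>lborel)"
      by (subst (2) nn_integral_real_affine[where c="-1" and t=1]) auto
    also have "ennreal (M / B * K1) * ennreal (1 / \<alpha>) + ennreal (M / B * K2) *
        (\<integral>\<^sup>+t. ennreal (t powr (e - 1) * (t + d) powr (- w)) * indicator {0<..<1} t \<partial>lborel) \<le>
        ennreal (M / B * K1) * ennreal (1 / \<alpha>) + ennreal (M / B * K2) * ennreal (C1 * d powr (- \<kappa>))"
      by (intro add_left_mono mult_left_mono C1 d) simp
    also have "\<dots> = ennreal (M / B * K1 * (1 / \<alpha>) + M / B * K2 * (C1 * d powr (- \<kappa>)))"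
      using M B K C1(1) ab by (simp flip: ennreal_mult ennreal_plus)
    finally have "\<bar>\<Sum>k. pochhammer \<alpha> k / pochhammer \<beta> k * z k\<bar> \<le> M / B * K1 * (1 / \<alpha>) + M / B * K2 * (C1 * d powr (- \<kappa>))"
      using M B K C1(1) ab by (subst (asm) ennreal_le_iff) auto
    \<comment> \<open>The contribution of small \<open>t\<close> contains no \<open>d\<close>; as
      \<open>d \<le> 2\<close>, it is absorbed into \<open>d powr (- \<kappa>)\<close> at the cost
      of \<open>2 powr \<kappa>\<close>.\<close>
    also have "\<dots> \<le> M / B * K1 * (1 / \<alpha>) * (2 powr \<kappa> * d powr (- \<kappa>)) + M / B * K2 * (C1 * d powr (- \<kappa>))"
    proof -
      have "d powr \<kappa> \<le> 2 powr \<kappa>" using d k by (intro powr_mono2) auto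
      then have "1 \<le> 2 powr \<kappa> * d powr (- \<kappa>)" using d by (simp add: powr_minus_divide)
      moreover have "0 \<le> M / B * K1 * (1 / \<alpha>)" using M B K ab by simp
      ultimately show ?thesis using mult_left_mono[of 1 "2 powr \<kappa> * d powr (- \<kappa>)" "M / B * K1 * (1 / \<alpha>)"] by simp
    qed
    also have "\<dots> = C * M * d powr (- \<kappa>)"
      unfolding C_def using B ab by (simp add: field_simps)
    finally show ?thesis .
  qed
  then show thesis using that C0 by blast
qed

section \<open>Upper bounds for the kernel\<close>

text \<open>The extended zonal harmonic in the variables \<open>u\<close> and \<open>v\<close>, with
  \<open>l\<close> half the dimension. Degree 0 is separate because the truncated
  \<open>i - 1\<close> would produce \<open>l - 1\<close> there.\<close>

definition zon :: "real \<Rightarrow> nat \<Rightarrow> real \<Rightarrow> real \<Rightarrow> real" where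
  "zon l k u v = (if k = 0 then 1 else (real k + l - 1) * gbpoly (\<lambda>i. pochhammer l (i - 1)) k u v)"

definition gam :: "real \<Rightarrow> real \<Rightarrow> nat \<Rightarrow> real" where
  "gam l c k = (if c > -(1 + l) then pochhammer (1 + l + c) k / pochhammer l k
     else (fact k)^2 / (pochhammer (1 - (l + c)) k * pochhammer l k))"

lemma gamma_coef_eq_gam: "gamma_coef TYPE('n::finite) c k = gam (real CARD('n) / 2) c k"
  by (simp add: gamma_coef_def gam_def Let_def)

text \<open>A matter of powers of two: the product of the factors \<open>n + 2 * i\<close> is a
  power of 2 times a Pochhammer symbol of \<open>n / 2\<close>, and the leftover
  \<open>2 ^ (k - 2 * j)\<close> turns powers of \<open>x \<bullet> y\<close> into powers of
  \<open>2 * u\<close>.\<close>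

lemma zonal_eq_zon:
  "zonal k x (y :: real^'n::finite) = zon (real CARD('n) / 2) k (x \<bullet> y) ((norm x * norm y)\<^sup>2)"
proof (cases "k = 0")
  case True
  then show ?thesis by (simp add: zonal_def zon_def Let_def)
next
  case False
  define l where "l = real CARD('n) / 2"
  have n: "real CARD('n) = 2 * l" by (simp add: l_def)
  have p: "(\<Prod>i<m. 2 * l + 2 * real i) = 2 ^ m * pochhammer l m" for m
    by (induction m) (simp_all add: pochhammer_Suc algebra_simps)
  have "(2 * l + 2 * real k - 2) * (((-1)^j * (\<Prod>i<k - j - 1. 2 * l + 2 * real i)
          / (2^j * fact j * fact (k - 2 * j)) * u^(k - 2 * j) * r^(2 * j))) =
      (real k + l - 1) * (pochhammer l (k - j - 1) * gterm k j u (r\<^sup>2))" if "j \<le> k div 2" for j u r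
  proof -
    have "k - j - 1 + 1 = (k - 2 * j) + j" using that False by simp
    then have "(2::real) * 2 ^ (k - j - 1) = 2 ^ (k - 2 * j) * 2 ^ j"
      by (simp flip: power_add power_Suc)
    then have e: "2 * ((2::real) ^ (k - j - 1) / 2 ^ j) = 2 ^ (k - 2 * j)" by (simp add: field_simps)
    have "(2 * l + 2 * real k - 2) * (((-1)^j * (\<Prod>i<k - j - 1. 2 * l + 2 * real i)
          / (2^j * fact j * fact (k - 2 * j)) * u^(k - 2 * j) * r^(2 * j))) =
       (real k + l - 1) * (pochhammer l (k - j - 1) * ((-1) ^ j / (fact j * fact (k - 2 * j)) *
        ((2 * (2 ^ (k - j - 1) / 2 ^ j)) * u ^ (k - 2 * j)) * r ^ (2 * j)))"
      unfolding p by (simp add: field_simps)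
    also have "\<dots> = (real k + l - 1) * (pochhammer l (k - j - 1) * gterm k j u (r\<^sup>2))"
      unfolding e gterm_def by (simp add: power_mult_distrib power_mult)
    finally show ?thesis .
  qed
  then show ?thesis using False
    unfolding zonal_def zon_def Let_def gbpoly_def n
    by (simp add: sum_distrib_left atMost_atLeast0)
qed

lemma zon_0 [simp]: "zon l 0 u v = 1" by (simp add: zon_def)

lemma zon_1 [simp]: "zon l (Suc 0) u v = geg l (Suc 0) u v" by (simp add: zon_def)

text \<open>Each coefficient splits through \<open>k + l + 1 = (l + k + 1 - j) + j\<close>. The
  Gegenbauer index here is \<open>l\<close>, not the classical \<open>l - 1\<close>, which
  degenerates to 0 in dimension two.\<close>

lemma zon_Suc_Suc: "zon l (k + 2) u v = geg l (k + 2) u v - v * geg l k u v"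
proof -
  define c where "c i = pochhammer l (i - 1)" for i :: nat
  have c: "(\<lambda>i. c (Suc i)) = pochhammer l" by (simp add: c_def fun_eq_iff)
  have 2: "v * geg l k u v =
    - (\<Sum>j\<le>Suc (Suc k) div 2. real j * c (Suc (Suc k) - j) * gterm (Suc (Suc k)) j u v)"
    using gbpoly_shift_v[of v c k u] by (simp add: c)
  have "zon l (k + 2) u v = (\<Sum>j\<le>Suc (Suc k) div 2. (real k + l + 1) * (c (Suc (Suc k) - j) * gterm (Suc (Suc k)) j u v))"
    by (simp add: zon_def gbpoly_def c_def sum_distrib_left algebra_simps del: div2_Suc_Suc sum.atMost_Suc)
  also have "\<dots> = (\<Sum>j\<le>Suc (Suc k) div 2. pochhammer l (Suc (Suc k) - j) * gterm (Suc (Suc k)) j u v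
      + real j * c (Suc (Suc k) - j) * gterm (Suc (Suc k)) j u v)"
  proof (rule sum.cong[OF refl])
    fix j assume "j \<in> {..Suc (Suc k) div 2}"
    then have j: "j \<le> Suc k" by auto
    then have *: "Suc k - j = Suc (Suc k) - j - 1" by simp
    have "pochhammer l (Suc (Suc k) - j) = c (Suc (Suc k) - j) * (l + real (Suc k) - real j)"
      unfolding c_def *[symmetric] by (rule pochhammer_Suc_diff) fact
    then show "(real k + l + 1) * (c (Suc (Suc k) - j) * gterm (Suc (Suc k)) j u v) =
       pochhammer l (Suc (Suc k) - j) * gterm (Suc (Suc k)) j u v
      + real j * c (Suc (Suc k) - j) * gterm (Suc (Suc k)) j u v"
      by (simp only:) (simp add: algebra_simps)
  qed
  also have "\<dots> = geg l (k + 2) u v - v * geg l k u v"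
    unfolding 2 sum.distrib by (simp add: gbpoly_def del: div2_Suc_Suc sum.atMost_Suc)
  finally show ?thesis .
qed

text \<open>The sum is the extended Poisson kernel. Its factor \<open>1 - v\<close> comes from the
  two Gegenbauer series shifted against each other and lowers the singular order from
  \<open>2 * l\<close> to \<open>2 * l - 1\<close>.\<close>

lemma zon_sums:
  assumes "u\<^sup>2 \<le> v" "v < 1"
  shows "(\<lambda>k. zon l k u v) sums ((1 - v) * (1 - 2 * u + v) powr (- l))"
proof -
  define h where "h k = (if k < 2 then 0 else v * geg l (k - 2) u v)" for k
  have "(\<lambda>k. v * geg l k u v) sums (v * (1 - 2 * u + v) powr (- l))"
    by (intro sums_mult geg_sums assms)
  then have "(\<lambda>k. h (k + 2)) sums (v * (1 - 2 * u + v) powr (- l))" by (simp add: h_def)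
  then have "h sums (v * (1 - 2 * u + v) powr (- l))"
    by (subst (asm) sums_zero_iff_shift) (auto simp: h_def)
  from sums_diff[OF geg_sums[OF assms, of l] this]
  have "(\<lambda>k. geg l k u v - h k) sums ((1 - v) * (1 - 2 * u + v) powr (- l))"
    by (simp add: algebra_simps)
  moreover have "geg l k u v - h k = zon l k u v" for k
  proof -
    consider "k = 0" | "k = Suc 0" | j where "k = j + 2"
      by (metis One_nat_def add_2_eq_Suc' not0_implies_Suc)
    then show ?thesis
    proof cases
      case 3
      then show ?thesis using zon_Suc_Suc[of l j u v] by (simp add: h_def)
    qed (simp_all add: h_def)
  qed
  ultimately show ?thesis by simp
qed

text \<open>Isolates what the multiplier arguments use, namely the degree under dilation and a
  growth bound, so that they serve both the zonal harmonics and the weighted Gegenbauer polynomials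
  in the \<open>u\<close>-derivative of the kernel.\<close>

definition homog_family :: "(nat \<Rightarrow> real \<Rightarrow> real \<Rightarrow> real) \<Rightarrow> bool" where
  "homog_family Y \<longleftrightarrow> (\<forall>k u v t. Y k (t * u) (t\<^sup>2 * v) = t ^ k * Y k u v) \<and>
     (\<exists>p. polyb p \<and> (\<forall>k u v. u\<^sup>2 \<le> v \<longrightarrow> v < 1 \<longrightarrow> \<bar>Y k u v\<bar> \<le> p k * sqrt v ^ k))"

lemma homog_familyI:
  assumes "\<And>k u v t. Y k (t * u) (t\<^sup>2 * v) = t ^ k * Y k u v" "polyb p"
    "\<And>k u v. u\<^sup>2 \<le> v \<Longrightarrow> v < 1 \<Longrightarrow> \<bar>Y k u v\<bar> \<le> p k * sqrt v ^ k"
  shows "homog_family Y"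
  using assms unfolding homog_family_def by blast

lemma homog_family_scale: "homog_family Y \<Longrightarrow> Y k (t * u) (t\<^sup>2 * v) = t ^ k * Y k u v"
  unfolding homog_family_def by blast

lemma homog_family_summable:
  assumes "homog_family Y" "polyb g" "u\<^sup>2 \<le> v" "v < 1" "0 \<le> K" "K * sqrt v < 1"
  shows "summable (\<lambda>k. \<bar>g k * Y k u v\<bar> * K ^ k)"
proof -
  obtain p where p: "polyb p" "\<And>k u v. u\<^sup>2 \<le> v \<Longrightarrow> v < 1 \<Longrightarrow> \<bar>Y k u v\<bar> \<le> p k * sqrt v ^ k"
    using assms(1) unfolding homog_family_def by blast
  have "summable (\<lambda>k. \<bar>g k * p k\<bar> * (K * sqrt v) ^ k)"
    using bracket_bounds[OF assms(3,4)] assms by (intro polyb_summable polyb_mult p) auto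
  then show ?thesis
  proof (rule summable_comparison_test'[where N = 0])
    fix k
    have "\<bar>Y k u v\<bar> \<le> \<bar>p k\<bar> * sqrt v ^ k"
      by (rule order_trans[OF p(2)[OF assms(3,4)]]) (simp add: mult_right_mono bracket_bounds[OF assms(3,4)])
    then have "\<bar>g k\<bar> * \<bar>Y k u v\<bar> * K ^ k \<le> \<bar>g k\<bar> * (\<bar>p k\<bar> * sqrt v ^ k) * K ^ k"
      using assms(5) by (intro mult_right_mono mult_left_mono) auto
    then show "norm (\<bar>g k * Y k u v\<bar> * K ^ k) \<le> \<bar>g k * p k\<bar> * (K * sqrt v) ^ k"
      using assms(5) by (simp add: abs_mult power_mult_distrib mult_ac)
  qed
qed

lemma homog_family_summable1:
  assumes "homog_family Y" "polyb g" "u\<^sup>2 \<le> v" "v < 1"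
  shows "summable (\<lambda>k. \<bar>g k * Y k u v\<bar>)" "summable (\<lambda>k. g k * Y k u v)"
proof -
  show 1: "summable (\<lambda>k. \<bar>g k * Y k u v\<bar>)"
    using homog_family_summable[OF assms, of 1] bracket_bounds[OF assms(3,4)] by simp
  show "summable (\<lambda>k. g k * Y k u v)" by (rule summable_rabs_cancel[OF 1])
qed

lemma homog_family_geg:
  assumes "m \<ge> 0"
  shows "homog_family (geg m)"
proof (cases "m = 0")
  case True
  show ?thesis
    by (rule homog_familyI[OF gbpoly_scale polyb_const[of 1]], rule order_trans[OF geg_abs_le])
       (auto simp: True pochhammer_0_left bracket_bounds)
next
  case False
  then show ?thesis
    using assms by (intro homog_familyI[OF gbpoly_scale polyb_pochhammer_fact[of "2 * m"] geg_abs_le]) auto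
qed

lemma homog_family_geg_weighted:
  assumes "homog_family Y" "polyb a"
  shows "homog_family (\<lambda>k u v. a k * Y k u v)"
proof -
  obtain p where p: "polyb p" "\<And>k u v. u\<^sup>2 \<le> v \<Longrightarrow> v < 1 \<Longrightarrow> \<bar>Y k u v\<bar> \<le> p k * sqrt v ^ k"
    using assms(1) unfolding homog_family_def by blast
  have "polyb (\<lambda>k. \<bar>a k\<bar>)" using assms(2) by (simp add: polyb_def)
  then show ?thesis
  proof (intro homog_familyI[OF _ polyb_mult[OF _ p(1)]])
    fix k u v assume "u\<^sup>2 \<le> v" "v < (1::real)"
    from p(2)[OF this, of k] show "\<bar>a k * Y k u v\<bar> \<le> \<bar>a k\<bar> * p k * sqrt v ^ k"
      by (simp add: abs_mult mult.assoc mult_left_mono)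
  qed (use assms(1) in \<open>simp add: homog_family_scale\<close>)
qed

lemma homog_family_zon:
  assumes "l \<ge> 1"
  shows "homog_family (zon l)"
proof -
  \<comment> \<open>\<open>zon l k\<close> consists of two Gegenbauer terms, and the bound for the
    one of degree \<open>k - 2\<close> has no larger coefficient; hence the 2.\<close>
  define p where "p k = 2 * (pochhammer (2 * l) k / fact k)" for k
  show ?thesis
  proof (rule homog_familyI)
    show "zon l k (t * u) (t\<^sup>2 * v) = t ^ k * zon l k u v" for k u v t
      by (simp add: zon_def gbpoly_scale)
    show "polyb p" unfolding p_def using assms by (intro polyb_mult polyb_const polyb_pochhammer_fact) auto
    fix k u v assume uv: "u\<^sup>2 \<le> v" "v < (1::real)"
    have v0: "0 \<le> v" using bracket_bounds[OF uv] by simp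
    have P: "0 \<le> pochhammer (2 * l) k" for k using assms by (intro less_imp_le pochhammer_pos) auto
    consider "k = 0" | "k = Suc 0" | j where "k = j + 2"
      by (metis One_nat_def add_2_eq_Suc' not0_implies_Suc)
    then show "\<bar>zon l k u v\<bar> \<le> p k * sqrt v ^ k"
    proof cases
      case 1
      then show ?thesis by (simp add: p_def)
    next
      case 2
      have "\<bar>geg l k u v\<bar> \<le> pochhammer (2 * l) k / fact k * sqrt v ^ k" using uv assms by (intro geg_abs_le) auto
      also have "\<dots> \<le> p k * sqrt v ^ k" unfolding p_def using divide_nonneg_pos[OF P[of k] fact_gt_zero[of k]] v0
        by (intro mult_right_mono) (linarith, simp)
      finally show ?thesis using 2 by simp
    next
      case 3
      have "pochhammer (2 * l) j / fact j \<le> pochhammer (2 * l) k / fact k"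
      proof -
        have "pochhammer (2 * l) k / fact k = pochhammer (2 * l) j / fact j * ((2 * l + real j) * (2 * l + real j + 1) / (real (j + 1) * real (j + 2)))"
          unfolding 3 by (simp add: pochhammer_Suc field_simps)
        moreover have "1 \<le> (2 * l + real j) * (2 * l + real j + 1) / (real (j + 1) * real (j + 2))"
          using assms by (simp add: divide_simps) (intro mult_mono, auto)
        ultimately show ?thesis using P[of j]
          mult_left_mono[of 1 "(2 * l + real j) * (2 * l + real j + 1) / (real (j + 1) * real (j + 2))" "pochhammer (2 * l) j / fact j"] by simp
      qed
      then have "pochhammer (2 * l) j / fact j * sqrt v ^ k \<le> pochhammer (2 * l) k / fact k * sqrt v ^ k"
        using v0 by (intro mult_right_mono) auto
      moreover have "\<bar>geg l k u v\<bar> \<le> pochhammer (2 * l) k / fact k * sqrt v ^ k"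
          "\<bar>geg l j u v\<bar> \<le> pochhammer (2 * l) j / fact j * sqrt v ^ j"
        by (rule geg_abs_le[OF uv(1)], use assms in simp)+
      moreover have "v * \<bar>geg l j u v\<bar> \<le> pochhammer (2 * l) j / fact j * sqrt v ^ k"
      proof -
        have "v * \<bar>geg l j u v\<bar> \<le> v * (pochhammer (2 * l) j / fact j * sqrt v ^ j)"
          using uv assms v0 by (intro mult_left_mono geg_abs_le) auto
        also have "\<dots> = pochhammer (2 * l) j / fact j * (sqrt v ^ j * (sqrt v)\<^sup>2)" using v0 by simp
        finally show ?thesis unfolding 3 power_add .
      qed
      moreover have "\<bar>zon l k u v\<bar> \<le> \<bar>geg l k u v\<bar> + v * \<bar>geg l j u v\<bar>"
        unfolding 3 zon_Suc_Suc using v0 abs_triangle_ineq4[of "geg l (j + 2) u v" "v * geg l j u v"] by (simp add: abs_mult)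
      ultimately show ?thesis unfolding p_def by (simp only: mult_2 distrib_right)
    qed
  qed
qed

text \<open>Here \<open>q\<close> stands for \<open>1 - v\<close> and \<open>e\<close> for \<open>1 - 2u + v\<close>. Since \<open>q = O(e powr (1/2))\<close>, a monomial
  satisfying the side condition is \<open>O(e powr (-w/2))\<close>, and the class is stable under the dilation derivative
  at the cost of one unit of \<open>w\<close>.\<close>

inductive singular_expr :: "real \<Rightarrow> (real \<Rightarrow> real \<Rightarrow> real) \<Rightarrow> bool" for w where
  mono: "2 * \<mu> - real a \<le> w \<Longrightarrow> singular_expr w (\<lambda>q e. c * q ^ a * e powr (- \<mu>))"
| add: "singular_expr w f \<Longrightarrow> singular_expr w g \<Longrightarrow> singular_expr w (\<lambda>q e. f q e + g q e)"

lemma singular_expr_scale: "singular_expr w f \<Longrightarrow> singular_expr w (\<lambda>q e. C * f q e)"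
proof (induction rule: singular_expr.induct)
  case (mono \<mu> a c)
  from singular_expr.mono[OF this, of "C * c"] show ?case by (simp add: mult_ac)
next
  case (add f g)
  from singular_expr.add[OF add.IH] show ?case by (simp add: distrib_left)
qed

lemma singular_expr_weaken: "singular_expr w f \<Longrightarrow> w \<le> w' \<Longrightarrow> singular_expr w' f"
  by (induction rule: singular_expr.induct) (auto intro: singular_expr.intros)

lemma singular_expr_bound:
  assumes "singular_expr w f"
  shows "\<exists>C\<ge>0. \<forall>u v. u\<^sup>2 \<le> v \<longrightarrow> v < 1 \<longrightarrow> \<bar>f (1 - v) (1 - 2 * u + v)\<bar> \<le> C * (1 - 2 * u + v) powr (- w / 2)"
  using assms
proof (induction rule: singular_expr.induct)
  case (mono \<mu> a c)
  \<comment> \<open>\<open>\<delta>\<close> is the slack in the side condition of the monomial.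
    Being nonnegative, it costs at most \<open>4 powr \<delta>\<close>, because
    \<open>1 - 2 * u + v \<le> 4\<close>.\<close>
  define \<delta> where "\<delta> = (w + real a) / 2 - \<mu>"
  have d: "\<delta> \<ge> 0" using mono by (simp add: \<delta>_def field_simps)
  have "\<bar>c * (1 - v) ^ a * (1 - 2 * u + v) powr (- \<mu>)\<bar> \<le> (\<bar>c\<bar> * 2 ^ a * 4 powr \<delta>) * (1 - 2 * u + v) powr (- w / 2)"
    if uv: "u\<^sup>2 \<le> v" "v < 1" for u v
  proof -
    note E = bracket_bounds[OF uv]
    let ?E = "1 - 2 * u + v"
    have "1 - sqrt v \<le> sqrt ?E" using E by (intro real_le_rsqrt) auto
    then have "(1 - sqrt v) * 2 \<le> sqrt ?E * 2" by (rule mult_right_mono) simp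
    moreover have "1 - v \<le> (1 - sqrt v) * 2"
    proof -
      have "1 - v = (1 - sqrt v) * (1 + sqrt v)" using E by (simp add: algebra_simps)
      also have "\<dots> \<le> (1 - sqrt v) * 2" using E by (intro mult_left_mono) auto
      finally show ?thesis .
    qed
    ultimately have "1 - v \<le> 2 * sqrt ?E" by (simp only: mult.commute[of 2])
    then have "(1 - v) ^ a \<le> (2 * sqrt ?E) ^ a" using uv by (intro power_mono) auto
    also have "\<dots> = 2 ^ a * ?E powr (real a / 2)"
    proof -
      have "sqrt ?E ^ a = sqrt ?E powr real a" using E by (intro powr_realpow[symmetric]) simp
      also have "\<dots> = (?E powr (1 / 2)) powr real a" using E by (simp only: powr_half_sqrt less_imp_le)
      also have "\<dots> = ?E powr (real a / 2)" by (simp only: powr_powr) simp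
      finally show ?thesis by (simp only: power_mult_distrib)
    qed
    finally have "(1 - v) ^ a * ?E powr (- \<mu>) \<le> 2 ^ a * ?E powr (real a / 2) * ?E powr (- \<mu>)"
      by (intro mult_right_mono) auto
    also have "\<dots> = 2 ^ a * (?E powr \<delta> * ?E powr (- w / 2))"
    proof -
      have "real a / 2 + - \<mu> = \<delta> + - w / 2" by (simp add: \<delta>_def add_divide_distrib)
      then show ?thesis by (simp only: mult.assoc powr_add[symmetric])
    qed
    also have "\<dots> \<le> 2 ^ a * (4 powr \<delta> * ?E powr (- w / 2))"
      using E d by (intro mult_left_mono mult_right_mono powr_mono2) auto
    finally have "\<bar>c\<bar> * ((1 - v) ^ a * ?E powr (- \<mu>)) \<le> \<bar>c\<bar> * (2 ^ a * (4 powr \<delta> * ?E powr (- w / 2)))"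
      by (rule mult_left_mono) simp
    then show ?thesis using uv by (simp add: abs_mult mult_ac)
  qed
  then show ?case by (intro exI[of _ "\<bar>c\<bar> * 2 ^ a * 4 powr \<delta>"]) auto
next
  case (add f g)
  then obtain C D where "C \<ge> 0" "\<And>u v. u\<^sup>2 \<le> v \<Longrightarrow> v < 1 \<Longrightarrow> \<bar>f (1 - v) (1 - 2 * u + v)\<bar> \<le> C * (1 - 2 * u + v) powr (- w / 2)"
    and "D \<ge> 0" "\<And>u v. u\<^sup>2 \<le> v \<Longrightarrow> v < 1 \<Longrightarrow> \<bar>g (1 - v) (1 - 2 * u + v)\<bar> \<le> D * (1 - 2 * u + v) powr (- w / 2)"
    by metis
  then show ?case
    by (intro exI[of _ "C + D"]) (auto simp: distrib_right intro!: order_trans[OF abs_triangle_ineq] add_mono)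
qed

lemma singular_expr_theta:
  assumes "singular_expr w f"
  shows "\<exists>f'. singular_expr (w + 1) f' \<and> (\<forall>u v. u\<^sup>2 \<le> v \<longrightarrow> v < 1 \<longrightarrow>
     ((\<lambda>t. f (1 - t\<^sup>2 * v) (1 - 2 * (t * u) + t\<^sup>2 * v)) has_real_derivative f' (1 - v) (1 - 2 * u + v)) (at 1))"
  using assms
proof (induction rule: singular_expr.induct)
  case (mono \<mu> a c)
  \<comment> \<open>At \<open>t = 1\<close> the derivatives of \<open>q\<close> and \<open>e\<close>
    are \<open>- 2 v = 2 q - 2\<close> and \<open>2 v - 2 u = e - q\<close>, so neither
    \<open>u\<close> nor \<open>v\<close> survives. For \<open>a = 0\<close> the truncated
    \<open>a - 1\<close> does no harm, its coefficient being 0.\<close>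
  let ?f' = "\<lambda>q e. (c * (2 * real a - \<mu>)) * q ^ a * e powr (- \<mu>) + ((- 2 * real a * c) * q ^ (a - 1) * e powr (- \<mu>)
      + (\<mu> * c) * q ^ (a + 1) * e powr (- (\<mu> + 1)))"
  have "singular_expr (w + 1) ?f'"
    using mono by (intro singular_expr.add singular_expr.mono) auto
  moreover have "((\<lambda>t. c * (1 - t\<^sup>2 * v) ^ a * (1 - 2 * (t * u) + t\<^sup>2 * v) powr (- \<mu>)) has_real_derivative
      ?f' (1 - v) (1 - 2 * u + v)) (at 1)" if uv: "u\<^sup>2 \<le> v" "v < 1" for u v
  proof -
    note E = bracket_bounds[OF uv]
    let ?E = "1 - 2 * u + v" and ?q = "1 - v"
    have "((\<lambda>t. c * (1 - t\<^sup>2 * v) ^ a * (1 - 2 * (t * u) + t\<^sup>2 * v) powr (- \<mu>)) has_real_derivative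
       c * (real a * ?q ^ (a - 1) * (- (2 * v))) * ?E powr (- \<mu>) +
       c * ?q ^ a * ((- \<mu>) * ?E powr (- \<mu> - 1) * (2 * v - 2 * u))) (at 1)"
      by (rule derivative_eq_intros refl | (use E in \<open>simp add: algebra_simps; fail\<close>))+
    moreover have "?E powr (- \<mu>) = ?E * ?E powr (- \<mu> - 1)"
      using E by (simp add: powr_mult_base)
    moreover have "real a * ?q ^ a = real a * (?q * ?q ^ (a - 1))" by (cases a) auto
    moreover have "?E powr (- (\<mu> + 1)) = ?E powr (- \<mu> - 1)" by (rule arg_cong) simp
    moreover have "c * (A * Q1 * (- (2 * v))) * X + c * Q * ((- \<mu>) * P * (2 * v - 2 * u)) =
        c * (2 * A - \<mu>) * Q * X + ((- 2 * A * c) * Q1 * X + (\<mu> * c) * (Q * q) * P)"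
      if "X = E * P" "A * Q = A * (q * Q1)" "E = 1 - 2 * u + v" "q = 1 - v" for A Q Q1 X E P q :: real
      using that by algebra
    ultimately show ?thesis
      by (elim DERIV_cong) (simp only: power_add power_one_right)
  qed
  ultimately show ?case by blast
next
  case (add f g)
  from add.IH(1) obtain f' where f': "singular_expr (w + 1) f'" "\<And>u v. u\<^sup>2 \<le> v \<Longrightarrow> v < 1 \<Longrightarrow>
     ((\<lambda>t. f (1 - t\<^sup>2 * v) (1 - 2 * (t * u) + t\<^sup>2 * v)) has_real_derivative f' (1 - v) (1 - 2 * u + v)) (at 1)"
    by blast
  from add.IH(2) obtain g' where g': "singular_expr (w + 1) g'" "\<And>u v. u\<^sup>2 \<le> v \<Longrightarrow> v < 1 \<Longrightarrow>
     ((\<lambda>t. g (1 - t\<^sup>2 * v) (1 - 2 * (t * u) + t\<^sup>2 * v)) has_real_derivative g' (1 - v) (1 - 2 * u + v)) (at 1)"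
    by blast
  show ?case
    by (intro exI[of _ "\<lambda>q e. f' q e + g' q e"] conjI singular_expr.add f' g' allI impI DERIV_add)
qed

text \<open>Passing from \<open>m\<close> to \<open>m + 1\<close> multiplies the \<open>k\<close>-th
  coefficient by \<open>1 + k / (s + m)\<close>. This is the identity plus a multiple of the
  dilation derivative at \<open>t = 1\<close>, and \<open>singular_expr_theta\<close> keeps the sum
  explicit.\<close>

lemma pochhammer_multiplier_singular:
  assumes Y: "homog_family Y" and f: "singular_expr w f" "\<And>u v. u\<^sup>2 \<le> v \<Longrightarrow> v < 1 \<Longrightarrow> (\<Sum>k. Y k u v) = f (1 - v) (1 - 2 * u + v)"
    and s: "s > 0"
  shows "\<exists>g. singular_expr (w + real m) g \<and> (\<forall>u v. u\<^sup>2 \<le> v \<longrightarrow> v < 1 \<longrightarrow>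
     (\<Sum>k. pochhammer (s + real m) k / pochhammer s k * Y k u v) = g (1 - v) (1 - 2 * u + v))"
proof (induction m)
  case 0
  have "pochhammer s k \<noteq> 0" for k using pochhammer_pos[OF s, of k] by simp
  then show ?case using f by auto
next
  case (Suc m)
  then obtain g where g: "singular_expr (w + real m) g" "\<And>u v. u\<^sup>2 \<le> v \<Longrightarrow> v < 1 \<Longrightarrow>
     (\<Sum>k. pochhammer (s + real m) k / pochhammer s k * Y k u v) = g (1 - v) (1 - 2 * u + v)" by blast
  obtain g' where g': "singular_expr (w + real m + 1) g'" "\<And>u v. u\<^sup>2 \<le> v \<Longrightarrow> v < 1 \<Longrightarrow>
     ((\<lambda>t. g (1 - t\<^sup>2 * v) (1 - 2 * (t * u) + t\<^sup>2 * v)) has_real_derivative g' (1 - v) (1 - 2 * u + v)) (at 1)"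
    using singular_expr_theta[OF g(1)] by blast
  define S where "S = s + real m"
  have S: "S > 0" using s by (simp add: S_def)
  define a where "a k = pochhammer S k / pochhammer s k" for k
  have a: "polyb a" unfolding a_def using S s by (rule polyb_pochhammer)
  define h where "h q e = g q e + (1 / S) * g' q e" for q e
  have "singular_expr (w + real (Suc m)) h"
    unfolding h_def using g' g by (intro singular_expr.add singular_expr_scale) (auto intro: singular_expr_weaken simp: add_ac)
  moreover have "(\<Sum>k. pochhammer (s + real (Suc m)) k / pochhammer s k * Y k u v) = h (1 - v) (1 - 2 * u + v)"
    if uv: "u\<^sup>2 \<le> v" "v < 1" for u v
  proof -
    note E = bracket_bounds[OF uv]
    define z where "z k = a k * Y k u v" for k
    \<comment> \<open>Differentiating the power series in \<open>t\<close> at 1 requires convergence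
      beyond 1, so \<open>K > 1\<close> is taken with \<open>K * sqrt v\<close> still below
      1.\<close>
    obtain K where K: "1 < K" "K * sqrt v < 1"
    proof -
      have "(1 + sqrt v) / 2 < 1" "0 < (1 + sqrt v) / 2" "sqrt v < (1 + sqrt v) / 2" using E by (simp_all add: field_simps add_pos_nonneg)
      then show thesis using that[of "inverse ((1 + sqrt v) / 2)"] by (simp add: one_less_inverse field_simps)
    qed
    have sK: "summable (\<lambda>k. z k * K ^ k)"
      by (rule summable_rabs_cancel) (use homog_family_summable[OF Y a uv, of K] K in \<open>simp add: z_def abs_mult\<close>)
    have D1: "DERIV (\<lambda>t. \<Sum>k. z k * t ^ k) 1 :> (\<Sum>k. diffs z k * 1 ^ k)"
      by (rule termdiffs_strong[OF sK]) (use K in simp)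
    have ev: "eventually (\<lambda>t. (\<Sum>k. z k * t ^ k) = g (1 - t\<^sup>2 * v) (1 - 2 * (t * u) + t\<^sup>2 * v)) (nhds 1)"
    proof -
      have "((\<lambda>t. t\<^sup>2 * v) \<longlongrightarrow> 1\<^sup>2 * v) (nhds 1)" by (intro tendsto_intros filterlim_ident)
      then have "eventually (\<lambda>t. t\<^sup>2 * v < 1) (nhds 1)" using uv by (intro order_tendstoD) auto
      then show ?thesis
      proof eventually_elim
        case (elim t)
        have "(t * u)\<^sup>2 \<le> t\<^sup>2 * v" using uv by (simp add: power_mult_distrib mult_left_mono)
        have "pochhammer (s + real m) k / pochhammer s k * Y k (t * u) (t\<^sup>2 * v) = z k * t ^ k" for k
          unfolding homog_family_scale[OF Y] by (simp add: z_def a_def S_def)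
        then show ?case using g(2)[OF \<open>(t * u)\<^sup>2 \<le> t\<^sup>2 * v\<close> elim] by simp
      qed
    qed
    have "DERIV (\<lambda>t. \<Sum>k. z k * t ^ k) 1 :> g' (1 - v) (1 - 2 * u + v)"
      using DERIV_cong_ev[OF refl ev refl] g'(2)[OF uv] by blast
    then have d: "(\<Sum>k. diffs z k) = g' (1 - v) (1 - 2 * u + v)"
      using DERIV_unique[OF D1] by simp
    have sz': "suminf z = g (1 - v) (1 - 2 * u + v)" using g(2)[OF uv] by (simp add: z_def[abs_def] a_def S_def)
    have sz: "summable z" unfolding z_def by (rule homog_family_summable1(2)[OF Y a uv])
    have "polyb (\<lambda>k. (real k + 0) * a k)" by (intro polyb_mult a polyb_linear)
    from homog_family_summable1(2)[OF Y this uv] have skz: "summable (\<lambda>k. real k * z k)" by (simp add: z_def mult_ac)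
    have "(\<Sum>k. real k * z k) = (\<Sum>k. diffs z k)"
      using suminf_split_head[OF skz] by (simp add: diffs_def)
    then have "(\<Sum>k. z k + (1 / S) * (real k * z k)) = h (1 - v) (1 - 2 * u + v)"
      using suminf_add[OF sz summable_mult[OF skz, of "1 / S"]] suminf_mult[OF skz, of "1 / S"] sz' d
      by (simp add: h_def)
    moreover have "pochhammer (s + real (Suc m)) k / pochhammer s k * Y k u v = z k + (1 / S) * (real k * z k)" for k
    proof -
      have "S * pochhammer (S + 1) k = pochhammer S k * (S + real k)"
        using pochhammer_rec[of S k] pochhammer_Suc[of S k] by simp
      then have "pochhammer (S + 1) k = pochhammer S k * (1 + real k / S)" using S by (simp add: field_simps)
      moreover have "s + real (Suc m) = S + 1" by (simp add: S_def)
      ultimately show ?thesis unfolding z_def a_def by (simp only:) (simp add: algebra_simps add_divide_distrib)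
    qed
    ultimately show ?thesis by simp
  qed
  ultimately show ?case by blast
qed

text \<open>The exponent is halved because \<open>sqrt (1 - 2 * u + v)\<close> is the distance that
  plays the role of \<open>d\<close> in the Beta average.\<close>

definition kernel_bound :: "(nat \<Rightarrow> real \<Rightarrow> real \<Rightarrow> real) \<Rightarrow> (nat \<Rightarrow> real) \<Rightarrow> real \<Rightarrow> bool" where
  "kernel_bound Y g w \<longleftrightarrow> (\<exists>C\<ge>0. \<forall>u v. u\<^sup>2 \<le> v \<longrightarrow> v < 1 \<longrightarrow> \<bar>\<Sum>k. g k * Y k u v\<bar> \<le> C * (1 - 2 * u + v) powr (- w / 2))"

text \<open>For the conjugate pair \<open>w\<close>, both \<open>1 - t\<close> and
  \<open>|1 - w|\<close> are controlled by \<open>|1 - t w|\<close>: the first because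
  \<open>|w| < 1\<close>, the second by the triangle inequality. This gives a bound at the dilated
  point the form that \<open>beta_multiplier_bound\<close> expects.\<close>

lemma sqrt_E_shrink:
  assumes uv: "u\<^sup>2 \<le> v" "v < 1" and t: "0 < t" "t < 1"
  shows "1 - t + sqrt (1 - 2 * u + v) \<le> 4 * sqrt (1 - 2 * (t * u) + t\<^sup>2 * v)"
proof -
  obtain w where w: "w + cnj w = of_real (2 * u)" "w * cnj w = of_real v" and c: "cmod w = sqrt v"
    by (rule conjugate_pair[OF uv(1)])
  have E: "cmod (1 - of_real t * w) = sqrt (1 - 2 * (t * u) + t\<^sup>2 * v)" for t
  proof -
    have "complex_of_real ((cmod (1 - of_real t * w))\<^sup>2) = (1 - of_real t * w) * cnj (1 - of_real t * w)" by (rule complex_norm_square)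
    also have "\<dots> = 1 - of_real t * (w + cnj w) + of_real (t\<^sup>2) * (w * cnj w)" by (simp add: algebra_simps power2_eq_square)
    also have "\<dots> = of_real (1 - 2 * (t * u) + t\<^sup>2 * v)" by (simp only: w, simp?)
    finally have "(cmod (1 - of_real t * w))\<^sup>2 = 1 - 2 * (t * u) + t\<^sup>2 * v" unfolding of_real_eq_iff .
    then show ?thesis by (metis norm_ge_zero real_sqrt_unique)
  qed
  have c1: "cmod w < 1" using c bracket_bounds[OF uv] by simp
  have "1 - w = (1 - of_real t * w) - of_real (1 - t) * w" by (simp add: algebra_simps)
  then have "cmod (1 - w) \<le> cmod (1 - of_real t * w) + cmod (of_real (1 - t) * w)"
    by (metis norm_triangle_ineq4)
  moreover have "cmod (of_real (1 - t) * w) = (1 - t) * cmod w"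
    using t by (simp only: norm_mult norm_of_real, simp?)
  moreover have "(1 - t) * cmod w \<le> 1 - t" using c1 t by (simp add: mult_left_le)
  moreover have "1 - t * cmod w \<le> cmod (1 - of_real t * w)"
    using norm_triangle_ineq2[of 1 "of_real t * w"] t by (simp add: norm_mult)
  moreover have "t * cmod w \<le> t" using c1 t by (simp add: mult_left_le)
  ultimately have "1 - t + cmod (1 - w) \<le> 4 * cmod (1 - of_real t * w)" using norm_ge_zero[of "1 - of_real t * w"] t by linarith
  then show ?thesis using E[of 1] E[of t] by simp
qed

text \<open>The Beta average is applied at every point with \<open>d = sqrt (1 - 2 * u + v)\<close>;
  homogeneity identifies \<open>\<Sum>k. g k * Y k u v * t ^ k\<close> with the value at the dilated
  point, where the given bound holds.\<close>

lemma kernel_bound_lower: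
  assumes Y: "homog_family Y" and g: "polyb g" and kernel_bound: "kernel_bound Y g w" and ab: "0 < \<alpha>" "\<alpha> < \<beta>" and w: "w \<ge> 0"
    and k: "\<kappa> \<ge> 0" "\<kappa> \<ge> w - (\<beta> - \<alpha>)" "\<kappa> > 0 \<or> \<kappa> > w - (\<beta> - \<alpha>)"
  shows "kernel_bound Y (\<lambda>k. pochhammer \<alpha> k / pochhammer \<beta> k * g k) \<kappa>"
proof -
  obtain C where C: "C \<ge> 0" "\<And>u v. u\<^sup>2 \<le> v \<Longrightarrow> v < 1 \<Longrightarrow> \<bar>\<Sum>k. g k * Y k u v\<bar> \<le> C * (1 - 2 * u + v) powr (- w / 2)"
    using kernel_bound unfolding kernel_bound_def by blast
  obtain D where D: "D \<ge> 0" "\<And>z d M. summable (\<lambda>k. \<bar>z k\<bar>) \<Longrightarrow> 0 < d \<Longrightarrow> d \<le> 2 \<Longrightarrow> M \<ge> 0 \<Longrightarrow>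
     (\<And>t. 0 < t \<Longrightarrow> t < 1 \<Longrightarrow> \<bar>\<Sum>k. z k * t ^ k\<bar> \<le> M * (1 - t + d) powr (- w)) \<Longrightarrow>
     \<bar>\<Sum>k. pochhammer \<alpha> k / pochhammer \<beta> k * z k\<bar> \<le> D * M * d powr (- \<kappa>)"
    by (rule beta_multiplier_bound[OF ab w k]) blast
  have "\<bar>\<Sum>k. pochhammer \<alpha> k / pochhammer \<beta> k * g k * Y k u v\<bar> \<le> (D * (C * 4 powr w)) * (1 - 2 * u + v) powr (- \<kappa> / 2)"
    if uv: "u\<^sup>2 \<le> v" "v < 1" for u v
  proof -
    note E = bracket_bounds[OF uv]
    let ?d = "sqrt (1 - 2 * u + v)"
    have "\<bar>\<Sum>k. pochhammer \<alpha> k / pochhammer \<beta> k * (g k * Y k u v)\<bar> \<le> D * (C * 4 powr w) * ?d powr (- \<kappa>)"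
    proof (rule D(2))
      show "summable (\<lambda>k. \<bar>g k * Y k u v\<bar>)" by (rule homog_family_summable1[OF Y g uv])
      show "0 < ?d" using E by simp
      show "?d \<le> 2" using E by (intro real_le_lsqrt) auto
      show "0 \<le> C * 4 powr w" using C by simp
      fix t :: real assume t: "0 < t" "t < 1"
      have tuv: "(t * u)\<^sup>2 \<le> t\<^sup>2 * v" "t\<^sup>2 * v < 1"
      proof -
        show "(t * u)\<^sup>2 \<le> t\<^sup>2 * v" using uv by (simp add: power_mult_distrib mult_left_mono)
        have "t\<^sup>2 * v \<le> 1 * v" using t E by (intro mult_right_mono) (auto simp: power_le_one)
        then show "t\<^sup>2 * v < 1" using uv by simp
      qed
      let ?E = "1 - 2 * (t * u) + t\<^sup>2 * v"
      have Ep: "?E > 0" using bracket_bounds[OF tuv] by simp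
      have "(\<Sum>k. g k * Y k u v * t ^ k) = (\<Sum>k. g k * Y k (t * u) (t\<^sup>2 * v))"
        unfolding homog_family_scale[OF Y] by (simp add: mult_ac)
      then have "\<bar>\<Sum>k. g k * Y k u v * t ^ k\<bar> \<le> C * ?E powr (- w / 2)" using C(2)[OF tuv] by simp
      also have "?E powr (- w / 2) = sqrt ?E powr (- w)"
        using Ep by (simp add: powr_half_sqrt[symmetric] powr_powr)
      also have "C * sqrt ?E powr (- w) \<le> C * ((1 - t + ?d) / 4) powr (- w)"
        using sqrt_E_shrink[OF uv t] t E w C by (intro mult_left_mono powr_mono2') (auto intro!: add_pos_pos)
      also have "((1 - t + ?d) / 4) powr (- w) = 4 powr w * (1 - t + ?d) powr (- w)"
        by (simp add: powr_divide powr_minus_divide)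
      finally show "\<bar>\<Sum>k. g k * Y k u v * t ^ k\<bar> \<le> C * 4 powr w * (1 - t + ?d) powr (- w)" by (simp add: mult_ac)
    qed
    also have "?d powr (- \<kappa>) = (1 - 2 * u + v) powr (- \<kappa> / 2)"
      using E by (simp add: powr_half_sqrt[symmetric] powr_powr)
    finally show ?thesis by (simp add: mult.assoc)
  qed
  moreover have "D * (C * 4 powr w) \<ge> 0" using C D by simp
  ultimately show ?thesis unfolding kernel_bound_def by blast
qed

lemma kernel_bound_scale:
  assumes Y: "homog_family Y" and g: "polyb g" and kernel_bound: "kernel_bound Y g w"
  shows "kernel_bound Y (\<lambda>k. a * g k) w"
proof -
  obtain C where C: "C \<ge> 0" "\<And>u v. u\<^sup>2 \<le> v \<Longrightarrow> v < 1 \<Longrightarrow> \<bar>\<Sum>k. g k * Y k u v\<bar> \<le> C * (1 - 2 * u + v) powr (- w / 2)"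
    using kernel_bound unfolding kernel_bound_def by blast
  have "\<bar>\<Sum>k. a * g k * Y k u v\<bar> \<le> (\<bar>a\<bar> * C) * (1 - 2 * u + v) powr (- w / 2)" if uv: "u\<^sup>2 \<le> v" "v < 1" for u v
  proof -
    have "(\<Sum>k. a * g k * Y k u v) = a * (\<Sum>k. g k * Y k u v)"
      using suminf_mult[OF homog_family_summable1(2)[OF Y g uv], of a] by (simp add: mult.assoc)
    then show ?thesis using mult_left_mono[OF C(2)[OF uv], of "\<bar>a\<bar>"] by (simp add: abs_mult mult.assoc)
  qed
  then show ?thesis unfolding kernel_bound_def using C by (intro exI[of _ "\<bar>a\<bar> * C"]) auto
qed

text \<open>The order changes by \<open>c + 1\<close>, the growth exponent of
  \<open>gam l c k\<close>. The offset \<open>i\<close> is there for the derivative of the kernel,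
  whose coefficients are \<open>gam l c (Suc k)\<close>.\<close>

lemma kernel_bound_gam:
  assumes Y: "homog_family Y" and f: "singular_expr w f" "\<And>u v. u\<^sup>2 \<le> v \<Longrightarrow> v < 1 \<Longrightarrow> (\<Sum>k. Y k u v) = f (1 - v) (1 - 2 * u + v)"
    and l: "l \<ge> 1" "w \<ge> 2 * l - 1"
    and k: "\<kappa> \<ge> 0" "\<kappa> \<ge> w + c + 1" "\<kappa> > 0 \<or> \<kappa> > w + c + 1"
  shows "kernel_bound Y (\<lambda>k. gam l c (i + k)) \<kappa>"
proof (cases "c > - (1 + l)")
  case True
  \<comment> \<open>The integer \<open>m\<close> overshoots: the multiplier
    \<open>pochhammer (s + m) k / pochhammer s k\<close> raises the order by \<open>m\<close>, and
    \<open>m > 1 + c\<close> leaves a genuine Beta average for the way down to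
    \<open>\<alpha> = s + 1 + c\<close>.\<close>
  define m where "m = nat \<lceil>1 + c\<rceil> + 1"
  have m: "real m > 1 + c" unfolding m_def by linarith
  define s where "s = l + real i"
  have s: "s > 0" using l by (simp add: s_def)
  obtain g where g: "singular_expr (w + real m) g" "\<And>u v. u\<^sup>2 \<le> v \<Longrightarrow> v < 1 \<Longrightarrow>
     (\<Sum>k. pochhammer (s + real m) k / pochhammer s k * Y k u v) = g (1 - v) (1 - 2 * u + v)"
    using pochhammer_multiplier_singular[OF Y f s, of m] by blast
  have kb1: "kernel_bound Y (\<lambda>k. pochhammer (s + real m) k / pochhammer s k) (w + real m)"
    unfolding kernel_bound_def using singular_expr_bound[OF g(1)] g(2) by simp
  define \<alpha> where "\<alpha> = 1 + l + c + real i"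
  have \<alpha>: "\<alpha> > 0" using True by (simp add: \<alpha>_def)
  have "kernel_bound Y (\<lambda>k. pochhammer \<alpha> k / pochhammer (s + real m) k * (pochhammer (s + real m) k / pochhammer s k)) \<kappa>"
    by (rule kernel_bound_lower[OF Y polyb_pochhammer kb1]) (use s \<alpha> m l k in \<open>auto simp: \<alpha>_def s_def\<close>)
  moreover have "pochhammer (s + real m) k \<noteq> 0" for k using pochhammer_pos[of "s + real m" k] s by simp
  ultimately have "kernel_bound Y (\<lambda>k. pochhammer \<alpha> k / pochhammer s k) \<kappa>" by simp
  from kernel_bound_scale[OF Y polyb_pochhammer[OF \<alpha> s] this, of "pochhammer (1 + l + c) i / pochhammer l i"]
  show ?thesis using True by (simp add: gam_def pochhammer_product' \<alpha>_def s_def)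
next
  case False
  \<comment> \<open>Here \<open>gam l c\<close> is the product of the Pochhammer ratios of 1 over
    \<open>l\<close> and of 1 over \<open>\<beta>\<close>, and Beta averages lower the order by
    \<open>l - 1\<close> and \<open>\<beta> - 1\<close>; for \<open>l = 1\<close> the first is the
    identity. The intermediate exponent \<open>\<kappa>1\<close> is positive, so it costs no
    logarithm.\<close>
  define \<beta> where "\<beta> = 1 - (l + c)"
  have \<beta>: "\<beta> \<ge> 2" using False by (simp add: \<beta>_def)
  have kb1: "kernel_bound Y (\<lambda>k. 1) w" unfolding kernel_bound_def using singular_expr_bound[OF f(1)] f(2) by simp
  define \<kappa>1 where "\<kappa>1 = w - (l - 1)"
  have \<kappa>1: "\<kappa>1 > 0" using l by (simp add: \<kappa>1_def)
  define a where "a k = pochhammer (1 + real i) k / pochhammer (l + real i) k" for k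
  have pa: "polyb a" unfolding a_def using l by (intro polyb_pochhammer) auto
  have kb2: "kernel_bound Y a \<kappa>1"
  proof (cases "l = 1")
    case True
    have "pochhammer (1 + real i) k \<noteq> 0" for k using pochhammer_pos[of "1 + real i" k] by simp
    then have "a = (\<lambda>k. 1)" using True by (simp add: a_def fun_eq_iff)
    then show ?thesis using kb1 True by (simp add: \<kappa>1_def)
  next
    case False
    have "kernel_bound Y (\<lambda>k. pochhammer (1 + real i) k / pochhammer (l + real i) k * 1) \<kappa>1"
      by (rule kernel_bound_lower[OF Y polyb_const kb1]) (use False l \<kappa>1 in \<open>auto simp: \<kappa>1_def\<close>)
    then show ?thesis by (simp add: a_def[abs_def])
  qed
  have "kernel_bound Y (\<lambda>k. pochhammer (1 + real i) k / pochhammer (\<beta> + real i) k * a k) \<kappa>"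
    by (rule kernel_bound_lower[OF Y pa kb2]) (use \<beta> \<kappa>1 k in \<open>auto simp: \<kappa>1_def \<beta>_def\<close>)
  moreover have "polyb (\<lambda>k. pochhammer (1 + real i) k / pochhammer (\<beta> + real i) k * a k)"
    using \<beta> by (intro polyb_mult pa polyb_pochhammer) auto
  ultimately have "kernel_bound Y (\<lambda>k. (fact i)^2 / (pochhammer \<beta> i * pochhammer l i) * (pochhammer (1 + real i) k / pochhammer (\<beta> + real i) k * a k)) \<kappa>"
    using kernel_bound_scale[OF Y] by blast
  moreover have "fact (i + k) = fact i * pochhammer (1 + real i) k" for k
    using pochhammer_product'[of "1::real" i k] by (simp add: pochhammer_fact)
  ultimately show ?thesis using False by (simp add: gam_def a_def pochhammer_product' \<beta>_def power2_eq_square mult_ac)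
qed

text \<open>Starting from the order \<open>2 * l - 1\<close> of the Poisson kernel, the final order
  is \<open>2 * l + c\<close>, that is \<open>n + c\<close>.\<close>

lemma kernel_bound_zon:
  assumes l: "l \<ge> 1" and k: "\<kappa> \<ge> 0" "\<kappa> \<ge> 2 * l + c" "\<kappa> > 0 \<or> \<kappa> > 2 * l + c"
  shows "kernel_bound (zon l) (gam l c) \<kappa>"
proof -
  have "singular_expr (2 * l - 1) (\<lambda>q e. 1 * q ^ 1 * e powr (- l))" by (rule singular_expr.mono) simp
  then have "kernel_bound (zon l) (\<lambda>k. gam l c (0 + k)) \<kappa>"
    by (rule kernel_bound_gam[OF homog_family_zon[OF l]]) (use zon_sums l k in \<open>auto simp: sums_iff\<close>)
  then show ?thesis by simp
qed

text \<open>The summands are the \<open>u\<close>-derivatives of \<open>zon l (Suc k)\<close>. The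
  factor \<open>k + l\<close> is \<open>l\<close> times a Pochhammer ratio of \<open>l + 1\<close>
  over \<open>l\<close>, hence one dilation derivative of \<open>E powr (- l)\<close>; together with
  \<open>gam\<close> the order ends two above that of the kernel.\<close>

lemma kernel_bound_dzon:
  assumes l: "l \<ge> 1" and c: "2 * l + c \<ge> 0"
  shows "kernel_bound (\<lambda>k u v. 2 * (real k + l) * geg l k u v) (\<lambda>k. gam l c (Suc k)) (2 * l + c + 2)"
proof -
  have G: "homog_family (geg l)" using l by (intro homog_family_geg) simp
  let ?Y = "\<lambda>k u v. 2 * (real k + l) * geg l k u v"
  have Y: "homog_family ?Y" by (intro homog_family_geg_weighted G polyb_mult) auto
  have "singular_expr (2 * l) (\<lambda>q e. 1 * q ^ 0 * e powr (- l))" by (rule singular_expr.mono) simp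
  from pochhammer_multiplier_singular[OF G this _ , of l 1]
  obtain g where g: "singular_expr (2 * l + 1) g" "\<And>u v. u\<^sup>2 \<le> v \<Longrightarrow> v < 1 \<Longrightarrow>
     (\<Sum>k. pochhammer (l + 1) k / pochhammer l k * geg l k u v) = g (1 - v) (1 - 2 * u + v)"
    using geg_sums l by (auto simp: sums_iff)
  have p: "pochhammer (l + 1) k / pochhammer l k = (real k + l) / l" for k
  proof -
    have "l * pochhammer (l + 1) k = pochhammer l k * (l + real k)"
      using pochhammer_rec[of l k] pochhammer_Suc[of l k] by simp
    moreover have "pochhammer l k > 0" using l by (intro pochhammer_pos) simp
    ultimately show ?thesis using l by (simp add: field_simps)
  qed
  have "kernel_bound ?Y (\<lambda>k. gam l c (1 + k)) (2 * l + c + 2)"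
  proof (rule kernel_bound_gam[OF Y singular_expr_scale[OF g(1), of "2 * l"]])
    fix u v :: real assume uv: "u\<^sup>2 \<le> v" "v < 1"
    have "summable (\<lambda>k. pochhammer (l + 1) k / pochhammer l k * geg l k u v)"
      using l by (intro homog_family_summable1[OF G polyb_pochhammer uv]) auto
    from suminf_mult[OF this, of "2 * l"]
    have "(\<Sum>k. 2 * l * (pochhammer (l + 1) k / pochhammer l k * geg l k u v)) = 2 * l * g (1 - v) (1 - 2 * u + v)"
      using g(2)[OF uv] by simp
    moreover have "2 * l * (pochhammer (l + 1) k / pochhammer l k * geg l k u v) = ?Y k u v" for k
      using l by (simp add: p)
    ultimately show "(\<Sum>k. ?Y k u v) = 2 * l * g (1 - v) (1 - 2 * u + v)" by simp
  qed (use l c in auto)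
  then show ?thesis by simp
qed

section \<open>The kernel near the diagonal\<close>

text \<open>Both branches of \<open>gam\<close> have the same growth: in the second one the two
  ratios contribute \<open>1 - \<beta>\<close> and \<open>1 - l\<close>, and
  \<open>\<beta> = 1 - (l + c)\<close> makes the sum \<open>c + 1\<close>.\<close>

lemma gam_bounds:
  assumes l: "l > 0"
  obtains c0 C where "c0 > 0" "\<And>k. c0 * real (k + 1) powr (c + 1) \<le> gam l c k"
    "\<And>k. gam l c k \<le> C * real (k + 1) powr (c + 1)"
proof (cases "c > - (1 + l)")
  case True
  then have "1 + l + c > 0" by simp
  from pochhammer_ratio_bounds[OF this l] obtain c0 C where
    "c0 > 0" "\<And>k. c0 * real (k + 1) powr (1 + l + c - l) \<le> pochhammer (1 + l + c) k / pochhammer l k"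
    "\<And>k. pochhammer (1 + l + c) k / pochhammer l k \<le> C * real (k + 1) powr (1 + l + c - l)" by blast
  moreover have "1 + l + c - l = c + 1" by simp
  ultimately show thesis using True that[of c0 C] by (simp add: gam_def)
next
  case False
  define \<beta> where "\<beta> = 1 - (l + c)"
  have \<beta>: "\<beta> > 0" using False by (simp add: \<beta>_def)
  obtain c1 C1 where 1: "c1 > 0" "\<And>k. c1 * real (k + 1) powr (1 - \<beta>) \<le> pochhammer 1 k / pochhammer \<beta> k"
    "\<And>k. pochhammer 1 k / pochhammer \<beta> k \<le> C1 * real (k + 1) powr (1 - \<beta>)"
    using pochhammer_ratio_bounds[OF zero_less_one \<beta>] by blast
  obtain c2 C2 where 2: "c2 > 0" "\<And>k. c2 * real (k + 1) powr (1 - l) \<le> pochhammer 1 k / pochhammer l k"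
    "\<And>k. pochhammer 1 k / pochhammer l k \<le> C2 * real (k + 1) powr (1 - l)"
    using pochhammer_ratio_bounds[OF zero_less_one l] by blast
  have e: "real (k + 1) powr (1 - \<beta>) * real (k + 1) powr (1 - l) = real (k + 1) powr (c + 1)" for k
    by (simp add: \<beta>_def powr_add[symmetric] del: of_nat_add)
  have p: "pochhammer (1::real) k > 0" "pochhammer \<beta> k > 0" "pochhammer l k > 0" for k
    using l \<beta> by (auto intro: pochhammer_pos)
  have g: "gam l c k = pochhammer 1 k / pochhammer \<beta> k * (pochhammer 1 k / pochhammer l k)" for k
    using False by (simp add: gam_def \<beta>_def power2_eq_square pochhammer_fact)
  have nn: "0 \<le> pochhammer 1 k / pochhammer \<beta> k" "0 \<le> pochhammer 1 k / pochhammer l k" for k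
    using p[of k] by auto
  show thesis
  proof (rule that[of "c1 * c2" "C1 * C2"])
    show "c1 * c2 > 0" using 1 2 by simp
    show "c1 * c2 * real (k + 1) powr (c + 1) \<le> gam l c k" for k
    proof -
      have "(c1 * real (k + 1) powr (1 - \<beta>)) * (c2 * real (k + 1) powr (1 - l)) \<le> gam l c k"
        unfolding g using 1(1) 2(1) nn by (intro mult_mono 1 2) auto
      then show ?thesis unfolding e[symmetric] by (simp only: mult_ac)
    qed
    show "gam l c k \<le> C1 * C2 * real (k + 1) powr (c + 1)" for k
    proof -
      have "gam l c k \<le> (C1 * real (k + 1) powr (1 - \<beta>)) * (C2 * real (k + 1) powr (1 - l))"
        unfolding g by (intro mult_mono 1 2 nn order_trans[OF nn(1) 1(3)])
      then show ?thesis unfolding e[symmetric] by (simp only: mult_ac)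
    qed
  qed
qed

lemma gam_pos: "l > 0 \<Longrightarrow> gam l c k > 0"
  by (auto simp: gam_def intro!: divide_pos_pos mult_pos_pos pochhammer_pos)

lemma polyb_gam:
  assumes "l > 0"
  shows "polyb (gam l c)"
proof -
  obtain C where "\<And>k. gam l c k \<le> C * real (k + 1) powr (c + 1)" using gam_bounds[OF assms] by blast
  then show ?thesis using gam_pos[OF assms, of c] by (intro polybI_powr[of _ C "c + 1"]) (simp add: less_imp_le)
qed

text \<open>The value at the pole is the dimension of the space of spherical harmonics of degree
  \<open>k\<close>; the bound retains its growth of order \<open>k ^ (n - 2)\<close>, with
  \<open>n = 2 * l\<close>.\<close>

lemma zon_diag_lower:
  assumes "l \<ge> 1"
  shows "zon l k 1 1 \<ge> pochhammer (2 * l - 1) k / fact k"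
proof -
  have d: "geg l k 1 1 = pochhammer (2 * l) k / fact k" for k using geg_diag[of l k 1] by simp
  consider "k = 0" | "k = Suc 0" | j where "k = j + 2"
    by (metis One_nat_def add_2_eq_Suc' not0_implies_Suc)
  then show ?thesis
  proof cases
    case 3
    define p where "p = pochhammer (2 * l) j / fact j"
    have p: "p \<ge> 0" unfolding p_def using assms by (intro divide_nonneg_pos less_imp_le[OF pochhammer_pos]) auto
    define D where "D = real (j + 1) * real (j + 2)"
    have D: "D > 0" by (simp add: D_def)
    have f: "fact (j + 2) = D * fact j" by (simp add: D_def algebra_simps)
    have 1: "pochhammer (2 * l) k / fact k = p * ((2 * l + real j) * (2 * l + real j + 1)) / D"
      unfolding 3 p_def f by (simp add: pochhammer_Suc field_simps)
    have "pochhammer (2 * l - 1) (Suc (Suc j)) = (2 * l - 1) * (pochhammer (2 * l) j * (2 * l + real j))"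
      using pochhammer_rec[of "2 * l - 1" "Suc j"] pochhammer_Suc[of "2 * l" j] by simp
    then have 2: "pochhammer (2 * l - 1) k / fact k = p * ((2 * l - 1) * (2 * l + real j)) / D"
      unfolding 3 p_def f by (simp add: field_simps)
    have "(2 * l - 1) * (2 * l + real j) \<le> (2 * l + real j) * (2 * l + real j + 1) - D"
    proof -
      have "0 \<le> (2 * l - 1) * (real j + 2)" using assms by simp
      also have "\<dots> = (2 * l + real j) * (2 * l + real j + 1) - D - (2 * l - 1) * (2 * l + real j)"
        by (simp add: D_def algebra_simps)
      finally show ?thesis by simp
    qed
    then have "p * ((2 * l - 1) * (2 * l + real j)) / D \<le> p * ((2 * l + real j) * (2 * l + real j + 1) - D) / D"
      using p D by (intro divide_right_mono mult_left_mono) auto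
    also have "\<dots> = p * ((2 * l + real j) * (2 * l + real j + 1)) / D - p"
      using D by (simp add: right_diff_distrib diff_divide_distrib)
    finally have "pochhammer (2 * l - 1) k / fact k \<le> pochhammer (2 * l) k / fact k - p"
      using 1 2 by (simp only:)
    moreover have "zon l k 1 1 = pochhammer (2 * l) k / fact k - p"
      using zon_Suc_Suc[of l j 1 1] unfolding 3 d p_def by simp
    ultimately show ?thesis by simp
  qed simp_all
qed

lemma diag_terms_lower:
  assumes l: "l \<ge> 1"
  obtains c0 where "c0 > 0" "\<And>k r. 0 \<le> r \<Longrightarrow> c0 * real (k + 1) powr (2 * l + c - 1) * r ^ k \<le> gam l c k * zon l k r (r\<^sup>2)"
proof -
  obtain c1 C1 where c1: "c1 > 0" "\<And>k. c1 * real (k + 1) powr (c + 1) \<le> gam l c k"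
    "\<And>k. gam l c k \<le> C1 * real (k + 1) powr (c + 1)"
    by (rule gam_bounds[OF less_le_trans[OF zero_less_one l], of c]) blast
  have l1: "2 * l - 1 > 0" using l by simp
  obtain c2 C2 where c2: "c2 > 0" "\<And>k. c2 * real (k + 1) powr (2 * l - 1 - 1) \<le> pochhammer (2 * l - 1) k / pochhammer 1 k"
    "\<And>k. pochhammer (2 * l - 1) k / pochhammer 1 k \<le> C2 * real (k + 1) powr (2 * l - 1 - 1)"
    by (rule pochhammer_ratio_bounds[OF l1 zero_less_one]) blast
  show thesis
  proof (rule that[of "c1 * c2"])
    show "c1 * c2 > 0" using c1 c2 by simp
    fix k and r :: real assume r: "0 \<le> r"
    have "zon l k r (r\<^sup>2) = r ^ k * zon l k 1 1"
      using homog_family_scale[OF homog_family_zon[OF l], of k r 1 1] by simp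
    moreover have "c2 * real (k + 1) powr (2 * l - 1 - 1) \<le> zon l k 1 1"
      using c2(2)[of k] zon_diag_lower[OF l, of k] by (simp add: pochhammer_fact)
    moreover have "c1 * real (k + 1) powr (c + 1) * (c2 * real (k + 1) powr (2 * l - 1 - 1)) \<le> gam l c k * zon l k 1 1"
      using c1(1) c2(1) calculation(2) gam_pos[of l c k] l by (intro mult_mono c1(2)) auto
    moreover have "real (k + 1) powr (c + 1) * real (k + 1) powr (2 * l - 1 - 1) = real (k + 1) powr (2 * l + c - 1)"
      by (simp add: powr_add[symmetric] add.commute del: of_nat_add)
    ultimately have "c1 * c2 * real (k + 1) powr (2 * l + c - 1) \<le> gam l c k * zon l k 1 1"
      by (simp add: mult_ac)
    then have "c1 * c2 * real (k + 1) powr (2 * l + c - 1) * r ^ k \<le> gam l c k * zon l k 1 1 * r ^ k"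
      using r by (intro mult_right_mono) auto
    then show "c1 * c2 * real (k + 1) powr (2 * l + c - 1) * r ^ k \<le> gam l c k * zon l k r (r\<^sup>2)"
      using \<open>zon l k r (r\<^sup>2) = r ^ k * zon l k 1 1\<close> by (simp add: mult_ac)
  qed
qed

text \<open>For \<open>s > 0\<close> the last term dominates, and for \<open>s = 0\<close> the sum
  is \<open>j + 1\<close>; one expression thus preserves the logarithm of the borderline
  case.\<close>

definition geom_sum :: "real \<Rightarrow> nat \<Rightarrow> real" where
  "geom_sum s j = (\<Sum>i\<le>j. 2 powr (real i * s))"

text \<open>The 12 is twice the bound 6 for \<open>k * (1 - r)\<close>. The condition on
  \<open>j\<close> makes \<open>1 - r\<close> at most 3/8, inside the range where
  \<open>exp (- 2 * x) \<le> 1 - x\<close>.\<close>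

lemma power_lower:
  fixes r :: real
  assumes "3 \<le> j" "1 - r \<le> 3 / 2 ^ j" "r < 1" "k \<le> 2 ^ Suc j"
  shows "exp (- 12) \<le> r ^ k"
proof -
  define x where "x = 1 - r"
  have "(2::real) ^ 3 \<le> 2 ^ j" using assms(1) by (intro power_increasing) auto
  then have "3 / 2 ^ j \<le> (3 / 2 ^ 3 :: real)" by (intro divide_left_mono) auto
  then have x: "0 \<le> x" "x \<le> 1/2" using assms by (simp_all add: x_def)
  have "- 2 * x \<le> - x - 2 * x\<^sup>2"
    using mult_left_mono[OF x(2), of x] x by (simp add: power2_eq_square)
  also have "\<dots> \<le> ln (1 - x)" by (rule ln_one_minus_pos_lower_bound[OF x])
  finally have "exp (- 2 * x) \<le> exp (ln (1 - x))" by (simp only: exp_le_cancel_iff)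
  also have "\<dots> = 1 - x" using x by simp
  finally have "exp (- 2 * x) \<le> 1 - x" .
  then have "exp (- 2 * x) ^ k \<le> r ^ k" by (intro power_mono) (auto simp: x_def)
  moreover have "exp (- 12) \<le> exp (- 2 * x) ^ k"
  proof -
    have "real k * x \<le> 2 ^ Suc j * (3 / 2 ^ j)"
    proof (rule mult_mono)
      have "real k \<le> real (2 ^ Suc j)" using assms(4) by (simp only: of_nat_le_iff)
      then show "real k \<le> 2 ^ Suc j" by simp
    qed (use assms x in \<open>auto simp: x_def\<close>)
    then have "x * real k \<le> 6" by (simp add: mult.commute)
    then show ?thesis by (simp add: exp_of_nat_mult[symmetric] mult.commute)
  qed
  ultimately show ?thesis by linarith
qed

text \<open>All terms are nonnegative on the diagonal, so the dyadic blocks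
  \<open>2 ^ i \<le> k < 2 ^ Suc i\<close> with \<open>i \<le> j\<close> bound the sum from below:
  there \<open>r ^ k\<close> stays above a constant, and \<open>2 ^ i\<close> terms of size about
  \<open>2 powr (i * (s - 1))\<close> give \<open>2 powr (i * s)\<close>.\<close>

lemma diag_lower:
  assumes l: "l \<ge> 1" and s: "s = 2 * l + c" "s \<ge> 0"
  obtains c0 where "c0 > 0" "\<And>j r. 3 \<le> j \<Longrightarrow> 0 \<le> r \<Longrightarrow> r < 1 \<Longrightarrow> 1 - r \<le> 3 / 2 ^ j \<Longrightarrow>
     c0 * geom_sum s j \<le> (\<Sum>k. gam l c k * zon l k r (r\<^sup>2))"
proof -
  obtain c1 where c1: "c1 > 0" "\<And>k r. 0 \<le> r \<Longrightarrow> c1 * real (k + 1) powr (s - 1) * r ^ k \<le> gam l c k * zon l k r (r\<^sup>2)"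
    using diag_terms_lower[OF l] s by metis
  \<comment> \<open>The 2 comes from estimating \<open>1 / (k + 1)\<close> by
    \<open>1 / 2 ^ Suc i\<close> on a block of \<open>2 ^ i\<close> terms.\<close>
  define c0 where "c0 = c1 * exp (- 12) / 2"
  have c0: "c0 > 0" using c1 by (simp add: c0_def)
  have "c0 * geom_sum s j \<le> (\<Sum>k. gam l c k * zon l k r (r\<^sup>2))"
    if j: "3 \<le> j" and r: "0 \<le> r" "r < 1" "1 - r \<le> 3 / 2 ^ j" for j r
  proof -
    let ?t = "\<lambda>k. gam l c k * zon l k r (r\<^sup>2)"
    have t0: "0 \<le> ?t k" for k
      using c1(2)[OF r(1), of k] c1(1) r by (smt (verit) mult_nonneg_nonneg powr_ge_zero zero_le_power)
    have block: "c0 * 2 powr (real i * s) \<le> (\<Sum>k\<in>{2^i..<2^Suc i}. ?t k)" if i: "i \<le> j" for i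
    proof -
      have "c1 * (2 powr (real i * s) / 2 ^ Suc i) * exp (- 12) \<le> ?t k" if k: "k \<in> {2^i..<2^Suc i}" for k
      proof -
        have "k + 1 \<le> 2 ^ Suc i" "2 ^ i \<le> k + 1" using k by auto
        then have k1: "real (k + 1) \<le> 2 ^ Suc i" "2 ^ i \<le> real (k + 1)"
          by (metis of_nat_le_iff of_nat_numeral of_nat_power)+
        have "2 powr (real i * s) = (2 ^ i) powr s" by (simp add: powr_powr powr_realpow[symmetric])
        also have "\<dots> \<le> real (k + 1) powr s" using k1 s by (intro powr_mono2) auto
        finally have "2 powr (real i * s) / 2 ^ Suc i \<le> real (k + 1) powr s / real (k + 1)"
          using k1 by (intro frac_le) auto
        also have "\<dots> = real (k + 1) powr (s - 1)" by (simp add: powr_diff)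
        finally have a: "2 powr (real i * s) / 2 ^ Suc i \<le> real (k + 1) powr (s - 1)" .
        have "(2::nat) ^ Suc i \<le> 2 ^ Suc j" using i by (intro power_increasing) auto
        moreover have "k \<le> 2 ^ Suc i" using k by simp
        ultimately have "k \<le> 2 ^ Suc j" by (rule order_trans[rotated])
        then have "exp (- 12) \<le> r ^ k" using j r by (intro power_lower) auto
        with a have "c1 * (2 powr (real i * s) / 2 ^ Suc i) * exp (- 12) \<le> c1 * real (k + 1) powr (s - 1) * r ^ k"
          using c1(1) by (intro mult_mono) auto
        then show ?thesis using c1(2)[OF r(1), of k] by linarith
      qed
      then have le: "(\<Sum>k\<in>{2^i..<2^Suc i::nat}. c1 * (2 powr (real i * s) / 2 ^ Suc i) * exp (- 12)) \<le> (\<Sum>k\<in>{2^i..<2^Suc i}. ?t k)"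
        by (rule sum_mono)
      have eq: "(\<Sum>k\<in>{2^i..<2^Suc i::nat}. c1 * (2 powr (real i * s) / 2 ^ Suc i) * exp (- 12)) = c0 * 2 powr (real i * s)"
        by (simp add: c0_def)
      show ?thesis using le unfolding eq .
    qed
    have "c0 * geom_sum s j \<le> (\<Sum>i\<le>j. \<Sum>k\<in>{2^i..<2^Suc i}. ?t k)"
      unfolding geom_sum_def sum_distrib_left by (intro sum_mono block) auto
    also have "\<dots> = (\<Sum>k\<in>{1..<2^Suc j}. ?t k)"
    proof -
      have "(\<Sum>i\<le>m. \<Sum>k\<in>{2^i..<2^Suc i}. ?t k) = (\<Sum>k\<in>{1..<2^Suc m}. ?t k)" for m
      proof (induction m)
        case (Suc m)
        have "1 \<le> (2::nat) ^ Suc m" "(2::nat) ^ Suc m \<le> 2 ^ Suc (Suc m)" by auto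
        then show ?case using Suc by (simp only: sum.atMost_Suc sum.atLeastLessThan_concat)
      qed simp
      then show ?thesis .
    qed
    also have "\<dots> \<le> (\<Sum>k. ?t k)"
    proof (rule sum_le_suminf)
      have "r\<^sup>2 < 1" using r by (simp add: power_less_one_iff abs_square_less_1)
      then show "summable ?t" using l by (intro homog_family_summable1(2)[OF homog_family_zon[OF l] polyb_gam]) auto
    qed (use t0 in auto)
    finally show ?thesis .
  qed
  then show thesis using c0 that by blast
qed

lemma zon_has_derivative_u:
  "((\<lambda>u. zon l (Suc k) u v) has_field_derivative 2 * (real k + l) * geg l k u v) (at u within S)"
proof (cases k)
  case 0
  have "((\<lambda>u. l * (2 * u)) has_field_derivative 2 * l) (at u within S)"
    by (auto intro!: derivative_eq_intros)
  then show ?thesis using 0 by simp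
next
  case (Suc m)
  have "((\<lambda>u. gbpoly (\<lambda>i. pochhammer l (i - 1)) (m + 2) u v) has_derivative
     (\<lambda>h. 2 * gbpoly (\<lambda>i. pochhammer l (Suc i - 1)) (m + 1) u v * h
           - gbpoly (\<lambda>i. pochhammer l (Suc i - 1)) m u v * 0)) (at u within S)"
    by (rule has_derivative_gbpoly) (auto intro!: derivative_eq_intros)
  then have "((\<lambda>u. gbpoly (\<lambda>i. pochhammer l (i - 1)) (m + 2) u v) has_field_derivative 2 * geg l k u v) (at u within S)"
    by (simp add: has_field_derivative_def Suc)
  from DERIV_cmult[OF this, of "real k + l"]
  have "((\<lambda>u. (real k + l) * gbpoly (\<lambda>i. pochhammer l (i - 1)) (m + 2) u v) has_field_derivative 2 * (real k + l) * geg l k u v) (at u within S)"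
    by (simp only: mult_ac)
  moreover have "zon l (Suc k) u v = (real k + l) * gbpoly (\<lambda>i. pochhammer l (i - 1)) (m + 2) u v" for u
    by (simp add: zon_def Suc algebra_simps)
  ultimately show ?thesis by simp
qed

text \<open>The mean value theorem in \<open>u\<close> at fixed \<open>v = r^2\<close>. The
  derivative has order \<open>s + 2\<close> by \<open>kernel_bound_dzon\<close>, and on the whole
  interval from \<open>- r\<close> to \<open>r\<close> the bracket is at least
  \<open>(1 - r)^2\<close>.\<close>

lemma kernel_perturb:
  assumes l: "l \<ge> 1" and s: "s = 2 * l + c" "s \<ge> 0"
  obtains C where "C \<ge> 0" "\<And>u r. \<bar>u\<bar> \<le> r \<Longrightarrow> r < 1 \<Longrightarrow>
     (\<Sum>k. gam l c k * zon l k r (r\<^sup>2)) - C * (r - u) * (1 - r) powr (- (s + 2)) \<le> (\<Sum>k. gam l c k * zon l k u (r\<^sup>2))"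
proof -
  let ?Y = "\<lambda>k u v. 2 * (real k + l) * geg l k u v"
  have l0: "l > 0" using l by simp
  have G: "homog_family (geg l)" using l by (intro homog_family_geg) simp
  have Y: "homog_family ?Y" by (intro homog_family_geg_weighted G polyb_mult) auto
  have "kernel_bound ?Y (\<lambda>k. gam l c (Suc k)) (s + 2)" using kernel_bound_dzon[OF l, of c] s by simp
  then obtain C where C: "C \<ge> 0" "\<And>u v. u\<^sup>2 \<le> v \<Longrightarrow> v < 1 \<Longrightarrow>
      \<bar>\<Sum>k. gam l c (Suc k) * ?Y k u v\<bar> \<le> C * (1 - 2 * u + v) powr (- (s + 2) / 2)"
    unfolding kernel_bound_def by blast
  have "(\<Sum>k. gam l c k * zon l k r (r\<^sup>2)) - C * (r - u) * (1 - r) powr (- (s + 2)) \<le> (\<Sum>k. gam l c k * zon l k u (r\<^sup>2))"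
    if u: "\<bar>u\<bar> \<le> r" and r: "r < 1" for u r
  proof -
    define S where "S = {- r..r}"
    have r0: "0 \<le> r" using u by simp
    have r2: "r\<^sup>2 < 1" using r r0 by (simp add: power_less_one_iff abs_square_less_1)
    have Sv: "t\<^sup>2 \<le> r\<^sup>2" if "t \<in> S" for t using that by (intro power2_le_iff_abs_le[THEN iffD2]) (auto simp: S_def r0)
    obtain p where p: "polyb p" "\<And>k u v. u\<^sup>2 \<le> v \<Longrightarrow> v < 1 \<Longrightarrow> \<bar>?Y k u v\<bar> \<le> p k * sqrt v ^ k"
      using Y unfolding homog_family_def by blast
    have sm: "summable (\<lambda>k. \<bar>gam l c (Suc k) * p k\<bar> * r ^ k)"
      using r0 r by (intro polyb_summable polyb_mult p polyb_Suc polyb_gam l0)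
    have ul: "uniform_limit S (\<lambda>n t. \<Sum>i<n. gam l c (Suc i) * ?Y i t (r\<^sup>2)) (\<lambda>t. \<Sum>i. gam l c (Suc i) * ?Y i t (r\<^sup>2)) sequentially"
    proof (rule Weierstrass_m_test[OF _ sm])
      fix k t assume "t \<in> S"
      from p(2)[OF Sv[OF this] r2, of k] have "\<bar>?Y k t (r\<^sup>2)\<bar> \<le> \<bar>p k\<bar> * r ^ k"
        using r0 by (simp add: order_trans[OF _ mult_right_mono[of "p k" "\<bar>p k\<bar>"]])
      then have "\<bar>gam l c (Suc k)\<bar> * \<bar>?Y k t (r\<^sup>2)\<bar> \<le> \<bar>gam l c (Suc k)\<bar> * (\<bar>p k\<bar> * r ^ k)"
        by (rule mult_left_mono) simp
      then show "norm (gam l c (Suc k) * ?Y k t (r\<^sup>2)) \<le> \<bar>gam l c (Suc k) * p k\<bar> * r ^ k"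
        by (simp only: real_norm_def abs_mult mult.assoc)
    qed
    have sz: "summable (\<lambda>k. gam l c k * zon l k t (r\<^sup>2))" if "t \<in> S" for t
      using Sv[OF that] r2 by (intro homog_family_summable1(2)[OF homog_family_zon[OF l] polyb_gam[OF l0]])
    have "\<exists>g. \<forall>t\<in>S. (\<lambda>k. gam l c (Suc k) * zon l (Suc k) t (r\<^sup>2)) sums g t \<and>
        (g has_field_derivative (\<Sum>i. gam l c (Suc i) * ?Y i t (r\<^sup>2))) (at t within S)"
    proof (rule has_field_derivative_series[OF _ _ ul])
      show "convex S" by (simp add: S_def)
      show "((\<lambda>t. gam l c (Suc n) * zon l (Suc n) t (r\<^sup>2)) has_field_derivative gam l c (Suc n) * ?Y n t (r\<^sup>2)) (at t within S)" for n t
        by (intro DERIV_cmult zon_has_derivative_u)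
      show "r \<in> S" using r0 by (simp add: S_def)
      show "summable (\<lambda>k. gam l c (Suc k) * zon l (Suc k) r (r\<^sup>2))"
        using sz[OF \<open>r \<in> S\<close>] by (subst summable_Suc_iff)
    qed
    then obtain g where g: "\<And>t. t \<in> S \<Longrightarrow> (\<lambda>k. gam l c (Suc k) * zon l (Suc k) t (r\<^sup>2)) sums g t"
      "\<And>t. t \<in> S \<Longrightarrow> (g has_field_derivative (\<Sum>i. gam l c (Suc i) * ?Y i t (r\<^sup>2))) (at t within S)" by blast
    have K: "(\<Sum>k. gam l c k * zon l k t (r\<^sup>2)) = gam l c 0 + g t" if "t \<in> S" for t
      using suminf_split_head[OF sz[OF that]] sums_unique[OF g(1)[OF that]] by simp
    have "norm (g u - g r) \<le> C * (1 - r) powr (- (s + 2)) * norm (u - r)"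
    proof (rule field_differentiable_bound[OF _ g(2)])
      show "convex S" "u \<in> S" "r \<in> S" using u by (auto simp: S_def)
      fix t assume t: "t \<in> S"
      note E = bracket_bounds[OF Sv[OF t] r2]
      have "norm (\<Sum>i. gam l c (Suc i) * ?Y i t (r\<^sup>2)) \<le> C * (1 - 2 * t + r\<^sup>2) powr (- (s + 2) / 2)"
        using C(2)[OF Sv[OF t] r2] by simp
      also have "\<dots> \<le> C * ((1 - r)\<^sup>2) powr (- (s + 2) / 2)"
        using E r r0 s C by (intro mult_left_mono powr_mono2') auto
      also have "((1 - r)\<^sup>2) powr (- (s + 2) / 2) = (1 - r) powr (- (s + 2))"
      proof -
        have "((1 - r)\<^sup>2) powr (- (s + 2) / 2) = ((1 - r) powr 2) powr (- (s + 2) / 2)" using r by simp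
        moreover have "2 * (- (s + 2) / 2) = - (s + 2)" by simp
        ultimately show ?thesis by (simp only: powr_powr)
      qed
      finally show "norm (\<Sum>i. gam l c (Suc i) * ?Y i t (r\<^sup>2)) \<le> C * (1 - r) powr (- (s + 2))" .
    qed
    then have "g r - g u \<le> C * (1 - r) powr (- (s + 2)) * (r - u)" using u by simp
    moreover have "u \<in> S" "r \<in> S" using u by (auto simp: S_def)
    ultimately show ?thesis by (simp add: K mult_ac)
  qed
  then show thesis using C(1) that by blast
qed

section \<open>Differentiation under the integral and harmonicity\<close>

text \<open>Differentiation in \<open>x\<close> turns such a series of index \<open>m\<close> into
  series of index \<open>m + 1\<close> with shifted coefficients, so this form reproduces
  itself.\<close>

definition geg_series :: "(nat \<Rightarrow> real) \<Rightarrow> real \<Rightarrow> real^'n::finite \<Rightarrow> real^'n \<Rightarrow> real" where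
  "geg_series b m x y = (\<Sum>k. b k * geg m k (x \<bullet> y) ((norm x * norm y)\<^sup>2))"

lemma inner_sq_le: "(x \<bullet> y)\<^sup>2 \<le> (norm x * norm (y :: 'a::real_inner))\<^sup>2"
  using Cauchy_Schwarz_ineq2[of x y] by (metis abs_ge_zero power2_abs power_mono)

lemma gbpoly_cmult: "gbpoly (\<lambda>i. a * c i) k u v = a * gbpoly c k u v"
  by (simp add: gbpoly_def sum_distrib_left mult_ac)

lemma gbpoly_zero: "gbpoly c (Suc k) 0 0 = 0"
proof -
  have "gterm (Suc k) j 0 0 = 0" for j
    by (cases j) (auto simp: gterm_def power_0_left)
  then show ?thesis by (simp add: gbpoly_def)
qed

lemma norm_prod_less:
  assumes "norm x \<le> r" "norm (y :: 'a::real_normed_vector) \<le> 1" "r < 1"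
  shows "(norm x * norm y)\<^sup>2 < 1" "norm x * norm y \<le> r"
proof -
  have "norm x * norm y \<le> norm x * 1" using assms by (intro mult_left_mono) auto
  then show r: "norm x * norm y \<le> r" using assms by simp
  show "(norm x * norm y)\<^sup>2 < 1" using r assms by (simp add: power_less_one_iff abs_square_less_1)
qed

lemma geg_ball_bound:
  assumes "m \<ge> 0" "norm x \<le> r" "norm y \<le> 1"
  shows "\<bar>geg m k (x \<bullet> y) ((norm x * norm y)\<^sup>2)\<bar> \<le> pochhammer (2 * m) k / fact k * r ^ k"
proof -
  have "norm x * norm y \<le> norm x * 1" using assms by (intro mult_left_mono) auto
  then have r: "norm x * norm y \<le> r" using assms by simp
  have P: "0 \<le> pochhammer (2 * m) k"
    by (cases "m = 0") (use assms in \<open>auto simp: pochhammer_0_left intro!: less_imp_le[OF pochhammer_pos]\<close>)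
  have "\<bar>geg m k (x \<bullet> y) ((norm x * norm y)\<^sup>2)\<bar> \<le> pochhammer (2 * m) k / fact k * sqrt ((norm x * norm y)\<^sup>2) ^ k"
    by (rule geg_abs_le[OF inner_sq_le assms(1)])
  also have "\<dots> \<le> pochhammer (2 * m) k / fact k * r ^ k"
    using r P by (intro mult_left_mono power_mono) auto
  finally show ?thesis .
qed

lemma geg_series_summable_bound:
  assumes "m > 0" "polyb b" "0 \<le> r" "r < 1"
  shows "summable (\<lambda>k. \<bar>b k\<bar> * (pochhammer (2 * m) k / fact k * r ^ k))"
proof -
  have "summable (\<lambda>k. \<bar>b k * (pochhammer (2 * m) k / fact k)\<bar> * r ^ k)"
    using assms by (intro polyb_summable polyb_mult polyb_pochhammer_fact) auto
  moreover have "0 \<le> pochhammer (2 * m) k" for k using assms by (intro less_imp_le[OF pochhammer_pos]) auto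
  ultimately show ?thesis by (simp add: abs_mult mult_ac)
qed

lemma geg_series_term_bound:
  assumes "m > 0" "norm x \<le> r" "norm y \<le> 1"
  shows "norm (b k * geg m k (x \<bullet> y) ((norm x * norm y)\<^sup>2)) \<le> \<bar>b k\<bar> * (pochhammer (2 * m) k / fact k * r ^ k)"
  unfolding real_norm_def abs_mult[of "b k"] by (rule mult_left_mono[OF geg_ball_bound]) (use assms in auto)

lemma geg_series_summable:
  assumes "m > 0" "polyb b" "norm x < 1" "norm y \<le> 1"
  shows "summable (\<lambda>k. b k * geg m k (x \<bullet> y) ((norm x * norm y)\<^sup>2))"
proof (rule summable_comparison_test'[where N = 0])
  show "summable (\<lambda>k. \<bar>b k\<bar> * (pochhammer (2 * m) k / fact k * norm x ^ k))"
    using assms by (intro geg_series_summable_bound) auto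
qed (use assms in \<open>intro geg_series_term_bound, auto\<close>)

lemma geg_series_bounded:
  assumes "m > 0" "polyb b" "0 \<le> r" "r < 1"
  shows "\<exists>C. \<forall>x y :: real^'n::finite. norm x \<le> r \<longrightarrow> norm y \<le> 1 \<longrightarrow> \<bar>geg_series b m x y\<bar> \<le> C"
proof (intro exI allI impI)
  fix x y :: "real^'n" assume xy: "norm x \<le> r" "norm y \<le> 1"
  have "norm (geg_series b m x y) \<le> (\<Sum>k. \<bar>b k\<bar> * (pochhammer (2 * m) k / fact k * r ^ k))"
    unfolding geg_series_def
  proof (rule norm_suminf_le)
    show "summable (\<lambda>k. \<bar>b k\<bar> * (pochhammer (2 * m) k / fact k * r ^ k))" by (rule geg_series_summable_bound[OF assms])
  qed (use assms xy in \<open>intro geg_series_term_bound, auto\<close>)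
  then show "\<bar>geg_series b m x y\<bar> \<le> (\<Sum>k. \<bar>b k\<bar> * (pochhammer (2 * m) k / fact k * r ^ k))" by simp
qed

lemma series_has_derivative:
  fixes x y :: "real^'n::finite"
  assumes m: "m > 0" and b: "polyb b" and c: "\<And>i. c (Suc i) = \<kappa> * pochhammer m i" and x: "norm x < 1" and y: "norm y \<le> 1"
  shows "summable (\<lambda>k. b k * gbpoly c k (x \<bullet> y) ((norm x * norm y)\<^sup>2))" (is ?S)
    and "((\<lambda>x. \<Sum>k. b k * gbpoly c k (x \<bullet> y) ((norm x * norm y)\<^sup>2)) has_derivative
      (\<lambda>h. 2 * \<kappa> * geg_series (\<lambda>k. b (Suc k)) m x y * (h \<bullet> y) - \<kappa> * geg_series (\<lambda>k. b (Suc (Suc k))) m x y * (2 * (norm y)\<^sup>2 * (x \<bullet> h)))) (at x)" (is ?D)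
proof -
  obtain r where r: "norm x < r" "r < 1" using dense[OF x] by auto
  have r0: "0 \<le> r" using r norm_ge_zero[of x] by linarith
  define S where "S = ball (0::real^'n) r"
  have S: "norm z \<le> r" if "z \<in> S" for z using that by (simp add: S_def)
  define G where "G k z = geg m k (z \<bullet> y) ((norm z * norm y)\<^sup>2)" for k z
  \<comment> \<open>\<open>D1\<close> and \<open>D2\<close> are indexed by the term they are derived
    from, with zeros in the lowest degrees, so that the series of derivatives can be formed
    termwise.\<close>
  define D1 where "D1 k z = (if k = 0 then 0 else 2 * \<kappa> * b k * G (k - 1) z)" for k z
  define D2 where "D2 k z = (if k < 2 then 0 else \<kappa> * b k * G (k - 2) z)" for k z
  define M where "M b k = \<bar>b k\<bar> * (pochhammer (2 * m) k / fact k * r ^ k)" for b :: "nat \<Rightarrow> real" and k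
  have M: "summable (M b)" if "polyb b" for b unfolding M_def[abs_def] by (rule geg_series_summable_bound[OF m that r0 r(2)])
  have bG: "\<bar>a k * G k z\<bar> \<le> M a k" if "z \<in> S" for a k z
    using geg_series_term_bound[OF m S[OF that] y, of a k] by (simp add: M_def G_def)
  have c': "(\<lambda>i. c (Suc i)) = (\<lambda>i. \<kappa> * pochhammer m i)" using c by simp
  have V: "((\<lambda>z. (norm z * norm y)\<^sup>2) has_derivative (\<lambda>h. 2 * (norm y)\<^sup>2 * (z \<bullet> h))) (at z within S)" for z
    unfolding power_mult_distrib power2_norm_eq_inner[of "_::real^'n"]
    by (auto intro!: derivative_eq_intros simp: inner_commute power2_norm_eq_inner)
  have U: "((\<lambda>z. z \<bullet> y) has_derivative (\<lambda>h. h \<bullet> y)) (at z within S)" for z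
    by (auto intro!: derivative_eq_intros)
  have fd: "((\<lambda>z. b k * gbpoly c k (z \<bullet> y) ((norm z * norm y)\<^sup>2)) has_derivative
     (\<lambda>h. D1 k z * (h \<bullet> y) - D2 k z * (2 * (norm y)\<^sup>2 * (z \<bullet> h)))) (at z within S)" for k z
  proof -
    consider "k = 0" | "k = Suc 0" | j where "k = j + 2"
      by (metis One_nat_def add_2_eq_Suc' not0_implies_Suc)
    then show ?thesis
    proof cases
      case 1
      then show ?thesis by (simp add: D1_def D2_def)
    next
      case 2
      have "((\<lambda>z. b 1 * (c 1 * (2 * (z \<bullet> y)))) has_derivative (\<lambda>h. b 1 * (c 1 * (2 * (h \<bullet> y))))) (at z within S)"
        by (intro has_derivative_mult_right U)
      then show ?thesis using 2 c[of 0] by (simp add: D1_def D2_def G_def mult_ac)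
    next
      case 3
      have "((\<lambda>z. b k * gbpoly c (j + 2) (z \<bullet> y) ((norm z * norm y)\<^sup>2)) has_derivative
        (\<lambda>h. b k * (2 * (\<kappa> * G (j + 1) z) * (h \<bullet> y) - \<kappa> * G j z * (2 * (norm y)\<^sup>2 * (z \<bullet> h))))) (at z within S)"
        using has_derivative_mult_right[OF has_derivative_gbpoly[OF U V, of c j z], of "b k"]
        unfolding c' gbpoly_cmult G_def .
      then show ?thesis using 3 by (simp add: D1_def D2_def algebra_simps)
    qed
  qed
  have M1: "summable (\<lambda>k. if k = 0 then 0 else \<bar>2 * \<kappa>\<bar> * M (\<lambda>k. b (Suc k)) (k - 1))"
  proof (rule iffD1[OF summable_Suc_iff])
    show "summable (\<lambda>k. if Suc k = 0 then 0 else \<bar>2 * \<kappa>\<bar> * M (\<lambda>k. b (Suc k)) (Suc k - 1))"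
      using summable_mult[OF M[OF polyb_Suc[OF b]], of "\<bar>2 * \<kappa>\<bar>"] by (simp only: nat.distinct if_False diff_Suc_1)
  qed
  have M2: "summable (\<lambda>k. if k < 2 then 0 else \<bar>\<kappa>\<bar> * M (\<lambda>k. b (Suc (Suc k))) (k - 2))"
  proof (rule iffD1[OF summable_iff_shift[of _ 2]])
    have "(\<lambda>k. if k + 2 < 2 then 0 else \<bar>\<kappa>\<bar> * M (\<lambda>k. b (Suc (Suc k))) (k + 2 - 2)) = (\<lambda>k. \<bar>\<kappa>\<bar> * M (\<lambda>k. b (Suc (Suc k))) k)"
      by (simp add: fun_eq_iff)
    then show "summable (\<lambda>k. if k + 2 < 2 then 0 else \<bar>\<kappa>\<bar> * M (\<lambda>k. b (Suc (Suc k))) (k + 2 - 2))"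
      using summable_mult[OF M[OF polyb_Suc[OF polyb_Suc[OF b]]], of "\<bar>\<kappa>\<bar>"] by (simp only:)
  qed
  have n1: "norm (D1 k z) \<le> (if k = 0 then 0 else \<bar>2 * \<kappa>\<bar> * M (\<lambda>k. b (Suc k)) (k - 1))" if "z \<in> S" for k z
  proof (cases k)
    case (Suc j)
    have "\<bar>2 * \<kappa>\<bar> * \<bar>b (Suc j) * G j z\<bar> \<le> \<bar>2 * \<kappa>\<bar> * M (\<lambda>k. b (Suc k)) j"
      using bG[OF that, of "\<lambda>k. b (Suc k)" j] by (rule mult_left_mono) simp
    then show ?thesis using Suc by (simp add: D1_def abs_mult mult.assoc)
  qed (simp add: D1_def)
  have n2: "norm (D2 k z) \<le> (if k < 2 then 0 else \<bar>\<kappa>\<bar> * M (\<lambda>k. b (Suc (Suc k))) (k - 2))" if "z \<in> S" for k z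
  proof (cases "k < 2")
    case False
    then obtain j where j: "k = Suc (Suc j)" by (metis Suc_1 less_2_cases_iff not0_implies_Suc)
    have "\<bar>\<kappa>\<bar> * \<bar>b (Suc (Suc j)) * G j z\<bar> \<le> \<bar>\<kappa>\<bar> * M (\<lambda>k. b (Suc (Suc k))) j"
      using bG[OF that, of "\<lambda>k. b (Suc (Suc k))" j] by (rule mult_left_mono) simp
    then show ?thesis using j by (simp add: D2_def abs_mult mult.assoc)
  qed (simp add: D2_def)
  have u1: "uniform_limit S (\<lambda>n z. \<Sum>i<n. D1 i z) (\<lambda>z. \<Sum>i. D1 i z) sequentially"
    by (rule Weierstrass_m_test[OF n1 M1])
  have u2: "uniform_limit S (\<lambda>n z. \<Sum>i<n. D2 i z) (\<lambda>z. \<Sum>i. D2 i z) sequentially"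
    by (rule Weierstrass_m_test[OF n2 M2])
  have s1: "summable (\<lambda>k. D1 k x)"
  proof (rule summable_comparison_test'[OF M1])
    fix k show "norm (D1 k x) \<le> (if k = 0 then 0 else \<bar>2 * \<kappa>\<bar> * M (\<lambda>k. b (Suc k)) (k - 1))"
      by (rule n1) (use r in \<open>simp add: S_def\<close>)
  qed
  have s2: "summable (\<lambda>k. D2 k x)"
  proof (rule summable_comparison_test'[OF M2])
    fix k show "norm (D2 k x) \<le> (if k < 2 then 0 else \<bar>\<kappa>\<bar> * M (\<lambda>k. b (Suc (Suc k))) (k - 2))"
      by (rule n2) (use r in \<open>simp add: S_def\<close>)
  qed
  have "\<exists>g. \<forall>z\<in>S. (\<lambda>k. b k * gbpoly c k (z \<bullet> y) ((norm z * norm y)\<^sup>2)) sums g z \<and>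
      (g has_derivative (\<lambda>h. (\<Sum>k. D1 k z) * (h \<bullet> y) - (\<Sum>k. D2 k z) * (2 * (norm y)\<^sup>2 * (z \<bullet> h)))) (at z within S)"
  proof (rule has_derivative_series[OF _ fd])
    show "convex S" by (simp add: S_def)
    show "0 \<in> S" using r norm_ge_zero[of x] by (simp add: S_def, linarith)
    have "(\<lambda>k. b k * gbpoly c k ((0::real^'n) \<bullet> y) ((norm (0::real^'n) * norm y)\<^sup>2)) = (\<lambda>k. if k = 0 then b 0 * c 0 else 0)"
      using gbpoly_zero[of c] by (auto simp: fun_eq_iff gr0_conv_Suc)
    then show "(\<lambda>k. b k * gbpoly c k ((0::real^'n) \<bullet> y) ((norm (0::real^'n) * norm y)\<^sup>2)) sums (b 0 * c 0)"
      using sums_single[of 0 "\<lambda>_. b 0 * c 0"] by simp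
    \<comment> \<open>Thirds, because the term with \<open>D2\<close> carries a factor 2.\<close>
    fix e :: real assume e: "e > 0"
    have "\<forall>\<^sub>F n in sequentially. \<forall>z\<in>S. dist (\<Sum>i<n. D1 i z) (\<Sum>i. D1 i z) < e / 3"
      "\<forall>\<^sub>F n in sequentially. \<forall>z\<in>S. dist (\<Sum>i<n. D2 i z) (\<Sum>i. D2 i z) < e / 3"
      using e by (auto intro!: uniform_limitD[OF u1, of "e / 3"] uniform_limitD[OF u2, of "e / 3"] simp del: less_divide_eq_numeral1)
    then show "\<forall>\<^sub>F n in sequentially. \<forall>z\<in>S. \<forall>h. norm ((\<Sum>i<n. D1 i z * (h \<bullet> y) - D2 i z * (2 * (norm y)\<^sup>2 * (z \<bullet> h))) -
       ((\<Sum>k. D1 k z) * (h \<bullet> y) - (\<Sum>k. D2 k z) * (2 * (norm y)\<^sup>2 * (z \<bullet> h)))) \<le> e * norm h"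
    proof eventually_elim
      case (elim n)
      show ?case
      proof (intro ballI allI)
        fix z h assume z: "z \<in> S"
        define p where "p = (\<Sum>i<n. D1 i z) - (\<Sum>i. D1 i z)"
        define q where "q = (\<Sum>i<n. D2 i z) - (\<Sum>i. D2 i z)"
        have pq: "\<bar>p\<bar> \<le> e / 3" "\<bar>q\<bar> \<le> e / 3" using elim z by (auto simp: p_def q_def dist_real_def less_imp_le)
        have hy: "\<bar>h \<bullet> y\<bar> \<le> norm h"
          using Cauchy_Schwarz_ineq2[of h y] mult_left_mono[OF y, of "norm h"] by simp
        have zh: "\<bar>z \<bullet> h\<bar> \<le> norm h"
          using Cauchy_Schwarz_ineq2[of z h] mult_right_mono[of "norm z" 1 "norm h"] S[OF z] r by simp
        have y2: "(norm y)\<^sup>2 \<le> 1" using y by (simp add: power_le_one)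
        have "(\<Sum>i<n. D1 i z * (h \<bullet> y) - D2 i z * (2 * (norm y)\<^sup>2 * (z \<bullet> h))) -
          ((\<Sum>k. D1 k z) * (h \<bullet> y) - (\<Sum>k. D2 k z) * (2 * (norm y)\<^sup>2 * (z \<bullet> h))) =
          p * (h \<bullet> y) - q * (2 * (norm y)\<^sup>2 * (z \<bullet> h))"
          by (simp add: p_def q_def sum_subtractf sum_distrib_right[symmetric] algebra_simps)
        also have "norm \<dots> \<le> \<bar>p\<bar> * \<bar>h \<bullet> y\<bar> + \<bar>q\<bar> * (2 * (norm y)\<^sup>2 * \<bar>z \<bullet> h\<bar>)"
          using abs_triangle_ineq4[of "p * (h \<bullet> y)" "q * (2 * (norm y)\<^sup>2 * (z \<bullet> h))"] by (simp add: abs_mult)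
        also have "\<dots> \<le> e / 3 * norm h + e / 3 * (2 * 1 * norm h)"
          using pq hy zh y2 e by (intro add_mono mult_mono) auto
        finally show "norm ((\<Sum>i<n. D1 i z * (h \<bullet> y) - D2 i z * (2 * (norm y)\<^sup>2 * (z \<bullet> h))) -
          ((\<Sum>k. D1 k z) * (h \<bullet> y) - (\<Sum>k. D2 k z) * (2 * (norm y)\<^sup>2 * (z \<bullet> h)))) \<le> e * norm h" by simp
      qed
    qed
  qed
  then obtain g where g: "\<And>z. z \<in> S \<Longrightarrow> (\<lambda>k. b k * gbpoly c k (z \<bullet> y) ((norm z * norm y)\<^sup>2)) sums g z"
    "\<And>z. z \<in> S \<Longrightarrow> (g has_derivative (\<lambda>h. (\<Sum>k. D1 k z) * (h \<bullet> y) - (\<Sum>k. D2 k z) * (2 * (norm y)\<^sup>2 * (z \<bullet> h)))) (at z within S)"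
    by blast
  have xS: "x \<in> S" "open S" using r by (auto simp: S_def)
  show ?S using g(1)[OF xS(1)] by (simp add: sums_iff)
  have "(\<Sum>k. D1 k x) = 2 * \<kappa> * geg_series (\<lambda>k. b (Suc k)) m x y"
  proof -
    have "(\<Sum>k. D1 k x) = (\<Sum>k. D1 (Suc k) x)" using suminf_split_head[OF s1] by (simp add: D1_def)
    also have "\<dots> = (\<Sum>k. 2 * \<kappa> * (b (Suc k) * G k x))" by (simp add: D1_def mult.assoc)
    also have "\<dots> = 2 * \<kappa> * geg_series (\<lambda>k. b (Suc k)) m x y"
      unfolding geg_series_def G_def by (rule suminf_mult[OF geg_series_summable[OF m polyb_Suc[OF b] x y]])
    finally show ?thesis .
  qed
  moreover have "(\<Sum>k. D2 k x) = \<kappa> * geg_series (\<lambda>k. b (Suc (Suc k))) m x y"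
  proof -
    have "(\<Sum>k. D2 k x) = (\<Sum>k. D2 (k + 2) x)" using suminf_minus_initial_segment[OF s2, of 2]
      by (simp add: D2_def numeral_2_eq_2)
    also have "\<dots> = (\<Sum>k. \<kappa> * (b (Suc (Suc k)) * G k x))" by (simp add: D2_def mult.assoc)
    also have "\<dots> = \<kappa> * geg_series (\<lambda>k. b (Suc (Suc k))) m x y"
      unfolding geg_series_def G_def by (rule suminf_mult[OF geg_series_summable[OF m _ x y, of "\<lambda>k. b (Suc (Suc k))"]]) (intro polyb_Suc b)
    finally show ?thesis .
  qed
  moreover have "(g has_derivative (\<lambda>h. (\<Sum>k. D1 k x) * (h \<bullet> y) - (\<Sum>k. D2 k x) * (2 * (norm y)\<^sup>2 * (x \<bullet> h)))) (at x)"
    using g(2)[OF xS(1)] by (simp only: at_within_open[OF xS])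
  ultimately have "(g has_derivative (\<lambda>h. 2 * \<kappa> * geg_series (\<lambda>k. b (Suc k)) m x y * (h \<bullet> y) - \<kappa> * geg_series (\<lambda>k. b (Suc (Suc k))) m x y * (2 * (norm y)\<^sup>2 * (x \<bullet> h)))) (at x)"
    by (simp only: mult.assoc)
  then show ?D
    by (rule has_derivative_transform_within_open[OF _ xS(2,1)]) (use g(1) in \<open>simp add: sums_iff\<close>)
qed

section \<open>From partial derivatives to harmonicity\<close>

definition coord_blinfun :: "'n::finite \<Rightarrow> (real^'n) \<Rightarrow>\<^sub>L real" where
  "coord_blinfun i = Blinfun (\<lambda>h. h $ i)"

lemma coord_blinfun_apply [simp]: "blinfun_apply (coord_blinfun i) h = h $ i"
  by (simp add: coord_blinfun_def bounded_linear_Blinfun_apply bounded_linear_vec_nth)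

text \<open>Rank-one maps in one coordinate. Sums of them package partial derivatives as bounded
  linear maps, and linearity in \<open>z\<close> allows the packaging to be differentiated in
  turn.\<close>

definition coord_scale_blinfun :: "'n::finite \<Rightarrow> 'b::real_normed_vector \<Rightarrow> (real^'n) \<Rightarrow>\<^sub>L 'b" where
  "coord_scale_blinfun i z = blinfun_scaleR_left z o\<^sub>L coord_blinfun i"

lemma coord_scale_blinfun_apply [simp]: "blinfun_apply (coord_scale_blinfun i z) h = h $ i *\<^sub>R z"
  by (simp add: coord_scale_blinfun_def)

lemma bounded_linear_coord_scale_blinfun: "bounded_linear (coord_scale_blinfun i)"
  unfolding coord_scale_blinfun_def[abs_def]
  by (rule bounded_linear_compose[OF bounded_bilinear.bounded_linear_left[OF bounded_bilinear_blinfun_compose] bounded_linear_blinfun_scaleR_left])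

lemma harmonic_onI:
  fixes F :: "real^'n::finite \<Rightarrow> complex"
  assumes "open S"
    and F1: "\<And>x. x \<in> S \<Longrightarrow> (F has_derivative (\<lambda>h. \<Sum>i\<in>UNIV. h $ i *\<^sub>R F1 i x)) (at x)"
    and F2: "\<And>i x. x \<in> S \<Longrightarrow> (F1 i has_derivative (\<lambda>h. \<Sum>j\<in>UNIV. h $ j *\<^sub>R F2 i j x)) (at x)"
    and cont: "\<And>i j. continuous_on S (F2 i j)"
    and lap: "\<And>x. x \<in> S \<Longrightarrow> (\<Sum>i\<in>UNIV. F2 i i x) = 0"
  shows "harmonic_on S F"
proof -
  define u' where "u' x = (\<Sum>i\<in>UNIV. coord_scale_blinfun i (F1 i x))" for x
  define u'' where "u'' x = (\<Sum>i\<in>UNIV. \<Sum>j\<in>UNIV. coord_scale_blinfun j (coord_scale_blinfun i (F2 i j x)))" for x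
  have a1: "blinfun_apply (u' x) = (\<lambda>h. \<Sum>i\<in>UNIV. h $ i *\<^sub>R F1 i x)" for x
    by (simp add: u'_def fun_eq_iff blinfun.sum_left)
  have a2: "blinfun_apply (u'' x) = (\<lambda>h. \<Sum>i\<in>UNIV. coord_scale_blinfun i (\<Sum>j\<in>UNIV. h $ j *\<^sub>R F2 i j x))" for x
  proof
    fix h
    interpret E: bounded_linear "coord_scale_blinfun i :: complex \<Rightarrow> _" for i :: 'n by (rule bounded_linear_coord_scale_blinfun)
    show "blinfun_apply (u'' x) h = (\<Sum>i\<in>UNIV. coord_scale_blinfun i (\<Sum>j\<in>UNIV. h $ j *\<^sub>R F2 i j x))"
      by (simp add: u''_def blinfun.sum_left E.sum E.scaleR)
  qed
  show ?thesis unfolding harmonic_on_def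
  proof (intro conjI exI[of _ u'] exI[of _ u''] ballI)
    fix x assume x: "x \<in> S"
    show "(F has_derivative blinfun_apply (u' x)) (at x)" unfolding a1 by (rule F1[OF x])
    show "(u' has_derivative blinfun_apply (u'' x)) (at x)"
      unfolding a2 unfolding u'_def
      by (intro has_derivative_sum bounded_linear.has_derivative[OF bounded_linear_coord_scale_blinfun] F2[OF x])
    have "(\<Sum>i\<in>UNIV. blinfun_apply (blinfun_apply (u'' x) (axis i 1)) (axis i 1)) = (\<Sum>i\<in>UNIV. F2 i i x)"
      by (intro sum.cong refl) (simp add: a2 blinfun.sum_left axis_def if_distrib[of "\<lambda>t. t *\<^sub>R _"] cong: if_cong)
    then show "(\<Sum>i\<in>UNIV. blinfun_apply (blinfun_apply (u'' x) (axis i 1)) (axis i 1)) = 0" using lap[OF x] by simp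
  next
    show "continuous_on S u''"
      unfolding u''_def
      by (intro continuous_on_sum bounded_linear.continuous_on[OF bounded_linear_coord_scale_blinfun] cont)
  qed fact
qed

lemma space_nu [simp]: "space (nu :: (real^'n::finite) measure) = unit_ball"
  by (simp add: nu_def space_restrict_space)

lemma borel_measurable_nu:
  fixes f :: "real^'n::finite \<Rightarrow> 'b::topological_space"
  assumes "f \<in> borel_measurable borel"
  shows "f \<in> borel_measurable nu"
proof -
  have "sets (nu :: (real^'n) measure) = sets (lebesgue_on unit_ball)" by (simp add: nu_def)
  moreover have "f \<in> borel_measurable (lebesgue_on unit_ball)"
    using assms by (intro measurable_restrict_space1 measurable_completion) simp
  ultimately show ?thesis by (subst measurable_cong_sets[OF _ refl])
qed

lemma borel_measurable_gbpoly:
  fixes U V :: "'a \<Rightarrow> real"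
  assumes "U \<in> borel_measurable M" "V \<in> borel_measurable M"
  shows "(\<lambda>y. gbpoly c k (U y) (V y)) \<in> borel_measurable M"
  unfolding gbpoly_def gterm_def
  by (intro borel_measurable_sum borel_measurable_times borel_measurable_power borel_measurable_const assms)

lemma geg_series_measurable: "(\<lambda>y. geg_series b m x y) \<in> borel_measurable borel"
  unfolding geg_series_def
proof (intro borel_measurable_suminf borel_measurable_times borel_measurable_const borel_measurable_gbpoly)
  show "(\<lambda>y. x \<bullet> y) \<in> borel_measurable borel" by (intro borel_measurable_continuous_onI continuous_intros)
  show "(\<lambda>y. (norm x * norm y)\<^sup>2) \<in> borel_measurable borel" by (intro borel_measurable_continuous_onI continuous_intros)
qed

text \<open>The class is closed under derivatives in \<open>x\<close>, and each member is bounded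
  for \<open>norm x \<le> r < 1\<close> uniformly up to \<open>norm y = 1\<close>. Differentiation
  under the integral can therefore be repeated against any integrable \<open>g\<close>.\<close>

inductive smooth_kernel :: "(real^'n::finite \<Rightarrow> real^'n \<Rightarrow> real) \<Rightarrow> bool" where
  geg_series: "m > 0 \<Longrightarrow> polyb b \<Longrightarrow> smooth_kernel (geg_series b m)"
| const: "smooth_kernel (\<lambda>x y. c)"
| fst: "smooth_kernel (\<lambda>x y. x $ i)"
| snd: "smooth_kernel (\<lambda>x y. y $ i)"
| add: "smooth_kernel K \<Longrightarrow> smooth_kernel L \<Longrightarrow> smooth_kernel (\<lambda>x y. K x y + L x y)"
| mult: "smooth_kernel K \<Longrightarrow> smooth_kernel L \<Longrightarrow> smooth_kernel (\<lambda>x y. K x y * L x y)"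

lemma smooth_kernel_sum: "finite A \<Longrightarrow> (\<And>i. i \<in> A \<Longrightarrow> smooth_kernel (K i)) \<Longrightarrow> smooth_kernel (\<lambda>x y. \<Sum>i\<in>A. K i x y)"
  by (induction A rule: finite_induct) (simp_all add: smooth_kernel.const smooth_kernel.add)

lemma smooth_kernel_diff: "smooth_kernel K \<Longrightarrow> smooth_kernel L \<Longrightarrow> smooth_kernel (\<lambda>x y. K x y - L x y)"
  using smooth_kernel.add[OF _ smooth_kernel.mult[OF smooth_kernel.const[of "-1"]], of K L] by simp

lemma smooth_kernel_norm_snd: "smooth_kernel (\<lambda>x y. (norm y)\<^sup>2)"
  unfolding power2_norm_eq_inner inner_vec_def inner_real_def
  by (rule smooth_kernel_sum, simp, rule smooth_kernel.mult[OF smooth_kernel.snd smooth_kernel.snd])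

lemma smooth_kernel_bounded:
  fixes K :: "real^'n::finite \<Rightarrow> real^'n \<Rightarrow> real"
  assumes "smooth_kernel K" "0 \<le> r" "r < 1"
  shows "\<exists>C\<ge>0. \<forall>x y. norm x \<le> r \<longrightarrow> norm y \<le> 1 \<longrightarrow> \<bar>K x y\<bar> \<le> C"
  using assms(1)
proof (induction rule: smooth_kernel.induct)
  case (geg_series m b)
  then obtain C where C: "\<And>x y :: real^'n. norm x \<le> r \<Longrightarrow> norm y \<le> 1 \<Longrightarrow> \<bar>geg_series b m x y\<bar> \<le> C"
    using geg_series_bounded[OF _ _ assms(2,3)] by blast
  have "\<bar>geg_series b m x y\<bar> \<le> max 0 C" if "norm x \<le> r" "norm y \<le> 1" for x y :: "real^'n"
    using C[OF that] by simp
  then show ?case by (intro exI[of _ "max 0 C"]) auto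
next
  case (const c)
  then show ?case by (intro exI[of _ "\<bar>c\<bar>"]) auto
next
  case (fst i)
  then show ?case using assms by (intro exI[of _ r]) (auto intro: order_trans[OF component_le_norm_cart])
next
  case (snd i)
  then show ?case by (intro exI[of _ 1]) (auto intro: order_trans[OF component_le_norm_cart])
next
  case (add K L)
  then obtain C D where "C \<ge> 0" "\<And>x y. norm x \<le> r \<Longrightarrow> norm y \<le> 1 \<Longrightarrow> \<bar>K x y\<bar> \<le> C"
    "D \<ge> 0" "\<And>x y. norm x \<le> r \<Longrightarrow> norm y \<le> 1 \<Longrightarrow> \<bar>L x y\<bar> \<le> D" by auto
  then show ?case by (intro exI[of _ "C + D"]) (auto intro!: order_trans[OF abs_triangle_ineq] add_mono)
next
  case (mult K L)
  then obtain C D where "C \<ge> 0" "\<And>x y. norm x \<le> r \<Longrightarrow> norm y \<le> 1 \<Longrightarrow> \<bar>K x y\<bar> \<le> C"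
    "D \<ge> 0" "\<And>x y. norm x \<le> r \<Longrightarrow> norm y \<le> 1 \<Longrightarrow> \<bar>L x y\<bar> \<le> D" by auto
  then show ?case by (intro exI[of _ "C * D"]) (auto simp: abs_mult intro!: mult_mono)
qed

lemma smooth_kernel_measurable:
  assumes "smooth_kernel K"
  shows "(\<lambda>y. K x y) \<in> borel_measurable borel"
  using assms
proof (induction rule: smooth_kernel.induct)
  case (geg_series m b)
  show ?case by (rule geg_series_measurable)
next
  case (snd i)
  show ?case by (intro borel_measurable_continuous_onI continuous_intros)
qed (simp_all add: borel_measurable_add borel_measurable_times)

text \<open>The \<open>i\<close>-th partial derivative in \<open>x\<close> of the series in
  \<open>series_has_derivative\<close>; its two parts come from \<open>x \<bullet> y\<close> and
  from the squared norms.\<close>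

definition geg_series_d :: "(nat \<Rightarrow> real) \<Rightarrow> real \<Rightarrow> real \<Rightarrow> 'n::finite \<Rightarrow> real^'n \<Rightarrow> real^'n \<Rightarrow> real" where
  "geg_series_d b m \<kappa> i x y = 2 * \<kappa> * geg_series (\<lambda>k. b (Suc k)) m x y * y $ i - 2 * \<kappa> * geg_series (\<lambda>k. b (Suc (Suc k))) m x y * (norm y)\<^sup>2 * x $ i"

lemma smooth_kernel_ser_d: "m > 0 \<Longrightarrow> polyb b \<Longrightarrow> smooth_kernel (geg_series_d b m \<kappa> i)"
  unfolding geg_series_d_def[abs_def]
  by (rule smooth_kernel_diff[OF smooth_kernel.mult[OF smooth_kernel.mult[OF smooth_kernel.const smooth_kernel.geg_series[OF _ polyb_Suc]] smooth_kernel.snd]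
        smooth_kernel.mult[OF smooth_kernel.mult[OF smooth_kernel.mult[OF smooth_kernel.const smooth_kernel.geg_series[OF _ polyb_Suc[OF polyb_Suc]]] smooth_kernel_norm_snd] smooth_kernel.fst]])

lemma inner_cart_sum: "(\<Sum>i\<in>UNIV. h $ i * (a * y $ i)) = a * (h \<bullet> (y :: real^'n::finite))"
  by (simp add: inner_vec_def sum_distrib_left mult_ac)

lemma series_has_derivative_cart:
  fixes x y :: "real^'n::finite"
  assumes "m > 0" "polyb b" "\<And>i. c (Suc i) = \<kappa> * pochhammer m i" "norm x < 1" "norm y \<le> 1"
  shows "((\<lambda>x. \<Sum>k. b k * gbpoly c k (x \<bullet> y) ((norm x * norm y)\<^sup>2)) has_derivative
      (\<lambda>h. \<Sum>i\<in>UNIV. h $ i * geg_series_d b m \<kappa> i x y)) (at x)"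
proof -
  have "(\<lambda>h. \<Sum>i\<in>UNIV. h $ i * geg_series_d b m \<kappa> i x y) =
    (\<lambda>h. 2 * \<kappa> * geg_series (\<lambda>k. b (Suc k)) m x y * (h \<bullet> y) - \<kappa> * geg_series (\<lambda>k. b (Suc (Suc k))) m x y * (2 * (norm y)\<^sup>2 * (x \<bullet> h)))"
  proof
    fix h :: "real^'n"
    have "(\<Sum>i\<in>UNIV. h $ i * geg_series_d b m \<kappa> i x y) =
      (\<Sum>i\<in>UNIV. h $ i * ((2 * \<kappa> * geg_series (\<lambda>k. b (Suc k)) m x y) * y $ i)) -
      (\<Sum>i\<in>UNIV. h $ i * ((2 * \<kappa> * geg_series (\<lambda>k. b (Suc (Suc k))) m x y * (norm y)\<^sup>2) * x $ i))"
      by (simp add: geg_series_d_def right_diff_distrib sum_subtractf mult_ac)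
    then show "(\<Sum>i\<in>UNIV. h $ i * geg_series_d b m \<kappa> i x y) =
      2 * \<kappa> * geg_series (\<lambda>k. b (Suc k)) m x y * (h \<bullet> y) - \<kappa> * geg_series (\<lambda>k. b (Suc (Suc k))) m x y * (2 * (norm y)\<^sup>2 * (x \<bullet> h))"
      unfolding inner_cart_sum by (simp add: inner_commute)
  qed
  then show ?thesis using series_has_derivative(2)[OF assms] by simp
qed

lemma geg_series_has_derivative:
  fixes x y :: "real^'n::finite"
  assumes "m > 0" "polyb b" "norm x < 1" "norm y \<le> 1"
  shows "((\<lambda>x. geg_series b m x y) has_derivative (\<lambda>h. \<Sum>i\<in>UNIV. h $ i * geg_series_d b (m + 1) m i x y)) (at x)"
  using series_has_derivative_cart[OF _ assms(2) pochhammer_rec assms(3,4)] assms(1) by (simp add: geg_series_def)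

lemma smooth_kernel_deriv:
  fixes K :: "real^'n::finite \<Rightarrow> real^'n \<Rightarrow> real"
  assumes "smooth_kernel K"
  shows "\<exists>K'. (\<forall>i. smooth_kernel (K' i)) \<and> (\<forall>x y. norm x < 1 \<longrightarrow> norm y \<le> 1 \<longrightarrow>
     ((\<lambda>x. K x y) has_derivative (\<lambda>h. \<Sum>i\<in>UNIV. h $ i * K' i x y)) (at x))"
  using assms
proof (induction rule: smooth_kernel.induct)
  case (geg_series m b)
  then show ?case by (intro exI[of _ "geg_series_d b (m + 1) m"]) (auto intro: smooth_kernel_ser_d geg_series_has_derivative)
next
  case (const c)
  then show ?case by (intro exI[of _ "\<lambda>i x y. 0"]) (auto intro: smooth_kernel.const)
next
  case (fst i)
  have "(\<lambda>h :: real^'n. \<Sum>j\<in>UNIV. h $ j * (if j = i then 1 else 0)) = (\<lambda>h. h $ i)"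
    by (auto simp: fun_eq_iff if_distrib[of "(*) _"] cong: if_cong)
  then show ?case by (intro exI[of _ "\<lambda>j x y. if j = i then 1 else 0"])
    (auto intro: smooth_kernel.const bounded_linear_imp_has_derivative bounded_linear_vec_nth)
next
  case (snd i)
  then show ?case by (intro exI[of _ "\<lambda>i x y. 0"]) (auto intro: smooth_kernel.const)
next
  case (add K L)
  from add.IH(1) obtain K' where K: "\<And>i. smooth_kernel (K' i)" "\<And>x y. norm x < 1 \<Longrightarrow> norm y \<le> 1 \<Longrightarrow>
     ((\<lambda>x. K x y) has_derivative (\<lambda>h. \<Sum>i\<in>UNIV. h $ i * K' i x y)) (at x)" by blast
  from add.IH(2) obtain L' where L: "\<And>i. smooth_kernel (L' i)" "\<And>x y. norm x < 1 \<Longrightarrow> norm y \<le> 1 \<Longrightarrow>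
     ((\<lambda>x. L x y) has_derivative (\<lambda>h. \<Sum>i\<in>UNIV. h $ i * L' i x y)) (at x)" by blast
  show ?case
    by (intro exI[of _ "\<lambda>i x y. K' i x y + L' i x y"])
       (auto intro!: smooth_kernel.add K L has_derivative_add simp: distrib_left sum.distrib)
next
  case (mult K L)
  from mult.IH(1) obtain K' where K: "\<And>i. smooth_kernel (K' i)" "\<And>x y. norm x < 1 \<Longrightarrow> norm y \<le> 1 \<Longrightarrow>
     ((\<lambda>x. K x y) has_derivative (\<lambda>h. \<Sum>i\<in>UNIV. h $ i * K' i x y)) (at x)" by blast
  from mult.IH(2) obtain L' where L: "\<And>i. smooth_kernel (L' i)" "\<And>x y. norm x < 1 \<Longrightarrow> norm y \<le> 1 \<Longrightarrow>
     ((\<lambda>x. L x y) has_derivative (\<lambda>h. \<Sum>i\<in>UNIV. h $ i * L' i x y)) (at x)" by blast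
  have "((\<lambda>x. K x y * L x y) has_derivative (\<lambda>h. \<Sum>i\<in>UNIV. h $ i * (K x y * L' i x y + K' i x y * L x y))) (at x)"
    if "norm x < 1" "norm y \<le> 1" for x y
    using has_derivative_mult[OF K(2)[OF that] L(2)[OF that]]
    by (simp add: distrib_left sum.distrib sum_distrib_left sum_distrib_right mult_ac)
  then show ?case using mult K L
    by (intro exI[of _ "\<lambda>i x y. K x y * L' i x y + K' i x y * L x y"]) (auto intro!: smooth_kernel.add smooth_kernel.mult)
qed

lemma abs_sum_cart_le:
  assumes "\<And>i. \<bar>a i\<bar> \<le> C"
  shows "\<bar>\<Sum>i\<in>UNIV. h $ i * a i\<bar> \<le> norm (h :: real^'n::finite) * (real CARD('n) * C)"
proof -
  have "\<bar>\<Sum>i\<in>UNIV. h $ i * a i\<bar> \<le> (\<Sum>i\<in>(UNIV::'n set). norm h * C)"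
    by (rule order_trans[OF sum_abs], rule sum_mono)
       (auto simp: abs_mult intro!: mult_mono component_le_norm_cart assms)
  then show ?thesis by (simp add: mult_ac)
qed

text \<open>The derivative kernels lie in the same bounded class. The estimate will be applied to
  first derivatives, where it controls second-order remainders.\<close>

lemma smooth_kernel_lipschitz:
  fixes K :: "real^'n::finite \<Rightarrow> real^'n \<Rightarrow> real"
  assumes "smooth_kernel K" "0 \<le> r" "r < 1"
  shows "\<exists>L\<ge>0. \<forall>x z y. norm x \<le> r \<longrightarrow> norm z \<le> r \<longrightarrow> norm y \<le> 1 \<longrightarrow> \<bar>K x y - K z y\<bar> \<le> L * norm (x - z)"
proof -
  obtain K' where K': "\<And>i. smooth_kernel (K' i)" "\<And>x y. norm x < 1 \<Longrightarrow> norm y \<le> 1 \<Longrightarrow>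
     ((\<lambda>x. K x y) has_derivative (\<lambda>h. \<Sum>i\<in>UNIV. h $ i * K' i x y)) (at x)"
    using smooth_kernel_deriv[OF assms(1)] by blast
  have "\<forall>i. \<exists>C\<ge>0. \<forall>x y. norm x \<le> r \<longrightarrow> norm y \<le> 1 \<longrightarrow> \<bar>K' i x y\<bar> \<le> C"
    using smooth_kernel_bounded[OF K'(1) assms(2,3)] by blast
  then obtain C where C: "\<And>i. C i \<ge> 0" "\<And>i x y. norm x \<le> r \<Longrightarrow> norm y \<le> 1 \<Longrightarrow> \<bar>K' i x y\<bar> \<le> C i" by metis
  define D where "D = real CARD('n) * (\<Sum>i\<in>UNIV. C i)"
  have CD: "C i \<le> (\<Sum>i\<in>UNIV. C i)" for i by (rule member_le_sum) (auto simp: C)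
  have D: "D \<ge> 0" by (simp add: D_def sum_nonneg C)
  have "\<bar>K x y - K z y\<bar> \<le> D * norm (x - z)" if "norm x \<le> r" "norm z \<le> r" "norm y \<le> 1" for x z y
  proof -
    have "norm (K x y - K z y) \<le> D * norm (x - z)"
    proof (rule differentiable_bound)
      show "convex (cball (0::real^'n) r)" by simp
      show "x \<in> cball (0::real^'n) r" "z \<in> cball (0::real^'n) r" using that by auto
      fix w :: "real^'n" assume w: "w \<in> cball 0 r"
      show "((\<lambda>x. K x y) has_derivative (\<lambda>h. \<Sum>i\<in>UNIV. h $ i * K' i w y)) (at w within cball 0 r)"
      proof (rule has_derivative_at_withinI[OF K'(2)])
        show "norm w < 1" using w assms(3) by simp
      qed fact
      show "onorm (\<lambda>h. \<Sum>i\<in>UNIV. h $ i * K' i w y) \<le> D"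
      proof (rule onorm_bound[OF D])
        fix h :: "real^'n"
        have "\<bar>K' i w y\<bar> \<le> (\<Sum>i\<in>UNIV. C i)" for i
          using C(2)[of w y i] w that CD[of i] by auto
        from abs_sum_cart_le[OF this] show "norm (\<Sum>i\<in>UNIV. h $ i * K' i w y) \<le> D * norm h"
          by (simp add: D_def mult_ac)
      qed
    qed
    then show ?thesis by simp
  qed
  then show ?thesis using D by blast
qed

lemma nu_AE_ball: "AE y in (nu :: (real^'n::finite) measure). norm y < 1"
  by (rule AE_I2) simp

lemma integrable_kernel_mult:
  fixes g :: "real^'n::finite \<Rightarrow> complex"
  assumes g: "integrable nu g" and K: "K \<in> borel_measurable borel" "\<And>y. norm y \<le> 1 \<Longrightarrow> \<bar>K y\<bar> \<le> C"
  shows "integrable nu (\<lambda>y. complex_of_real (K y) * g y)"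
proof (rule Bochner_Integration.integrable_bound[of _ "\<lambda>y. C * norm (g y)"])
  show "integrable nu (\<lambda>y. C * norm (g y))" using g by simp
  have [measurable]: "K \<in> borel_measurable nu" "g \<in> borel_measurable nu"
    using K(1) g by (auto intro: borel_measurable_nu)
  show "(\<lambda>y. complex_of_real (K y) * g y) \<in> borel_measurable nu" by measurable
  show "AE y in nu. norm (complex_of_real (K y) * g y) \<le> norm (C * norm (g y))"
    using nu_AE_ball
  proof eventually_elim
    case (elim y)
    then have "\<bar>K y\<bar> \<le> C" by (intro K) simp
    then show ?case by (simp add: norm_mult mult_right_mono)
  qed
qed

text \<open>The linearisation error is at most a constant times the square of
  \<open>norm (z - x)\<close>, uniformly in \<open>y\<close>, so integrating it against
  \<open>g\<close> replaces a limit theorem. Class membership concerns \<open>K'\<close> rather than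
  \<open>K\<close>, because \<open>R_kernel\<close> itself would be a series of index
  \<open>l - 1\<close>, which is 0 in dimension two.\<close>

lemma deriv_under_integral:
  fixes g :: "real^'n::finite \<Rightarrow> complex" and K :: "real^'n \<Rightarrow> real^'n \<Rightarrow> real"
  assumes g: "integrable nu g"
    and K: "\<And>x. norm x < 1 \<Longrightarrow> integrable nu (\<lambda>y. complex_of_real (K x y) * g y)"
    and K': "\<And>i. smooth_kernel (K' i)" "\<And>x y. norm x < 1 \<Longrightarrow> norm y \<le> 1 \<Longrightarrow>
     ((\<lambda>x. K x y) has_derivative (\<lambda>h. \<Sum>i\<in>UNIV. h $ i * K' i x y)) (at x)"
    and x: "norm x < 1"
  shows "((\<lambda>x. \<integral>y. complex_of_real (K x y) * g y \<partial>nu) has_derivative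
     (\<lambda>h. \<Sum>i\<in>UNIV. h $ i *\<^sub>R (\<integral>y. complex_of_real (K' i x y) * g y \<partial>nu))) (at x)"
proof -
  obtain r where r: "norm x < r" "r < 1" using dense[OF x] by auto
  have r0: "0 \<le> r" using r norm_ge_zero[of x] by linarith
  have "\<forall>i. \<exists>L\<ge>0. \<forall>x z y. norm x \<le> r \<longrightarrow> norm z \<le> r \<longrightarrow> norm y \<le> 1 \<longrightarrow> \<bar>K' i x y - K' i z y\<bar> \<le> L * norm (x - z)"
    using smooth_kernel_lipschitz[OF K'(1) r0 r(2)] by blast
  then obtain L where L: "\<And>i. L i \<ge> 0" "\<And>i x z y. norm x \<le> r \<Longrightarrow> norm z \<le> r \<Longrightarrow> norm y \<le> 1 \<Longrightarrow> \<bar>K' i x y - K' i z y\<bar> \<le> L i * norm (x - z)" by metis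
  define M where "M = (\<Sum>i\<in>UNIV. L i)"
  have LM: "L i \<le> M" for i unfolding M_def by (rule member_le_sum) (auto simp: L)
  have M: "M \<ge> 0" by (simp add: M_def sum_nonneg L)
  define D where "D = real CARD('n) * M"
  have D: "D \<ge> 0" using M by (simp add: D_def)
  have K'int: "integrable nu (\<lambda>y. complex_of_real (K' i x y) * g y)" for i
  proof -
    obtain C where "\<And>z y. norm z \<le> r \<Longrightarrow> norm y \<le> 1 \<Longrightarrow> \<bar>K' i z y\<bar> \<le> C"
      using smooth_kernel_bounded[OF K'(1) r0 r(2), of i] by blast
    then show ?thesis using r by (intro integrable_kernel_mult[OF g smooth_kernel_measurable[OF K'(1)], where C = C]) auto
  qed
  define I where "I = (\<integral>y. norm (g y) \<partial>nu)"
  have point: "\<bar>K z y - K x y - (\<Sum>i\<in>UNIV. (z - x) $ i * K' i x y)\<bar> \<le> norm (z - x) * (D * norm (z - x))"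
    if z: "norm z \<le> r" and y: "norm y \<le> 1" for z y
  proof -
    \<comment> \<open>Points no farther from \<open>x\<close> than \<open>z\<close> is: the segment
      from \<open>x\<close> to \<open>z\<close> stays inside, and the Lipschitz bound makes the
      derivatives there differ by \<open>O(norm (z - x))\<close>.\<close>
    define S where "S = {w. norm w \<le> r \<and> norm (w - x) \<le> norm (z - x)}"
    have "norm (K z y - K x y - (\<lambda>h. \<Sum>i\<in>UNIV. h $ i * K' i x y) (z - x)) \<le> norm (z - x) * (D * norm (z - x))"
    proof (rule differentiable_bound_linearization[where f' = "\<lambda>w h. \<Sum>i\<in>UNIV. h $ i * K' i w y" and S = S])
      fix t :: real assume t: "t \<in> {0..1}"
      have "x + t *\<^sub>R (z - x) = (1 - t) *\<^sub>R x + t *\<^sub>R z" by (simp add: algebra_simps)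
      moreover have "norm ((1 - t) *\<^sub>R x + t *\<^sub>R z) \<le> (1 - t) * norm x + t * norm z"
        using t by (intro order_trans[OF norm_triangle_ineq]) simp
      moreover have "(1 - t) * norm x + t * norm z \<le> (1 - t) * r + t * r"
        using t r z by (intro add_mono mult_left_mono) auto
      moreover have "t * norm (z - x) \<le> norm (z - x)" using t by (simp add: mult_left_le_one_le)
      moreover have "norm (x + t *\<^sub>R (z - x) - x) = t * norm (z - x)" using t by simp
      moreover have "(1 - t) * r + t * r = r" by (simp add: algebra_simps)
      ultimately show "x + t *\<^sub>R (z - x) \<in> S" unfolding S_def by (simp only: mem_Collect_eq) (auto intro: order_trans)
    next
      fix w assume w: "w \<in> S"
      show "((\<lambda>x. K x y) has_derivative (\<lambda>h. \<Sum>i\<in>UNIV. h $ i * K' i w y)) (at w within S)"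
        using w r y by (intro has_derivative_at_withinI[OF K'(2)]) (auto simp: S_def)
      show "onorm ((\<lambda>h. \<Sum>i\<in>UNIV. h $ i * K' i w y) - (\<lambda>h. \<Sum>i\<in>UNIV. h $ i * K' i x y)) \<le> D * norm (z - x)"
      proof (rule onorm_bound)
        fix h :: "real^'n"
        have "\<bar>K' i w y - K' i x y\<bar> \<le> M * norm (z - x)" for i
        proof -
          have "\<bar>K' i w y - K' i x y\<bar> \<le> L i * norm (w - x)" using w r y by (intro L(2)) (auto simp: S_def)
          also have "\<dots> \<le> M * norm (z - x)" using w LM[of i] M by (intro mult_mono) (auto simp: S_def)
          finally show ?thesis .
        qed
        from abs_sum_cart_le[OF this, of h]
        show "norm (((\<lambda>h. \<Sum>i\<in>UNIV. h $ i * K' i w y) - (\<lambda>h. \<Sum>i\<in>UNIV. h $ i * K' i x y)) h) \<le> D * norm (z - x) * norm h"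
          by (simp add: D_def sum_subtractf right_diff_distrib mult_ac)
      qed (use D in simp)
    next
      show "x \<in> S" using r by (simp add: S_def)
    qed
    then show ?thesis by simp
  qed
  show ?thesis
  proof (rule has_derivativeI_sandwich[where e = "r - norm x" and H = "\<lambda>z. D * I * norm (z - x)"])
    show "0 < r - norm x" using r by simp
    show "bounded_linear (\<lambda>h. \<Sum>i\<in>UNIV. h $ i *\<^sub>R (\<integral>y. complex_of_real (K' i x y) * g y \<partial>nu))"
      by (intro bounded_linear_sum bounded_linear_scaleR_const bounded_linear_vec_nth)
    show "((\<lambda>z. D * I * norm (z - x)) \<longlongrightarrow> 0) (at x)"
      by (rule tendsto_eq_intros refl tendsto_ident_at | simp)+
    fix z assume zx: "z \<noteq> x" and d: "dist z x < r - norm x"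
    have z: "norm z \<le> r" using d norm_triangle_ineq2[of z x] by (simp add: dist_norm)
    have z1: "norm z < 1" using z r by simp
    let ?D = "\<lambda>y. K z y - K x y - (\<Sum>i\<in>UNIV. (z - x) $ i * K' i x y)"
    have eq: "complex_of_real (K z y) * g y - complex_of_real (K x y) * g y - (\<Sum>i\<in>UNIV. (z - x) $ i *\<^sub>R (complex_of_real (K' i x y) * g y))
        = complex_of_real (?D y) * g y" for y
      by (simp add: algebra_simps sum_distrib_left sum_distrib_right scaleR_conv_of_real sum_subtractf)
    have int: "integrable nu (\<lambda>y. complex_of_real (K z y) * g y - complex_of_real (K x y) * g y - (\<Sum>i\<in>UNIV. (z - x) $ i *\<^sub>R (complex_of_real (K' i x y) * g y)))"
      by (intro Bochner_Integration.integrable_diff K z1 x Bochner_Integration.integrable_sum integrable_scaleR_right K'int)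
    have "(\<integral>y. complex_of_real (K z y) * g y \<partial>nu) - (\<integral>y. complex_of_real (K x y) * g y \<partial>nu) -
      (\<Sum>i\<in>UNIV. (z - x) $ i *\<^sub>R (\<integral>y. complex_of_real (K' i x y) * g y \<partial>nu)) =
      (\<integral>y. complex_of_real (K z y) * g y - complex_of_real (K x y) * g y - (\<Sum>i\<in>UNIV. (z - x) $ i *\<^sub>R (complex_of_real (K' i x y) * g y)) \<partial>nu)"
      using K[OF z1] K[OF x] K'int
      by (simp add: Bochner_Integration.integral_diff Bochner_Integration.integral_sum Bochner_Integration.integrable_sum)
    also have "norm \<dots> \<le> (\<integral>y. norm (complex_of_real (?D y) * g y) \<partial>nu)"
      unfolding eq by (rule integral_norm_bound)
    also have "\<dots> \<le> (\<integral>y. norm (z - x) * (D * norm (z - x)) * norm (g y) \<partial>nu)"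
    proof (rule integral_mono_AE)
      show "integrable nu (\<lambda>y. norm (complex_of_real (?D y) * g y))" using int unfolding eq by (rule integrable_norm)
      show "integrable nu (\<lambda>y. norm (z - x) * (D * norm (z - x)) * norm (g y))" using g by simp
      show "AE y in nu. norm (complex_of_real (?D y) * g y) \<le> norm (z - x) * (D * norm (z - x)) * norm (g y)"
        using nu_AE_ball
      proof eventually_elim
        case (elim y)
        then show ?case unfolding norm_mult norm_of_real using z by (intro mult_right_mono point) auto
      qed
    qed
    also have "\<dots> = norm (z - x) * (D * norm (z - x)) * I" by (simp add: I_def)
    finally show "norm ((\<integral>y. complex_of_real (K z y) * g y \<partial>nu) - (\<integral>y. complex_of_real (K x y) * g y \<partial>nu) -
      (\<Sum>i\<in>UNIV. (z - x) $ i *\<^sub>R (\<integral>y. complex_of_real (K' i x y) * g y \<partial>nu))) / norm (z - x) \<le> D * I * norm (z - x)"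
      using zx by (simp add: field_simps)
  qed
qed

lemma R_kernel_eq:
  fixes x y :: "real^'n::finite"
  shows "R_kernel c x y = (\<Sum>k. gam (real CARD('n) / 2) c k * zon (real CARD('n) / 2) k (x \<bullet> y) ((norm x * norm y)\<^sup>2))"
  unfolding R_kernel_def gamma_coef_eq_gam zonal_eq_zon ..

lemma R_kernel_0 [simp]: "R_kernel c 0 (y :: real^'n::finite) = 1"
proof -
  let ?l = "real CARD('n) / 2"
  have "(\<lambda>k. gam ?l c k * zon ?l k ((0::real^'n) \<bullet> y) ((norm (0::real^'n) * norm y)\<^sup>2)) = (\<lambda>k. if k = 0 then 1 else 0)"
    using gbpoly_zero by (auto simp: fun_eq_iff zon_def gam_def gr0_conv_Suc)
  then show ?thesis unfolding R_kernel_eq using sums_single[of 0 "\<lambda>_. 1 :: real"] by (simp add: sums_iff)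
qed

lemma R_kernel_measurable: "(\<lambda>y. R_kernel c (x :: real^'n::finite) y) \<in> borel_measurable borel"
  unfolding R_kernel_eq zon_def
proof (intro borel_measurable_suminf borel_measurable_times borel_measurable_const)
  let ?l = "real CARD('n) / 2"
  fix k
  have "(\<lambda>y. gbpoly (\<lambda>i. pochhammer ?l (i - 1)) k (x \<bullet> y) ((norm x * norm y)\<^sup>2)) \<in> borel_measurable borel"
    by (intro borel_measurable_gbpoly borel_measurable_continuous_onI continuous_intros)
  then show "(\<lambda>y. if k = 0 then 1 else (real k + ?l - 1) * gbpoly (\<lambda>i. pochhammer ?l (i - 1)) k (x \<bullet> y) ((norm x * norm y)\<^sup>2)) \<in> borel_measurable borel"
    by (cases "k = 0") (simp_all add: borel_measurable_times)
qed

lemma R_kernel_bounded: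
  assumes n: "CARD('n::finite) \<ge> 2" and r: "0 \<le> r" "r < 1"
  shows "\<exists>C. \<forall>x y :: real^'n. norm x \<le> r \<longrightarrow> norm y \<le> 1 \<longrightarrow> \<bar>R_kernel c x y\<bar> \<le> C"
proof -
  define l where "l = real CARD('n) / 2"
  have l: "l \<ge> 1" "l > 0" using n by (auto simp: l_def)
  obtain p where p: "polyb p" "\<And>k u v. u\<^sup>2 \<le> v \<Longrightarrow> v < 1 \<Longrightarrow> \<bar>zon l k u v\<bar> \<le> p k * sqrt v ^ k"
    using homog_family_zon[OF l(1)] unfolding homog_family_def by blast
  have sm: "summable (\<lambda>k. \<bar>gam l c k * p k\<bar> * r ^ k)"
    by (intro polyb_summable polyb_mult p polyb_gam l r)
  have "\<bar>R_kernel c x y\<bar> \<le> (\<Sum>k. \<bar>gam l c k * p k\<bar> * r ^ k)" if xy: "norm x \<le> r" "norm y \<le> 1" for x y :: "real^'n"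
  proof -
    note np = norm_prod_less[OF xy r(2)]
    have "norm (R_kernel c x y) \<le> (\<Sum>k. \<bar>gam l c k * p k\<bar> * r ^ k)"
      unfolding R_kernel_eq l_def[symmetric]
    proof (rule norm_suminf_le[OF _ sm])
      fix k
      have "\<bar>zon l k (x \<bullet> y) ((norm x * norm y)\<^sup>2)\<bar> \<le> p k * sqrt ((norm x * norm y)\<^sup>2) ^ k"
        by (rule p(2)[OF inner_sq_le np(1)])
      also have "\<dots> \<le> \<bar>p k\<bar> * r ^ k"
        using np(2) by (intro mult_mono power_mono) auto
      finally have "\<bar>gam l c k\<bar> * \<bar>zon l k (x \<bullet> y) ((norm x * norm y)\<^sup>2)\<bar> \<le> \<bar>gam l c k\<bar> * (\<bar>p k\<bar> * r ^ k)"
        by (rule mult_left_mono) simp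
      then show "norm (gam l c k * zon l k (x \<bullet> y) ((norm x * norm y)\<^sup>2)) \<le> \<bar>gam l c k * p k\<bar> * r ^ k"
        by (simp only: real_norm_def abs_mult mult.assoc)
    qed
    then show ?thesis by simp
  qed
  then show ?thesis by blast
qed

lemma R_kernel_integrable:
  fixes g :: "real^'n::finite \<Rightarrow> complex"
  assumes n: "CARD('n) \<ge> 2" and g: "integrable nu g" and x: "norm x < 1"
  shows "integrable nu (\<lambda>y. complex_of_real (R_kernel c x y) * g y)"
proof -
  obtain C where C: "\<And>z y :: real^'n. norm z \<le> norm x \<Longrightarrow> norm y \<le> 1 \<Longrightarrow> \<bar>R_kernel c z y\<bar> \<le> C"
    using R_kernel_bounded[OF n norm_ge_zero x, of c] by blast
  show ?thesis by (rule integrable_kernel_mult[OF g R_kernel_measurable C]) auto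
qed

lemma smooth_kernel_integrable:
  fixes g :: "real^'n::finite \<Rightarrow> complex"
  assumes K: "smooth_kernel K" and g: "integrable nu g" and x: "norm x < 1"
  shows "integrable nu (\<lambda>y. complex_of_real (K x y) * g y)"
proof -
  obtain C where C: "\<And>z y :: real^'n. norm z \<le> norm x \<Longrightarrow> norm y \<le> 1 \<Longrightarrow> \<bar>K z y\<bar> \<le> C"
    using smooth_kernel_bounded[OF K norm_ge_zero x] by blast
  show ?thesis by (rule integrable_kernel_mult[OF g smooth_kernel_measurable[OF K] C]) auto
qed

lemma R_kernel_has_derivative:
  fixes x y :: "real^'n::finite"
  assumes n: "CARD('n) \<ge> 2" and l: "l = real CARD('n) / 2" and b: "b = (\<lambda>k. gam l c k * (real k + (l - 1)))"
    and x: "norm x < 1" and y: "norm y \<le> 1"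
  shows "((\<lambda>x. R_kernel c x y) has_derivative (\<lambda>h. \<Sum>i\<in>UNIV. h $ i * geg_series_d b l 1 i x y)) (at x)"
proof -
  have l0: "l > 0" using n l by simp
  have pb: "polyb b" unfolding b by (intro polyb_mult polyb_gam l0 polyb_linear)
  define d where "d i = pochhammer l (i - 1)" for i :: nat
  have d: "d (Suc i) = 1 * pochhammer l i" for i by (simp add: d_def)
  \<comment> \<open>In degree 0 the shifted Pochhammer formula gives \<open>l - 1\<close> instead of
    1; the added constant corrects this by \<open>2 - l\<close>.\<close>
  define F where "F z = (\<Sum>k. b k * gbpoly d k (z \<bullet> y) ((norm z * norm y)\<^sup>2)) + (gam l c 0 * (2 - l))" for z :: "real^'n"
  have "(F has_derivative (\<lambda>h. (\<Sum>i\<in>UNIV. h $ i * geg_series_d b l 1 i x y) + 0)) (at x)"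
    unfolding F_def by (intro has_derivative_add series_has_derivative_cart[OF l0 pb d x y] has_derivative_const)
  moreover have "F z = R_kernel c z y" if "z \<in> ball 0 1" for z
  proof -
    have "summable (\<lambda>k. b k * gbpoly d k (z \<bullet> y) ((norm z * norm y)\<^sup>2))"
      by (rule series_has_derivative(1)[OF l0 pb d _ y]) (use that in simp)
    from sums_add[OF summable_sums[OF this] sums_single[of 0 "\<lambda>_. gam l c 0 * (2 - l)"]]
    have "(\<lambda>k. b k * gbpoly d k (z \<bullet> y) ((norm z * norm y)\<^sup>2) + (if k = 0 then gam l c 0 * (2 - l) else 0)) sums F z"
      unfolding F_def by simp
    moreover have "b k * gbpoly d k (z \<bullet> y) ((norm z * norm y)\<^sup>2) + (if k = 0 then gam l c 0 * (2 - l) else 0) =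
        gam l c k * zon l k (z \<bullet> y) ((norm z * norm y)\<^sup>2)" for k
      by (simp add: zon_def b d_def[abs_def] algebra_simps)
    ultimately show ?thesis unfolding R_kernel_eq l[symmetric] by (simp add: sums_iff)
  qed
  ultimately show ?thesis
    by (auto intro: has_derivative_transform_within_open[of F _ x UNIV "ball 0 1"] simp: x)
qed

text \<open>This is \<open>geg_contiguous\<close> summed against \<open>d\<close>; the lower degrees
  are realigned by shifting the coefficients instead.\<close>

lemma geg_series_contiguous:
  fixes x y :: "real^'n::finite"
  assumes m: "m > 0" and d: "polyb d" and x: "norm x < 1" and y: "norm y \<le> 1"
  shows "geg_series d m x y = geg_series d (m + 1) x y - 2 * (x \<bullet> y) * geg_series (\<lambda>k. d (Suc k)) (m + 1) x y
     + (norm x * norm y)\<^sup>2 * geg_series (\<lambda>k. d (Suc (Suc k))) (m + 1) x y"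
proof -
  let ?u = "x \<bullet> y" and ?v = "(norm x * norm y)\<^sup>2"
  let ?G = "\<lambda>k. geg (m + 1) k ?u ?v"
  have m1: "m + 1 > 0" using m by simp
  define f1 where "f1 k = (if k = 0 then 0 else d k * ?G (k - 1))" for k
  define f2 where "f2 k = (if k < 2 then 0 else d k * ?G (k - 2))" for k
  have s0: "(\<lambda>k. d k * ?G k) sums geg_series d (m + 1) x y"
    unfolding geg_series_def by (rule summable_sums[OF geg_series_summable[OF m1 d x y]])
  have "(\<lambda>k. d (Suc k) * ?G k) sums geg_series (\<lambda>k. d (Suc k)) (m + 1) x y"
    unfolding geg_series_def by (rule summable_sums[OF geg_series_summable[OF m1 polyb_Suc[OF d] x y]])
  then have "(\<lambda>k. f1 (Suc k)) sums geg_series (\<lambda>k. d (Suc k)) (m + 1) x y" by (simp add: f1_def)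
  then have s1: "f1 sums geg_series (\<lambda>k. d (Suc k)) (m + 1) x y" by (subst (asm) sums_Suc_iff) (simp add: f1_def)
  have "(\<lambda>k. d (Suc (Suc k)) * ?G k) sums geg_series (\<lambda>k. d (Suc (Suc k))) (m + 1) x y"
    unfolding geg_series_def by (rule summable_sums[OF geg_series_summable[OF m1 polyb_Suc[OF polyb_Suc[OF d]] x y]])
  then have "(\<lambda>k. f2 (k + 2)) sums geg_series (\<lambda>k. d (Suc (Suc k))) (m + 1) x y" by (simp add: f2_def)
  then have s2: "f2 sums geg_series (\<lambda>k. d (Suc (Suc k))) (m + 1) x y"
    by (subst (asm) sums_zero_iff_shift) (auto simp: f2_def)
  have "d k * geg m k ?u ?v = d k * ?G k - 2 * ?u * f1 k + ?v * f2 k" for k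
  proof -
    consider "k = 0" | "k = Suc 0" | j where "k = j + 2"
      by (metis One_nat_def add_2_eq_Suc' not0_implies_Suc)
    then show ?thesis
    proof cases
      case 3
      have "geg m k ?u ?v = ?G k - 2 * ?u * ?G (j + 1) + ?v * ?G j" using geg_contiguous[of m j ?u ?v] 3 by simp
      moreover have "f1 k = d k * ?G (j + 1)" "f2 k = d k * ?G j" using 3 by (simp_all add: f1_def f2_def)
      ultimately show ?thesis by (simp only: right_diff_distrib distrib_left mult_ac)
    qed (simp_all add: f1_def f2_def algebra_simps)
  qed
  then have "geg_series d m x y = (\<Sum>k. d k * ?G k - 2 * ?u * f1 k + ?v * f2 k)" unfolding geg_series_def by simp
  then show ?thesis
    using sums_add[OF sums_diff[OF s0 sums_mult[OF s1, of "2 * ?u"]] sums_mult[OF s2, of ?v]] by (simp add: sums_iff)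
qed

lemma sum_ser_d_mult:
  fixes x y z :: "real^'n::finite"
  shows "(\<Sum>i\<in>UNIV. geg_series_d b m \<kappa> i x y * z $ i) =
    2 * \<kappa> * geg_series (\<lambda>k. b (Suc k)) m x y * (y \<bullet> z) - 2 * \<kappa> * geg_series (\<lambda>k. b (Suc (Suc k))) m x y * (norm y)\<^sup>2 * (x \<bullet> z)"
proof -
  have "(\<Sum>i\<in>UNIV. geg_series_d b m \<kappa> i x y * z $ i) =
    (\<Sum>i\<in>UNIV. 2 * \<kappa> * geg_series (\<lambda>k. b (Suc k)) m x y * (y $ i * z $ i) - 2 * \<kappa> * geg_series (\<lambda>k. b (Suc (Suc k))) m x y * (norm y)\<^sup>2 * (x $ i * z $ i))"
    by (simp add: geg_series_d_def algebra_simps)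
  then show ?thesis by (simp add: sum_subtractf sum_distrib_left[symmetric] inner_vec_def)
qed

lemma harmonic_R_integral:
  fixes g :: "real^'n::finite \<Rightarrow> complex"
  assumes n: "CARD('n) \<ge> 2" and g: "integrable nu g"
  shows "harmonic_on unit_ball (\<lambda>x. \<integral>y. complex_of_real (R_kernel c x y) * g y \<partial>nu)"
proof -
  define l where "l = real CARD('n) / 2"
  define b where "b = (\<lambda>k. gam l c k * (real k + (l - 1)))"
  have l0: "l > 0" "l + 1 > 0" using n by (auto simp: l_def)
  have pb: "polyb b" unfolding b_def by (intro polyb_mult polyb_gam l0 polyb_linear)
  define b1 where "b1 k = b (Suc k)" for k
  define b2 where "b2 k = b (Suc (Suc k))" for k
  have pb1: "polyb b1" "polyb b2" unfolding b1_def[abs_def] b2_def[abs_def] by (intro polyb_Suc pb)+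
  define R1 where "R1 i = geg_series_d b l 1 i" for i :: 'n
  define R2 where "R2 i j = (\<lambda>x y. 2 * y $ i * geg_series_d b1 (l + 1) l j x y -
     2 * (norm y)\<^sup>2 * (geg_series_d b2 (l + 1) l j x y * x $ i + geg_series b2 l x y * (if j = i then 1 else 0)))" for i j :: 'n
  have k1: "smooth_kernel (R1 i)" for i unfolding R1_def by (rule smooth_kernel_ser_d[OF l0(1) pb])
  have k2: "smooth_kernel (R2 i j)" for i j unfolding R2_def
    by (rule smooth_kernel_diff[OF smooth_kernel.mult[OF smooth_kernel.mult[OF smooth_kernel.const smooth_kernel.snd] smooth_kernel_ser_d[OF l0(2) pb1(1)]]
       smooth_kernel.mult[OF smooth_kernel.mult[OF smooth_kernel.const smooth_kernel_norm_snd]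
         smooth_kernel.add[OF smooth_kernel.mult[OF smooth_kernel_ser_d[OF l0(2) pb1(2)] smooth_kernel.fst] smooth_kernel.mult[OF smooth_kernel.geg_series[OF l0(1) pb1(2)] smooth_kernel.const]]]])
  have D2: "((\<lambda>x. R1 i x y) has_derivative (\<lambda>h. \<Sum>j\<in>UNIV. h $ j * R2 i j x y)) (at x)"
    if x: "norm x < 1" and y: "norm y \<le> 1" for i x y
  proof -
    have e: "R1 i = (\<lambda>x y. 2 * y $ i * geg_series b1 l x y - 2 * (norm y)\<^sup>2 * (geg_series b2 l x y * x $ i))"
      by (simp add: R1_def geg_series_d_def b1_def[abs_def] b2_def[abs_def] fun_eq_iff mult_ac)
    have "((\<lambda>x. R1 i x y) has_derivative (\<lambda>h. 2 * y $ i * (\<Sum>j\<in>UNIV. h $ j * geg_series_d b1 (l + 1) l j x y) -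
       2 * (norm y)\<^sup>2 * (geg_series b2 l x y * h $ i + (\<Sum>j\<in>UNIV. h $ j * geg_series_d b2 (l + 1) l j x y) * x $ i))) (at x)"
      unfolding e
      by (intro has_derivative_diff has_derivative_mult_right has_derivative_mult
          geg_series_has_derivative[OF l0(1) pb1(1) x y] geg_series_has_derivative[OF l0(1) pb1(2) x y]
          bounded_linear_imp_has_derivative bounded_linear_vec_nth)
    moreover have "(\<lambda>h. 2 * y $ i * (\<Sum>j\<in>UNIV. h $ j * geg_series_d b1 (l + 1) l j x y) -
       2 * (norm y)\<^sup>2 * (geg_series b2 l x y * h $ i + (\<Sum>j\<in>UNIV. h $ j * geg_series_d b2 (l + 1) l j x y) * x $ i)) =
       (\<lambda>h. \<Sum>j\<in>UNIV. h $ j * R2 i j x y)"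
    proof
      fix h :: "real^'n"
      have hi: "h $ i = (\<Sum>j\<in>UNIV. h $ j * (if j = i then 1 else 0))"
        by (simp add: if_distrib[of "(*) _"] cong: if_cong)
      show "2 * y $ i * (\<Sum>j\<in>UNIV. h $ j * geg_series_d b1 (l + 1) l j x y) -
       2 * (norm y)\<^sup>2 * (geg_series b2 l x y * h $ i + (\<Sum>j\<in>UNIV. h $ j * geg_series_d b2 (l + 1) l j x y) * x $ i) =
       (\<Sum>j\<in>UNIV. h $ j * R2 i j x y)"
        unfolding R2_def hi sum_distrib_left sum_distrib_right sum.distrib[symmetric] sum_subtractf[symmetric]
        by (intro sum.cong refl) (simp only: distrib_left right_diff_distrib mult_ac)
    qed
    ultimately show ?thesis by simp
  qed
  \<comment> \<open>The trace is \<open>4 l (norm y)^2\<close> times the difference of the two sides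
    of \<open>geg_series_contiguous\<close>. The term with \<open>CARD('n) = 2 * l\<close> arises
    from differentiating the coordinates \<open>x $ i\<close>.\<close>
  have lap: "(\<Sum>i\<in>UNIV. R2 i i x y) = 0" if x: "norm x < 1" and y: "norm y \<le> 1" for x y
  proof -
    let ?S = "\<lambda>d. geg_series d (l + 1) x y"
    have c: "geg_series b2 l x y = ?S b2 - 2 * (x \<bullet> y) * ?S (\<lambda>k. b2 (Suc k)) + (norm x * norm y)\<^sup>2 * ?S (\<lambda>k. b2 (Suc (Suc k)))"
      by (rule geg_series_contiguous[OF l0(1) pb1(2) x y])
    have "(\<Sum>i\<in>UNIV. R2 i i x y) = 2 * (\<Sum>i\<in>UNIV. geg_series_d b1 (l + 1) l i x y * y $ i) -
       2 * (norm y)\<^sup>2 * ((\<Sum>i\<in>UNIV. geg_series_d b2 (l + 1) l i x y * x $ i) + real CARD('n) * geg_series b2 l x y)"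
      by (simp add: R2_def sum_subtractf sum.distrib sum_distrib_left mult_ac distrib_left)
    also have "\<dots> = 2 * (2 * l * ?S b2 * (y \<bullet> y) - 2 * l * ?S (\<lambda>k. b2 (Suc k)) * (norm y)\<^sup>2 * (x \<bullet> y)) -
       2 * (norm y)\<^sup>2 * (2 * l * ?S (\<lambda>k. b2 (Suc k)) * (y \<bullet> x) - 2 * l * ?S (\<lambda>k. b2 (Suc (Suc k))) * (norm y)\<^sup>2 * (x \<bullet> x) + real CARD('n) * geg_series b2 l x y)"
      unfolding sum_ser_d_mult by (simp add: b1_def[abs_def] b2_def[abs_def])
    also have "\<dots> = 0"
    proof -
      have "real CARD('n) = 2 * l" by (simp add: l_def)
      then show ?thesis unfolding c
        by (simp add: power2_norm_eq_inner[symmetric] inner_commute[of y x] power_mult_distrib algebra_simps)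
    qed
    finally show ?thesis .
  qed
  define F1 where "F1 i x = (\<integral>y. complex_of_real (R1 i x y) * g y \<partial>nu)" for i x
  define F2 where "F2 i j x = (\<integral>y. complex_of_real (R2 i j x y) * g y \<partial>nu)" for i j x
  show ?thesis
  proof (rule harmonic_onI[where ?F1.0 = F1 and ?F2.0 = F2])
    show "open unit_ball" by simp
    fix x :: "real^'n" assume "x \<in> unit_ball"
    then have x: "norm x < 1" by simp
    show "((\<lambda>x. \<integral>y. complex_of_real (R_kernel c x y) * g y \<partial>nu) has_derivative (\<lambda>h. \<Sum>i\<in>UNIV. h $ i *\<^sub>R F1 i x)) (at x)"
      unfolding F1_def
      by (rule deriv_under_integral[OF g R_kernel_integrable[OF n g] k1 _ x])
         (simp_all add: R1_def R_kernel_has_derivative[OF n l_def b_def])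
    show "(F1 i has_derivative (\<lambda>h. \<Sum>j\<in>UNIV. h $ j *\<^sub>R F2 i j x)) (at x)" for i
      unfolding F1_def[abs_def] F2_def
      by (rule deriv_under_integral[OF g smooth_kernel_integrable[OF k1 g] k2 D2 x])
    have "(\<Sum>i\<in>UNIV. F2 i i x) = (\<integral>y. (\<Sum>i\<in>UNIV. complex_of_real (R2 i i x y) * g y) \<partial>nu)"
      unfolding F2_def by (rule Bochner_Integration.integral_sum[symmetric]) (rule smooth_kernel_integrable[OF k2 g x])
    also have "\<dots> = (\<integral>y. 0 \<partial>(nu :: (real^'n) measure))"
    proof (rule Bochner_Integration.integral_cong[OF refl])
      fix y :: "real^'n" assume "y \<in> space nu"
      then have "norm y \<le> 1" by simp
      from lap[OF x this] show "(\<Sum>i\<in>UNIV. complex_of_real (R2 i i x y) * g y) = 0"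
        by (simp add: sum_distrib_right[symmetric] of_real_sum[symmetric] del: of_real_sum)
    qed
    finally show "(\<Sum>i\<in>UNIV. F2 i i x) = 0" by simp
  next
    fix i j
    obtain K' where K': "\<And>k. smooth_kernel (K' k)" "\<And>x y. norm x < 1 \<Longrightarrow> norm y \<le> 1 \<Longrightarrow>
     ((\<lambda>x. R2 i j x y) has_derivative (\<lambda>h. \<Sum>k\<in>UNIV. h $ k * K' k x y)) (at x)"
      using smooth_kernel_deriv[OF k2] by blast
    have "isCont (F2 i j) x" if "x \<in> unit_ball" for x
    proof -
      have x: "norm x < 1" using that by simp
      from deriv_under_integral[OF g smooth_kernel_integrable[OF k2 g] K' x]
      show ?thesis unfolding F2_def[abs_def] by (rule has_derivative_continuous)
    qed
    then show "continuous_on unit_ball (F2 i j)" by (simp add: continuous_at_imp_continuous_on)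
  qed
qed

section \<open>Integrals of kernel bounds over the ball\<close>

lemma nn_integral_lborel_scale:
  fixes g :: "'a::euclidean_space \<Rightarrow> ennreal"
  assumes [measurable]: "g \<in> borel_measurable borel" and t: "t > 0"
  shows "(\<integral>\<^sup>+y. g y \<partial>lborel) = ennreal (t ^ DIM('a)) * (\<integral>\<^sup>+z. g (t *\<^sub>R z) \<partial>lborel)"
proof -
  have "(\<integral>\<^sup>+y. g y \<partial>lborel) = (\<integral>\<^sup>+y. g y \<partial>density (distr lborel borel (\<lambda>x. 0 + t *\<^sub>R x)) (\<lambda>_. \<bar>t\<bar>^DIM('a)))"
    by (subst lborel_affine[of t 0, symmetric]) (use t in auto)
  also have "\<dots> = ennreal (t ^ DIM('a)) * (\<integral>\<^sup>+z. g (t *\<^sub>R z) \<partial>lborel)"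
    using t by (simp add: nn_integral_density nn_integral_distr nn_integral_cmult)
  finally show ?thesis .
qed

lemma nn_integral_inverse_ln2:
  assumes "c > 0"
  shows "(\<integral>\<^sup>+t. ennreal (1 / t) * indicator {c / 2<..<c} t \<partial>lborel) = ennreal (ln 2)"
proof -
  have "((\<lambda>t. 1 / t) has_integral (ln c - ln (c / 2))) {c / 2..c}"
    using assms by (intro fundamental_theorem_of_calculus)
      (auto simp: has_real_derivative_iff_has_vector_derivative[symmetric] intro!: derivative_eq_intros)
  then have "((\<lambda>t. 1 / t) has_integral ln 2) {c / 2<..<c}"
    using assms by (simp add: has_integral_Icc_iff_Ioo ln_div)
  from nn_integral_has_integral_lebesgue'[OF _ this] show ?thesis using assms by simp
qed

text \<open>Averaging a function over all dilates of the shell \<open>1 < norm z < 2\<close> turns a comparison of radial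
  integrals into a comparison of volume integrals, so polar coordinates are not needed.\<close>

lemma nn_integral_dilates:
  fixes g :: "'a::euclidean_space \<Rightarrow> ennreal"
  assumes [measurable]: "g \<in> borel_measurable borel"
  shows "(\<integral>\<^sup>+z. indicator {z. 1 < norm z \<and> norm z < 2} z *
      (\<integral>\<^sup>+t. g (t *\<^sub>R z) * ennreal (t ^ (DIM('a) - 1)) * indicator {0<..} t \<partial>lborel) \<partial>lborel) =
    ennreal (ln 2) * (\<integral>\<^sup>+y. g y \<partial>lborel)"
proof -
  let ?A = "{z::'a. 1 < norm z \<and> norm z < 2}"
  \<comment> \<open>The substitution \<open>y = t *\<^sub>R z\<close> turns the shell condition on
    \<open>z\<close> into \<open>norm y / 2 < t < norm y\<close> and leaves the factor
    \<open>1 / t\<close>; integrated over \<open>t\<close> this gives \<open>ln 2\<close> for every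
    nonzero \<open>y\<close>.\<close>
  define W where "W t y = (if norm y / 2 < t \<and> t < norm y then ennreal (1 / t) else 0)" for t :: real and y :: 'a
  have "(\<integral>\<^sup>+z. indicator ?A z *
      (\<integral>\<^sup>+t. g (t *\<^sub>R z) * ennreal (t ^ (DIM('a) - 1)) * indicator {0<..} t \<partial>lborel) \<partial>lborel) =
    (\<integral>\<^sup>+z. (\<integral>\<^sup>+t. indicator ?A z * (g (t *\<^sub>R z) * ennreal (t ^ (DIM('a) - 1)) * indicator {0<..} t) \<partial>lborel) \<partial>lborel)"
    by (intro nn_integral_cong nn_integral_cmult[symmetric]) simp
  also have "\<dots> = (\<integral>\<^sup>+t. (\<integral>\<^sup>+z. indicator ?A z * (g (t *\<^sub>R z) * ennreal (t ^ (DIM('a) - 1)) * indicator {0<..} t) \<partial>lborel) \<partial>lborel)"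
    by (rule lborel_pair.Fubini') measurable
  also have "\<dots> = (\<integral>\<^sup>+t. (\<integral>\<^sup>+y. g y * W t y \<partial>lborel) \<partial>lborel)"
  proof (rule nn_integral_cong)
    fix t :: real
    show "(\<integral>\<^sup>+z. indicator ?A z * (g (t *\<^sub>R z) * ennreal (t ^ (DIM('a) - 1)) * indicator {0<..} t) \<partial>lborel) =
      (\<integral>\<^sup>+y. g y * W t y \<partial>lborel)"
    proof (cases "t > 0")
      case True
      have p: "t ^ DIM('a) * (1 / t) = t ^ (DIM('a) - 1)"
        using True by (subst power_eq_if) simp
      have "(\<integral>\<^sup>+y. g y * W t y \<partial>lborel) =
        ennreal (t ^ DIM('a)) * (\<integral>\<^sup>+z. g (t *\<^sub>R z) * W t (t *\<^sub>R z) \<partial>lborel)"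
        unfolding W_def by (rule nn_integral_lborel_scale[OF _ True]) measurable
      also have "\<dots> = (\<integral>\<^sup>+z. ennreal (t ^ DIM('a)) * (g (t *\<^sub>R z) * W t (t *\<^sub>R z)) \<partial>lborel)"
        unfolding W_def by (rule nn_integral_cmult[symmetric]) measurable
      also have "\<dots> = (\<integral>\<^sup>+z. indicator ?A z * (g (t *\<^sub>R z) * ennreal (t ^ (DIM('a) - 1)) * indicator {0<..} t) \<partial>lborel)"
      proof (rule nn_integral_cong)
        fix z :: 'a
        have 1: "W t (t *\<^sub>R z) = indicator ?A z * ennreal (1 / t)"
          using True by (auto simp: W_def indicator_def field_simps)
        have 2: "ennreal (t ^ (DIM('a) - 1)) = ennreal (t ^ DIM('a)) * ennreal (1 / t)"
          using True p by (simp flip: ennreal_mult)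
        have 3: "(indicator {0<..} t :: ennreal) = 1" using True by simp
        show "ennreal (t ^ DIM('a)) * (g (t *\<^sub>R z) * W t (t *\<^sub>R z)) =
          indicator ?A z * (g (t *\<^sub>R z) * ennreal (t ^ (DIM('a) - 1)) * indicator {0<..} t)"
          unfolding 1 2 3 by (simp only: mult_1_right mult_1_left mult_ac)
      qed
      finally show ?thesis by simp
    next
      case False
      have z0: "W t y = 0" for y
      proof -
        have "\<not> norm y / 2 < t" using False norm_ge_zero[of y] by linarith
        then show ?thesis by (simp add: W_def)
      qed
      show ?thesis using False by (simp add: z0)
    qed
  qed
  also have "\<dots> = (\<integral>\<^sup>+y. (\<integral>\<^sup>+t. g y * W t y \<partial>lborel) \<partial>lborel)"
    unfolding W_def by (rule lborel_pair.Fubini') measurable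
  also have "\<dots> = (\<integral>\<^sup>+y. ennreal (ln 2) * g y \<partial>lborel)"
  proof (rule nn_integral_cong_AE)
    have "AE y in lborel. y \<noteq> (0::'a)" by (rule AE_lborel_singleton)
    then show "AE y in lborel. (\<integral>\<^sup>+t. g y * W t y \<partial>lborel) = ennreal (ln 2) * g y"
    proof eventually_elim
      case (elim y)
      have "(\<integral>\<^sup>+t. g y * W t y \<partial>lborel) =
        g y * (\<integral>\<^sup>+t. W t y \<partial>lborel)"
        unfolding W_def by (rule nn_integral_cmult) measurable
      moreover have "W t y = ennreal (1 / t) * indicator {norm y / 2<..<norm y} t" for t
        by (auto simp: W_def indicator_def)
      ultimately show ?case using elim by (simp add: nn_integral_inverse_ln2 mult.commute)
    qed
  qed
  also have "\<dots> = ennreal (ln 2) * (\<integral>\<^sup>+y. g y \<partial>lborel)" by (rule nn_integral_cmult) measurable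
  finally show ?thesis .
qed

text \<open>The shell averages of \<open>nn_integral_dilates\<close> are compared ray by ray. The
  ray through \<open>z\<close> is rescaled to its unit direction with the same factor on both sides,
  and \<open>ln 2\<close> cancels at the end.\<close>

lemma radial_comparison:
  fixes g h :: "'a::euclidean_space \<Rightarrow> ennreal"
  assumes [measurable]: "g \<in> borel_measurable borel" "h \<in> borel_measurable borel"
    and le: "\<And>\<eta>. norm \<eta> = 1 \<Longrightarrow> (\<integral>\<^sup>+r. g (r *\<^sub>R \<eta>) * ennreal (r ^ (DIM('a) - 1)) * indicator {0<..} r \<partial>lborel) \<le>
       C * (\<integral>\<^sup>+r. h (r *\<^sub>R \<eta>) * ennreal (r ^ (DIM('a) - 1)) * indicator {0<..} r \<partial>lborel)"
  shows "(\<integral>\<^sup>+y. g y \<partial>lborel) \<le> C * (\<integral>\<^sup>+y. h y \<partial>lborel)"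
proof -
  let ?A = "{z::'a. 1 < norm z \<and> norm z < 2}"
  let ?I = "\<lambda>g z. \<integral>\<^sup>+t. g (t *\<^sub>R z) * ennreal (t ^ (DIM('a) - 1)) * indicator {0<..} t \<partial>lborel"
  have ray: "?I f z = ennreal ((1 / norm z) ^ DIM('a)) * ?I f (z /\<^sub>R norm z)"
    if z: "z \<noteq> 0" and [measurable]: "f \<in> borel_measurable borel" for f :: "'a \<Rightarrow> ennreal" and z
  proof -
    define c where "c = 1 / norm z"
    have c: "c > 0" using z by (simp add: c_def)
    have "?I f z = ennreal \<bar>c\<bar> * (\<integral>\<^sup>+r. f ((0 + c * r) *\<^sub>R z) * ennreal ((0 + c * r) ^ (DIM('a) - 1)) * indicator {0<..} (0 + c * r) \<partial>lborel)"
      by (rule nn_integral_real_affine) (use c in \<open>auto\<close>)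
    also have "\<dots> = ennreal \<bar>c\<bar> * (\<integral>\<^sup>+r. ennreal (c ^ (DIM('a) - 1)) * (f (r *\<^sub>R (z /\<^sub>R norm z)) * ennreal (r ^ (DIM('a) - 1)) * indicator {0<..} r) \<partial>lborel)"
    proof (intro arg_cong[where f = "(*) _"] nn_integral_cong)
      fix r :: real
      have e1: "(c * r) *\<^sub>R z = r *\<^sub>R (z /\<^sub>R norm z)" by (simp add: c_def field_simps)
      have e2: "indicator {0<..} (c * r) = (indicator {0<..} r :: ennreal)"
        using c by (auto simp: indicator_def zero_less_mult_iff)
      have e3: "ennreal ((c * r) ^ (DIM('a) - 1)) = ennreal (c ^ (DIM('a) - 1)) * ennreal (r ^ (DIM('a) - 1))" if "r > 0"
        using c that by (simp add: power_mult_distrib ennreal_mult)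
      show "f ((0 + c * r) *\<^sub>R z) * ennreal ((0 + c * r) ^ (DIM('a) - 1)) * indicator {0<..} (0 + c * r) =
        ennreal (c ^ (DIM('a) - 1)) * (f (r *\<^sub>R (z /\<^sub>R norm z)) * ennreal (r ^ (DIM('a) - 1)) * indicator {0<..} r)"
      proof (cases "r > 0")
        case True
        show ?thesis unfolding add_0_left e1 e2 e3[OF True] by (simp only: mult_ac)
      next
        case False
        then have "(indicator {0<..} r :: ennreal) = 0" by simp
        then show ?thesis unfolding add_0_left e2 by simp
      qed
    qed
    also have "\<dots> = ennreal \<bar>c\<bar> * (ennreal (c ^ (DIM('a) - 1)) * ?I f (z /\<^sub>R norm z))"
      by (subst nn_integral_cmult) auto
    also have "\<dots> = ennreal (c ^ DIM('a)) * ?I f (z /\<^sub>R norm z)"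
    proof -
      have "c * c ^ (DIM('a) - 1) = c ^ DIM('a)" by (simp add: power_eq_if[of c "DIM('a)"])
      then have "ennreal \<bar>c\<bar> * ennreal (c ^ (DIM('a) - 1)) = ennreal (c ^ DIM('a))"
        using c by (simp flip: ennreal_mult)
      then show ?thesis by (simp flip: mult.assoc)
    qed
    finally show ?thesis by (simp add: c_def)
  qed
  have rayle: "?I g z \<le> C * ?I h z" if "z \<noteq> 0" for z
  proof -
    have "?I g z \<le> ennreal ((1 / norm z) ^ DIM('a)) * (C * ?I h (z /\<^sub>R norm z))"
      using that unfolding ray[OF that assms(1)] by (intro mult_left_mono le) auto
    also have "\<dots> = C * ?I h z" unfolding ray[OF that assms(2)] by (simp add: mult_ac)
    finally show ?thesis .
  qed
  have "ennreal (ln 2) * (\<integral>\<^sup>+y. g y \<partial>lborel) = (\<integral>\<^sup>+z. indicator ?A z * ?I g z \<partial>lborel)"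
    by (rule nn_integral_dilates[symmetric]) fact
  also have "\<dots> \<le> (\<integral>\<^sup>+z. C * (indicator ?A z * ?I h z) \<partial>lborel)"
  proof (rule nn_integral_mono)
    fix z
    show "indicator ?A z * ?I g z \<le> C * (indicator ?A z * ?I h z)"
    proof (cases "z \<in> ?A")
      case True
      then have "z \<noteq> 0" by auto
      from rayle[OF this] show ?thesis using True by simp
    qed simp
  qed
  also have "\<dots> = C * (\<integral>\<^sup>+z. indicator ?A z * ?I h z \<partial>lborel)"
    by (rule nn_integral_cmult) measurable
  also have "\<dots> = C * (ennreal (ln 2) * (\<integral>\<^sup>+y. h y \<partial>lborel))"
    by (subst nn_integral_dilates) auto
  finally have "ennreal (ln 2) * (\<integral>\<^sup>+y. g y \<partial>lborel) \<le> ennreal (ln 2) * (C * (\<integral>\<^sup>+y. h y \<partial>lborel))"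
    by (simp add: mult_ac)
  then have "ennreal (1 / ln 2) * (ennreal (ln 2) * (\<integral>\<^sup>+y. g y \<partial>lborel)) \<le> ennreal (1 / ln 2) * (ennreal (ln 2) * (C * (\<integral>\<^sup>+y. h y \<partial>lborel)))"
    by (rule mult_left_mono) simp
  moreover have "ennreal (1 / ln 2) * (ennreal (ln 2) * X) = X" for X
    by (simp flip: mult.assoc ennreal_mult)
  ultimately show ?thesis by simp
qed

text \<open>The comparison function is the indicator of the ball, whose integral is finite.
  \<open>A\<close> and \<open>B\<close> are the two radial integrals up to 2; the first converges
  because \<open>\<gamma> < n\<close>.\<close>

lemma nn_integral_norm_powr_finite:
  assumes "\<gamma> < real CARD('n)"
  shows "(\<integral>\<^sup>+z. ennreal (norm z powr (- \<gamma>)) * indicator (ball 0 2) (z :: real^'n::finite) \<partial>lborel) < \<infinity>"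
proof -
  let ?n = "real CARD('n)"
  let ?N = "CARD('n) - 1"
  have N: "real ?N = ?n - 1" by (simp add: of_nat_diff Suc_leI)
  define A where "A = 2 powr (?n - \<gamma>) / (?n - \<gamma>)"
  define B where "B = 2 powr ?n / ?n"
  have AB: "A > 0" "B > 0" using assms by (auto simp: A_def B_def)
  have [measurable]: "ball (0::real^'n) 2 \<in> sets borel" by simp
  have "(\<integral>\<^sup>+z. ennreal (norm z powr (- \<gamma>)) * indicator (ball 0 2) (z :: real^'n::finite) \<partial>lborel) \<le>
     ennreal (A / B) * (\<integral>\<^sup>+z. indicator (ball 0 2) (z :: real^'n::finite) \<partial>lborel)"
  proof (rule radial_comparison)
    fix \<eta> :: "real^'n" assume e: "norm \<eta> = 1"
    have r1: "ennreal (norm (r *\<^sub>R \<eta>) powr (- s)) * indicator (ball 0 2) (r *\<^sub>R \<eta>) * ennreal (r ^ (DIM(real^'n) - 1)) * indicator {0<..} r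
       \<le> ennreal (r powr (?n - s - 1)) * indicator {0..2} r" for r s
    proof (cases "0 < r \<and> r < 2")
      case True
      have "r powr (- s) * r ^ ?N = r powr (?n - s - 1)"
        using True N by (simp add: powr_realpow[symmetric] powr_add[symmetric] algebra_simps)
      then show ?thesis using True e by (simp flip: ennreal_mult)
    qed (use e in \<open>auto simp: indicator_def\<close>)
    have r2: "ennreal (r powr (?n - 1)) * indicator {0<..<2} r \<le> indicator (ball 0 2) (r *\<^sub>R \<eta>) * ennreal (r ^ (DIM(real^'n) - 1)) * indicator {0<..} r" for r
      using e N by (auto simp: indicator_def powr_realpow[symmetric])
    have "(\<integral>\<^sup>+r. ennreal (norm (r *\<^sub>R \<eta>) powr (- \<gamma>)) * indicator (ball 0 2) (r *\<^sub>R \<eta>) * ennreal (r ^ (DIM(real^'n) - 1)) * indicator {0<..} r \<partial>lborel)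
      \<le> (\<integral>\<^sup>+r. ennreal (r powr (?n - \<gamma> - 1)) * indicator {0..2} r \<partial>lborel)"
      by (intro nn_integral_mono r1)
    also have "\<dots> = ennreal A" using assms by (subst nn_integral_powr_0) (auto simp: A_def)
    also have "\<dots> = ennreal (A / B) * ennreal B" using AB by (simp flip: ennreal_mult)
    also have "ennreal B = (\<integral>\<^sup>+r. ennreal (r powr (?n - 1)) * indicator {0..2} r \<partial>lborel)"
      by (subst nn_integral_powr_0) (auto simp: B_def)
    also have "\<dots> = (\<integral>\<^sup>+r. ennreal (r powr (?n - 1)) * indicator {0<..<2} r \<partial>lborel)"
    proof (rule nn_integral_cong_AE)
      have "AE r in lborel. r \<noteq> (0::real)" "AE r in lborel. r \<noteq> (2::real)" by (rule AE_lborel_singleton)+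
      then show "AE r in lborel. ennreal (r powr (?n - 1)) * indicator {0..2} r = ennreal (r powr (?n - 1)) * indicator {0<..<2} r"
        by eventually_elim (auto simp: indicator_def)
    qed
    also have "\<dots> \<le> (\<integral>\<^sup>+r. indicator (ball 0 2) (r *\<^sub>R \<eta>) * ennreal (r ^ (DIM(real^'n) - 1)) * indicator {0<..} r \<partial>lborel)"
      by (intro nn_integral_mono r2)
    finally show "(\<integral>\<^sup>+r. ennreal (norm (r *\<^sub>R \<eta>) powr (- \<gamma>)) * indicator (ball 0 2) (r *\<^sub>R \<eta>) * ennreal (r ^ (DIM(real^'n) - 1)) * indicator {0<..} r \<partial>lborel)
      \<le> ennreal (A / B) * (\<integral>\<^sup>+r. indicator (ball 0 2) (r *\<^sub>R \<eta>) * ennreal (r ^ (DIM(real^'n) - 1)) * indicator {0<..} r \<partial>lborel)"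
      by (simp add: mult_left_mono)
  qed measurable
  also have "\<dots> < \<infinity>"
    using emeasure_bounded_finite[of "ball (0::real^'n) 2"] by (simp add: ennreal_mult_less_top)
  finally show ?thesis .
qed

lemma nn_integral_nu:
  fixes f :: "real^'n::finite \<Rightarrow> ennreal"
  assumes f: "f \<in> borel_measurable borel"
  shows "(\<integral>\<^sup>+y. f y \<partial>nu) = ennreal (1 / measure lebesgue (unit_ball :: (real^'n) set)) * (\<integral>\<^sup>+y. f y * indicator unit_ball y \<partial>lborel)"
proof -
  have f1: "f \<in> borel_measurable lebesgue" using f by (intro measurable_completion) simp
  have f2: "f \<in> borel_measurable (lebesgue_on unit_ball)" using f1 by (rule measurable_restrict_space1)
  have "(\<integral>\<^sup>+y. f y \<partial>nu) = ennreal (1 / measure lebesgue (unit_ball :: (real^'n) set)) * (\<integral>\<^sup>+y. f y \<partial>lebesgue_on unit_ball)"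
    unfolding nu_def using f2 by (simp add: nn_integral_density nn_integral_cmult)
  also have "(\<integral>\<^sup>+y. f y \<partial>lebesgue_on unit_ball) = (\<integral>\<^sup>+y. f y * indicator unit_ball y \<partial>lebesgue)"
    by (rule nn_integral_restrict_space) simp
  also have "\<dots> = (\<integral>\<^sup>+y. f y * indicator unit_ball y \<partial>lborel)"
    by (rule nn_integral_completion)
  finally show ?thesis .
qed

lemma unit_ball_measure_pos: "measure lebesgue (unit_ball :: (real^'n::finite) set) > 0"
  by (simp add: content_ball_pos)

lemma bracket_eq:
  fixes x y :: "'a::real_inner"
  assumes "norm \<xi> = 1" "x = norm x *\<^sub>R \<xi>"
  shows "1 - 2 * (x \<bullet> y) + (norm x * norm y)\<^sup>2 = (norm (norm x *\<^sub>R y - \<xi>))\<^sup>2"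
proof -
  have "\<xi> \<bullet> \<xi> = 1" using assms(1) by (simp add: norm_eq_1)
  moreover have "x \<bullet> y = norm x * (\<xi> \<bullet> y)" using assms(2) by (metis inner_scaleR_left)
  ultimately show ?thesis
    by (simp add: power2_norm_eq_inner inner_diff_left inner_diff_right inner_commute power_mult_distrib algebra_simps)
       (auto simp: dot_square_norm power2_eq_square)
qed

text \<open>Trades \<open>x\<close> for the boundary point \<open>\<xi>\<close> in its direction, at
  distance \<open>1 - norm x\<close>; by \<open>bracket_eq\<close> the root of the bracket is the
  distance of \<open>norm x *\<^sub>R y\<close> from \<open>\<xi>\<close>.\<close>

lemma bracket_lower:
  fixes x y :: "'a::real_inner"
  assumes xi: "norm \<xi> = 1" "x = norm x *\<^sub>R \<xi>" and x: "norm x < 1" and y: "norm y < 1"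
  shows "(norm (y - \<xi>) + (1 - norm x)) / 4 \<le> sqrt (1 - 2 * (x \<bullet> y) + (norm x * norm y)\<^sup>2)"
proof -
  have D: "sqrt (1 - 2 * (x \<bullet> y) + (norm x * norm y)\<^sup>2) = norm (norm x *\<^sub>R y - \<xi>)"
    unfolding bracket_eq[OF xi] by simp
  have "norm x * norm y \<le> norm x" using y by (simp add: mult_left_le)
  moreover have "1 - norm x * norm y \<le> norm (norm x *\<^sub>R y - \<xi>)"
    using norm_triangle_ineq2[of \<xi> "norm x *\<^sub>R y"] xi(1) by (simp add: norm_minus_commute)
  moreover have "norm (y - \<xi>) \<le> norm (y - norm x *\<^sub>R y) + norm (norm x *\<^sub>R y - \<xi>)"
    using norm_triangle_ineq[of "y - norm x *\<^sub>R y" "norm x *\<^sub>R y - \<xi>"] by simp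
  moreover have "norm (y - norm x *\<^sub>R y) \<le> 1 - norm x"
  proof -
    have "y - norm x *\<^sub>R y = (1 - norm x) *\<^sub>R y" by (simp add: algebra_simps)
    then have "norm (y - norm x *\<^sub>R y) = (1 - norm x) * norm y" using x by simp
    also have "\<dots> \<le> 1 - norm x" using x y by (simp add: mult_left_le)
    finally show ?thesis .
  qed
  ultimately have "1 - norm x \<le> norm (norm x *\<^sub>R y - \<xi>)" "norm (y - \<xi>) \<le> 1 - norm x + norm (norm x *\<^sub>R y - \<xi>)"
    by simp_all
  then show ?thesis unfolding D using x by (simp add: field_simps)
qed

text \<open>Along each ray the integrand contributes at most a multiple of
  \<open>d powr (- \<kappa>)\<close>, while the unweighted function
  \<open>(norm (y - \<xi>) + \<epsilon>) powr (- (\<kappa> + 1))\<close> contributes at least such a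
  multiple. The weight is thus traded for a change of exponent, and the new integral is uniformly
  bounded since \<open>\<kappa> + 1 < n\<close>.\<close>

lemma weighted_ball_integral:
  fixes s \<beta> :: real
  assumes n: "CARD('n::finite) \<ge> 2" and s: "s > -1" and b: "\<beta> \<ge> 0" "\<beta> < real CARD('n) + s"
  obtains C where "C \<ge> 0" "\<And>\<xi> \<epsilon>. norm (\<xi> :: real^'n) = 1 \<Longrightarrow> 0 < \<epsilon> \<Longrightarrow> \<epsilon> \<le> 1 \<Longrightarrow>
    (\<integral>\<^sup>+y. ennreal ((1 - norm y) powr s * (norm (y - \<xi>) + \<epsilon>) powr (- \<beta>)) * indicator unit_ball y \<partial>lborel) \<le> ennreal C"
proof -
  let ?n = "real CARD('n)"
  \<comment> \<open>\<open>\<kappa>\<close> has to be positive, at least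
    \<open>\<beta> - s - 1\<close> and less than \<open>n - 1\<close>. The value
    \<open>(n - 1) / 2\<close> secures positivity and stays below \<open>n - 1\<close> because
    \<open>n \<ge> 2\<close>.\<close>
  define \<kappa> where "\<kappa> = max (\<beta> - s - 1) ((?n - 1) / 2)"
  have n2: "?n \<ge> 2" using n by simp
  have k: "\<kappa> > 0" "\<kappa> \<ge> \<beta> - s - 1" "\<kappa> + 1 < ?n"
    using n2 b unfolding \<kappa>_def max_def by (auto simp: field_simps)
  obtain C1 where C1: "C1 > 0" "\<And>d. 0 < d \<Longrightarrow> d \<le> 2 \<Longrightarrow>
    (\<integral>\<^sup>+t. ennreal (t powr s * (t + d) powr (- \<beta>)) * indicator {0<..<1} t \<partial>lborel) \<le> ennreal (C1 * d powr (- \<kappa>))"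
    by (rule nn_integral_powr_shift_le[OF s b(1), of \<kappa>]) (use k in auto)
  define J where "J = (\<integral>\<^sup>+z. ennreal (norm z powr (- (\<kappa> + 1))) * indicator (ball 0 2) (z :: real^'n) \<partial>lborel)"
  have J: "J < \<infinity>" unfolding J_def by (rule nn_integral_norm_powr_finite[OF k(3)])
  \<comment> \<open>From below only the end piece \<open>1 - d / 4 < r < 1\<close> of a ray is used:
    its length is \<open>d / 4\<close>, the distance on it is at most \<open>5 / 2 * d\<close>, and
    \<open>r \<ge> 1 / 2\<close> in the Jacobian.\<close>
  define c0 where "c0 = (1 / 4) * (5 / 2) powr (- (\<kappa> + 1)) * (1 / 2) ^ (CARD('n) - 1)"
  have c0: "c0 > 0" by (simp add: c0_def)
  define C2 where "C2 = 2 powr \<beta> * C1 / c0"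
  have C2: "C2 > 0" using c0 C1(1) by (simp add: C2_def)
  have "(\<integral>\<^sup>+y. ennreal ((1 - norm y) powr s * (norm (y - \<xi>) + \<epsilon>) powr (- \<beta>)) * indicator unit_ball y \<partial>lborel) \<le> ennreal C2 * J"
    if xi: "norm \<xi> = 1" and e: "0 < \<epsilon>" "\<epsilon> \<le> 1" for \<xi> :: "real^'n" and \<epsilon>
  proof -
    have [measurable]: "(unit_ball :: (real^'n) set) \<in> sets borel" by simp
    let ?g = "\<lambda>y::real^'n. ennreal ((1 - norm y) powr s * (norm (y - \<xi>) + \<epsilon>) powr (- \<beta>)) * indicator unit_ball y"
    let ?h = "\<lambda>y::real^'n. ennreal ((norm (y - \<xi>) + \<epsilon>) powr (- (\<kappa> + 1))) * indicator unit_ball y"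
    have "(\<integral>\<^sup>+y. ?g y \<partial>lborel) \<le> ennreal C2 * (\<integral>\<^sup>+y. ?h y \<partial>lborel)"
    proof (rule radial_comparison)
      show "?g \<in> borel_measurable borel" "?h \<in> borel_measurable borel" by measurable
      fix \<eta> :: "real^'n" assume eta: "norm \<eta> = 1"
      \<comment> \<open>The halving keeps \<open>d\<close> at most 3/2, inside the range
        \<open>d \<le> 2\<close> of the one-dimensional estimate.\<close>
      define d where "d = (norm (\<eta> - \<xi>) + \<epsilon>) / 2"
      have "norm (\<eta> - \<xi>) \<le> 2" using norm_triangle_ineq4[of \<eta> \<xi>] eta xi by simp
      then have d: "0 < d" "d \<le> 3 / 2" using e by (auto simp: d_def intro: add_nonneg_pos)
      have nr: "norm (\<eta> - r *\<^sub>R \<eta>) = 1 - r" if "r < 1" for r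
      proof -
        have "\<eta> - r *\<^sub>R \<eta> = (1 - r) *\<^sub>R \<eta>" by (simp add: algebra_simps)
        then show ?thesis using that eta by simp
      qed
      have lo: "(1 - r + d) / 2 \<le> norm (r *\<^sub>R \<eta> - \<xi>) + \<epsilon>" if r: "0 < r" "r < 1" for r
      proof -
        have "1 - r \<le> norm (r *\<^sub>R \<eta> - \<xi>)" using norm_triangle_ineq2[of \<xi> "r *\<^sub>R \<eta>"] xi eta r by (simp add: norm_minus_commute)
        moreover have "norm (\<eta> - \<xi>) \<le> norm (\<eta> - r *\<^sub>R \<eta>) + norm (r *\<^sub>R \<eta> - \<xi>)"
          using norm_triangle_ineq[of "\<eta> - r *\<^sub>R \<eta>" "r *\<^sub>R \<eta> - \<xi>"] by simp
        moreover have "(1 - r + (a + \<epsilon>) / 2) / 2 \<le> N + \<epsilon>" if "1 - r \<le> N" "a \<le> m + N" "m = 1 - r" for a N m :: real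
          using that e by (simp add: field_simps)
        ultimately show ?thesis using nr[OF r(2)] unfolding d_def by blast
      qed
      have up: "norm (r *\<^sub>R \<eta> - \<xi>) + \<epsilon> \<le> 2 * (1 - r + d)" if r: "0 < r" "r < 1" for r
      proof -
        have "norm (r *\<^sub>R \<eta> - \<xi>) \<le> norm (r *\<^sub>R \<eta> - \<eta>) + norm (\<eta> - \<xi>)"
          using norm_triangle_ineq[of "r *\<^sub>R \<eta> - \<eta>" "\<eta> - \<xi>"] by simp
        moreover have "N + \<epsilon> \<le> 2 * (1 - r + (a + \<epsilon>) / 2)" if "N \<le> m + a" "m = 1 - r" for a N m :: real
          using that r e by (simp add: field_simps)
        ultimately show ?thesis using nr[OF r(2)] unfolding d_def norm_minus_commute[of "r *\<^sub>R \<eta>" \<eta>] by blast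
      qed
      have "(\<integral>\<^sup>+r. ?g (r *\<^sub>R \<eta>) * ennreal (r ^ (DIM(real^'n) - 1)) * indicator {0<..} r \<partial>lborel) \<le>
        (\<integral>\<^sup>+r. ennreal (2 powr \<beta>) * (ennreal ((1 - r) powr s * (1 - r + d) powr (- \<beta>)) * indicator {0<..<1} (1 - r)) \<partial>lborel)"
      proof (rule nn_integral_mono)
        fix r :: real
        show "?g (r *\<^sub>R \<eta>) * ennreal (r ^ (DIM(real^'n) - 1)) * indicator {0<..} r \<le>
          ennreal (2 powr \<beta>) * (ennreal ((1 - r) powr s * (1 - r + d) powr (- \<beta>)) * indicator {0<..<1} (1 - r))"
        proof (cases "0 < r \<and> r < 1")
          case True
          have "(norm (r *\<^sub>R \<eta> - \<xi>) + \<epsilon>) powr (- \<beta>) \<le> ((1 - r + d) / 2) powr (- \<beta>)"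
            using lo True d b by (intro powr_mono2') auto
          also have "\<dots> = 2 powr \<beta> * (1 - r + d) powr (- \<beta>)" by (simp add: powr_divide powr_minus_divide)
          finally have 1: "(1 - r) powr s * (norm (r *\<^sub>R \<eta> - \<xi>) + \<epsilon>) powr (- \<beta>) \<le> (1 - r) powr s * (2 powr \<beta> * (1 - r + d) powr (- \<beta>))"
            by (rule mult_left_mono) simp
          have "(1 - r) powr s * (norm (r *\<^sub>R \<eta> - \<xi>) + \<epsilon>) powr (- \<beta>) * r ^ (CARD('n) - 1) \<le> (1 - r) powr s * (norm (r *\<^sub>R \<eta> - \<xi>) + \<epsilon>) powr (- \<beta>)"
            using True by (intro mult_left_le power_le_one) auto
          with 1 have "(1 - r) powr s * (norm (r *\<^sub>R \<eta> - \<xi>) + \<epsilon>) powr (- \<beta>) * r ^ (CARD('n) - 1) \<le> 2 powr \<beta> * ((1 - r) powr s * (1 - r + d) powr (- \<beta>))"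
            by (simp add: mult_ac)
          then show ?thesis using True eta by (simp flip: ennreal_mult)
        qed (use eta in \<open>auto simp: indicator_def\<close>)
      qed
      also have "\<dots> = ennreal (2 powr \<beta>) * (\<integral>\<^sup>+r. ennreal ((1 - r) powr s * (1 - r + d) powr (- \<beta>)) * indicator {0<..<1} (1 - r) \<partial>lborel)"
        by (rule nn_integral_cmult) measurable
      also have "(\<integral>\<^sup>+r. ennreal ((1 - r) powr s * (1 - r + d) powr (- \<beta>)) * indicator {0<..<1} (1 - r) \<partial>lborel) =
          (\<integral>\<^sup>+t. ennreal (t powr s * (t + d) powr (- \<beta>)) * indicator {0<..<1} t \<partial>lborel)"
        by (subst (2) nn_integral_real_affine[where c="-1" and t=1]) auto
      also have "ennreal (2 powr \<beta>) * \<dots> \<le> ennreal (2 powr \<beta>) * ennreal (C1 * d powr (- \<kappa>))"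
        using d by (intro mult_left_mono C1(2)) auto
      also have "\<dots> = ennreal C2 * ennreal (c0 * d powr (- \<kappa>))"
        using c0 C1(1) by (simp add: C2_def flip: ennreal_mult)
      also have "ennreal (c0 * d powr (- \<kappa>)) \<le>
         (\<integral>\<^sup>+r. ?h (r *\<^sub>R \<eta>) * ennreal (r ^ (DIM(real^'n) - 1)) * indicator {0<..} r \<partial>lborel)"
      proof -
        define m where "m = (5 / 2 * d) powr (- (\<kappa> + 1)) * (1 / 2) ^ (CARD('n) - 1)"
        have "ennreal (c0 * d powr (- \<kappa>)) = ennreal m * ennreal (d / 4)"
        proof -
          have "d powr (- \<kappa>) = d * d powr (- (\<kappa> + 1))"
            using d by (simp add: powr_mult_base)
          moreover have "(5 / 2 * d) powr (- (\<kappa> + 1)) = (5 / 2) powr (- (\<kappa> + 1)) * d powr (- (\<kappa> + 1))"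
            by (rule powr_mult)
          ultimately have "c0 * d powr (- \<kappa>) = m * (d / 4)" unfolding c0_def m_def by (simp only:) (simp only: times_divide_eq_right times_divide_eq_left mult_1_left mult_1_right mult_ac)
          moreover have "0 \<le> m" by (simp add: m_def)
          ultimately show ?thesis using d by (simp only: ennreal_mult[of m "d / 4"])
        qed
        also have "\<dots> = (\<integral>\<^sup>+r. ennreal m * indicator {1 - d / 4<..<1} r \<partial>lborel)"
          using d by (simp add: nn_integral_cmult)
        also have "\<dots> \<le> (\<integral>\<^sup>+r. ?h (r *\<^sub>R \<eta>) * ennreal (r ^ (DIM(real^'n) - 1)) * indicator {0<..} r \<partial>lborel)"
        proof (rule nn_integral_mono)
          fix r :: real
          show "ennreal m * indicator {1 - d / 4<..<1} r \<le> ?h (r *\<^sub>R \<eta>) * ennreal (r ^ (DIM(real^'n) - 1)) * indicator {0<..} r"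
          proof (cases "r \<in> {1 - d / 4<..<1}")
            case True
            then have r: "1 / 2 \<le> r" "0 < r" "r < 1" using d by auto
            have "norm (r *\<^sub>R \<eta> - \<xi>) + \<epsilon> \<le> 5 / 2 * d" using up[OF r(2,3)] True by auto
            then have "(5 / 2 * d) powr (- (\<kappa> + 1)) \<le> (norm (r *\<^sub>R \<eta> - \<xi>) + \<epsilon>) powr (- (\<kappa> + 1))"
              using e k by (intro powr_mono2') (auto intro: add_nonneg_pos)
            moreover have "(1 / 2) ^ (CARD('n) - 1) \<le> r ^ (CARD('n) - 1)" using r by (intro power_mono) auto
            ultimately have "m \<le> (norm (r *\<^sub>R \<eta> - \<xi>) + \<epsilon>) powr (- (\<kappa> + 1)) * r ^ (CARD('n) - 1)"
              unfolding m_def by (intro mult_mono) auto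
            then show ?thesis using True r eta by (simp flip: ennreal_mult)
          qed simp
        qed
        finally show ?thesis .
      qed
      finally show "(\<integral>\<^sup>+r. ?g (r *\<^sub>R \<eta>) * ennreal (r ^ (DIM(real^'n) - 1)) * indicator {0<..} r \<partial>lborel) \<le>
        ennreal C2 * (\<integral>\<^sup>+r. ?h (r *\<^sub>R \<eta>) * ennreal (r ^ (DIM(real^'n) - 1)) * indicator {0<..} r \<partial>lborel)"
        by (simp add: mult_left_mono)
    qed
    also have "(\<integral>\<^sup>+y. ?h y \<partial>lborel) \<le> J"
    proof -
      have "(\<integral>\<^sup>+y. ?h y \<partial>lborel) \<le> (\<integral>\<^sup>+y. ennreal (norm (y - \<xi>) powr (- (\<kappa> + 1))) * indicator (ball 0 2) (y - \<xi>) \<partial>lborel)"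
      proof (rule nn_integral_mono_AE)
        have "AE y in lborel. y \<noteq> \<xi>" by (rule AE_lborel_singleton)
        then show "AE y in lborel. ?h y \<le> ennreal (norm (y - \<xi>) powr (- (\<kappa> + 1))) * indicator (ball 0 2) (y - \<xi>)"
        proof eventually_elim
          case (elim y)
          show ?case
          proof (cases "y \<in> unit_ball")
            case True
            then have "norm (y - \<xi>) < 2" using norm_triangle_ineq4[of y \<xi>] xi by simp
            moreover have "(norm (y - \<xi>) + \<epsilon>) powr (- (\<kappa> + 1)) \<le> norm (y - \<xi>) powr (- (\<kappa> + 1))"
              using elim e k by (intro powr_mono2') auto
            ultimately show ?thesis using True by (auto intro: ennreal_leI)
          qed simp
        qed
      qed
      also have "\<dots> = J"
      proof -
        have [measurable]: "ball (0::real^'n) 2 \<in> sets borel" by simp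
        have "lborel = distr lborel borel (\<lambda>x. - \<xi> + x)" by (rule lborel_distr_plus[symmetric])
        then have "J = (\<integral>\<^sup>+z. ennreal (norm z powr (- (\<kappa> + 1))) * indicator (ball 0 2) (z :: real^'n) \<partial>distr lborel borel (\<lambda>x. - \<xi> + x))"
          unfolding J_def by simp
        also have "\<dots> = (\<integral>\<^sup>+y. ennreal (norm (- \<xi> + y) powr (- (\<kappa> + 1))) * indicator (ball 0 2) (- \<xi> + y) \<partial>lborel)"
          by (rule nn_integral_distr) measurable
        finally show ?thesis by simp
      qed
      finally show ?thesis .
    qed
    finally show ?thesis by (simp add: mult_left_mono)
  qed
  moreover have "ennreal C2 * J = ennreal (C2 * enn2real J)"
    using J C2 by (cases J) (auto simp flip: ennreal_mult)
  ultimately show thesis using that[of "C2 * enn2real J"] C2 by simp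
qed

text \<open>Reduces to a pole on the boundary through \<open>bracket_lower\<close>, with
  \<open>\<epsilon> = 1 - norm x\<close>. The condition \<open>\<beta> < n + s\<close> selects the
  regime in which the Forelli-Rudin integral stays bounded as \<open>x\<close> approaches the
  sphere.\<close>

lemma kernel_integral_bound:
  fixes s \<beta> :: real
  assumes n: "CARD('n::finite) \<ge> 2" and s: "s > -1" and b: "\<beta> \<ge> 0" "\<beta> < real CARD('n) + s"
  obtains C where "C \<ge> 0" "\<And>x :: real^'n. norm x < 1 \<Longrightarrow>
    (\<integral>\<^sup>+y. ennreal ((1 - (norm y)\<^sup>2) powr s * (1 - 2 * (x \<bullet> y) + (norm x * norm y)\<^sup>2) powr (- \<beta> / 2)) \<partial>nu) \<le> ennreal C"
proof -
  obtain C where C: "C \<ge> 0" "\<And>\<xi> \<epsilon>. norm (\<xi> :: real^'n) = 1 \<Longrightarrow> 0 < \<epsilon> \<Longrightarrow> \<epsilon> \<le> 1 \<Longrightarrow>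
    (\<integral>\<^sup>+y. ennreal ((1 - norm y) powr s * (norm (y - \<xi>) + \<epsilon>) powr (- \<beta>)) * indicator unit_ball y \<partial>lborel) \<le> ennreal C"
    by (rule weighted_ball_integral[OF n s b]) blast
  define k where "k = 1 / measure lebesgue (unit_ball :: (real^'n) set)"
  have k: "k > 0" unfolding k_def using unit_ball_measure_pos by simp
  define K where "K = 2 powr \<bar>s\<bar> * 4 powr \<beta>"
  have K: "K > 0" by (simp add: K_def)
  have "(\<integral>\<^sup>+y. ennreal ((1 - (norm y)\<^sup>2) powr s * (1 - 2 * (x \<bullet> y) + (norm x * norm y)\<^sup>2) powr (- \<beta> / 2)) \<partial>nu) \<le> ennreal (k * (K * C))"
    if x: "norm x < 1" for x :: "real^'n"
  proof -
    have [measurable]: "(unit_ball :: (real^'n) set) \<in> sets borel" by simp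
    obtain \<xi> where xi: "norm \<xi> = 1" "x = norm x *\<^sub>R \<xi>"
    proof (cases "x = 0")
      case True
      show thesis by (rule that[of "axis undefined 1"]) (simp_all add: True)
    next
      case False
      show thesis by (rule that[of "x /\<^sub>R norm x"]) (use False in simp_all)
    qed
    define \<epsilon> where "\<epsilon> = 1 - norm x"
    have e: "0 < \<epsilon>" "\<epsilon> \<le> 1" using x by (auto simp: \<epsilon>_def)
    let ?f = "\<lambda>y. (1 - (norm y)\<^sup>2) powr s * (1 - 2 * (x \<bullet> y) + (norm x * norm y)\<^sup>2) powr (- \<beta> / 2)"
    let ?g = "\<lambda>y. (1 - norm y) powr s * (norm (y - \<xi>) + \<epsilon>) powr (- \<beta>)"
    have fg: "?f y \<le> K * ?g y" if y: "norm y < 1" for y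
    proof -
      have "1 - (norm y)\<^sup>2 = (1 - norm y) * (1 + norm y)" by (simp add: power2_eq_square algebra_simps)
      then have "(1 - (norm y)\<^sup>2) powr s = (1 - norm y) powr s * (1 + norm y) powr s"
        by (simp add: powr_mult)
      also have "(1 + norm y) powr s \<le> (1 + norm y) powr \<bar>s\<bar>" by (intro powr_mono) auto
      also have "(1 + norm y) powr \<bar>s\<bar> \<le> 2 powr \<bar>s\<bar>" using y by (intro powr_mono2) auto
      finally have 1: "(1 - (norm y)\<^sup>2) powr s \<le> (1 - norm y) powr s * 2 powr \<bar>s\<bar>"
        by (simp add: mult_left_mono)
      let ?E = "1 - 2 * (x \<bullet> y) + (norm x * norm y)\<^sup>2"
      have nz: "0 < (norm (y - \<xi>) + \<epsilon>) / 4" using e by (simp add: add_nonneg_pos)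
      have "0 < sqrt ?E" using less_le_trans[OF nz] bracket_lower[OF xi x y] by (simp only: \<epsilon>_def)
      then have Ep: "0 < ?E" by (simp only: real_sqrt_gt_0_iff)
      have "?E powr (- \<beta> / 2) = sqrt ?E powr (- \<beta>)" using Ep by (simp add: powr_half_sqrt[symmetric] powr_powr)
      also have "\<dots> \<le> ((norm (y - \<xi>) + \<epsilon>) / 4) powr (- \<beta>)"
        using bracket_lower[OF xi x y] nz b by (intro powr_mono2') (auto simp: \<epsilon>_def)
      also have "\<dots> = 4 powr \<beta> * (norm (y - \<xi>) + \<epsilon>) powr (- \<beta>)" by (simp add: powr_divide powr_minus_divide)
      finally have "?f y \<le> ((1 - norm y) powr s * 2 powr \<bar>s\<bar>) * (4 powr \<beta> * (norm (y - \<xi>) + \<epsilon>) powr (- \<beta>))"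
        using 1 by (intro mult_mono) auto
      then show ?thesis by (simp add: K_def mult_ac)
    qed
    have eq: "(\<integral>\<^sup>+y. ennreal (?f y) \<partial>nu) = ennreal k * (\<integral>\<^sup>+y. ennreal (?f y) * indicator unit_ball y \<partial>lborel)"
      unfolding k_def by (rule nn_integral_nu) measurable
    have "(\<integral>\<^sup>+y. ennreal (?f y) * indicator unit_ball y \<partial>lborel) \<le> (\<integral>\<^sup>+y. ennreal K * (ennreal (?g y) * indicator unit_ball y) \<partial>lborel)"
    proof (rule nn_integral_mono)
      fix y
      show "ennreal (?f y) * indicator unit_ball y \<le> ennreal K * (ennreal (?g y) * indicator unit_ball y)"
      proof (cases "y \<in> unit_ball")
        case True
        then show ?thesis using fg[of y] K by (simp flip: ennreal_mult)
      qed simp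
    qed
    also have "\<dots> = ennreal K * (\<integral>\<^sup>+y. ennreal (?g y) * indicator unit_ball y \<partial>lborel)"
      by (rule nn_integral_cmult) measurable
    also have "\<dots> \<le> ennreal K * ennreal C"
      by (rule mult_left_mono[OF C(2)[OF xi(1) e]]) simp
    finally have "ennreal k * (\<integral>\<^sup>+y. ennreal (?f y) * indicator unit_ball y \<partial>lborel) \<le> ennreal k * (ennreal K * ennreal C)"
      by (rule mult_left_mono) simp
    then show ?thesis unfolding eq using k K C(1) by (simp add: ennreal_mult)
  qed
  moreover have "k * (K * C) \<ge> 0" using k K C(1) by simp
  ultimately show thesis using that by blast
qed

section \<open>Sufficiency\<close>

lemma R_kernel_upper:
  assumes n: "CARD('n::finite) \<ge> 2"
    and k: "\<kappa> \<ge> 0" "\<kappa> \<ge> real CARD('n) + c" "\<kappa> > 0 \<or> \<kappa> > real CARD('n) + c"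
  obtains C where "C \<ge> 0" "\<And>x y :: real^'n. norm x < 1 \<Longrightarrow> norm y < 1 \<Longrightarrow>
     \<bar>R_kernel c x y\<bar> \<le> C * (1 - 2 * (x \<bullet> y) + (norm x * norm y)\<^sup>2) powr (- \<kappa> / 2)"
proof -
  have "kernel_bound (zon (real CARD('n) / 2)) (gam (real CARD('n) / 2) c) \<kappa>"
    by (rule kernel_bound_zon) (use n k in auto)
  then obtain C where C: "C \<ge> 0" "\<And>u v. u\<^sup>2 \<le> v \<Longrightarrow> v < 1 \<Longrightarrow>
     \<bar>\<Sum>k. gam (real CARD('n) / 2) c k * zon (real CARD('n) / 2) k u v\<bar> \<le> C * (1 - 2 * u + v) powr (- \<kappa> / 2)"
    unfolding kernel_bound_def by blast
  show thesis
  proof (rule that[OF C(1)])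
    fix x y :: "real^'n" assume "norm x < 1" "norm y < 1"
    then have "(norm x * norm y)\<^sup>2 < 1" by (intro norm_prod_less(1)[of x "norm x"]) auto
    then show "\<bar>R_kernel c x y\<bar> \<le> C * (1 - 2 * (x \<bullet> y) + (norm x * norm y)\<^sup>2) powr (- \<kappa> / 2)"
      unfolding R_kernel_eq by (intro C(2) inner_sq_le)
  qed
qed

section \<open>The normalised measure and its weights\<close>

lemma emeasure_nu:
  assumes "A \<in> sets borel" "A \<subseteq> unit_ball"
  shows "emeasure (nu :: (real^'n::finite) measure) A = ennreal (measure lebesgue A / measure lebesgue (unit_ball :: (real^'n) set))"
proof -
  have A: "A \<in> sets lebesgue" using assms(1) by auto
  have fin: "emeasure lborel A < \<infinity>"
    using emeasure_bounded_finite[OF bounded_subset[OF bounded_ball assms(2)]] .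
  have "emeasure nu A = (\<integral>\<^sup>+y. indicator A y \<partial>(nu :: (real^'n) measure))"
    using assms by (intro nn_integral_indicator[symmetric]) (auto simp: nu_def sets_restrict_space)
  also have "\<dots> = ennreal (1 / measure lebesgue (unit_ball :: (real^'n) set)) * (\<integral>\<^sup>+y. indicator A y * indicator unit_ball y \<partial>lborel)"
    by (rule nn_integral_nu) (use assms in measurable)
  also have "(\<lambda>y. indicator A y * indicator unit_ball y :: ennreal) = indicator A"
    using assms(2) by (auto simp: indicator_def fun_eq_iff)
  also have "(\<integral>\<^sup>+y. indicator A y \<partial>lborel) = emeasure lborel A"
    using assms(1) by simp
  also have "\<dots> = ennreal (measure lebesgue A)"
    using fin assms by (simp add: measure_def emeasure_completion ennreal_enn2real_if)
  finally show ?thesis by (simp flip: ennreal_mult)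
qed

lemma emeasure_nu_space: "emeasure (nu :: (real^'n::finite) measure) unit_ball = 1"
  using unit_ball_measure_pos[where 'n = 'n] by (subst emeasure_nu) auto

lemma prob_space_nu: "prob_space (nu :: (real^'n::finite) measure)"
  by (rule prob_spaceI) (simp add: emeasure_nu_space)

lemma measure_nu:
  assumes "A \<in> sets borel" "A \<subseteq> unit_ball"
  shows "measure (nu :: (real^'n::finite) measure) A = measure lebesgue A / measure lebesgue (unit_ball :: (real^'n) set)"
  using emeasure_nu[OF assms] by (simp add: measure_def)

lemma weight_measurable: "(\<lambda>y :: real^'n::finite. (1 - (norm y)\<^sup>2) powr a) \<in> borel_measurable nu"
  by (rule borel_measurable_nu) measurable

lemma weight_pos: "norm y < 1 \<Longrightarrow> 0 < 1 - (norm y)\<^sup>2"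
  by (simp add: abs_square_less_1)

text \<open>A Bochner integral defaults to 0 when it does not exist, so integrability of the weight
  must come before positivity; it is the kernel estimate with \<open>\<beta> = 0\<close> at the
  centre.\<close>

lemma V_const_pos:
  assumes n: "CARD('n::finite) \<ge> 2"
  shows "V_const TYPE('n) a > 0"
proof (cases "a > -1")
  case True
  obtain C where C: "C \<ge> 0" "\<And>x :: real^'n. norm x < 1 \<Longrightarrow>
    (\<integral>\<^sup>+y. ennreal ((1 - (norm y)\<^sup>2) powr a * (1 - 2 * (x \<bullet> y) + (norm x * norm y)\<^sup>2) powr (- (0::real) / 2)) \<partial>nu) \<le> ennreal C"
    by (rule kernel_integral_bound[OF n True, of 0]) (use True n in auto)
  have int: "integrable nu (\<lambda>y :: real^'n. (1 - (norm y)\<^sup>2) powr a)"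
  proof (rule integrableI_bounded[OF weight_measurable])
    have "(\<integral>\<^sup>+(y :: real^'n). ennreal (norm ((1 - (norm y)\<^sup>2) powr a)) \<partial>nu) \<le> ennreal C"
      using C(2)[of 0] by simp
    then show "(\<integral>\<^sup>+(y :: real^'n). ennreal (norm ((1 - (norm y)\<^sup>2) powr a)) \<partial>nu) < \<infinity>"
      by (rule le_less_trans) simp
  qed
  have "(\<integral>(y :: real^'n). (1 - (norm y)\<^sup>2) powr a \<partial>nu) \<noteq> 0"
  proof
    assume "(\<integral>(y :: real^'n). (1 - (norm y)\<^sup>2) powr a \<partial>nu) = 0"
    then have "AE y :: real^'n in nu. (1 - (norm y)\<^sup>2) powr a = 0"
      using integral_nonneg_eq_0_iff_AE[OF int] by simp
    then have "AE y :: real^'n in nu. False"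
      using nu_AE_ball by eventually_elim (use weight_pos in fastforce)
    then show False using prob_space.AE_False[OF prob_space_nu] by blast
  qed
  moreover have "(\<integral>(y :: real^'n). (1 - (norm y)\<^sup>2) powr a \<partial>nu) \<ge> 0" by (rule integral_nonneg_AE) simp
  ultimately show ?thesis using True by (simp add: V_const_def less_le)
qed (simp add: V_const_def)

lemma nu_w_integral:
  fixes f :: "real^'n::finite \<Rightarrow> real"
  assumes n: "CARD('n) \<ge> 2" and f: "f \<in> borel_measurable nu"
  shows "integrable (nu_w a) f \<longleftrightarrow> integrable nu (\<lambda>y. (1 - (norm y)\<^sup>2) powr a * f y)"
    and "(\<integral>y. f y \<partial>nu_w a) = (\<integral>y. (1 - (norm y)\<^sup>2) powr a * f y \<partial>nu) / V_const TYPE('n) a"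
proof -
  let ?V = "V_const TYPE('n) a"
  have V: "?V > 0" by (rule V_const_pos[OF n])
  have m: "(\<lambda>y :: real^'n. (1 - (norm y)\<^sup>2) powr a / ?V) \<in> borel_measurable nu"
    by (intro borel_measurable_divide weight_measurable borel_measurable_const)
  have nn: "AE y :: real^'n in nu. 0 \<le> (1 - (norm y)\<^sup>2) powr a / ?V" using V by simp
  have "integrable (nu_w a) f \<longleftrightarrow> integrable nu (\<lambda>y. (1 / ?V) * ((1 - (norm y)\<^sup>2) powr a * f y))"
    unfolding nu_w_def integrable_density[OF f m nn] by simp
  also have "\<dots> \<longleftrightarrow> integrable nu (\<lambda>y. (1 - (norm y)\<^sup>2) powr a * f y)"
    using V by (simp only: integrable_mult_left_iff integrable_mult_right_iff) simp
  finally show "integrable (nu_w a) f \<longleftrightarrow> integrable nu (\<lambda>y. (1 - (norm y)\<^sup>2) powr a * f y)" .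
  show "(\<integral>y. f y \<partial>nu_w a) = (\<integral>y. (1 - (norm y)\<^sup>2) powr a * f y \<partial>nu) / ?V"
    unfolding nu_w_def integral_density[OF f m nn] by simp
qed

text \<open>One integrable majorant for each point \<open>x\<close>, with a uniform bound on its
  integral, yields all that boundedness demands, harmonicity included.\<close>

lemma T_boundedI:
  fixes p :: ereal
  assumes n: "CARD('n::finite) \<ge> 2" and C: "C \<ge> 0"
    and dom: "\<And>f :: real^'n \<Rightarrow> complex. f \<in> Lp_w a p \<Longrightarrow> \<exists>N. Lp_norm a p f = ereal N \<and>
      (\<forall>x. norm x < 1 \<longrightarrow> (\<exists>D. integrable nu D \<and> (AE y in nu. \<bar>R_kernel c x y\<bar> * (1 - (norm y)\<^sup>2) powr b * cmod (f y) \<le> D y) \<and> (\<integral>y. D y \<partial>nu) \<le> C * N))"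
  shows "T_bounded TYPE('n) b c a p"
  unfolding T_bounded_def
proof (intro exI[of _ C] ballI conjI)
  fix f :: "real^'n \<Rightarrow> complex" assume f: "f \<in> Lp_w a p"
  then have fm: "f \<in> borel_measurable nu" by (simp add: Lp_w_def)
  obtain N where N: "Lp_norm a p f = ereal N" and D: "\<And>x. norm x < 1 \<Longrightarrow> \<exists>D. integrable nu D \<and>
      (AE y in nu. \<bar>R_kernel c x y\<bar> * (1 - (norm y)\<^sup>2) powr b * cmod (f y) \<le> D y) \<and> (\<integral>y. D y \<partial>nu) \<le> C * N"
    using dom[OF f] by blast
  let ?F = "\<lambda>x y. complex_of_real (R_kernel c x y * (1 - (norm y)\<^sup>2) powr b) * f y"
  have Fm: "(\<lambda>y. ?F x y) \<in> borel_measurable nu" for x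
  proof (rule borel_measurable_times[OF _ fm])
    have "(\<lambda>y. R_kernel c x y * (1 - (norm y)\<^sup>2) powr b) \<in> borel_measurable nu"
      by (rule borel_measurable_times[OF borel_measurable_nu[OF R_kernel_measurable] weight_measurable])
    then show "(\<lambda>y. complex_of_real (R_kernel c x y * (1 - (norm y)\<^sup>2) powr b)) \<in> borel_measurable nu"
      by measurable
  qed
  have nF: "norm (?F x y) = \<bar>R_kernel c x y\<bar> * (1 - (norm y)\<^sup>2) powr b * cmod (f y)" for x y
    by (simp add: norm_mult abs_mult)
  have int: "integrable nu (\<lambda>y. ?F x y)" if x: "norm x < 1" for x
  proof -
    obtain D where D: "integrable nu D" "AE y in nu. \<bar>R_kernel c x y\<bar> * (1 - (norm y)\<^sup>2) powr b * cmod (f y) \<le> D y"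
      using D[OF x] by blast
    show ?thesis
      by (rule Bochner_Integration.integrable_bound[OF D(1) Fm]) (use D(2) in \<open>eventually_elim, simp only: nF, simp\<close>)
  qed
  have bd: "cmod (T_op b c f x) \<le> C * N" if x: "norm x < 1" for x
  proof -
    obtain D where D: "integrable nu D" "AE y in nu. \<bar>R_kernel c x y\<bar> * (1 - (norm y)\<^sup>2) powr b * cmod (f y) \<le> D y" "(\<integral>y. D y \<partial>nu) \<le> C * N"
      using D[OF x] by blast
    have "cmod (T_op b c f x) \<le> (\<integral>y. norm (?F x y) \<partial>nu)" unfolding T_op_def by (rule integral_norm_bound)
    also have "\<dots> \<le> (\<integral>y. D y \<partial>nu)"
      unfolding nF using D(1,2) integrable_norm[OF int[OF x]] unfolding nF by (intro integral_mono_AE)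
    finally show ?thesis using D(3) by simp
  qed
  show "integrable nu (\<lambda>y. ?F x y)" if "x \<in> unit_ball" for x using int that by simp
  \<comment> \<open>At \<open>x = 0\<close> the kernel is 1, so the weighted function is itself
    integrable; this is the input for harmonicity.\<close>
  have "integrable nu (\<lambda>y. ?F 0 y)" by (rule int) simp
  then have g: "integrable nu (\<lambda>y. complex_of_real ((1 - (norm y)\<^sup>2) powr b) * f y)" by simp
  have "T_op b c f = (\<lambda>x. \<integral>y. complex_of_real (R_kernel c x y) * (complex_of_real ((1 - (norm y)\<^sup>2) powr b) * f y) \<partial>nu)"
    by (simp add: T_op_def fun_eq_iff mult.assoc)
  with harmonic_R_integral[OF n g] show "harmonic_on unit_ball (T_op b c f)" by simp
  show "bounded (T_op b c f ` unit_ball)" unfolding bounded_iff using bd by (intro exI[of _ "C * N"]) auto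
  show "ereal (cmod (T_op b c f x)) \<le> ereal C * Lp_norm a p f" if "x \<in> unit_ball" for x
    using bd[of x] that by (simp add: N)
qed

text \<open>The bracket is at least \<open>(1 - norm y)^2\<close>, so the kernel bound with
  \<open>\<kappa> = b - a\<close> becomes a multiple of the weight to the power
  \<open>a - b\<close>. The conditions of \<open>R_kernel_upper\<close> for this
  \<open>\<kappa>\<close> are exactly the two alternatives.\<close>

lemma T_bounded_p1:
  assumes n: "CARD('n::finite) \<ge> 2"
    and cond: "(a < b \<and> c \<le> b - (real CARD('n) + a)) \<or> (a \<le> b \<and> c < b - (real CARD('n) + a))"
  shows "T_bounded TYPE('n) b c a 1"
proof -
  define \<kappa> where "\<kappa> = b - a"
  have k: "\<kappa> \<ge> 0" "\<kappa> \<ge> real CARD('n) + c" "\<kappa> > 0 \<or> \<kappa> > real CARD('n) + c" using cond by (auto simp: \<kappa>_def)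
  obtain C where C: "C \<ge> 0" "\<And>x y :: real^'n. norm x < 1 \<Longrightarrow> norm y < 1 \<Longrightarrow>
     \<bar>R_kernel c x y\<bar> \<le> C * (1 - 2 * (x \<bullet> y) + (norm x * norm y)\<^sup>2) powr (- \<kappa> / 2)"
    by (rule R_kernel_upper[OF n k]) blast
  let ?V = "V_const TYPE('n) a"
  have V: "?V > 0" by (rule V_const_pos[OF n])
  define K where "K = C * 2 powr \<kappa>"
  have K: "K \<ge> 0" using C by (simp add: K_def)
  have ker: "\<bar>R_kernel c x y\<bar> * (1 - (norm y)\<^sup>2) powr b \<le> K * (1 - (norm y)\<^sup>2) powr a"
    if x: "norm x < 1" and y: "norm y < 1" for x y :: "real^'n"
  proof -
    have "(norm x * norm y)\<^sup>2 < 1" using x y by (intro norm_prod_less(1)[of x "norm x"]) auto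
    note E = bracket_bounds[OF inner_sq_le[of x y] this]
    let ?E = "1 - 2 * (x \<bullet> y) + (norm x * norm y)\<^sup>2"
    have w: "1 - (norm y)\<^sup>2 > 0" by (rule weight_pos[OF y])
    have "norm x * norm y \<le> norm y" using x by (simp add: mult_left_le_one_le less_imp_le)
    then have "1 - norm y \<le> 1 - sqrt ((norm x * norm y)\<^sup>2)" by simp
    then have e: "(1 - norm y)\<^sup>2 \<le> ?E" using E(1) y by (intro order_trans[OF power_mono E(1)]) auto
    have "?E powr (- \<kappa> / 2) \<le> ((1 - norm y)\<^sup>2) powr (- \<kappa> / 2)"
      using e y k by (intro powr_mono2') auto
    also have "\<dots> = (1 - norm y) powr (- \<kappa>)"
    proof -
      have "((1 - norm y)\<^sup>2) powr (- \<kappa> / 2) = ((1 - norm y) powr 2) powr (- \<kappa> / 2)" using y by simp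
      then show ?thesis by (simp only: powr_powr) simp
    qed
    also have "\<dots> \<le> ((1 - (norm y)\<^sup>2) / 2) powr (- \<kappa>)"
    proof (rule powr_mono2')
      have "1 - (norm y)\<^sup>2 = (1 - norm y) * (1 + norm y)" by (simp add: power2_eq_square algebra_simps)
      also have "\<dots> \<le> (1 - norm y) * 2" using y by (intro mult_left_mono) auto
      finally show "(1 - (norm y)\<^sup>2) / 2 \<le> 1 - norm y" by simp
    qed (use k w in auto)
    also have "\<dots> = 2 powr \<kappa> * (1 - (norm y)\<^sup>2) powr (- \<kappa>)" by (simp add: powr_divide powr_minus_divide)
    finally have "\<bar>R_kernel c x y\<bar> \<le> C * (2 powr \<kappa> * (1 - (norm y)\<^sup>2) powr (- \<kappa>))"
      using C(2)[OF x y] C(1) by (meson mult_left_mono order_trans)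
    then have "\<bar>R_kernel c x y\<bar> * (1 - (norm y)\<^sup>2) powr b \<le> C * (2 powr \<kappa> * (1 - (norm y)\<^sup>2) powr (- \<kappa>)) * (1 - (norm y)\<^sup>2) powr b"
      by (rule mult_right_mono) simp
    also have "\<dots> = K * (1 - (norm y)\<^sup>2) powr a"
      by (simp add: K_def \<kappa>_def mult.assoc powr_add[symmetric])
    finally show ?thesis .
  qed
  show ?thesis
  proof (rule T_boundedI[OF n, of "K * ?V"])
    show "0 \<le> K * ?V" using K V by simp
    fix f :: "real^'n \<Rightarrow> complex" assume "f \<in> Lp_w a 1"
    then have fm: "f \<in> borel_measurable nu" and fi: "integrable (nu_w a) (\<lambda>x. cmod (f x))"
      by (auto simp: Lp_w_def)
    have nm: "(\<lambda>x. cmod (f x)) \<in> borel_measurable nu" using fm by measurable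
    have wi: "integrable nu (\<lambda>y. (1 - (norm y)\<^sup>2) powr a * cmod (f y))"
      using fi nu_w_integral(1)[OF n nm] by simp
    define N where "N = (\<integral>y. cmod (f y) \<partial>nu_w a)"
    have N0: "N \<ge> 0" unfolding N_def by (rule integral_nonneg_AE) simp
    have NV: "(\<integral>y. (1 - (norm y)\<^sup>2) powr a * cmod (f y) \<partial>nu) = ?V * N"
      unfolding N_def nu_w_integral(2)[OF n nm] using V by simp
    have "Lp_norm a 1 f = ereal N" using N0 by (simp add: Lp_norm_def N_def)
    moreover have "\<exists>D. integrable nu D \<and> (AE y in nu. \<bar>R_kernel c x y\<bar> * (1 - (norm y)\<^sup>2) powr b * cmod (f y) \<le> D y) \<and> (\<integral>y. D y \<partial>nu) \<le> K * ?V * N"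
      if x: "norm x < 1" for x
    proof (intro exI[of _ "\<lambda>y. K * ((1 - (norm y)\<^sup>2) powr a * cmod (f y))"] conjI)
      show "integrable nu (\<lambda>y. K * ((1 - (norm y)\<^sup>2) powr a * cmod (f y)))" using wi by simp
      show "(\<integral>y. K * ((1 - (norm y)\<^sup>2) powr a * cmod (f y)) \<partial>nu) \<le> K * ?V * N" by (simp add: NV)
      show "AE y in nu. \<bar>R_kernel c x y\<bar> * (1 - (norm y)\<^sup>2) powr b * cmod (f y) \<le> K * ((1 - (norm y)\<^sup>2) powr a * cmod (f y))"
        using nu_AE_ball
      proof eventually_elim
        case (elim y)
        from mult_right_mono[OF ker[OF x elim], of "cmod (f y)"] show ?case by (simp add: mult.assoc)
      qed
    qed
    ultimately show "\<exists>N. Lp_norm a 1 f = ereal N \<and> (\<forall>x. norm x < 1 \<longrightarrow> (\<exists>D. integrable nu D \<and>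
       (AE y in nu. \<bar>R_kernel c x y\<bar> * (1 - (norm y)\<^sup>2) powr b * cmod (f y) \<le> D y) \<and> (\<integral>y. D y \<partial>nu) \<le> K * ?V * N))"
      by blast
  qed
qed

lemma R_kernel_integral_bound:
  fixes q s :: real
  assumes n: "CARD('n::finite) \<ge> 2" and q: "q \<ge> 1" and s: "s > -1" and c: "(real CARD('n) + c) * q < real CARD('n) + s"
  obtains C where "C \<ge> 0" "\<And>x :: real^'n. norm x < 1 \<Longrightarrow> integrable nu (\<lambda>y. \<bar>R_kernel c x y\<bar> powr q * (1 - (norm y)\<^sup>2) powr s)"
    "\<And>x :: real^'n. norm x < 1 \<Longrightarrow> (\<integral>y. \<bar>R_kernel c x y\<bar> powr q * (1 - (norm y)\<^sup>2) powr s \<partial>nu) \<le> C"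
proof -
  \<comment> \<open>The second argument of \<open>max\<close> provides a positive exponent whose
    product with \<open>q\<close> is half of \<open>n + s\<close>, well inside the range of
    \<open>kernel_integral_bound\<close>.\<close>
  define \<kappa> where "\<kappa> = max (real CARD('n) + c) ((real CARD('n) + s) / (2 * q))"
  have ns: "real CARD('n) + s > 0" using n s by simp
  have "(real CARD('n) + s) / (2 * q) > 0" using ns q by (intro divide_pos_pos) auto
  then have k: "\<kappa> \<ge> real CARD('n) + c" "\<kappa> > 0" by (auto simp: \<kappa>_def less_max_iff_disj)
  have "(real CARD('n) + s) / (2 * q) * q = (real CARD('n) + s) / 2" using q by simp
  then have kq: "\<kappa> * q < real CARD('n) + s"
    unfolding \<kappa>_def max_def using c ns by (auto split: if_splits)
  obtain C1 where C1: "C1 \<ge> 0" "\<And>x y :: real^'n. norm x < 1 \<Longrightarrow> norm y < 1 \<Longrightarrow>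
     \<bar>R_kernel c x y\<bar> \<le> C1 * (1 - 2 * (x \<bullet> y) + (norm x * norm y)\<^sup>2) powr (- \<kappa> / 2)"
    by (rule R_kernel_upper[OF n, of \<kappa> c]) (use k in auto)
  obtain C2 where C2: "C2 \<ge> 0" "\<And>x :: real^'n. norm x < 1 \<Longrightarrow>
    (\<integral>\<^sup>+y. ennreal ((1 - (norm y)\<^sup>2) powr s * (1 - 2 * (x \<bullet> y) + (norm x * norm y)\<^sup>2) powr (- (\<kappa> * q) / 2)) \<partial>nu) \<le> ennreal C2"
    by (rule kernel_integral_bound[OF n s, of "\<kappa> * q"]) (use k q kq in auto)
  define K where "K = C1 powr q"
  have K: "K \<ge> 0" by (simp add: K_def)
  let ?F = "\<lambda>x y. \<bar>R_kernel c x y\<bar> powr q * (1 - (norm y)\<^sup>2) powr s"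
  have Fm: "(\<lambda>y. ?F x y) \<in> borel_measurable nu" for x :: "real^'n"
    by (rule borel_measurable_times[OF powr_real_measurable[OF borel_measurable_abs[OF borel_measurable_nu[OF R_kernel_measurable]]
      borel_measurable_const] weight_measurable])
  have le: "?F x y \<le> K * ((1 - (norm y)\<^sup>2) powr s * (1 - 2 * (x \<bullet> y) + (norm x * norm y)\<^sup>2) powr (- (\<kappa> * q) / 2))"
    if x: "norm x < 1" and y: "norm y < 1" for x y :: "real^'n"
  proof -
    let ?E = "1 - 2 * (x \<bullet> y) + (norm x * norm y)\<^sup>2"
    have "\<bar>R_kernel c x y\<bar> powr q \<le> (C1 * ?E powr (- \<kappa> / 2)) powr q"
      using C1(2)[OF x y] q by (intro powr_mono2) auto
    also have "\<dots> = K * ?E powr (- (\<kappa> * q) / 2)"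
      by (simp add: K_def powr_mult powr_powr)
    finally have "?F x y \<le> (K * ?E powr (- (\<kappa> * q) / 2)) * (1 - (norm y)\<^sup>2) powr s"
      by (rule mult_right_mono) simp
    then show ?thesis by (simp add: mult_ac)
  qed
  have nn: "(\<integral>\<^sup>+y. ennreal (?F x y) \<partial>nu) \<le> ennreal (K * C2)" if x: "norm x < 1" for x :: "real^'n"
  proof -
    let ?G = "\<lambda>y. (1 - (norm y)\<^sup>2) powr s * (1 - 2 * (x \<bullet> y) + (norm x * norm y)\<^sup>2) powr (- (\<kappa> * q) / 2)"
    have "(\<integral>\<^sup>+y. ennreal (?F x y) \<partial>nu) \<le> (\<integral>\<^sup>+y. ennreal K * ennreal (?G y) \<partial>nu)"
    proof (rule nn_integral_mono)
      fix y :: "real^'n" assume "y \<in> space nu"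
      then have "norm y < 1" by simp
      from le[OF x this] have "ennreal (?F x y) \<le> ennreal (K * ?G y)" by (rule ennreal_leI)
      then show "ennreal (?F x y) \<le> ennreal K * ennreal (?G y)" using K by (simp add: ennreal_mult)
    qed
    moreover have "(\<integral>\<^sup>+y. ennreal K * ennreal (?G y) \<partial>nu) = ennreal K * (\<integral>\<^sup>+y. ennreal (?G y) \<partial>nu)"
    proof (rule nn_integral_cmult)
      show "(\<lambda>y. ennreal (?G y)) \<in> borel_measurable nu"
        by (rule borel_measurable_nu) measurable
    qed
    moreover have "ennreal K * (\<integral>\<^sup>+y. ennreal (?G y) \<partial>nu) \<le> ennreal K * ennreal C2"
      by (rule mult_left_mono[OF C2(2)[OF x]]) simp
    moreover have "ennreal K * ennreal C2 = ennreal (K * C2)" using K C2(1) by (simp add: ennreal_mult)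
    ultimately show ?thesis by simp
  qed
  have int: "integrable nu (\<lambda>y. ?F x y)" if x: "norm x < 1" for x :: "real^'n"
  proof (rule integrableI_bounded[OF Fm])
    have "(\<integral>\<^sup>+y. ennreal (norm (?F x y)) \<partial>nu) \<le> ennreal (K * C2)" using nn[OF x] by simp
    then show "(\<integral>\<^sup>+y. ennreal (norm (?F x y)) \<partial>nu) < \<infinity>" by (rule le_less_trans) simp
  qed
  have "(\<integral>y. ?F x y \<partial>nu) \<le> K * C2" if x: "norm x < 1" for x :: "real^'n"
  proof -
    have "ennreal (\<integral>y. ?F x y \<partial>nu) = (\<integral>\<^sup>+y. ennreal (?F x y) \<partial>nu)"
      by (rule nn_integral_eq_integral[symmetric, OF int[OF x]]) simp
    then have "ennreal (\<integral>y. ?F x y \<partial>nu) \<le> ennreal (K * C2)" using nn[OF x] by simp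
    then show ?thesis using K C2(1) by simp
  qed
  then show thesis using that[of "K * C2"] int K C2(1) by simp
qed

text \<open>An essential supremum in the extended reals could a priori be
  \<open>- \<infinity>\<close> or negative; both are excluded because \<open>nu\<close> is a
  probability measure.\<close>

lemma Lp_norm_infinity:
  fixes f :: "real^'n::finite \<Rightarrow> complex"
  assumes f: "f \<in> Lp_w a \<infinity>"
  obtains N where "Lp_norm a \<infinity> f = ereal N" "N \<ge> 0" "AE y in nu. (1 - (norm y)\<^sup>2) powr a * cmod (f y) \<le> N"
proof -
  let ?g = "\<lambda>y. (1 - (norm y)\<^sup>2) powr a * cmod (f y)"
  let ?S = "esssup (nu :: (real^'n) measure) (\<lambda>y. ereal (?g y))"
  have fin: "?S < \<infinity>" using f by (simp add: Lp_w_def)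
  have ae: "AE y in nu. ereal (?g y) \<le> ?S" by (rule esssup_AE)
  have "?S \<noteq> - \<infinity>"
  proof
    assume "?S = - \<infinity>"
    have "AE y :: real^'n in nu. False" using ae unfolding \<open>?S = - \<infinity>\<close> by simp
    then show False using prob_space.AE_False[OF prob_space_nu] by blast
  qed
  then obtain N where N: "?S = ereal N" using fin by (cases ?S) auto
  have aeN: "AE y in nu. ?g y \<le> N" using ae unfolding N by simp
  have N0: "N \<ge> 0"
  proof (rule ccontr)
    assume "\<not> N \<ge> 0"
    have "AE y :: real^'n in nu. False" using aeN
    proof eventually_elim
      case (elim y)
      moreover have "0 \<le> ?g y" by simp
      ultimately show ?case using \<open>\<not> N \<ge> 0\<close> by linarith
    qed
    then show False using prob_space.AE_False[OF prob_space_nu] by blast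
  qed
  have "Lp_norm a \<infinity> f = ereal N" using N by (simp add: Lp_norm_def)
  then show thesis using that N0 aeN by blast
qed

text \<open>The case \<open>q = 1\<close>, \<open>s = b - a\<close> of the integral bound, whose two
  requirements are then the two hypotheses.\<close>

lemma T_bounded_infinity:
  assumes n: "CARD('n::finite) \<ge> 2" and cond: "a - 1 < b" "c < b - a"
  shows "T_bounded TYPE('n) b c a \<infinity>"
proof -
  obtain C where C: "C \<ge> 0" "\<And>x :: real^'n. norm x < 1 \<Longrightarrow> integrable nu (\<lambda>y. \<bar>R_kernel c x y\<bar> powr 1 * (1 - (norm y)\<^sup>2) powr (b - a))"
    "\<And>x :: real^'n. norm x < 1 \<Longrightarrow> (\<integral>y. \<bar>R_kernel c x y\<bar> powr 1 * (1 - (norm y)\<^sup>2) powr (b - a) \<partial>nu) \<le> C"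
    by (rule R_kernel_integral_bound[OF n, of 1 "b - a" c]) (use cond in auto)
  show ?thesis
  proof (rule T_boundedI[OF n C(1)])
    fix f :: "real^'n \<Rightarrow> complex" assume f: "f \<in> Lp_w a \<infinity>"
    obtain N where LN: "Lp_norm a \<infinity> f = ereal N" and N0: "N \<ge> 0"
      and aeN: "AE y in nu. (1 - (norm y)\<^sup>2) powr a * cmod (f y) \<le> N"
      by (rule Lp_norm_infinity[OF f]) blast
    let ?g = "\<lambda>y. (1 - (norm y)\<^sup>2) powr a * cmod (f y)"
    note LN
    moreover have "\<exists>D. integrable nu D \<and> (AE y in nu. \<bar>R_kernel c x y\<bar> * (1 - (norm y)\<^sup>2) powr b * cmod (f y) \<le> D y) \<and> (\<integral>y. D y \<partial>nu) \<le> C * N"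
      if x: "norm x < 1" for x
    proof (intro exI[of _ "\<lambda>y. N * (\<bar>R_kernel c x y\<bar> powr 1 * (1 - (norm y)\<^sup>2) powr (b - a))"] conjI)
      show "integrable nu (\<lambda>y. N * (\<bar>R_kernel c x y\<bar> powr 1 * (1 - (norm y)\<^sup>2) powr (b - a)))"
        by (rule integrable_mult_right) (rule C(2)[OF x])
      have "(\<integral>y. N * (\<bar>R_kernel c x y\<bar> powr 1 * (1 - (norm y)\<^sup>2) powr (b - a)) \<partial>nu) = N * (\<integral>y. \<bar>R_kernel c x y\<bar> powr 1 * (1 - (norm y)\<^sup>2) powr (b - a) \<partial>nu)"
        by (rule Bochner_Integration.integral_mult_right_zero)
      also have "\<dots> \<le> N * C" by (rule mult_left_mono[OF C(3)[OF x] N0])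
      finally show "(\<integral>y. N * (\<bar>R_kernel c x y\<bar> powr 1 * (1 - (norm y)\<^sup>2) powr (b - a)) \<partial>nu) \<le> C * N" by (simp only: mult.commute)
      show "AE y in nu. \<bar>R_kernel c x y\<bar> * (1 - (norm y)\<^sup>2) powr b * cmod (f y) \<le> N * (\<bar>R_kernel c x y\<bar> powr 1 * (1 - (norm y)\<^sup>2) powr (b - a))"
        using aeN
      proof eventually_elim
        case (elim y)
        have "\<bar>R_kernel c x y\<bar> * (1 - (norm y)\<^sup>2) powr b * cmod (f y) = \<bar>R_kernel c x y\<bar> * (1 - (norm y)\<^sup>2) powr (b - a) * ?g y"
          by (simp add: mult.assoc[symmetric]) (simp add: mult.assoc powr_add[symmetric])
        also have "\<dots> \<le> \<bar>R_kernel c x y\<bar> * (1 - (norm y)\<^sup>2) powr (b - a) * N"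
          by (rule mult_left_mono[OF elim]) simp
        finally show ?case by (simp add: mult_ac)
      qed
    qed
    ultimately show "\<exists>N. Lp_norm a \<infinity> f = ereal N \<and> (\<forall>x. norm x < 1 \<longrightarrow> (\<exists>D. integrable nu D \<and>
       (AE y in nu. \<bar>R_kernel c x y\<bar> * (1 - (norm y)\<^sup>2) powr b * cmod (f y) \<le> D y) \<and> (\<integral>y. D y \<partial>nu) \<le> C * N))"
      by blast
  qed
qed

text \<open>With the conjugate exponent \<open>q\<close> and \<open>s = (b - a / p) * q\<close>, the
  first hypothesis says \<open>s > -1\<close> and the second says
  \<open>(n + c) * q < n + s\<close>: the two requirements of
  \<open>R_kernel_integral_bound\<close>.\<close>

lemma T_bounded_p:
  fixes p a b c :: real
  assumes n: "CARD('n::finite) \<ge> 2" and p: "p > 1"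
    and cond: "a + 1 < p * (b + 1)" "c < b - (real CARD('n) + a) / p"
  shows "T_bounded TYPE('n) b c a (ereal p)"
proof -
  define q where "q = p / (p - 1)"
  have q: "q > 1" and pq: "1 / p + 1 / q = 1" using p by (simp_all add: q_def field_simps)
  define s where "s = (b - a / p) * q"
  have "(a + 1) / p < b + 1" using cond(1) p by (simp add: divide_less_eq mult.commute)
  then have "b - a / p > - (1 - 1 / p)" by (simp add: add_divide_distrib)
  then have "s > - (1 - 1 / p) * q" unfolding s_def using q by (intro mult_strict_right_mono) auto
  moreover have "(1 - 1 / p) * q = 1" using p by (simp add: q_def field_simps)
  moreover have "- (1 - 1 / p) * q = - ((1 - 1 / p) * q)" by (rule mult_minus_left)
  ultimately have s: "s > -1" by linarith
  have "(real CARD('n) + c) * q < (real CARD('n) + (b - (real CARD('n) + a) / p)) * q"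
    using cond(2) q by (intro mult_strict_right_mono) auto
  also have "\<dots> = real CARD('n) * ((1 - 1 / p) * q) + s"
    using p by (simp add: s_def field_simps)
  finally have ncq: "(real CARD('n) + c) * q < real CARD('n) + s" using \<open>(1 - 1 / p) * q = 1\<close> by simp
  obtain C where C: "C \<ge> 0" "\<And>x :: real^'n. norm x < 1 \<Longrightarrow> integrable nu (\<lambda>y. \<bar>R_kernel c x y\<bar> powr q * (1 - (norm y)\<^sup>2) powr s)"
    "\<And>x :: real^'n. norm x < 1 \<Longrightarrow> (\<integral>y. \<bar>R_kernel c x y\<bar> powr q * (1 - (norm y)\<^sup>2) powr s \<partial>nu) \<le> C"
    by (rule R_kernel_integral_bound[OF n less_imp_le[OF q] s ncq]) blast
  let ?V = "V_const TYPE('n) a"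
  have V: "?V > 0" by (rule V_const_pos[OF n])
  define K where "K = ?V powr (1 / p) * (C / q + 1 / p)"
  have K: "K \<ge> 0" using C(1) p q V by (simp add: K_def)
  show ?thesis
  proof (rule T_boundedI[OF n K])
    fix f :: "real^'n \<Rightarrow> complex" assume "f \<in> Lp_w a (ereal p)"
    then have fm: "f \<in> borel_measurable nu" and fi: "integrable (nu_w a) (\<lambda>x. cmod (f x) powr p)"
      by (auto simp: Lp_w_def)
    have nm: "(\<lambda>x. cmod (f x) powr p) \<in> borel_measurable nu" using fm by measurable
    let ?G = "\<lambda>y. (1 - (norm y)\<^sup>2) powr a * cmod (f y) powr p"
    have wi: "integrable nu ?G" using fi nu_w_integral(1)[OF n nm] by simp
    define S where "S = (\<integral>y. ?G y \<partial>nu)"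
    have S0: "S \<ge> 0" unfolding S_def by (rule integral_nonneg_AE) simp
    define N where "N = (S / ?V) powr (1 / p)"
    have NS: "?V powr (1 / p) * N = S powr (1 / p)"
      using V S0 by (simp add: N_def powr_mult[symmetric])
    have "(\<integral>y. cmod (f y) powr p \<partial>nu_w a) = S / ?V" unfolding S_def by (rule nu_w_integral(2)[OF n nm])
    then have "Lp_norm a (ereal p) f = ereal N" by (simp add: Lp_norm_def N_def)
    moreover have "\<exists>D. integrable nu D \<and> (AE y in nu. \<bar>R_kernel c x y\<bar> * (1 - (norm y)\<^sup>2) powr b * cmod (f y) \<le> D y) \<and> (\<integral>y. D y \<partial>nu) \<le> K * N"
      if x: "norm x < 1" for x
    proof (cases "S = 0")
      case True
      then have "AE y in nu. ?G y = 0"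
        using integral_nonneg_eq_0_iff_AE[OF wi] by (simp add: S_def)
      then have "AE y in nu. f y = 0"
        using nu_AE_ball
      proof eventually_elim
        case (elim y)
        then show ?case using weight_pos[of y] by simp
      qed
      then have "AE y in nu. \<bar>R_kernel c x y\<bar> * (1 - (norm y)\<^sup>2) powr b * cmod (f y) \<le> 0"
        by eventually_elim simp
      moreover have "N = 0" using True p by (simp add: N_def)
      ultimately show ?thesis by (intro exI[of _ "\<lambda>_. 0"]) simp
    next
      case False
      with S0 have S: "S > 0" by simp
      let ?H = "\<lambda>y. \<bar>R_kernel c x y\<bar> powr q * (1 - (norm y)\<^sup>2) powr s"
      let ?D = "\<lambda>y. S powr (1 / p) * (?H y / q + ?G y / (S * p))"
      have int: "integrable nu (\<lambda>y. ?H y / q)" "integrable nu (\<lambda>y. ?G y / (S * p))"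
        using integrable_divide[OF C(2)[OF x], of q] integrable_divide[OF wi, of "S * p"] q p S by simp_all
      have "(\<integral>y. ?D y \<partial>nu) = S powr (1 / p) * ((\<integral>y. ?H y \<partial>nu) / q + S / (S * p))"
      proof -
        have "(\<integral>y. ?D y \<partial>nu) = S powr (1 / p) * (\<integral>y. (?H y / q + ?G y / (S * p)) \<partial>nu)"
          by (rule Bochner_Integration.integral_mult_right_zero)
        also have "(\<integral>y. (?H y / q + ?G y / (S * p)) \<partial>nu) = (\<integral>y. ?H y / q \<partial>nu) + (\<integral>y. ?G y / (S * p) \<partial>nu)"
          by (rule Bochner_Integration.integral_add[OF int])
        also have "(\<integral>y. ?H y / q \<partial>nu) = (\<integral>y. ?H y \<partial>nu) / q" by (rule Bochner_Integration.integral_divide_zero)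
        also have "(\<integral>y. ?G y / (S * p) \<partial>nu) = S / (S * p)" unfolding S_def by (rule Bochner_Integration.integral_divide_zero)
        finally show ?thesis .
      qed
      also have "\<dots> \<le> S powr (1 / p) * (C / q + 1 / p)"
      proof (rule mult_left_mono)
        have "(\<integral>y. ?H y \<partial>nu) / q \<le> C / q" using C(3)[OF x] q by (intro divide_right_mono) auto
        then show "(\<integral>y. ?H y \<partial>nu) / q + S / (S * p) \<le> C / q + 1 / p" using S by simp
      qed simp
      also have "\<dots> = K * N" unfolding K_def NS[symmetric] by (simp only: mult_ac)
      finally have le: "(\<integral>y. ?D y \<partial>nu) \<le> K * N" .
      have "AE y in nu. \<bar>R_kernel c x y\<bar> * (1 - (norm y)\<^sup>2) powr b * cmod (f y) \<le> ?D y"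
        using nu_AE_ball
      proof eventually_elim
        case (elim y)
        let ?w = "1 - (norm y)\<^sup>2"
        have w: "?w > 0" by (rule weight_pos[OF elim])
        define A where "A = \<bar>R_kernel c x y\<bar> * ?w powr (b - a / p)"
        \<comment> \<open>Dividing by \<open>S powr (1 / p)\<close> normalises the factor containing
          \<open>f\<close>, so that the additive inequality of Young yields a bound linear in the
          norm; this is why \<open>S = 0\<close> was treated apart.\<close>
        define B where "B = cmod (f y) * ?w powr (a / p) / S powr (1 / p)"
        have "A * B \<le> A powr q / q + B powr p / p"
          by (rule Youngs_inequality) (use p q pq in \<open>auto simp: A_def B_def\<close>)
        moreover have "A powr q = ?H y"
          using w by (simp add: A_def s_def powr_mult powr_powr)
        moreover have "B powr p = ?G y / S"
          using w p S by (simp add: B_def powr_mult powr_divide powr_powr)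
        ultimately have "S powr (1 / p) * (A * B) \<le> ?D y"
          by (intro mult_left_mono) (simp_all add: mult.commute)
        moreover have "S powr (1 / p) * (A * B) = \<bar>R_kernel c x y\<bar> * (?w powr (b - a / p) * ?w powr (a / p)) * cmod (f y)"
          using S by (simp add: A_def B_def)
        moreover have "?w powr (b - a / p) * ?w powr (a / p) = ?w powr b"
          by (simp add: powr_add[symmetric])
        ultimately show ?case by simp
      qed
      moreover have "integrable nu ?D"
        by (rule integrable_mult_right) (rule Bochner_Integration.integrable_add[OF int])
      ultimately show ?thesis using le by blast
    qed
    ultimately show "\<exists>N. Lp_norm a (ereal p) f = ereal N \<and> (\<forall>x. norm x < 1 \<longrightarrow> (\<exists>D. integrable nu D \<and>
       (AE y in nu. \<bar>R_kernel c x y\<bar> * (1 - (norm y)\<^sup>2) powr b * cmod (f y) \<le> D y) \<and> (\<integral>y. D y \<partial>nu) \<le> K * N))"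
      by blast
  qed
qed

section \<open>Necessity\<close>

text \<open>The offset 3 keeps all scales at most 1/8 and lets scale \<open>j\<close> meet the
  condition \<open>3 \<le> j\<close> of \<open>diag_lower\<close> at level
  \<open>j + 3\<close>.\<close>

definition dyad :: "nat \<Rightarrow> real" where "dyad j = (1 / 2) ^ (j + 3)"

lemma dyad_pos [simp]: "0 < dyad j"
  by (simp add: dyad_def)

lemma dyad_nonneg [simp]: "0 \<le> dyad j"
  by (simp add: dyad_def)

lemma dyad_neq_0 [simp]: "dyad j \<noteq> 0"
  by (simp add: dyad_def)

lemma dyad_le: "dyad j \<le> 1 / 8"
  using power_le_one[of "1/2 :: real" j] by (simp add: dyad_def power_add power3_eq_cube)

lemma dyad_antimono: "i \<le> j \<Longrightarrow> dyad j \<le> dyad i"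
  unfolding dyad_def by (intro power_decreasing) auto

lemma dyad_less: "i < j \<Longrightarrow> dyad j \<le> dyad i / 2"
proof -
  assume "i < j"
  then have "dyad j \<le> dyad (Suc i)" by (intro dyad_antimono) simp
  also have "\<dots> = dyad i / 2" by (simp add: dyad_def power_add power_numeral_reduce)
  finally show ?thesis .
qed

lemma dyad_powr: "dyad j powr t = 2 powr (- t * real (j + 3))"
proof -
  have "dyad j = 2 powr (- real (j + 3))"
    unfolding dyad_def by (subst powr_minus, subst powr_realpow) (simp_all add: power_one_over inverse_eq_divide)
  then show ?thesis by (simp only: powr_powr) (simp add: algebra_simps)
qed

lemma dyad_powr_le_1: "t \<ge> 0 \<Longrightarrow> dyad j powr t \<le> 1"
  using dyad_le[of j] by (intro powr_le1) (auto simp: less_imp_le[OF dyad_pos])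

lemma dyad_powr_unbounded:
  assumes "\<And>j. dyad j powr t \<le> K"
  shows "t \<ge> 0"
proof (rule ccontr)
  assume t: "\<not> t \<ge> 0"
  define s where "s = - t"
  have "s > 0" using t by (simp add: s_def)
  then have "filterlim (\<lambda>j. 2 powr (s * real (j + 3))) at_top sequentially" by real_asymp
  then have "filterlim (\<lambda>j. 2 powr (- t * real (j + 3))) at_top sequentially" by (simp only: s_def)
  then obtain j where "2 powr (- t * real (j + 3)) > K"
    using eventually_happens[OF filterlim_at_top_dense[THEN iffD1, rule_format]] by fastforce
  then show False using assms[of j] by (simp only: dyad_powr)
qed

text \<open>Only sizes are kept: weight \<open>dyad j\<close>, measure \<open>dyad j powr d\<close>,
  and a lower bound \<open>\<kappa> j\<close> for the kernel at one evaluation point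
  \<open>x J\<close> that serves all \<open>j \<le> J\<close>. Boundedness of the operator then
  becomes an inequality between sequences.\<close>

locale test_family =
  fixes A :: "nat \<Rightarrow> (real^'n::finite) set" and x :: "nat \<Rightarrow> real^'n" and \<kappa> :: "nat \<Rightarrow> real"
    and c d c1 c2 m1 m2 :: real
  assumes n: "CARD('n) \<ge> 2"
    and A_sets: "A j \<in> sets borel" and A_ball: "A j \<subseteq> unit_ball" and disj: "disjoint_family A"
    and c1: "c1 > 0" and A_weight: "y \<in> A j \<Longrightarrow> c1 * dyad j \<le> 1 - (norm y)\<^sup>2 \<and> 1 - (norm y)\<^sup>2 \<le> c2 * dyad j"
    and m1: "m1 > 0" and A_measure: "m1 * dyad j powr d \<le> measure nu (A j) \<and> measure nu (A j) \<le> m2 * dyad j powr d"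
    and x: "norm (x J) < 1"
    and \<kappa>: "\<kappa> j \<ge> 0" and A_kernel: "j \<le> J \<Longrightarrow> y \<in> A j \<Longrightarrow> \<kappa> j \<le> R_kernel c (x J) y"
begin

definition test :: "(nat \<Rightarrow> real) \<Rightarrow> nat \<Rightarrow> real^'n \<Rightarrow> real" where
  "test \<phi> J y = (\<Sum>j\<le>J. \<phi> j * indicator (A j) y)"

lemma test_cases:
  obtains (outside) "\<And>\<phi>. test \<phi> J y = 0" | (inside) j where "j \<le> J" "y \<in> A j" "\<And>\<phi>. test \<phi> J y = \<phi> j"
proof (cases "\<exists>j\<le>J. y \<in> A j")
  case True
  then obtain j where j: "j \<le> J" "y \<in> A j" by blast
  have "test \<phi> J y = \<phi> j" for \<phi>
  proof -
    have "test \<phi> J y = (\<Sum>i\<in>{j}. \<phi> i * indicator (A i) y)" unfolding test_def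
    proof (rule sum.mono_neutral_right)
      show "\<forall>i\<in>{..J} - {j}. \<phi> i * indicator (A i) y = 0"
        using j(2) disj by (auto simp: disjoint_family_on_def indicator_def)
    qed (use j in auto)
    then show ?thesis using j by simp
  qed
  then show thesis using inside j by blast
next
  case False
  then show thesis using outside by (auto simp: test_def indicator_def)
qed

lemma test_integral: "integrable nu (test \<phi> J)" "(\<integral>y. test \<phi> J y \<partial>nu) = (\<Sum>j\<le>J. \<phi> j * measure nu (A j))"
proof -
  have An: "A j \<in> sets nu" for j using A_sets[of j] A_ball[of j] by (auto simp: nu_def sets_restrict_space)
  have "emeasure nu (A j) < \<infinity>" for j using emeasure_nu[OF A_sets A_ball, of j] by simp
  then have int: "integrable nu (\<lambda>y. \<phi> j * indicator (A j) y)" for j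
    using An by (intro integrable_mult_right integrable_real_indicator)
  then show "integrable nu (test \<phi> J)" unfolding test_def by (intro Bochner_Integration.integrable_sum)
  have "A j \<inter> space nu = A j" for j using A_ball[of j] by auto
  then show "(\<integral>y. test \<phi> J y \<partial>nu) = (\<Sum>j\<le>J. \<phi> j * measure nu (A j))"
    unfolding test_def using int by (subst Bochner_Integration.integral_sum) simp_all
qed

lemma weight_bounds:
  obtains C D where "C > 0" "D > 0" "\<And>j y. y \<in> A j \<Longrightarrow> C * dyad j powr b \<le> (1 - (norm y)\<^sup>2) powr b"
    "\<And>j y. y \<in> A j \<Longrightarrow> (1 - (norm y)\<^sup>2) powr b \<le> D * dyad j powr b"
proof (rule that)
  \<comment> \<open>The exponent \<open>b\<close> may have either sign, so both ends of the range of
    the weight enter the constants; the maximum with 1 guarantees a positive upper factor.\<close>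
  let ?c = "max c2 1"
  show "min (c1 powr b) (?c powr b) > 0" "max (c1 powr b) (?c powr b) > 0" using c1 by (auto simp: less_max_iff_disj)
  fix j y assume y: "y \<in> A j"
  let ?w = "1 - (norm y)\<^sup>2"
  have w: "c1 * dyad j \<le> ?w" "?w \<le> ?c * dyad j"
    using A_weight[OF y] order_trans[OF _ mult_right_mono[of c2 ?c "dyad j"]] by (auto simp: less_imp_le)
  have p: "0 < c1 * dyad j" using c1 by simp
  with w(1) have p: "0 < c1 * dyad j" "0 < ?w" by linarith+
  define l u where "l = min (c1 powr b) (?c powr b)" and "u = max (c1 powr b) (?c powr b)"
  have "l \<le> c1 powr b" "l \<le> ?c powr b" "c1 powr b \<le> u" "?c powr b \<le> u" by (auto simp: l_def u_def)
  then have lu: "l * dyad j powr b \<le> (c1 * dyad j) powr b" "l * dyad j powr b \<le> (?c * dyad j) powr b"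
    "(c1 * dyad j) powr b \<le> u * dyad j powr b" "(?c * dyad j) powr b \<le> u * dyad j powr b"
    using c1 by (auto simp: powr_mult intro!: mult_right_mono)
  have "l * dyad j powr b \<le> ?w powr b \<and> ?w powr b \<le> u * dyad j powr b"
  proof (cases "b \<ge> 0")
    case True
    then have "(c1 * dyad j) powr b \<le> ?w powr b" "?w powr b \<le> (?c * dyad j) powr b"
      using w p by (auto intro!: powr_mono2)
    then show ?thesis using lu by linarith
  next
    case False
    then have "(?c * dyad j) powr b \<le> ?w powr b" "?w powr b \<le> (c1 * dyad j) powr b"
      using w p by (auto intro!: powr_mono2')
    then show ?thesis using lu by linarith
  qed
  then show "min (c1 powr b) (?c powr b) * dyad j powr b \<le> ?w powr b" "?w powr b \<le> max (c1 powr b) (?c powr b) * dyad j powr b"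
    by (simp_all only: l_def u_def)
qed

text \<open>\<open>K\<close> is fixed before \<open>J\<close> and \<open>\<phi>\<close>, since the
  contradictions will come from letting \<open>J\<close> grow. Nonnegativity of
  \<open>\<phi>\<close> and \<open>\<kappa>\<close> permits replacing the kernel by its lower
  bound.\<close>

lemma T_bounded_test:
  assumes T: "T_bounded TYPE('n) b c a p"
  obtains K where "K \<ge> 0" "\<And>J \<phi> N. (\<And>j. 0 \<le> \<phi> j) \<Longrightarrow> (\<lambda>y. complex_of_real (test \<phi> J y)) \<in> Lp_w a p \<Longrightarrow>
    Lp_norm a p (\<lambda>y. complex_of_real (test \<phi> J y)) = ereal N \<Longrightarrow> 0 \<le> N \<Longrightarrow>
    (\<Sum>j\<le>J. \<phi> j * \<kappa> j * dyad j powr (b + d)) \<le> K * N"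
proof -
  obtain C :: real where C: "\<And>f :: real^'n \<Rightarrow> complex. f \<in> Lp_w a p \<Longrightarrow>
      (\<forall>x\<in>unit_ball. integrable nu (\<lambda>y. complex_of_real (R_kernel c x y * (1 - (norm y)\<^sup>2) powr b) * f y)) \<and>
      (\<forall>x\<in>unit_ball. ereal (cmod (T_op b c f x)) \<le> ereal C * Lp_norm a p f)"
    using T unfolding T_bounded_def by blast
  obtain W where W: "W > 0" "\<And>j y. y \<in> A j \<Longrightarrow> W * dyad j powr b \<le> (1 - (norm y)\<^sup>2) powr b"
    by (rule weight_bounds[of b]) blast
  have Wm: "W * m1 > 0" using W m1 by simp
  show thesis
  proof (rule that[of "\<bar>C\<bar> / (W * m1)"])
    show "\<bar>C\<bar> / (W * m1) \<ge> 0" using Wm by simp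
    fix J N and \<phi> :: "nat \<Rightarrow> real"
    let ?f = "\<lambda>y. complex_of_real (test \<phi> J y)"
    assume \<phi>: "\<And>j. 0 \<le> \<phi> j" and f: "?f \<in> Lp_w a p" and N: "Lp_norm a p ?f = ereal N" "0 \<le> N"
    let ?G = "\<lambda>y. R_kernel c (x J) y * (1 - (norm y)\<^sup>2) powr b * test \<phi> J y"
    have G: "(\<lambda>y. complex_of_real (R_kernel c (x J) y * (1 - (norm y)\<^sup>2) powr b) * ?f y) = (\<lambda>y. complex_of_real (?G y))" by simp
    have xb: "x J \<in> unit_ball" using x by simp
    have "complex_integrable nu (\<lambda>y. complex_of_real (?G y))" using C[OF f] xb by (simp only: G[symmetric])
    then have int: "integrable nu ?G" by (rule complex_of_real_integrable_eq[THEN iffD1])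
    let ?\<psi> = "\<lambda>j. \<phi> j * \<kappa> j * (W * dyad j powr b)"
    have "W * m1 * (\<Sum>j\<le>J. \<phi> j * \<kappa> j * dyad j powr (b + d)) = (\<Sum>j\<le>J. ?\<psi> j * (m1 * dyad j powr d))"
      by (simp add: sum_distrib_left powr_add mult_ac)
    also have "\<dots> \<le> (\<Sum>j\<le>J. ?\<psi> j * measure nu (A j))"
      using A_measure \<phi> \<kappa> W(1) by (intro sum_mono mult_left_mono) auto
    also have "\<dots> = (\<integral>y. test ?\<psi> J y \<partial>nu)" by (rule test_integral(2)[symmetric])
    also have "\<dots> \<le> (\<integral>y. ?G y \<partial>nu)"
    proof (rule integral_mono[OF test_integral(1) int])
      fix y
      show "test ?\<psi> J y \<le> ?G y"
      proof (cases J y rule: test_cases)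
        case (inside j)
        have "\<kappa> j * (W * dyad j powr b) \<le> R_kernel c (x J) y * (1 - (norm y)\<^sup>2) powr b"
          using A_kernel[OF inside(1,2)] W(2)[OF inside(2)] W(1) \<kappa>[of j] by (intro mult_mono) auto
        from mult_left_mono[OF this \<phi>[of j]] show ?thesis by (simp add: inside(3) mult_ac)
      qed simp
    qed
    also have "\<dots> \<le> cmod (T_op b c ?f (x J))"
    proof -
      have "T_op b c ?f (x J) = complex_of_real (\<integral>y. ?G y \<partial>nu)"
        unfolding T_op_def G by (rule integral_complex_of_real)
      then show ?thesis by simp
    qed
    also have "\<dots> \<le> C * N" using C[OF f] xb N(1) by auto
    also have "\<dots> \<le> \<bar>C\<bar> * N" using N(2) by (intro mult_right_mono) auto
    finally show "(\<Sum>j\<le>J. \<phi> j * \<kappa> j * dyad j powr (b + d)) \<le> \<bar>C\<bar> / (W * m1) * N"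
      using Wm by (simp add: field_simps)
  qed
qed

lemma T_bounded_test_p:
  fixes p :: real
  assumes T: "T_bounded TYPE('n) b c a (ereal p)" and p: "p \<ge> 1"
  obtains K where "K \<ge> 0" "\<And>J \<phi>. (\<And>j. 0 \<le> \<phi> j) \<Longrightarrow>
    (\<Sum>j\<le>J. \<phi> j * \<kappa> j * dyad j powr (b + d)) \<le> K * (\<Sum>j\<le>J. \<phi> j powr p * dyad j powr (a + d)) powr (1 / p)"
proof -
  obtain K where K: "K \<ge> 0" "\<And>J \<phi> N. (\<And>j. 0 \<le> \<phi> j) \<Longrightarrow> (\<lambda>y. complex_of_real (test \<phi> J y)) \<in> Lp_w a (ereal p) \<Longrightarrow>
    Lp_norm a (ereal p) (\<lambda>y. complex_of_real (test \<phi> J y)) = ereal N \<Longrightarrow> 0 \<le> N \<Longrightarrow>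
    (\<Sum>j\<le>J. \<phi> j * \<kappa> j * dyad j powr (b + d)) \<le> K * N"
    by (rule T_bounded_test[OF T]) blast
  obtain D where D: "D > 0" "\<And>j y. y \<in> A j \<Longrightarrow> (1 - (norm y)\<^sup>2) powr a \<le> D * dyad j powr a"
    by (rule weight_bounds[of a]) blast
  let ?V = "V_const TYPE('n) a"
  have V: "?V > 0" by (rule V_const_pos[OF n])
  have m2: "m2 \<ge> 0"
  proof -
    have "0 \<le> m2 * dyad 0 powr d" using A_measure[of 0] measure_nonneg[of nu "A 0"] by linarith
    moreover have "dyad 0 powr d > 0" using dyad_pos[of 0] by simp
    ultimately show ?thesis by (simp add: zero_le_mult_iff)
  qed
  let ?L = "D * m2 / ?V"
  have L: "?L \<ge> 0" using D m2 V by simp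
  show thesis
  proof (rule that[of "K * ?L powr (1 / p)"])
    show "K * ?L powr (1 / p) \<ge> 0" using K by simp
    fix J and \<phi> :: "nat \<Rightarrow> real" assume \<phi>: "\<And>j. 0 \<le> \<phi> j"
    let ?f = "\<lambda>y. complex_of_real (test \<phi> J y)"
    let ?\<psi> = "\<lambda>j. \<phi> j powr p * (D * dyad j powr a)"
    let ?S = "\<Sum>j\<le>J. \<phi> j powr p * dyad j powr (a + d)"
    have tm: "test \<phi> J \<in> borel_measurable nu" using test_integral(1) by (rule borel_measurable_integrable)
    have fm: "?f \<in> borel_measurable nu" using tm by measurable
    have nm: "(\<lambda>y. cmod (?f y) powr p) \<in> borel_measurable nu" using tm by measurable
    have le: "(1 - (norm y)\<^sup>2) powr a * cmod (?f y) powr p \<le> test ?\<psi> J y" for y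
    proof (cases J y rule: test_cases)
      case (inside j)
      from mult_left_mono[OF D(2)[OF inside(2)], of "\<phi> j powr p"] show ?thesis
        using \<phi>[of j] by (simp add: inside(3) mult.commute)
    qed (use p in simp)
    have int: "integrable nu (\<lambda>y. (1 - (norm y)\<^sup>2) powr a * cmod (?f y) powr p)"
    proof (rule Bochner_Integration.integrable_bound[OF test_integral(1)[of ?\<psi> J]])
      show "(\<lambda>y. (1 - (norm y)\<^sup>2) powr a * cmod (?f y) powr p) \<in> borel_measurable nu"
        by (rule borel_measurable_times[OF weight_measurable nm])
      show "AE y in nu. norm ((1 - (norm y)\<^sup>2) powr a * cmod (?f y) powr p) \<le> norm (test ?\<psi> J y)"
        using order_trans[OF le abs_ge_self] by (intro AE_I2) (simp only: real_norm_def abs_mult abs_of_nonneg powr_ge_zero)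
    qed
    have f: "?f \<in> Lp_w a (ereal p)" using fm int nu_w_integral(1)[OF n nm, of a] by (simp add: Lp_w_def)
    define N where "N = (\<integral>y. cmod (?f y) powr p \<partial>nu_w a) powr (1 / p)"
    have "(\<integral>y. cmod (?f y) powr p \<partial>nu_w a) \<le> (\<integral>y. test ?\<psi> J y \<partial>nu) / ?V"
      unfolding nu_w_integral(2)[OF n nm] using V le by (intro divide_right_mono integral_mono[OF int test_integral(1)]) auto
    also have "\<dots> \<le> (\<Sum>j\<le>J. ?\<psi> j * (m2 * dyad j powr d)) / ?V"
      unfolding test_integral(2) using V A_measure D by (intro divide_right_mono sum_mono mult_left_mono) auto
    also have "\<dots> = ?L * ?S" by (simp add: sum_distrib_left sum_divide_distrib powr_add mult_ac)
    finally have "N \<le> (?L * ?S) powr (1 / p)"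
      unfolding N_def using p by (intro powr_mono2) (auto intro!: integral_nonneg_AE)
    also have "\<dots> = ?L powr (1 / p) * ?S powr (1 / p)"
      by (rule powr_mult)
    finally have NL: "N \<le> ?L powr (1 / p) * ?S powr (1 / p)" .
    have "(\<Sum>j\<le>J. \<phi> j * \<kappa> j * dyad j powr (b + d)) \<le> K * N"
      by (rule K(2)[OF \<phi> f]) (simp_all add: Lp_norm_def N_def)
    then show "(\<Sum>j\<le>J. \<phi> j * \<kappa> j * dyad j powr (b + d)) \<le> K * ?L powr (1 / p) * ?S powr (1 / p)"
      using mult_left_mono[OF NL K(1)] by (simp add: mult.assoc)
  qed
qed

lemma T_bounded_test_infinity:
  assumes T: "T_bounded TYPE('n) b c a \<infinity>"
  obtains K where "K \<ge> 0" "\<And>J \<phi>. (\<And>j. 0 \<le> \<phi> j) \<Longrightarrow> (\<And>j. dyad j powr a * \<phi> j \<le> 1) \<Longrightarrow>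
    (\<Sum>j\<le>J. \<phi> j * \<kappa> j * dyad j powr (b + d)) \<le> K"
proof -
  obtain K where K: "K \<ge> 0" "\<And>J \<phi> N. (\<And>j. 0 \<le> \<phi> j) \<Longrightarrow> (\<lambda>y. complex_of_real (test \<phi> J y)) \<in> Lp_w a \<infinity> \<Longrightarrow>
    Lp_norm a \<infinity> (\<lambda>y. complex_of_real (test \<phi> J y)) = ereal N \<Longrightarrow> 0 \<le> N \<Longrightarrow>
    (\<Sum>j\<le>J. \<phi> j * \<kappa> j * dyad j powr (b + d)) \<le> K * N"
    by (rule T_bounded_test[OF T]) blast
  obtain D where D: "D > 0" "\<And>j y. y \<in> A j \<Longrightarrow> (1 - (norm y)\<^sup>2) powr a \<le> D * dyad j powr a"
    by (rule weight_bounds[of a]) blast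
  show thesis
  proof (rule that[of "K * D"])
    show "K * D \<ge> 0" using K D by simp
    fix J and \<phi> :: "nat \<Rightarrow> real" assume \<phi>: "\<And>j. 0 \<le> \<phi> j" "\<And>j. dyad j powr a * \<phi> j \<le> 1"
    let ?f = "\<lambda>y. complex_of_real (test \<phi> J y)"
    have tm: "test \<phi> J \<in> borel_measurable nu" using test_integral(1) by (rule borel_measurable_integrable)
    have fm: "?f \<in> borel_measurable nu" using tm by measurable
    have wm: "(\<lambda>y. (1 - (norm y)\<^sup>2) powr a * cmod (?f y)) \<in> borel_measurable nu"
      by (rule borel_measurable_times[OF weight_measurable measurable_compose[OF fm borel_measurable_norm]])
    have le: "(1 - (norm y)\<^sup>2) powr a * cmod (?f y) \<le> D" for y
    proof (cases J y rule: test_cases)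
      case (inside j)
      have "(1 - (norm y)\<^sup>2) powr a * \<phi> j \<le> D * dyad j powr a * \<phi> j"
        using D(2)[OF inside(2)] \<phi>(1) by (rule mult_right_mono)
      also have "\<dots> \<le> D" using mult_left_mono[OF \<phi>(2)[of j], of D] D(1) by (simp add: mult.assoc)
      finally show ?thesis using \<phi>(1)[of j] by (simp add: inside(3))
    qed (use D in simp)
    have es: "esssup nu (\<lambda>y. ereal ((1 - (norm y)\<^sup>2) powr a * cmod (?f y))) \<le> ereal D"
      by (rule esssup_I) (use wm le in auto)
    then have f: "?f \<in> Lp_w a \<infinity>" using fm by (auto simp: Lp_w_def intro: le_less_trans)
    obtain N where N: "Lp_norm a \<infinity> ?f = ereal N" "N \<ge> 0" by (rule Lp_norm_infinity[OF f]) blast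
    have "N \<le> D" using es N(1) by (simp add: Lp_norm_def)
    have "(\<Sum>j\<le>J. \<phi> j * \<kappa> j * dyad j powr (b + d)) \<le> K * N" by (rule K(2)[OF \<phi>(1) f N])
    also have "\<dots> \<le> K * D" using \<open>N \<le> D\<close> K(1) by (rule mult_left_mono)
    finally show "(\<Sum>j\<le>J. \<phi> j * \<kappa> j * dyad j powr (b + d)) \<le> K * D" .
  qed
qed

text \<open>The chosen \<open>\<phi>\<close> makes every scale contribute at least \<open>k0\<close>
  to the left side, which therefore grows with \<open>J\<close>. If the inequality failed,
  \<open>\<phi>\<close> would still satisfy the normalisation
  \<open>dyad j powr a * \<phi> j \<le> 1\<close>.\<close>

lemma necessary_infinity:
  assumes T: "T_bounded TYPE('n) b c a \<infinity>" and k0: "k0 > 0" "\<And>j. k0 * dyad j powr (- s) \<le> \<kappa> j"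
  shows "a < b + d - s"
proof (rule ccontr)
  assume neg: "\<not> ?thesis"
  obtain K where K: "\<And>J \<phi>. (\<And>j. 0 \<le> \<phi> j) \<Longrightarrow> (\<And>j. dyad j powr a * \<phi> j \<le> 1) \<Longrightarrow>
    (\<Sum>j\<le>J. \<phi> j * \<kappa> j * dyad j powr (b + d)) \<le> K"
    by (rule T_bounded_test_infinity[OF T]) blast
  let ?\<phi> = "\<lambda>j. dyad j powr (- (b + d - s))"
  have "real J * k0 \<le> K" for J
  proof -
    have "k0 \<le> ?\<phi> j * \<kappa> j * dyad j powr (b + d)" for j
    proof -
      have "k0 = dyad j powr (- (b + d - s)) * (k0 * dyad j powr (- s)) * dyad j powr (b + d)"
        using less_imp_neq[OF dyad_pos[of j]] by (simp add: powr_diff powr_minus powr_add field_simps)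
      also have "\<dots> \<le> ?\<phi> j * \<kappa> j * dyad j powr (b + d)"
        using k0(2)[of j] by (intro mult_right_mono mult_left_mono) auto
      finally show ?thesis .
    qed
    then have "(\<Sum>j\<le>J. k0) \<le> (\<Sum>j\<le>J. ?\<phi> j * \<kappa> j * dyad j powr (b + d))" by (rule sum_mono)
    also have "\<dots> \<le> K"
    proof (rule K)
      show "dyad j powr a * ?\<phi> j \<le> 1" for j
        unfolding powr_add[symmetric] using neg by (intro dyad_powr_le_1) auto
    qed simp
    finally show ?thesis using k0(1) by (simp add: algebra_simps)
  qed
  moreover obtain J where "real J * k0 > K" using reals_Archimedean3[OF k0(1)] by blast
  ultimately show False by (meson not_le)
qed

text \<open>The same \<open>\<phi>\<close> as for the supremum norm. If the inequality failed, the
  left side would be at least \<open>k0 * (J + 1)\<close> and the right side at most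
  \<open>K * (J + 1) powr (1 / p)\<close>, which is impossible for large \<open>J\<close> even at
  equality of the exponents, because \<open>p > 1\<close>.\<close>

lemma necessary_p:
  fixes p :: real
  assumes T: "T_bounded TYPE('n) b c a (ereal p)" and p: "p > 1"
    and k0: "k0 > 0" "\<And>j. k0 * dyad j powr (- s) \<le> \<kappa> j"
  shows "a + d < p * (b + d - s)"
proof (rule ccontr)
  assume neg: "\<not> ?thesis"
  obtain K where K: "K \<ge> 0" "\<And>J \<phi>. (\<And>j. 0 \<le> \<phi> j) \<Longrightarrow>
    (\<Sum>j\<le>J. \<phi> j * \<kappa> j * dyad j powr (b + d)) \<le> K * (\<Sum>j\<le>J. \<phi> j powr p * dyad j powr (a + d)) powr (1 / p)"
    by (rule T_bounded_test_p[OF T]) (use p in auto)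
  let ?\<phi> = "\<lambda>j. dyad j powr (- (b + d - s))"
  have "real (Suc J) powr (1 - 1 / p) \<le> K / k0" for J
  proof -
    have "k0 \<le> ?\<phi> j * \<kappa> j * dyad j powr (b + d)" for j
    proof -
      have "k0 = dyad j powr (- (b + d - s)) * (k0 * dyad j powr (- s)) * dyad j powr (b + d)"
        using less_imp_neq[OF dyad_pos[of j]] by (simp add: powr_diff powr_minus powr_add field_simps)
      also have "\<dots> \<le> ?\<phi> j * \<kappa> j * dyad j powr (b + d)"
        using k0(2)[of j] by (intro mult_right_mono mult_left_mono) auto
      finally show ?thesis .
    qed
    then have "(\<Sum>j\<le>J. k0) \<le> (\<Sum>j\<le>J. ?\<phi> j * \<kappa> j * dyad j powr (b + d))" by (rule sum_mono)
    also have "\<dots> \<le> K * (\<Sum>j\<le>J. ?\<phi> j powr p * dyad j powr (a + d)) powr (1 / p)" by (rule K(2)) simp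
    also have "\<dots> \<le> K * real (Suc J) powr (1 / p)"
    proof (intro mult_left_mono[OF _ K(1)] powr_mono2)
      have "?\<phi> j powr p * dyad j powr (a + d) \<le> 1" for j
        unfolding powr_powr powr_add[symmetric] using neg by (intro dyad_powr_le_1) (simp add: algebra_simps)
      then have "(\<Sum>j\<le>J. ?\<phi> j powr p * dyad j powr (a + d)) \<le> (\<Sum>j\<le>J. 1)" by (rule sum_mono)
      then show "(\<Sum>j\<le>J. ?\<phi> j powr p * dyad j powr (a + d)) \<le> real (Suc J)" by simp
    qed (use p in \<open>auto intro!: sum_nonneg\<close>)
    finally have "real (Suc J) * k0 \<le> K * real (Suc J) powr (1 / p)" by simp
    then have "real (Suc J) * k0 / real (Suc J) powr (1 / p) \<le> K" by (simp add: divide_le_eq)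
    then show ?thesis using k0(1) by (simp add: powr_diff field_simps)
  qed
  moreover have "filterlim (\<lambda>J. real (Suc J) powr (1 - 1 / p)) at_top sequentially"
  proof -
    have "1 - 1 / p > 0" using p by simp
    then show ?thesis by real_asymp
  qed
  ultimately show False
    using eventually_happens[OF filterlim_at_top_dense[THEN iffD1, rule_format, of _ _ "K / k0"]]
    by (metis not_le sequentially_bot)
qed

text \<open>For \<open>p = 1\<close> both sides are linear in \<open>\<phi>\<close>, so combining
  scales gains nothing over a single set, and equality of the exponents remains possible.\<close>

lemma necessary_1:
  assumes T: "T_bounded TYPE('n) b c a 1"
  obtains K where "\<And>J. \<kappa> J * dyad J powr (b - a) \<le> K"
proof -
  obtain K where K: "\<And>J \<phi>. (\<And>j. 0 \<le> \<phi> j) \<Longrightarrow>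
    (\<Sum>j\<le>J. \<phi> j * \<kappa> j * dyad j powr (b + d)) \<le> K * (\<Sum>j\<le>J. \<phi> j powr 1 * dyad j powr (a + d)) powr (1 / 1)"
    by (rule T_bounded_test_p[of b a 1]) (use T in \<open>auto simp: one_ereal_def\<close>)
  show thesis
  proof (rule that[of K])
    fix J
    let ?\<phi> = "\<lambda>j :: nat. if j = J then 1 else 0 :: real"
    have "(\<Sum>j\<le>J. ?\<phi> j * \<kappa> j * dyad j powr (b + d)) = (\<Sum>j\<le>J. if j = J then \<kappa> j * dyad j powr (b + d) else 0)"
      by (intro sum.cong) auto
    moreover have "(\<Sum>j\<le>J. ?\<phi> j powr 1 * dyad j powr (a + d)) = (\<Sum>j\<le>J. if j = J then dyad j powr (a + d) else 0)"
      by (intro sum.cong) auto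
    ultimately have "\<kappa> J * dyad J powr (b + d) \<le> K * dyad J powr (a + d)"
      using K[of ?\<phi> J] by (simp add: sum.delta)
    moreover have "\<kappa> J * dyad J powr (b + d) = \<kappa> J * dyad J powr (b - a) * dyad J powr (a + d)"
      by (simp add: mult.assoc powr_add[symmetric] add_ac)
    ultimately show "\<kappa> J * dyad J powr (b - a) \<le> K"
      by (simp add: mult_le_cancel_right)
  qed
qed

end

section \<open>The two concrete families of test sets\<close>

lemma dyad_powr_le_geom_sum: "dyad j powr (- s) \<le> geom_sum s (j + 3)"
proof -
  have "dyad j powr (- s) = 2 powr (real (j + 3) * s)" unfolding dyad_powr by (simp add: mult.commute)
  also have "\<dots> \<le> geom_sum s (j + 3)"
    unfolding geom_sum_def by (rule member_le_sum) auto
  finally show ?thesis .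
qed

lemma measure_nu_ball:
  fixes z :: "real^'n::finite"
  assumes "ball z r \<subseteq> unit_ball" "r \<ge> 0"
  shows "measure nu (ball z r) = r ^ CARD('n)"
proof -
  have "measure nu (ball z r) = measure lebesgue (ball z r) / measure lebesgue (unit_ball :: (real^'n) set)"
    using assms(1) by (intro measure_nu) auto
  also have "\<dots> = r ^ CARD('n)"
    using content_ball_conv_unit_ball[OF assms(2), of z] unit_ball_measure_pos[where 'n = 'n] by (simp add: measure_completion)
  finally show ?thesis .
qed

lemma test_family_shells:
  assumes n: "CARD('n::finite) \<ge> 2"
  shows "test_family (\<lambda>j. ball (0 :: real^'n) (1 - dyad j / 2) - ball 0 (1 - dyad j)) (\<lambda>_. 0) (\<lambda>_. 1) c 1
    (1 / 2) 2 ((7 / 8) ^ (CARD('n) - 1) / 2) (real CARD('n))"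
proof
  let ?A = "\<lambda>j. ball (0 :: real^'n) (1 - dyad j / 2) - ball 0 (1 - dyad j)"
  note h = dyad_pos dyad_le
  show sets: "?A j \<in> sets borel" for j by (intro sets.Diff borel_open open_ball)
  show sub: "?A j \<subseteq> unit_ball" for j using h(1)[of j] by auto
  have less: "?A i \<inter> ?A j = {}" if "i < j" for i j using dyad_less[OF that] by auto
  show "disjoint_family ?A"
    unfolding disjoint_family_on_def using less by (metis Int_commute linorder_neqE_nat)
  show "1 / 2 * dyad j \<le> 1 - (norm y)\<^sup>2 \<and> 1 - (norm y)\<^sup>2 \<le> 2 * dyad j" if "y \<in> ?A j" for y j
  proof -
    have y: "1 - dyad j \<le> norm y" "norm y < 1 - dyad j / 2" using that by auto
    have "1 - (norm y)\<^sup>2 = (1 - norm y) * (1 + norm y)" by (simp add: power2_eq_square algebra_simps)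
    moreover have "dyad j / 2 * 1 \<le> (1 - norm y) * (1 + norm y)" using y h(1)[of j] by (intro mult_mono) auto
    moreover have "(1 - norm y) * (1 + norm y) \<le> dyad j * 2" using y h(1)[of j] by (intro mult_mono) auto
    ultimately show ?thesis by simp
  qed
  show "(7 / 8) ^ (CARD('n) - 1) / 2 * dyad j powr 1 \<le> measure nu (?A j) \<and> measure nu (?A j) \<le> real CARD('n) * dyad j powr 1" for j
  proof -
    \<comment> \<open>The difference of the two powers is at least the thickness times the inner
      radius to the power \<open>n - 1\<close>, with radius at least 7/8; from above it is
      controlled by Bernoulli's inequality.\<close>
    let ?u = "1 - dyad j / 2" and ?v = "1 - dyad j" and ?N = "CARD('n)"
    have uv: "7 / 8 \<le> ?v" "?v \<le> ?u" "?u \<le> 1" "?u - ?v = dyad j / 2" using h(1)[of j] h(2)[of j] by auto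
    have sub: "ball (0 :: real^'n) ?u \<subseteq> unit_ball" "ball (0 :: real^'n) ?v \<subseteq> unit_ball"
      using uv by (intro subset_ball; linarith)+
    have "measure nu (?A j) = measure nu (ball (0 :: real^'n) ?u) - measure nu (ball (0 :: real^'n) ?v)"
    proof (rule measure_Diff)
      have "emeasure nu (ball (0 :: real^'n) ?u) < \<infinity>" using sub by (subst emeasure_nu) auto
      then show "emeasure nu (ball (0 :: real^'n) ?u) \<noteq> \<infinity>" by simp
      show "ball (0 :: real^'n) ?u \<in> sets nu" "ball (0 :: real^'n) ?v \<in> sets nu"
        using sub by (auto simp: nu_def sets_restrict_space)
    qed (use uv in \<open>intro subset_ball, linarith\<close>)
    also have "\<dots> = ?u ^ ?N - ?v ^ ?N" using sub uv by (subst (1 2) measure_nu_ball) simp_all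
    finally have m: "measure nu (?A j) = ?u ^ ?N - ?v ^ ?N" .
    have "(7 / 8) ^ (?N - 1) * (dyad j / 2) \<le> ?v ^ (?N - 1) * (?u - ?v)"
      using uv h(1)[of j] by (intro mult_mono power_mono) auto
    also have "\<dots> \<le> ?u ^ ?N - ?v ^ ?N"
    proof -
      have "v ^ (?N - 1) * (u - v) \<le> u ^ ?N - v ^ ?N" if "0 \<le> v" "v \<le> u" for u v :: real
      proof -
        have "v ^ (?N - 1) * u \<le> u ^ (?N - 1) * u" using that by (intro mult_right_mono power_mono) auto
        moreover have "z ^ ?N = z ^ (?N - 1) * z" for z :: real using power_minus_mult[of ?N z] by simp
        ultimately show ?thesis by (simp add: right_diff_distrib)
      qed
      then show ?thesis by this (use uv in linarith)+
    qed
    finally have 1: "(7 / 8) ^ (?N - 1) * (dyad j / 2) \<le> measure nu (?A j)" by (simp only: m)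
    have "?u ^ ?N \<le> 1" using uv by (intro power_le_one) auto
    moreover have "1 + real ?N * (- dyad j) \<le> (1 + (- dyad j)) ^ ?N" using h(2)[of j] by (intro Bernoulli_inequality) auto
    ultimately have "measure nu (?A j) \<le> real ?N * dyad j" by (simp add: m)
    with 1 show ?thesis by (simp add: less_imp_le)
  qed
qed (use n in auto)

text \<open>For \<open>y\<close> in the \<open>j\<close>-th ball and the centre \<open>z J\<close>
  with \<open>j \<le> J\<close>, the number \<open>1 - norm (z J) * norm y\<close> has the size of
  \<open>dyad j\<close>, and both points lie close to one radius. The diagonal bound at level
  \<open>j + 3\<close> applies, and leaving the diagonal costs at most half of it.\<close>

lemma test_family_balls:
  assumes n: "CARD('n::finite) \<ge> 2" and s: "s = real CARD('n) + c" "s \<ge> 0"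
  obtains \<delta> k0 and z :: "nat \<Rightarrow> real^'n" where "\<delta> > 0" "k0 > 0"
    "test_family (\<lambda>j. ball (z j) (\<delta> * dyad j)) z (\<lambda>j. k0 * geom_sum s (j + 3)) c (real CARD('n))
      (7 / 8) (9 / 4) (\<delta> ^ CARD('n)) (\<delta> ^ CARD('n))"
proof -
  define l where "l = real CARD('n) / 2"
  have l: "l \<ge> 1" and sl: "s = 2 * l + c" using n s by (auto simp: l_def)
  obtain c0 where c0: "c0 > 0" "\<And>j r. 3 \<le> j \<Longrightarrow> 0 \<le> r \<Longrightarrow> r < 1 \<Longrightarrow> 1 - r \<le> 3 / 2 ^ j \<Longrightarrow>
      c0 * geom_sum s j \<le> (\<Sum>k. gam l c k * zon l k r (r\<^sup>2))"
    by (rule diag_lower[OF l sl s(2)]) blast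
  obtain C where C: "C \<ge> 0" "\<And>u r. \<bar>u\<bar> \<le> r \<Longrightarrow> r < 1 \<Longrightarrow>
      (\<Sum>k. gam l c k * zon l k r (r\<^sup>2)) - C * (r - u) * (1 - r) powr (- (s + 2)) \<le> (\<Sum>k. gam l c k * zon l k u (r\<^sup>2))"
    by (rule kernel_perturb[OF l sl s(2)]) blast
  \<comment> \<open>Relative to \<open>dyad j powr (- s)\<close> the perturbation will cost at most
    \<open>\<delta>^2 * M\<close>. The choice \<open>\<delta> \<le> c0 / (2 * M)\<close>, with
    \<open>\<delta> \<le> 1\<close>, makes this at most \<open>c0 / 2\<close>, and
    \<open>\<delta> \<le> 1 / 8\<close> separates the balls. The added 1 keeps \<open>M\<close>
    positive.\<close>
  define M where "M = C * (7 / 8) powr (- (s + 2)) + 1"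
  have M: "M > 0" using C(1) by (simp add: M_def add_nonneg_pos)
  define \<delta> where "\<delta> = min (1 / 8) (c0 / (2 * M))"
  have \<delta>: "\<delta> > 0" "\<delta> \<le> 1 / 8" using c0(1) M by (auto simp: \<delta>_def)
  have "\<delta>\<^sup>2 \<le> \<delta>" using \<delta> by (simp add: power2_eq_square mult_left_le_one_le)
  also have "\<delta> \<le> c0 / (2 * M)" by (simp add: \<delta>_def)
  finally have "\<delta>\<^sup>2 * M \<le> c0 / (2 * M) * M" using M by (intro mult_right_mono) auto
  then have "\<delta>\<^sup>2 * M \<le> c0 / 2" using M by simp
  moreover have "\<delta>\<^sup>2 * (C * (7 / 8) powr (- (s + 2))) \<le> \<delta>\<^sup>2 * M" by (intro mult_left_mono) (auto simp: M_def)
  ultimately have d2: "C * \<delta>\<^sup>2 * (7 / 8) powr (- (s + 2)) \<le> c0 / 2" by (simp add: mult_ac)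
  define \<xi> :: "real^'n" where "\<xi> = axis undefined 1"
  have \<xi>: "norm \<xi> = 1" by (simp add: \<xi>_def)
  then have \<xi>\<xi>: "\<xi> \<bullet> \<xi> = 1" by (simp add: norm_eq_1)
  define z where "z = (\<lambda>j. (1 - dyad j) *\<^sub>R \<xi>)"
  note h = dyad_pos dyad_le
  have nz: "norm (z j) = 1 - dyad j" for j using h(2)[of j] by (simp add: z_def \<xi>)
  let ?A = "\<lambda>j. ball (z j) (\<delta> * dyad j)"
  have near: "norm (y - z j) < \<delta> * dyad j" "1 - 9 / 8 * dyad j < norm y" "norm y < 1 - 7 / 8 * dyad j" if "y \<in> ?A j" for y j
  proof -
    show 1: "norm (y - z j) < \<delta> * dyad j" using that by (simp add: dist_norm norm_minus_commute)
    have "\<delta> * dyad j \<le> 1 / 8 * dyad j" using \<delta> h(1)[of j] by (intro mult_right_mono) auto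
    moreover have "norm y \<le> norm (z j) + norm (y - z j)" "norm (z j) \<le> norm y + norm (y - z j)"
      using norm_triangle_sub[of y "z j"] norm_triangle_sub[of "z j" y] by (simp_all add: norm_minus_commute)
    ultimately show "1 - 9 / 8 * dyad j < norm y" "norm y < 1 - 7 / 8 * dyad j" using 1 nz[of j] by linarith+
  qed
  have sub: "?A j \<subseteq> unit_ball" for j using near(3)[of _ j] h(1)[of j] by (force intro: less_trans)
  have kernel: "c0 / 2 * geom_sum s (j + 3) \<le> R_kernel c (z J) y" if "j \<le> J" "y \<in> ?A j" for j J y
  proof -
    note y = near[OF that(2)]
    have hJ: "dyad J \<le> dyad j" by (rule dyad_antimono[OF that(1)])
    define \<rho> u where "\<rho> = (1 - dyad J) * norm y" and "u = (1 - dyad J) * (\<xi> \<bullet> y)"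
    have R: "R_kernel c (z J) y = (\<Sum>k. gam l c k * zon l k u (\<rho>\<^sup>2))"
      unfolding R_kernel_eq nz by (simp add: z_def l_def u_def \<rho>_def)
    have "\<bar>\<xi> \<bullet> y\<bar> \<le> norm y" using Cauchy_Schwarz_ineq2[of \<xi> y] by (simp add: \<xi>)
    then have ab: "\<bar>u\<bar> \<le> \<rho>" unfolding u_def \<rho>_def abs_mult using h(2)[of J] by (auto intro!: mult_mono)
    have "\<rho> = norm y - dyad J * norm y" by (simp add: \<rho>_def algebra_simps)
    moreover have "norm y \<le> 1" using y(3) h(1)[of j] by linarith
    then have "dyad J * norm y \<le> dyad J * 1" by (rule mult_left_mono) simp
    moreover have "dyad J * norm y \<ge> 0" using h(1)[of J] by simp
    \<comment> \<open>\<open>17 / 8\<close> is the sum of \<open>9 / 8\<close> from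
      \<open>norm y\<close> and 1 from \<open>dyad J \<le> dyad j\<close>; it stays below the 3
      allowed by \<open>diag_lower\<close>.\<close>
    ultimately have \<rho>: "1 - \<rho> \<le> 17 / 8 * dyad j" "1 - \<rho> \<ge> 7 / 8 * dyad j" using y(2,3) hJ by linarith+
    have \<rho>0: "\<rho> \<ge> 0" "\<rho> < 1" using ab \<rho>(2) h(1)[of j] by linarith+
    have "3 * dyad j = 3 / 2 ^ (j + 3)" by (simp add: dyad_def power_one_over)
    then have "1 - \<rho> \<le> 3 / 2 ^ (j + 3)" using \<rho>(1) h(1)[of j] by linarith
    then have main: "c0 * geom_sum s (j + 3) \<le> (\<Sum>k. gam l c k * zon l k \<rho> (\<rho>\<^sup>2))"
      using \<rho>0 by (intro c0(2)) auto
    \<comment> \<open>A second-order quantity: since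
      \<open>norm y + \<xi> \<bullet> y \<ge> 1\<close>, the difference
      \<open>norm y - \<xi> \<bullet> y\<close> is at most the squared distance of \<open>y\<close>
      from the axis through \<open>\<xi>\<close>. The resulting \<open>dyad j powr 2\<close> offsets
      the two extra orders of the derivative.\<close>
    have "\<rho> - u = (1 - dyad J) * (norm y - \<xi> \<bullet> y)" by (simp add: \<rho>_def u_def algebra_simps)
    also have "\<dots> \<le> norm y - \<xi> \<bullet> y"
      using \<open>\<bar>\<xi> \<bullet> y\<bar> \<le> norm y\<close> h(1)[of J] h(2)[of J] by (intro mult_left_le_one_le) auto
    also have "\<dots> \<le> (norm y - \<xi> \<bullet> y) * (norm y + \<xi> \<bullet> y)"
    proof -
      have "\<xi> \<bullet> z j = 1 - dyad j" by (simp add: z_def \<xi>\<xi>)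
      moreover have "\<bar>\<xi> \<bullet> (y - z j)\<bar> \<le> norm (y - z j)" using Cauchy_Schwarz_ineq2[of \<xi> "y - z j"] by (simp add: \<xi>)
      moreover have "\<delta> * dyad j \<le> 1 / 8 * dyad j" using \<delta> h(1)[of j] by (intro mult_right_mono) auto
      moreover have "\<xi> \<bullet> (y - z j) = \<xi> \<bullet> y - \<xi> \<bullet> z j" by (rule inner_diff_right)
      ultimately have "\<xi> \<bullet> y \<ge> 1 - 9 / 8 * dyad j" using y(1) by linarith
      then have "1 \<le> norm y + \<xi> \<bullet> y" using y(2) h(2)[of j] by linarith
      then have "(norm y - \<xi> \<bullet> y) * 1 \<le> (norm y - \<xi> \<bullet> y) * (norm y + \<xi> \<bullet> y)"
        using \<open>\<bar>\<xi> \<bullet> y\<bar> \<le> norm y\<close> by (intro mult_left_mono) auto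
      then show ?thesis by simp
    qed
    also have "\<dots> \<le> (norm (y - z j))\<^sup>2"
    proof -
      have "(norm (y - z j))\<^sup>2 = (norm y)\<^sup>2 - 2 * (1 - dyad j) * (\<xi> \<bullet> y) + (1 - dyad j)\<^sup>2"
        unfolding power2_norm_eq_inner z_def
        by (simp add: \<xi>\<xi> inner_commute[of y \<xi>] power2_eq_square algebra_simps)
      moreover have "\<dots> = (norm y - \<xi> \<bullet> y) * (norm y + \<xi> \<bullet> y) + (\<xi> \<bullet> y - (1 - dyad j))\<^sup>2"
        by (simp add: power2_eq_square algebra_simps)
      moreover have "(\<xi> \<bullet> y - (1 - dyad j))\<^sup>2 \<ge> 0" by simp
      ultimately show ?thesis by linarith
    qed
    also have "\<dots> \<le> (\<delta> * dyad j)\<^sup>2" using y(1) by (intro power_mono) auto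
    finally have ru: "\<rho> - u \<le> (\<delta> * dyad j)\<^sup>2" .
    have "C * (\<rho> - u) * (1 - \<rho>) powr (- (s + 2)) \<le> C * (\<delta> * dyad j)\<^sup>2 * (7 / 8 * dyad j) powr (- (s + 2))"
      using ru ab \<rho>(2) h(1)[of j] C(1) s(2) by (intro mult_mono powr_mono2') auto
    also have "\<dots> = C * \<delta>\<^sup>2 * (7 / 8) powr (- (s + 2)) * (dyad j powr 2 * dyad j powr (- (s + 2)))"
    proof -
      have "(7 / 8 * dyad j) powr (- (s + 2)) = (7 / 8) powr (- (s + 2)) * dyad j powr (- (s + 2))"
        by (rule powr_mult)
      moreover have "dyad j powr 2 = (dyad j)\<^sup>2" using h(1)[of j] by simp
      ultimately show ?thesis by (simp only: power_mult_distrib mult_ac)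
    qed
    also have "dyad j powr 2 * dyad j powr (- (s + 2)) = dyad j powr (- s)" unfolding powr_add[symmetric] by simp
    also have "C * \<delta>\<^sup>2 * (7 / 8) powr (- (s + 2)) * dyad j powr (- s) \<le> c0 / 2 * dyad j powr (- s)"
      by (rule mult_right_mono[OF d2]) simp
    also have "\<dots> \<le> c0 / 2 * geom_sum s (j + 3)"
      using c0(1) dyad_powr_le_geom_sum by (intro mult_left_mono) auto
    finally have "C * (\<rho> - u) * (1 - \<rho>) powr (- (s + 2)) \<le> c0 / 2 * geom_sum s (j + 3)" .
    with main C(2)[OF ab \<rho>0(2)] show ?thesis unfolding R by linarith
  qed
  have "test_family ?A z (\<lambda>j. c0 / 2 * geom_sum s (j + 3)) c (real CARD('n)) (7 / 8) (9 / 4) (\<delta> ^ CARD('n)) (\<delta> ^ CARD('n))"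
  proof
    show "?A j \<in> sets borel" "?A j \<subseteq> unit_ball" for j using sub by auto
    have less: "?A i \<inter> ?A j = {}" if "i < j" for i j
    proof -
      have False if "y \<in> ?A i" "y \<in> ?A j" for y
        using near(3)[OF that(1)] near(2)[OF that(2)] dyad_less[OF \<open>i < j\<close>] h(1)[of i] by linarith
      then show ?thesis by blast
    qed
    show "disjoint_family ?A"
      unfolding disjoint_family_on_def using less by (metis Int_commute linorder_neqE_nat)
    show "7 / 8 * dyad j \<le> 1 - (norm y)\<^sup>2 \<and> 1 - (norm y)\<^sup>2 \<le> 9 / 4 * dyad j" if "y \<in> ?A j" for y j
    proof -
      note y = near[OF that]
      have "1 - (norm y)\<^sup>2 = (1 - norm y) * (1 + norm y)" by (simp add: power2_eq_square algebra_simps)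
      moreover have "7 / 8 * dyad j * 1 \<le> (1 - norm y) * (1 + norm y)" using y h(1)[of j] by (intro mult_mono) auto
      moreover have "(1 - norm y) * (1 + norm y) \<le> 9 / 8 * dyad j * 2" using y h(1)[of j] by (intro mult_mono) auto
      ultimately show ?thesis by simp
    qed
    show "\<delta> ^ CARD('n) * dyad j powr real CARD('n) \<le> measure nu (?A j) \<and> measure nu (?A j) \<le> \<delta> ^ CARD('n) * dyad j powr real CARD('n)" for j
      using sub[of j] \<delta>(1) h(1)[of j] by (subst (1 2) measure_nu_ball) (auto simp: power_mult_distrib powr_realpow)
    show "c0 / 2 * geom_sum s (j + 3) \<le> R_kernel c (z J) y" if "j \<le> J" "y \<in> ?A j" for j J y
      by (rule kernel[OF that])
    show "0 \<le> c0 / 2 * geom_sum s (j + 3)" for j using c0(1) by (simp add: geom_sum_def sum_nonneg)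
    show "norm (z J) < 1" for J using nz[of J] h(1)[of J] by simp
  qed (use n \<delta> in auto)
  then show thesis using that[of \<delta> "c0 / 2" z] \<delta>(1) c0(1) by simp
qed

section \<open>The necessary conditions in the three ranges of the exponent\<close>

lemma T_bounded_p_necessary:
  fixes p :: real
  assumes n: "CARD('n::finite) \<ge> 2" and p: "p > 1" and T: "T_bounded TYPE('n) b c a (ereal p)"
  shows "a + 1 < p * (b + 1)" "c < b - (real CARD('n) + a) / p"
proof -
  interpret S: test_family "\<lambda>j. ball (0 :: real^'n) (1 - dyad j / 2) - ball 0 (1 - dyad j)" "\<lambda>_. 0" "\<lambda>_. 1" c 1
    "1 / 2" 2 "(7 / 8) ^ (CARD('n) - 1) / 2" "real CARD('n)"
    by (rule test_family_shells[OF n])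
  show 1: "a + 1 < p * (b + 1)" using S.necessary_p[OF T p, of 1 0] by simp
  show "c < b - (real CARD('n) + a) / p"
  proof (rule ccontr)
    assume neg: "\<not> ?thesis"
    have "(a + 1) / p < b + 1" using 1 p by (simp add: divide_less_eq mult.commute)
    moreover have "(real CARD('n) + a) / p = (real CARD('n) - 1) / p + (a + 1) / p"
      by (simp add: add_divide_distrib[symmetric])
    moreover have "(real CARD('n) - 1) / p \<le> real CARD('n) - 1"
      using p n by (simp add: divide_le_eq mult_le_cancel_left1)
    \<comment> \<open>If the condition on \<open>c\<close> fails, the one on \<open>b\<close>
      already forces \<open>n + c \<ge> 0\<close>, under which the family of balls is
      available.\<close>
    ultimately have s: "real CARD('n) + c \<ge> 0" using neg by linarith
    obtain \<delta> k0 and z :: "nat \<Rightarrow> real^'n" where k0: "k0 > 0" and fam: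
      "test_family (\<lambda>j. ball (z j) (\<delta> * dyad j)) z (\<lambda>j. k0 * geom_sum (real CARD('n) + c) (j + 3)) c (real CARD('n))
        (7 / 8) (9 / 4) (\<delta> ^ CARD('n)) (\<delta> ^ CARD('n))"
      by (rule test_family_balls[OF n refl s]) blast
    have "a + real CARD('n) < p * (b + real CARD('n) - (real CARD('n) + c))"
      by (rule test_family.necessary_p[OF fam T p k0 mult_left_mono[OF dyad_powr_le_geom_sum less_imp_le[OF k0]]])
    then have "real CARD('n) + a < (b - c) * p" by (simp add: algebra_simps)
    then have "(real CARD('n) + a) / p < b - c" using p by (simp add: divide_less_eq)
    with neg show False by linarith
  qed
qed

lemma T_bounded_infinity_necessary:
  assumes n: "CARD('n::finite) \<ge> 2" and T: "T_bounded TYPE('n) b c a \<infinity>"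
  shows "a - 1 < b" "c < b - a"
proof -
  interpret S: test_family "\<lambda>j. ball (0 :: real^'n) (1 - dyad j / 2) - ball 0 (1 - dyad j)" "\<lambda>_. 0" "\<lambda>_. 1" c 1
    "1 / 2" 2 "(7 / 8) ^ (CARD('n) - 1) / 2" "real CARD('n)"
    by (rule test_family_shells[OF n])
  show 1: "a - 1 < b" using S.necessary_infinity[OF T, of 1 0] by simp
  show "c < b - a"
  proof (rule ccontr)
    assume neg: "\<not> ?thesis"
    then have s: "real CARD('n) + c \<ge> 0" using 1 n by linarith
    obtain \<delta> k0 and z :: "nat \<Rightarrow> real^'n" where k0: "k0 > 0" and fam:
      "test_family (\<lambda>j. ball (z j) (\<delta> * dyad j)) z (\<lambda>j. k0 * geom_sum (real CARD('n) + c) (j + 3)) c (real CARD('n))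
        (7 / 8) (9 / 4) (\<delta> ^ CARD('n)) (\<delta> ^ CARD('n))"
      by (rule test_family_balls[OF n refl s]) blast
    have "a < b + real CARD('n) - (real CARD('n) + c)"
      by (rule test_family.necessary_infinity[OF fam T k0 mult_left_mono[OF dyad_powr_le_geom_sum less_imp_le[OF k0]]])
    with neg show False by linarith
  qed
qed

lemma T_bounded_1_necessary:
  assumes n: "CARD('n::finite) \<ge> 2" and T: "T_bounded TYPE('n) b c a 1"
  shows "(a < b \<and> c \<le> b - (real CARD('n) + a)) \<or> (a \<le> b \<and> c < b - (real CARD('n) + a))"
proof -
  interpret S: test_family "\<lambda>j. ball (0 :: real^'n) (1 - dyad j / 2) - ball 0 (1 - dyad j)" "\<lambda>_. 0" "\<lambda>_. 1" c 1
    "1 / 2" 2 "(7 / 8) ^ (CARD('n) - 1) / 2" "real CARD('n)"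
    by (rule test_family_shells[OF n])
  obtain K where "\<And>J. 1 * dyad J powr (b - a) \<le> K" by (rule S.necessary_1[OF T]) blast
  then have ab: "a \<le> b" using dyad_powr_unbounded[of "b - a" K] by simp
  have "c < b - (real CARD('n) + a) \<or> (a < b \<and> c \<le> b - (real CARD('n) + a))"
  proof (rule ccontr)
    assume neg: "\<not> ?thesis"
    define s where "s = real CARD('n) + c"
    have s: "s \<ge> 0" using neg ab by (simp add: s_def)
    obtain \<delta> k0 and z :: "nat \<Rightarrow> real^'n" where k0: "k0 > 0" and fam:
      "test_family (\<lambda>j. ball (z j) (\<delta> * dyad j)) z (\<lambda>j. k0 * geom_sum s (j + 3)) c (real CARD('n))
        (7 / 8) (9 / 4) (\<delta> ^ CARD('n)) (\<delta> ^ CARD('n))"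
      by (rule test_family_balls[OF n s_def s]) blast
    obtain K where K: "\<And>J. k0 * geom_sum s (J + 3) * dyad J powr (b - a) \<le> K"
      by (rule test_family.necessary_1[OF fam T]) blast
    have "dyad J powr (b - a - s) \<le> K / k0" for J
    proof -
      have "k0 * dyad J powr (- s) * dyad J powr (b - a) \<le> k0 * geom_sum s (J + 3) * dyad J powr (b - a)"
        using k0 dyad_powr_le_geom_sum by (intro mult_right_mono mult_left_mono) auto
      with K[of J] have "k0 * (dyad J powr (- s) * dyad J powr (b - a)) \<le> K" by (simp add: mult.assoc)
      then show ?thesis unfolding powr_add[symmetric] using k0 by (simp add: field_simps)
    qed
    then have "b - a - s \<ge> 0" by (rule dyad_powr_unbounded)
    \<comment> \<open>The top term of \<open>geom_sum\<close> leaves only the corner where the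
      exponents balance at 0; there all \<open>J + 4\<close> terms of the sum equal 1, and their
      number contradicts the bound.\<close>
    then have eq: "a = b" "s = 0" using neg ab s by (auto simp: s_def)
    obtain J where "K < real J * k0" using reals_Archimedean3[OF k0] by blast
    also have "\<dots> \<le> real (J + 4) * k0" using k0 by (intro mult_right_mono) auto
    finally have "K < k0 * geom_sum s (J + 3)" using eq by (simp add: geom_sum_def algebra_simps)
    then show False using K[of J] eq by simp
  qed
  with ab show ?thesis by blast
qed

theorem theorem1p3:
  fixes b c a :: real and p :: ereal
  assumes "CARD('n::finite) \<ge> 2" and "1 \<le> p"
  shows "T_bounded TYPE('n) b c a p \<longleftrightarrow>
    ((1 < p \<and> p < \<infinity> \<and> a + 1 < real_of_ereal p * (b + 1)
        \<and> c < b - (real CARD('n) + a) / real_of_ereal p)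
     \<or> (p = 1 \<and> ((a < b \<and> c \<le> b - (real CARD('n) + a)) \<or> (a \<le> b \<and> c < b - (real CARD('n) + a))))
     \<or> (p = \<infinity> \<and> a - 1 < b \<and> c < b - a))"
proof -
  consider "p = 1" | r where "p = ereal r" "r > 1" | "p = \<infinity>"
    using assms(2) by (cases p) (auto simp: one_ereal_def less_le)
  then show ?thesis
  proof cases
    case 1
    then show ?thesis
      using T_bounded_p1[OF assms(1), of a b c] T_bounded_1_necessary[OF assms(1), of b c a] by auto
  next
    case 2
    then have "1 < p" "p < \<infinity>" "p \<noteq> 1" "p \<noteq> \<infinity>" "real_of_ereal p = r" by (auto simp: one_ereal_def)
    with 2 show ?thesis
      using T_bounded_p[OF assms(1) 2(2), of a b c] T_bounded_p_necessary[OF assms(1) 2(2), of b c a] by auto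
  next
    case 3
    then show ?thesis
      using T_bounded_infinity[OF assms(1), of a b c] T_bounded_infinity_necessary[OF assms(1), of b c a] by auto
  qed
qed

end
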